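(* Let $n\in\mathbb{N}$, $a<b$, $\tau>0$, $A,A_d\in L_\infty^{n\times3n}[a,b]$, and let $B\in\mathbb{R}^{2n\times4n}$ be such that the $2n\times 2n$ matrix $BH$ is invertible. Let $\mathcal{T},\mathcal{A}$ be the operators on $L_2^n[a,b]\times L_2^n[[0,1]\times[a,b]]$ defined in the context. (1) $\begin{bmatrix}\mathbf{v}\\ \boldsymbol\psi\end{bmatrix}$ is a solution to the PIE defined by $\{\mathcal{T},\mathcal{A}\}$ with initial state $\begin{bmatrix}\mathbf{v}_0\\ \boldsymbol\psi_0\end{bmatrix}$ if and only if $\begin{bmatrix}\mathbf{u}\\ \boldsymbol\phi\end{bmatrix}=\mathcal{T}\begin{bmatrix}\mathbf{v}\\ \boldsymbol\psi\end{bmatrix}$ is a solution to the DPDE defined by $\{A,A_d,B,\tau\}$ with initial state $\begin{bmatrix}\mathbf{u}_0\\ \boldsymbol\phi_0\end{bmatrix}=\mathcal{T}\begin{bmatrix}\mathbf{v}_0\\ \boldsymbol\psi_0\end{bmatrix}$. (2) Conversely, $\begin{bmatrix}\mathbf{u}\\ \boldsymbol\phi\end{bmatrix}$ is a solution to the DPDE defined by $\{A,A_d,B,\tau\}$ with initial state $\begin{bmatrix}\mathbf{u}_0\\ \boldsymbol\phi_0\end{bmatrix}$ if and only if $\begin{bmatrix}\mathbf{v}\\ \boldsymbol\psi\end{bmatrix}=\begin{bmatrix}\partial_x^2\mathbf{u}\\ \partial_s\partial_x^2\boldsymbol\phi\end{bmatrix}$ is a solution to the PIE defined by $\{\mathcal{T},\mathcal{A}\}$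 with initial state $\begin{bmatrix}\mathbf{v}_0\\ \boldsymbol\psi_0\end{bmatrix}=\begin{bmatrix}\partial_x^2\mathbf{u}_0\\ \partial_s\partial_x^2\boldsymbol\phi_0\end{bmatrix}$.
   Context: Spaces. $H_2^n[a,b]$ is the set of $\mathbf{u}$ with $\mathbf{u},\mathbf{u}_x,\mathbf{u}_{xx}\in L_2^n[a,b]$. $H_{(1,2)}^n$ is the set of functions $\boldsymbol\phi(s,x)$ on $[0,1]\times[a,b]$ with $\partial_s^{\alpha}\partial_x^{\beta}\boldsymbol\phi\in L_2^n$ for all $0\le\alpha\le1$, $0\le\beta\le2$. Define $$X_B=\{\mathbf{u}\in H_2^n[a,b] : B\,(\mathbf{u}(a),\mathbf{u}(b),\mathbf{u}_x(a),\mathbf{u}_x(b))^T=0\},$$ $$Y_{\mathbf{u}}=\{\boldsymbol\phi\in H_{(1,2)}^n : \boldsymbol\phi(0,x)=\mathbf{u}(x),\ \boldsymbol\phi(s,\cdot)\in X_B\}.$$ DPDE and solutions. The delayed PDE $\mathbf{u}_t(t,x)=A(x)(\mathbf{u},\mathbf{u}_x,\mathbf{u}_{xx})^T(t,x)+A_d(x)(\mathbf{u},\mathbf{u}_x,\mathbf{u}_{xx})^T(t-\tau,x)$, $\mathbf{u}(t)\in X_B$, is represented, with $\boldsymbol\phi(t,s)$ standing for $\mathbf{u}(t-s\tau)$, $s\in[0,1]$, as $$\mathbf{u}_t(t)=A\begin{bmatrix}\mathbf{u}(t)\\ \mathbf{u}_x(t)\\ \mathbf{u}_{xx}(t)\end{bmatrix}+A_d\begin{bmatrix}\boldsymbol\phi(t,1)\\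 \boldsymbol\phi_x(t,1)\\ \boldsymbol\phi_{xx}(t,1)\end{bmatrix},\quad \mathbf{u}(t)\in X_B,\qquad \boldsymbol\phi_t(t)=-\tfrac1\tau\boldsymbol\phi_s(t),\quad \boldsymbol\phi(t)\in Y_{\mathbf{u}(t)}.\qquad( * )$$ For a given initial state $(\mathbf{u}_0,\boldsymbol\phi_0)\in X_B\times Y_{\mathbf{u}_0}$, $(\mathbf{u},\boldsymbol\phi)$ is a solution to the DPDE defined by $\{A,A_d,B,\tau\}$ if $(\mathbf{u},\boldsymbol\phi)$ is Fréchet differentiable, $(\mathbf{u}(0),\boldsymbol\phi(0))=(\mathbf{u}_0,\boldsymbol\phi_0)$, and $(\mathbf{u}(t),\boldsymbol\phi(t))$ satisfies $( * )$ for all $t\ge0$. PIE and solutions. The PIE (partial integral equation) defined by $\{\mathcal{T},\mathcal{A}\}$ is $\mathcal{T}\mathbf{w}_t(t)=\mathcal{A}\mathbf{w}(t)$ with $\mathbf{w}(t)\in L_2^n[a,b]\times L_2^n[[0,1]\times[a,b]]$. For an initial state $\mathbf{w}_0$ in this space, $\mathbf{w}$ is a solution if it is Fréchet differentiable, $\mathbf{w}(0)=\mathbf{w}_0$, and the equation holds for all $t\ge0$. Operators. Let $$H=\begin{bmatrix} I_n & 0\\ I_n & (b-a) I_n\\ 0 & I_n\\ 0 & I_n\end{bmatrix},\quad Q(x,\theta)=\begin{bmatrix} 0\\ (b-\theta) I_n\\ 0\\ I_n\end{bmatrix},\quad K(x)=\begin{bmatrix} I_n & (x-a) I_n\end{bmatrix},$$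 $$T_2(x,\theta)=-K(x)(BH)^{-1}BQ(x,\theta),\qquad T_1(x,\theta)=(x-\theta)I_n+T_2(x,\theta).$$ On $L_2^n[a,b]$ define $$(\mathcal{T}_1\mathbf{v})(x)=\int_a^xT_1(x,\theta)\mathbf{v}(\theta)d\theta+\int_x^bT_2(x,\theta)\mathbf{v}(\theta)d\theta,$$ $$(\mathcal{A}_{11}\mathbf{v})(x)=A_0(x)\mathbf{v}(x)+\int_a^xA_1(x,\theta)\mathbf{v}(\theta)d\theta+\int_x^bA_2(x,\theta)\mathbf{v}(\theta)d\theta,$$ where $A_0(x)=A(x)\begin{bmatrix} 0\\ 0\\ I_n\end{bmatrix}$ and $A_j(x,\theta)=A(x)\begin{bmatrix}T_j(x,\theta)\\ \partial_xT_j(x,\theta)\\ 0\end{bmatrix}$, $j=1,2$. Let $\mathcal{A}_{11,d}$ be defined exactly as $\mathcal{A}_{11}$ with $A_d(x)$ in place of $A(x)$. For $\hat{\mathbf{v}}\in L_2^n[[0,1]\times[a,b]]$ let $$(\mathcal{T}_2\hat{\mathbf{v}})(s)=\int_0^s\mathcal{T}_1\hat{\mathbf{v}}(\theta)d\theta,\quad \mathcal{A}_{12}\hat{\mathbf{v}}=\int_0^1\mathcal{A}_{11,d}\hat{\mathbf{v}}(s)ds,\quad(\mathcal{A}_{22}\hat{\mathbf{v}})(s)=-\tfrac1\tau\mathcal{T}_1\hat{\mathbf{v}}(s).$$ Finally $$\mathcal{T}=\begin{bmatrix}\mathcal{T}_1&0\\ \mathcal{T}_1&\mathcal{T}_2\end{bmatrix},\qquad\mathcal{A}=\begin{bmatrix}\mathcal{A}_{11}+\mathcal{A}_{11,d}&\mathcal{A}_{12}\\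 0&\mathcal{A}_{22}\end{bmatrix},$$ where in the lower-left block of $\mathcal{T}$ the function $\mathcal{T}_1\mathbf{v}$ is viewed as a function on $[0,1]\times[a,b]$ constant in $s$.
   Formalization: In (2), (u(t),φ(t)) is assumed to lie in X_B × Y_{u(t)} for all t≥0: otherwise the "if" fails, since ∂_x² and ∂_s∂_x² forget affine parts. Fréchet differentiability of (u,φ) is taken in the norm of H_2 × H_(1,2). *)

theory Defs
  imports "HOL-Analysis.Analysis"
begin

text \<open>
  Elements of Lebesgue and Sobolev spaces are represented by functions, and equality of elements
  is equality almost everywhere on the domain. The spaces, weak derivatives, operators and solution
  predicates below depend only on the a.e. classes of their arguments.
\<close>

definition L2 :: "'a::euclidean_space set \<Rightarrow> ('a \<Rightarrow> 'b::euclidean_space) set" where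
  "L2 \<Omega> = {f \<in> borel_measurable (lebesgue_on \<Omega>). integrable (lebesgue_on \<Omega>) (\<lambda>x. (norm (f x))\<^sup>2)}"

definition L2_nrm :: "'a::euclidean_space set \<Rightarrow> ('a \<Rightarrow> 'b::euclidean_space) \<Rightarrow> real" where
  "L2_nrm \<Omega> f = sqrt (LINT x|lebesgue_on \<Omega>. (norm (f x))\<^sup>2)"

definition Linf :: "'a::euclidean_space set \<Rightarrow> ('a \<Rightarrow> 'b::euclidean_space) set" where
  "Linf \<Omega> = {f \<in> borel_measurable (lebesgue_on \<Omega>). \<exists>C. AE x in lebesgue_on \<Omega>. norm (f x) \<le> C}"

definition ae_eq :: "'a::euclidean_space set \<Rightarrow> ('a \<Rightarrow> 'b) \<Rightarrow> ('a \<Rightarrow> 'b) \<Rightarrow> bool" where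
  "ae_eq \<Omega> f g \<longleftrightarrow> (AE x in lebesgue_on \<Omega>. f x = g x)"

primrec times_differentiable :: "nat \<Rightarrow> ('a::euclidean_space \<Rightarrow> real) \<Rightarrow> bool" where
  "times_differentiable 0 \<eta> \<longleftrightarrow> continuous_on UNIV \<eta>"
| "times_differentiable (Suc k) \<eta> \<longleftrightarrow>
     (\<forall>x. \<eta> differentiable (at x)) \<and>
     (\<forall>i\<in>Basis. times_differentiable k (\<lambda>x. frechet_derivative \<eta> (at x) i))"

definition test_function :: "'a::euclidean_space set \<Rightarrow> ('a \<Rightarrow> real) \<Rightarrow> bool" where
  "test_function \<Omega> \<eta> \<longleftrightarrow> (\<forall>k. times_differentiable k \<eta>) \<and>
     compact (closure {x. \<eta> x \<noteq> 0}) \<and> closure {x. \<eta> x \<noteq> 0} \<subseteq> interior \<Omega>"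

text \<open>Here \<open>i \<in> Basis\<close> is a coordinate direction; test functions are the smooth functions
  with compact support inside the interior of \<open>\<Omega>\<close>.\<close>

definition has_weak_derivative ::
  "'a::euclidean_space set \<Rightarrow> 'a \<Rightarrow> ('a \<Rightarrow> 'b::euclidean_space) \<Rightarrow> ('a \<Rightarrow> 'b) \<Rightarrow> bool" where
  "has_weak_derivative \<Omega> i f g \<longleftrightarrow> f \<in> L2 \<Omega> \<and> g \<in> L2 \<Omega> \<and>
     (\<forall>\<eta>. test_function \<Omega> \<eta> \<longrightarrow>
        (LINT x|lebesgue_on \<Omega>. frechet_derivative \<eta> (at x) i *\<^sub>R f x)
          = - (LINT x|lebesgue_on \<Omega>. \<eta> x *\<^sub>R g x))"

definition weakly_differentiable ::
  "'a::euclidean_space set \<Rightarrow> 'a \<Rightarrow> ('a \<Rightarrow> 'b::euclidean_space) \<Rightarrow> bool" where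
  "weakly_differentiable \<Omega> i f \<longleftrightarrow> (\<exists>g. has_weak_derivative \<Omega> i f g)"

definition weak_derivative ::
  "'a::euclidean_space set \<Rightarrow> 'a \<Rightarrow> ('a \<Rightarrow> 'b::euclidean_space) \<Rightarrow> 'a \<Rightarrow> 'b" where
  "weak_derivative \<Omega> i f = (SOME g. has_weak_derivative \<Omega> i f g)"

abbreviation rect :: "real \<Rightarrow> real \<Rightarrow> (real \<times> real) set" where
  "rect a b \<equiv> {0..1} \<times> {a..b}"

text \<open>\<open>dX\<close> differentiates functions of \<open>x\<close>; \<open>dx\<close> and \<open>ds\<close> differentiate functions of \<open>(s, x)\<close>.\<close>

abbreviation dX :: "real \<Rightarrow> real \<Rightarrow> (real \<Rightarrow> 'b::euclidean_space) \<Rightarrow> real \<Rightarrow> 'b" where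
  "dX a b \<equiv> weak_derivative {a..b} 1"

abbreviation dx :: "real \<Rightarrow> real \<Rightarrow> (real \<times> real \<Rightarrow> 'b::euclidean_space) \<Rightarrow> real \<times> real \<Rightarrow> 'b" where
  "dx a b \<equiv> weak_derivative (rect a b) (0, 1)"

abbreviation ds :: "real \<Rightarrow> real \<Rightarrow> (real \<times> real \<Rightarrow> 'b::euclidean_space) \<Rightarrow> real \<times> real \<Rightarrow> 'b" where
  "ds a b \<equiv> weak_derivative (rect a b) (1, 0)"

definition H2 :: "real \<Rightarrow> real \<Rightarrow> (real \<Rightarrow> real^'n) set" where
  "H2 a b = {u. \<forall>\<beta><2. weakly_differentiable {a..b} 1 ((dX a b ^^ \<beta>) u)}"

definition H12 :: "real \<Rightarrow> real \<Rightarrow> (real \<times> real \<Rightarrow> real^'n) set" where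
  "H12 a b = {\<phi>. (\<forall>\<beta><2. weakly_differentiable (rect a b) (0, 1) ((dx a b ^^ \<beta>) \<phi>)) \<and>
                 (\<forall>\<beta>\<le>2. weakly_differentiable (rect a b) (1, 0) ((dx a b ^^ \<beta>) \<phi>))}"

definition H2_nrm :: "real \<Rightarrow> real \<Rightarrow> (real \<Rightarrow> real^'n) \<Rightarrow> real" where
  "H2_nrm a b u = sqrt (\<Sum>\<beta>\<le>2. (L2_nrm {a..b} ((dX a b ^^ \<beta>) u))\<^sup>2)"

definition H12_nrm :: "real \<Rightarrow> real \<Rightarrow> (real \<times> real \<Rightarrow> real^'n) \<Rightarrow> real" where
  "H12_nrm a b \<phi> =
     sqrt (\<Sum>\<alpha>\<le>1. \<Sum>\<beta>\<le>2. (L2_nrm (rect a b) ((ds a b ^^ \<alpha>) ((dx a b ^^ \<beta>) \<phi>)))\<^sup>2)"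

text \<open>
  The continuous representative, when it exists, is unique on the intervals and rectangles used
  below. It exists for \<open>u\<close> and \<open>dX a b u\<close> if \<open>u \<in> H2 a b\<close>, and for \<open>\<phi> \<in> H12 a b\<close>, by Sobolev
  embedding; point values, boundary values and slices are those of this representative.
\<close>

definition cont_rep :: "'a::euclidean_space set \<Rightarrow> ('a \<Rightarrow> 'b::euclidean_space) \<Rightarrow> 'a \<Rightarrow> 'b" where
  "cont_rep \<Omega> f = (SOME g. continuous_on \<Omega> g \<and> ae_eq \<Omega> g f)"

definition slice :: "real \<Rightarrow> real \<Rightarrow> (real \<times> real \<Rightarrow> real^'n) \<Rightarrow> real \<Rightarrow> real \<Rightarrow> real^'n" where
  "slice a b \<phi> s = (\<lambda>x. cont_rep (rect a b) \<phi> (s, x))"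

text \<open>
  Block vectors and block matrices: \<open>k\<close> blocks of size \<open>n\<close> are indexed by pairs \<open>(block, index)\<close>
  of type \<open>'k \<times> 'n\<close>. The function \<open>stack\<close> puts vectors (\<open>'a = real\<close>), or matrices
  (\<open>'a\<close> the type of rows), on top of each other; \<open>blockrow\<close> puts matrices side by side.
\<close>

definition stack :: "'a^'n^'k \<Rightarrow> 'a^('k \<times> 'n)" where
  "stack M = (\<chi> p. M $ fst p $ snd p)"

definition blockrow :: "'a^'n^'m^'k \<Rightarrow> 'a^('k \<times> 'n)^'m" where
  "blockrow M = (\<chi> i p. M $ fst p $ i $ snd p)"

definition boundary_values :: "real \<Rightarrow> real \<Rightarrow> (real \<Rightarrow> real^'n) \<Rightarrow> real^(4 \<times> 'n)" where
  "boundary_values a b u =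
     stack (vector [cont_rep {a..b} u a, cont_rep {a..b} u b,
                    cont_rep {a..b} (dX a b u) a, cont_rep {a..b} (dX a b u) b])"

definition X_dom :: "real \<Rightarrow> real \<Rightarrow> real^(4 \<times> 'n)^(2 \<times> 'n) \<Rightarrow> (real \<Rightarrow> real^'n) set" where
  "X_dom a b B = {u \<in> H2 a b. B *v boundary_values a b u = 0}"

definition Y_dom :: "real \<Rightarrow> real \<Rightarrow> real^(4 \<times> 'n)^(2 \<times> 'n) \<Rightarrow> (real \<Rightarrow> real^'n) \<Rightarrow>
    (real \<times> real \<Rightarrow> real^'n) set" where
  "Y_dom a b B u = {\<phi> \<in> H12 a b. ae_eq {a..b} (slice a b \<phi> 0) u \<and>
                                 (\<forall>s\<in>{0..1}. slice a b \<phi> s \<in> X_dom a b B)}"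

type_synonym 'n state = "(real \<Rightarrow> real^'n) \<times> (real \<times> real \<Rightarrow> real^'n)"

definition L2_states :: "real \<Rightarrow> real \<Rightarrow> 'n::finite state set" where
  "L2_states a b = L2 {a..b} \<times> L2 (rect a b)"

definition H_states :: "real \<Rightarrow> real \<Rightarrow> 'n::finite state set" where
  "H_states a b = H2 a b \<times> H12 a b"

definition dpde_states :: "real \<Rightarrow> real \<Rightarrow> real^(4 \<times> 'n)^(2 \<times> 'n) \<Rightarrow> 'n::finite state set" where
  "dpde_states a b B = (SIGMA u : X_dom a b B. Y_dom a b B u)"

definition L2_states_nrm :: "real \<Rightarrow> real \<Rightarrow> 'n::finite state \<Rightarrow> real" where
  "L2_states_nrm a b w = sqrt ((L2_nrm {a..b} (fst w))\<^sup>2 + (L2_nrm (rect a b) (snd w))\<^sup>2)"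

definition H_states_nrm :: "real \<Rightarrow> real \<Rightarrow> 'n::finite state \<Rightarrow> real" where
  "H_states_nrm a b z = sqrt ((H2_nrm a b (fst z))\<^sup>2 + (H12_nrm a b (snd z))\<^sup>2)"

definition state_eq :: "real \<Rightarrow> real \<Rightarrow> 'n::finite state \<Rightarrow> 'n state \<Rightarrow> bool" where
  "state_eq a b w z \<longleftrightarrow> ae_eq {a..b} (fst w) (fst z) \<and> ae_eq (rect a b) (snd w) (snd z)"

text \<open>
  Frechet derivative at time \<open>t\<close>, with respect to the norm \<open>N\<close>, of a curve \<open>w\<close> defined on
  \<open>{0..}\<close>: the derivative is the bounded linear map that sends \<open>h\<close> to \<open>h *\<^sub>R w'\<close>.
\<close>

definition has_frechet_derivative ::
  "('n::finite state \<Rightarrow> real) \<Rightarrow> (real \<Rightarrow> 'n state) \<Rightarrow> 'n state \<Rightarrow> real \<Rightarrow> bool" where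
  "has_frechet_derivative N w w' t \<longleftrightarrow>
     ((\<lambda>r. N ((\<lambda>x. fst (w r) x - fst (w t) x - (r - t) *\<^sub>R fst w' x),
              (\<lambda>p. snd (w r) p - snd (w t) p - (r - t) *\<^sub>R snd w' p)) / \<bar>r - t\<bar>) \<longlongrightarrow> 0)
       (at t within {0..})"

definition pie_solution ::
  "real \<Rightarrow> real \<Rightarrow> ('n state \<Rightarrow> 'n state) \<Rightarrow> ('n state \<Rightarrow> 'n state) \<Rightarrow>
   'n::finite state \<Rightarrow> (real \<Rightarrow> 'n state) \<Rightarrow> bool" where
  "pie_solution a b T A w0 w \<longleftrightarrow>
     w0 \<in> L2_states a b \<and> state_eq a b (w 0) w0 \<and>
     (\<exists>w'. \<forall>t\<ge>0. w t \<in> L2_states a b \<and> w' t \<in> L2_states a b \<and>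
           has_frechet_derivative (L2_states_nrm a b) w (w' t) t \<and>
           state_eq a b (T (w' t)) (A (w t)))"

definition pde_rhs :: "real \<Rightarrow> real \<Rightarrow> (real \<Rightarrow> real^(3 \<times> 'n)^'n) \<Rightarrow> (real \<Rightarrow> real^'n) \<Rightarrow>
    real \<Rightarrow> real^'n" where
  "pde_rhs a b A u x = A x *v stack (vector [u x, dX a b u x, dX a b (dX a b u) x])"

text \<open>The second component of a state takes the argument \<open>(s, x)\<close>; here \<open>fst (z' t)\<close> and
  \<open>snd (z' t)\<close> are the time derivatives of the two components.\<close>

definition dpde_solution ::
  "real \<Rightarrow> real \<Rightarrow> (real \<Rightarrow> real^(3 \<times> 'n)^'n) \<Rightarrow> (real \<Rightarrow> real^(3 \<times> 'n)^'n) \<Rightarrow>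
   real^(4 \<times> 'n)^(2 \<times> 'n) \<Rightarrow> real \<Rightarrow> 'n::finite state \<Rightarrow> (real \<Rightarrow> 'n state) \<Rightarrow> bool" where
  "dpde_solution a b A Ad B \<tau> z0 z \<longleftrightarrow>
     z0 \<in> dpde_states a b B \<and> state_eq a b (z 0) z0 \<and>
     (\<exists>z'. \<forall>t\<ge>0. z t \<in> dpde_states a b B \<and> z' t \<in> H_states a b \<and>
           has_frechet_derivative (H_states_nrm a b) z (z' t) t \<and>
           ae_eq {a..b} (fst (z' t))
             (\<lambda>x. pde_rhs a b A (fst (z t)) x + pde_rhs a b Ad (slice a b (snd (z t)) 1) x) \<and>
           ae_eq (rect a b) (snd (z' t)) (\<lambda>p. - (1 / \<tau>) *\<^sub>R ds a b (snd (z t)) p))"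

definition H_mat :: "real \<Rightarrow> real \<Rightarrow> real^(2 \<times> 'n::finite)^(4 \<times> 'n)" where
  "H_mat a b = stack (vector
     [blockrow (vector [mat 1, 0]),
      blockrow (vector [mat 1, (b - a) *\<^sub>R mat 1]),
      blockrow (vector [0, mat 1]),
      blockrow (vector [0, mat 1])])"

definition Q_mat :: "real \<Rightarrow> real \<Rightarrow> real \<Rightarrow> real^'n^(4 \<times> 'n)" where
  "Q_mat b x \<theta> = stack (vector [0, (b - \<theta>) *\<^sub>R mat 1, 0, mat 1])"

definition K_mat :: "real \<Rightarrow> real \<Rightarrow> real^(2 \<times> 'n)^'n" where
  "K_mat a x = blockrow (vector [mat 1, (x - a) *\<^sub>R mat 1])"

definition T2_ker :: "real \<Rightarrow> real \<Rightarrow> real^(4 \<times> 'n)^(2 \<times> 'n) \<Rightarrow> real \<Rightarrow> real \<Rightarrow> real^'n^'n" where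
  "T2_ker a b B x \<theta> = - (K_mat a x ** matrix_inv (B ** H_mat a b) ** B ** Q_mat b x \<theta>)"

definition T1_ker :: "real \<Rightarrow> real \<Rightarrow> real^(4 \<times> 'n)^(2 \<times> 'n) \<Rightarrow> real \<Rightarrow> real \<Rightarrow> real^'n^'n" where
  "T1_ker a b B x \<theta> = (x - \<theta>) *\<^sub>R mat 1 + T2_ker a b B x \<theta>"

definition T1_op :: "real \<Rightarrow> real \<Rightarrow> real^(4 \<times> 'n)^(2 \<times> 'n) \<Rightarrow>
    (real \<Rightarrow> real^'n) \<Rightarrow> real \<Rightarrow> real^'n" where
  "T1_op a b B v x =
     (LINT \<theta>|lebesgue_on {a..x}. T1_ker a b B x \<theta> *v v \<theta>) +
     (LINT \<theta>|lebesgue_on {x..b}. T2_ker a b B x \<theta> *v v \<theta>)"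

definition A_ker :: "(real \<Rightarrow> real^(3 \<times> 'n)^'n) \<Rightarrow> (real \<Rightarrow> real \<Rightarrow> real^'n^'n) \<Rightarrow>
    real \<Rightarrow> real \<Rightarrow> real^'n^'n" where
  "A_ker A T x \<theta> = A x ** stack (vector [T x \<theta>, vector_derivative (\<lambda>y. T y \<theta>) (at x), 0])"

definition A11_op :: "real \<Rightarrow> real \<Rightarrow> real^(4 \<times> 'n)^(2 \<times> 'n) \<Rightarrow> (real \<Rightarrow> real^(3 \<times> 'n)^'n) \<Rightarrow>
    (real \<Rightarrow> real^'n) \<Rightarrow> real \<Rightarrow> real^'n" where
  "A11_op a b B A v x =
     (A x ** stack (vector [0, 0, mat 1])) *v v x +
     (LINT \<theta>|lebesgue_on {a..x}. A_ker A (T1_ker a b B) x \<theta> *v v \<theta>) +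
     (LINT \<theta>|lebesgue_on {x..b}. A_ker A (T2_ker a b B) x \<theta> *v v \<theta>)"

text \<open>The integrals of L2-valued functions of \<open>s\<close> are evaluated pointwise in \<open>x\<close>.\<close>

definition T2_op :: "real \<Rightarrow> real \<Rightarrow> real^(4 \<times> 'n)^(2 \<times> 'n) \<Rightarrow>
    (real \<times> real \<Rightarrow> real^'n) \<Rightarrow> real \<times> real \<Rightarrow> real^'n" where
  "T2_op a b B \<psi> = (\<lambda>(s, x). LINT \<theta>|lebesgue_on {0..s}. T1_op a b B (\<lambda>y. \<psi> (\<theta>, y)) x)"

definition A12_op :: "real \<Rightarrow> real \<Rightarrow> real^(4 \<times> 'n)^(2 \<times> 'n) \<Rightarrow> (real \<Rightarrow> real^(3 \<times> 'n)^'n) \<Rightarrow>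
    (real \<times> real \<Rightarrow> real^'n) \<Rightarrow> real \<Rightarrow> real^'n" where
  "A12_op a b B Ad \<psi> x = (LINT s|lebesgue_on {0..1}. A11_op a b B Ad (\<lambda>y. \<psi> (s, y)) x)"

definition A22_op :: "real \<Rightarrow> real \<Rightarrow> real^(4 \<times> 'n)^(2 \<times> 'n) \<Rightarrow> real \<Rightarrow>
    (real \<times> real \<Rightarrow> real^'n) \<Rightarrow> real \<times> real \<Rightarrow> real^'n" where
  "A22_op a b B \<tau> \<psi> = (\<lambda>(s, x). - (1 / \<tau>) *\<^sub>R T1_op a b B (\<lambda>y. \<psi> (s, y)) x)"

definition T_op :: "real \<Rightarrow> real \<Rightarrow> real^(4 \<times> 'n)^(2 \<times> 'n) \<Rightarrow> 'n::finite state \<Rightarrow> 'n state" where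
  "T_op a b B = (\<lambda>(v, \<psi>).
     (T1_op a b B v,
      \<lambda>(s, x). T1_op a b B v x + T2_op a b B \<psi> (s, x)))"

definition A_op :: "real \<Rightarrow> real \<Rightarrow> (real \<Rightarrow> real^(3 \<times> 'n)^'n) \<Rightarrow> (real \<Rightarrow> real^(3 \<times> 'n)^'n) \<Rightarrow>
    real^(4 \<times> 'n)^(2 \<times> 'n) \<Rightarrow> real \<Rightarrow> 'n::finite state \<Rightarrow> 'n state" where
  "A_op a b A Ad B \<tau> = (\<lambda>(v, \<psi>).
     (\<lambda>x. A11_op a b B A v x + A11_op a b B Ad v x + A12_op a b B Ad \<psi> x,
      A22_op a b B \<tau> \<psi>))"

definition D_op :: "real \<Rightarrow> real \<Rightarrow> 'n::finite state \<Rightarrow> 'n state" where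
  "D_op a b = (\<lambda>(u, \<phi>). (dX a b (dX a b u), ds a b (dx a b (dx a b \<phi>))))"

end

theory Submission
  imports Defs
begin

text \<open>The second spatial derivative \<open>w\<close> of a function \<open>u\<close> determines \<open>u\<close> up to an affine function, and
  invertibility of \<open>B ** H_mat a b\<close> says exactly that the boundary conditions fix this affine part as a
  linear function of the two moments \<open>\<integral>w\<close> and \<open>\<integral>(b - \<theta>) w(\<theta>) d\<theta>\<close>. The operator \<open>T1_op\<close> performs this
  reconstruction. Likewise a history \<open>\<phi>\<close> over the unit delay interval is determined by its initial
  slice and by \<open>\<psi> = \<partial>\<^sub>s\<partial>\<^sub>x\<partial>\<^sub>x\<phi>\<close>. So \<open>T_op\<close> is a bijection, up to equality almost everywhere, from the
  square integrable states onto the states that satisfy all regularity and boundary constraints, with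
  inverse \<open>D_op\<close> (lemmas \<open>T_op_dpde_states\<close> and \<open>T_op_D_op\<close>). Both maps are linear and bounded between
  the L2 norm and the Sobolev norm, so they carry Frechet derivatives of curves to Frechet derivatives.

  Two points remain. The right-hand side of the delayed equation, evaluated at \<open>T_op w\<close>, is \<open>A_op w\<close>:
  this is the definition of the kernels of \<open>A11_op\<close> together with Fubini's theorem
  (\<open>A_op_eq_delay_rhs\<close>). Moreover, the time derivative \<open>z'\<close> of a solution of the delayed equation is
  required only to have Sobolev regularity, and it must be shown to lie in the range of \<open>T_op\<close>. It is
  the limit, in the Sobolev norm, of difference quotients that do lie there, and \<open>T_op \<circ> D_op\<close> is
  continuous and fixes them, hence it fixes \<open>z'\<close> (\<open>T_D_of_limit\<close>).

  The analytic basis is a description of weak derivatives by primitives: \<open>g\<close> is the weak derivative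
  of \<open>f\<close> in one coordinate iff \<open>f\<close> is almost everywhere a function of the other coordinates plus the
  primitive of \<open>g\<close> in that coordinate (\<open>has_weak_derivative_Icc_iff\<close>, \<open>has_weak_derivative_snd_iff\<close>,
  \<open>has_weak_derivative_fst_iff\<close>). It rests on the fundamental lemma of the calculus of variations, the
  du Bois-Reymond lemma and Fubini's theorem. Once it is available, test functions disappear from the
  argument, and everything becomes a computation with iterated integrals.\<close>

section \<open>Smooth bump functions\<close>

text \<open>The recursion defining \<open>times_differentiable\<close> speaks of \<open>frechet_derivative\<close>, a choice. The following
  two rules trade it for an explicit derivative, which is what calculations produce.\<close>

lemma times_differentiable_SucI:
  assumes "\<And>x. (f has_derivative f' x) (at x)"
    and "\<And>i. i \<in> Basis \<Longrightarrow> times_differentiable k (\<lambda>x. f' x i)"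
  shows "times_differentiable (Suc k) f"
proof -
  have "frechet_derivative f (at x) = f' x" for x
    using frechet_derivative_at[OF assms(1)] by simp
  then show ?thesis
    using assms by (auto simp: differentiable_def)
qed

lemma times_differentiable_SucE:
  assumes "times_differentiable (Suc k) f"
  shows "(f has_derivative frechet_derivative f (at x)) (at x)"
    and "i \<in> Basis \<Longrightarrow> times_differentiable k (\<lambda>x. frechet_derivative f (at x) i)"
  using assms by (simp_all flip: frechet_derivative_works)

lemma times_differentiable_mono: "times_differentiable (Suc k) f \<Longrightarrow> times_differentiable k f"
proof (induction k arbitrary: f)
  case 0
  then show ?case
    by (auto simp: continuous_on_eq_continuous_at intro: differentiable_imp_continuous_within)
next
  case (Suc k)
  then show ?case by simp
qed

lemma times_differentiable_const: "times_differentiable k (\<lambda>_. c)"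
proof (induction k arbitrary: c)
  case (Suc k)
  have "((\<lambda>_. c) has_derivative (\<lambda>_. 0)) (at x)" for x :: 'a
    by simp
  then show ?case
    by (rule times_differentiable_SucI) (rule Suc)
qed simp

lemma times_differentiable_add:
  "times_differentiable k f \<Longrightarrow> times_differentiable k g \<Longrightarrow> times_differentiable k (\<lambda>x. f x + g x)"
proof (induction k arbitrary: f g)
  case 0
  then show ?case by (simp add: continuous_on_mult continuous_on_add)
next
  case (Suc k)
  note f' = times_differentiable_SucE[OF Suc.prems(1)]
  note g' = times_differentiable_SucE[OF Suc.prems(2)]
  show ?case
    by (rule times_differentiable_SucI[OF has_derivative_add[OF f'(1) g'(1)]])
       (intro Suc.IH f' g')
qed

lemma times_differentiable_mult:
  "times_differentiable k f \<Longrightarrow> times_differentiable k g \<Longrightarrow> times_differentiable k (\<lambda>x. f x * g x)"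
proof (induction k arbitrary: f g)
  case 0
  then show ?case by (simp add: continuous_on_mult continuous_on_add)
next
  case (Suc k)
  note f' = times_differentiable_SucE[OF Suc.prems(1)]
  note g' = times_differentiable_SucE[OF Suc.prems(2)]
  show ?case
    by (rule times_differentiable_SucI[OF has_derivative_mult[OF f'(1) g'(1)]])
       (intro Suc.IH times_differentiable_add f' g' Suc.prems[THEN times_differentiable_mono])
qed

text \<open>Functions of one variable enter Euclidean space only through a linear functional; this form serves
  both the factors of a bump function and the extension of a test function to the plane.\<close>

lemma times_differentiable_compose_inner:
  fixes h :: "real \<Rightarrow> real" and v :: "'a::euclidean_space"
  shows "times_differentiable k h \<Longrightarrow> times_differentiable k (\<lambda>x. h (v \<bullet> x + c))"
proof (induction k arbitrary: h)
  case 0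
  have "continuous_on UNIV (h \<circ> (\<lambda>x. v \<bullet> x + c))"
    using 0 by (intro continuous_on_compose continuous_intros) (auto intro: continuous_on_subset)
  then show ?case by (simp add: o_def)
next
  case (Suc k)
  note h' = times_differentiable_SucE[OF Suc.prems]
  have "((\<lambda>x. h (v \<bullet> x + c)) has_derivative (\<lambda>w. (v \<bullet> w) * frechet_derivative h (at (v \<bullet> x + c)) 1)) (at x)" for x
  proof -
    have "((\<lambda>x. v \<bullet> x + c) has_derivative (\<lambda>w. v \<bullet> w)) (at x)"
      by (auto intro!: derivative_eq_intros)
    from has_derivative_compose[OF this h'(1)]
    have "((\<lambda>x. h (v \<bullet> x + c)) has_derivative (\<lambda>w. frechet_derivative h (at (v \<bullet> x + c)) (v \<bullet> w))) (at x)" .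
    moreover have "frechet_derivative h (at (v \<bullet> x + c)) (v \<bullet> w) = (v \<bullet> w) * frechet_derivative h (at (v \<bullet> x + c)) 1" for w
      using linear_cmul[OF has_derivative_linear[OF h'(1)], of _ "v \<bullet> w" 1] by simp
    ultimately show ?thesis by simp
  qed
  then show ?case
    by (rule times_differentiable_SucI)
       (intro times_differentiable_mult times_differentiable_const Suc.IH, use h'(2)[of 1] in simp)
qed

lemma times_differentiable_Suc_realI:
  assumes "\<And>x. (f has_real_derivative f' x) (at x)" and "times_differentiable k f'"
  shows "times_differentiable (Suc k) f"
  using assms(2) by (intro times_differentiable_SucI[OF assms(1)[unfolded has_field_derivative_def]]) simp

text \<open>The classical smooth function that vanishes exactly on the nonpositive half-line.\<close>

definition smooth_step :: "real \<Rightarrow> real" where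
  "smooth_step x = (if x \<le> 0 then 0 else exp (- (1 / x)))"

lemma smooth_step_0: "smooth_step 0 = 0"
  by (simp add: smooth_step_def)

lemma tendsto_poly_exp_at_right:
  fixes p :: "real poly"
  shows "((\<lambda>x. poly p (1 / x) * exp (- (1 / x))) \<longlongrightarrow> 0) (at_right 0)"
proof -
  have "((\<lambda>y. poly p y * exp (- y)) \<longlongrightarrow> 0) at_top"
  proof (induction p)
    case 0
    then show ?case by simp
  next
    case (pCons c p)
    have *: "((\<lambda>y. (\<Sum>i\<le>degree (pCons c p). coeff (pCons c p) i * (y ^ i / exp y))) \<longlongrightarrow>
        (\<Sum>i\<le>degree (pCons c p). coeff (pCons c p) i * 0)) at_top"
      by (intro tendsto_intros tendsto_power_div_exp_0)
    have "(\<lambda>y. (\<Sum>i\<le>degree (pCons c p). coeff (pCons c p) i * (y ^ i / exp y)))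
        = (\<lambda>y. poly (pCons c p) y * exp (- y))"
      by (auto simp: poly_altdef exp_minus field_simps sum_distrib_left sum_divide_distrib simp del: poly_pCons)
    with * show ?case by simp
  qed
  from filterlim_compose[OF this filterlim_inverse_at_top_right]
  show ?thesis by (simp add: inverse_eq_divide)
qed

text \<open>Derivatives of \<open>exp (- 1 / x)\<close> are again of the form \<open>p (1 / x) * exp (- 1 / x)\<close> with a polynomial \<open>p\<close>.
  Treating all such functions at once makes smoothness a plain induction.\<close>

lemma has_real_derivative_poly_smooth_step:
  "((\<lambda>x. poly p (1 / x) * smooth_step x) has_real_derivative
    poly ([:0, 0, 1:] * (p - pderiv p)) (1 / x) * smooth_step x) (at x)"
proof -
  consider "x < 0" | "x = 0" | "x > 0" by linarith
  then show ?thesis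
  proof cases
    case 1
    have "((\<lambda>x. 0) has_real_derivative 0) (at x)" by simp
    then have "((\<lambda>x. poly p (1 / x) * smooth_step x) has_real_derivative 0) (at x)"
      by (rule has_field_derivative_transform_within_open[of _ _ _ "{..<0}"])
         (use 1 in \<open>auto simp: smooth_step_def\<close>)
    then show ?thesis using 1 by (simp add: smooth_step_def)
  next
    case 2
    have l: "((\<lambda>h. poly p (1 / h) * smooth_step h / h) \<longlongrightarrow> 0) (at_left 0)"
      by (rule Lim_transform_eventually[OF tendsto_const])
         (auto simp: eventually_at_filter smooth_step_def)
    have r: "((\<lambda>h. poly p (1 / h) * smooth_step h / h) \<longlongrightarrow> 0) (at_right 0)"
      by (rule Lim_transform_eventually[OF tendsto_poly_exp_at_right[of "pCons 0 p"]])
         (auto simp: eventually_at_filter smooth_step_def)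
    have "((\<lambda>h. poly p (1 / h) * smooth_step h / h) \<longlongrightarrow> 0) (at 0)"
      using l r by (simp add: filterlim_split_at)
    then show ?thesis
      using 2 by (simp add: DERIV_def smooth_step_0)
  next
    case 3
    have inv: "((\<lambda>x. 1 / x) has_real_derivative - (1 / x\<^sup>2)) (at x)"
      using 3 by (auto intro!: derivative_eq_intros simp: power2_eq_square)
    have "((\<lambda>x. poly p (1 / x)) has_real_derivative poly (pderiv p) (1 / x) * - (1 / x\<^sup>2)) (at x)"
      by (rule DERIV_chain2[OF poly_DERIV inv])
    from DERIV_mult[OF this DERIV_chain2[OF DERIV_exp DERIV_minus[OF inv]]]
    have "((\<lambda>x. poly p (1 / x) * exp (- (1 / x))) has_real_derivative
        poly ([:0, 0, 1:] * (p - pderiv p)) (1 / x) * exp (- (1 / x))) (at x)"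
      by (rule DERIV_cong) (simp add: algebra_simps power2_eq_square)
    then have "((\<lambda>x. poly p (1 / x) * smooth_step x) has_real_derivative
        poly ([:0, 0, 1:] * (p - pderiv p)) (1 / x) * exp (- (1 / x))) (at x)"
      by (rule has_field_derivative_transform_within_open[of _ _ _ "{0<..}"])
         (use 3 in \<open>auto simp: smooth_step_def\<close>)
    then show ?thesis using 3 by (simp add: smooth_step_def)
  qed
qed

lemma times_differentiable_poly_smooth_step:
  "times_differentiable k (\<lambda>x. poly p (1 / x) * smooth_step x)"
proof (induction k arbitrary: p)
  case 0
  show ?case
    using has_real_derivative_poly_smooth_step[of p]
    by (auto simp: continuous_on_eq_continuous_at intro: DERIV_isCont)
next
  case (Suc k)
  show ?case
    by (rule times_differentiable_Suc_realI[OF has_real_derivative_poly_smooth_step Suc])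
qed

lemma times_differentiable_smooth_step: "times_differentiable k smooth_step"
  using times_differentiable_poly_smooth_step[of k 1] by simp

lemma smooth_step_bounds: "0 \<le> smooth_step x" "smooth_step x \<le> 1"
  by (auto simp: smooth_step_def)

text \<open>The shift by \<open>1\<close> keeps the support of the \<open>n\<close>-th bump at distance \<open>1 / n\<close> from the boundary of the box.
  The bumps are therefore test functions even for a box that touches the boundary of the domain, and
  they still exhaust the whole open box as \<open>n\<close> grows.\<close>

definition bump :: "nat \<Rightarrow> 'a::euclidean_space \<Rightarrow> 'a \<Rightarrow> 'a \<Rightarrow> real" where
  "bump n c d x = (\<Prod>i\<in>Basis. smooth_step (real n * ((x - c) \<bullet> i) - 1) * smooth_step (real n * ((d - x) \<bullet> i) - 1))"

lemma times_differentiable_prod: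
  "finite I \<Longrightarrow> (\<And>i. i \<in> I \<Longrightarrow> times_differentiable k (f i)) \<Longrightarrow> times_differentiable k (\<lambda>x. \<Prod>i\<in>I. f i x)"
  by (induction I rule: finite_induct) (auto intro: times_differentiable_mult times_differentiable_const)

lemma times_differentiable_bump: "times_differentiable k (bump n c d)"
proof -
  have 1: "times_differentiable k (\<lambda>x. smooth_step (real n * ((x - c) \<bullet> i) - 1))" for i c :: 'a
    using times_differentiable_compose_inner[OF times_differentiable_smooth_step,
        of k "real n *\<^sub>R i" "- (real n * (c \<bullet> i)) - 1"]
    by (simp add: inner_diff_left algebra_simps inner_commute)
  have 2: "times_differentiable k (\<lambda>x. smooth_step (real n * ((d - x) \<bullet> i) - 1))" for i d :: 'a
    using times_differentiable_compose_inner[OF times_differentiable_smooth_step,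
        of k "- (real n *\<^sub>R i)" "real n * (d \<bullet> i) - 1"]
    by (simp add: inner_diff_left algebra_simps inner_commute)
  show ?thesis
    unfolding bump_def[abs_def]
    by (intro times_differentiable_prod times_differentiable_mult 1 2 finite_Basis)
qed

lemma bump_bounds: "0 \<le> bump n c d x" "bump n c d x \<le> 1"
  unfolding bump_def
  by (intro prod_nonneg prod_le_1 ballI conjI mult_nonneg_nonneg mult_le_one smooth_step_bounds)+

lemma closure_support_bump: "closure {x. bump n c d x \<noteq> 0} \<subseteq> box c d"
  and compact_support_bump: "compact (closure {x. bump n c d x \<noteq> 0})"
proof -
  \<comment> \<open>a closed box at distance \<open>1 / n\<close> from the boundary of the open one; for \<open>n = 0\<close> the bump is zero\<close>
  define K where "K = (if n = 0 then {} else cbox (c + (\<Sum>i\<in>Basis. (1 / n) *\<^sub>R i)) (d - (\<Sum>i\<in>Basis. (1 / n) *\<^sub>R i)))"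
  have "{x. bump n c d x \<noteq> 0} \<subseteq> K"
  proof
    fix x assume "x \<in> {x. bump n c d x \<noteq> 0}"
    then have nz: "smooth_step (real n * ((x - c) \<bullet> i) - 1) \<noteq> 0" "smooth_step (real n * ((d - x) \<bullet> i) - 1) \<noteq> 0"
      if "i \<in> Basis" for i
      using that by (auto simp: bump_def)
    have "y > 0" if "smooth_step y \<noteq> 0" for y
      using that by (auto simp: smooth_step_def split: if_splits)
    from this[OF nz(1)] this[OF nz(2)]
    have pos: "real n * ((x - c) \<bullet> i) > 1" "real n * ((d - x) \<bullet> i) > 1" if "i \<in> Basis" for i
      using that by auto
    obtain j :: 'a where "j \<in> Basis" using nonempty_Basis by blast
    with pos(1)[of j] have n: "n \<noteq> 0" by (cases "n = 0") auto
    have "c \<bullet> i + 1 / n \<le> x \<bullet> i" "x \<bullet> i \<le> d \<bullet> i - 1 / n" if "i \<in> Basis" for i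
      using pos[OF that] n by (auto simp: inner_diff_left field_simps)
    then show "x \<in> K"
      using n by (simp add: K_def mem_box inner_add_left inner_diff_left inner_sum_left_Basis)
  qed
  moreover have K: "compact K" by (simp add: K_def)
  moreover have "K \<subseteq> box c d"
  proof
    fix x assume x: "x \<in> K"
    then have n: "n \<noteq> 0" by (auto simp: K_def split: if_splits)
    have "c \<bullet> i + 1 / n \<le> x \<bullet> i" "x \<bullet> i \<le> d \<bullet> i - 1 / n" if "i \<in> Basis" for i
      using x n that by (simp_all add: K_def mem_box inner_add_left inner_diff_left inner_sum_left_Basis)
    moreover have "1 / real n > 0" using n by simp
    ultimately show "x \<in> box c d"
      unfolding mem_box by (smt (verit))
  qed
  ultimately show "closure {x. bump n c d x \<noteq> 0} \<subseteq> box c d"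
    using closure_minimal[OF _ compact_imp_closed[OF K]] by blast
  show "compact (closure {x. bump n c d x \<noteq> 0})"
    using \<open>_ \<subseteq> K\<close> K by (meson bounded_subset compact_closure compact_imp_bounded)
qed

lemma test_function_bump:
  "box c d \<subseteq> \<Omega> \<Longrightarrow> test_function \<Omega> (bump n c d)"
  unfolding test_function_def
  using closure_support_bump[of n c d] compact_support_bump[of n c d]
    interior_maximal[OF _ open_box]
  by (blast intro: times_differentiable_bump)

lemma bump_tendsto_indicator: "(\<lambda>n. bump n c d x) \<longlonglongrightarrow> indicator (box c d) x"
proof (cases "x \<in> box c d")
  case True
  have step: "(\<lambda>n. smooth_step (real n * r - 1)) \<longlonglongrightarrow> 1" if "r > 0" for r
  proof -
    have top: "filterlim (\<lambda>n. real n * r - 1) at_top sequentially"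
      using filterlim_tendsto_add_at_top[OF tendsto_const
          filterlim_at_top_mult_tendsto_pos[OF tendsto_const that filterlim_real_sequentially], of "- 1"]
      by simp
    have "((\<lambda>y::real. exp (- (1 / y))) \<longlongrightarrow> exp (- 0)) at_top"
      by (intro tendsto_intros tendsto_divide_0[OF tendsto_const] filterlim_at_top_imp_at_infinity filterlim_ident)
    then have "(smooth_step \<longlongrightarrow> 1) at_top"
      unfolding minus_zero exp_zero
      by (rule Lim_transform_eventually)
         (auto simp: eventually_at_top_linorder smooth_step_def intro!: exI[of _ 1])
    from filterlim_compose[OF this top] show ?thesis .
  qed
  have "(\<lambda>n. bump n c d x) \<longlonglongrightarrow> (\<Prod>i\<in>(Basis::'a set). 1 * 1)"
    unfolding bump_def using True
    by (intro tendsto_prod tendsto_mult step) (auto simp: mem_box inner_diff_left)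
  moreover have "(indicator (box c d) x :: real) = 1" using True by (rule indicator_simps)
  ultimately show ?thesis by simp
next
  case False
  have "bump n c d x = 0" for n
    using False closure_support_bump[of n c d] closure_subset[of "{x. bump n c d x \<noteq> 0}"] by auto
  then show ?thesis using False by simp
qed

section \<open>Borel representatives and the fundamental lemma of the calculus of variations\<close>

lemma AE_lebesgue_on_iff:
  "S \<in> sets borel \<Longrightarrow> (AE x in lebesgue_on S. P x) \<longleftrightarrow> (AE x in lborel. x \<in> S \<longrightarrow> P x)"
  by (simp add: AE_restrict_space_iff AE_completion_iff)

lemma borel_measurable_lebesgue_on_AE:
  fixes f g :: "'a::euclidean_space \<Rightarrow> 'b::euclidean_space"
  assumes S: "S \<in> sets borel" and g: "g \<in> borel_measurable (lebesgue_on S)"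
    and ae: "AE x in lebesgue_on S. f x = g x"
  shows "f \<in> borel_measurable (lebesgue_on S)"
proof -
  have "(\<lambda>x. if x \<in> S then g x else 0) \<in> borel_measurable lebesgue"
    using g S by (simp add: borel_measurable_if)
  moreover have "AE x in lebesgue. (if x \<in> S then g x else 0) = (if x \<in> S then f x else 0)"
    using ae S by (auto simp: AE_restrict_space_iff)
  ultimately have "(\<lambda>x. if x \<in> S then f x else 0) \<in> borel_measurable lebesgue"
    by (rule borel_measurable_AE)
  then show ?thesis
    using S by (simp add: borel_measurable_if)
qed

text \<open>Fubini's theorem concerns the product of Borel measures, whose completion is Lebesgue
  measure; statements about Lebesgue measurable functions are transported through representatives of this kind.\<close>

lemma borel_representative:
  fixes f :: "'a::euclidean_space \<Rightarrow> 'b::euclidean_space"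
  assumes S: "S \<in> sets borel" and f: "f \<in> borel_measurable (lebesgue_on S)"
  shows "\<exists>g. g \<in> borel_measurable borel \<and> (\<forall>x. x \<notin> S \<longrightarrow> g x = 0) \<and> (AE x in lebesgue_on S. f x = g x)"
proof -
  have f0: "(\<lambda>x. if x \<in> S then f x else 0) \<in> borel_measurable lebesgue"
    using f S by (simp add: borel_measurable_if)
  have "\<exists>g. g \<in> borel_measurable lborel \<and> (AE x in lborel. (if x \<in> S then f x else 0) \<bullet> i = g x)" for i
    using completion_ex_borel_measurable_real[of "\<lambda>x. (if x \<in> S then f x else 0) \<bullet> i" lborel] f0
    by (auto intro: borel_measurable_inner)
  then obtain h where h: "\<And>i. h i \<in> borel_measurable lborel"
    "\<And>i. AE x in lborel. (if x \<in> S then f x else 0) \<bullet> i = h i x"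
    by metis
  define g where "g x = indicator S x *\<^sub>R (\<Sum>i\<in>Basis. h i x *\<^sub>R i)" for x
  have "AE x in lborel. \<forall>i\<in>Basis. (if x \<in> S then f x else 0) \<bullet> i = h i x"
    using h(2) by (intro AE_finite_allI) auto
  then have "AE x in lebesgue_on S. f x = g x"
    unfolding AE_lebesgue_on_iff[OF S]
  proof eventually_elim
    case (elim x)
    show ?case
    proof
      assume "x \<in> S"
      with elim have "g x = (\<Sum>i\<in>Basis. (f x \<bullet> i) *\<^sub>R i)" by (simp add: g_def)
      then show "f x = g x" by (simp add: euclidean_representation)
    qed
  qed
  moreover have "g \<in> borel_measurable borel"
    using h(1) S unfolding g_def by measurable
  moreover have "g x = 0" if "x \<notin> S" for x
    using that by (simp add: g_def)
  ultimately show ?thesis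
    by blast
qed

lemma
  fixes g :: "'a::euclidean_space \<Rightarrow> 'b::euclidean_space"
  assumes S: "S \<in> sets borel" and g: "g \<in> borel_measurable borel" "\<And>x. x \<notin> S \<Longrightarrow> g x = 0"
  shows integrable_lebesgue_on_lborel: "integrable (lebesgue_on S) g \<longleftrightarrow> integrable lborel g"
    and integral_lebesgue_on_lborel: "(LINT x|lebesgue_on S. g x) = (LINT x|lborel. g x)"
proof -
  have eq: "(\<lambda>x. indicator S x *\<^sub>R g x) = g"
    using g(2) by (auto simp: indicator_def)
  show "integrable (lebesgue_on S) g \<longleftrightarrow> integrable lborel g"
    using S g(1) eq by (simp add: integrable_restrict_space integrable_completion)
  show "(LINT x|lebesgue_on S. g x) = (LINT x|lborel. g x)"
    using S g(1) eq by (simp add: integral_restrict_space integral_completion)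
qed

lemma borel_measurable_lebesgue_onI:
  "g \<in> borel_measurable borel \<Longrightarrow> g \<in> borel_measurable (lebesgue_on S)"
  by (intro measurable_restrict_space1 measurable_completion) simp

text \<open>Bumps converge boundedly to indicators of boxes, so \<open>g\<close> integrates to zero over every box.
  Boxes form a generator of the Borel sets that is stable under intersection, so \<open>g\<close> integrates to zero
  over every Borel set.\<close>

lemma fundamental_lemma_variations:
  fixes g :: "'a::euclidean_space \<Rightarrow> 'b::euclidean_space"
  assumes g: "integrable (lebesgue_on (cbox l u)) g"
    and zero: "\<And>n c d. box c d \<subseteq> cbox l u \<Longrightarrow> (LINT x|lebesgue_on (cbox l u). bump n c d x *\<^sub>R g x) = 0"
  shows "AE x in lebesgue_on (cbox l u). g x = 0"
proof -
  define S where "S = cbox l u"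
  have S: "S \<in> sets borel" by (simp add: S_def)
  obtain h where h: "h \<in> borel_measurable borel" "\<And>x. x \<notin> S \<Longrightarrow> h x = 0"
    "AE x in lebesgue_on S. g x = h x"
    using borel_representative[OF S borel_measurable_integrable[OF g[folded S_def]]] by blast
  have bm: "bump n c d \<in> borel_measurable borel" for n and c d :: 'a
    using times_differentiable_bump[of 0 n c d] borel_measurable_continuous_onI by simp
  have hS: "integrable (lebesgue_on S) h"
    by (intro integrable_cong_AE_imp[OF g[folded S_def] borel_measurable_lebesgue_onI[OF h(1)]]) (use h(3) in auto)
  then have hi: "integrable lborel h"
    using integrable_lebesgue_on_lborel[OF S h(1,2)] by simp
  have box: "(LINT x|lborel. indicator (box c d) x *\<^sub>R h x) = 0" if "box c d \<subseteq> cbox l u" for c d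
  proof -
    have "(LINT x|lborel. bump n c d x *\<^sub>R h x) = 0" for n
    proof -
      have "(LINT x|lborel. bump n c d x *\<^sub>R h x) = (LINT x|lebesgue_on S. bump n c d x *\<^sub>R h x)"
        using S h(1,2) bm by (intro integral_lebesgue_on_lborel[symmetric]) (auto intro!: borel_measurable_scaleR)
      also have "\<dots> = (LINT x|lebesgue_on S. bump n c d x *\<^sub>R g x)"
        using h(3) by (intro integral_cong_AE borel_measurable_scaleR borel_measurable_lebesgue_onI[OF bm]
            borel_measurable_lebesgue_onI[OF h(1)] borel_measurable_integrable[OF g[folded S_def]]) auto
      finally show ?thesis using zero[OF that] by (simp add: S_def)
    qed
    moreover have "(\<lambda>n. LINT x|lborel. bump n c d x *\<^sub>R h x) \<longlonglongrightarrow> (LINT x|lborel. indicator (box c d) x *\<^sub>R h x)"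
    proof (rule integral_dominated_convergence[where w = "\<lambda>x. norm (h x)"])
      show "(\<lambda>x. indicat_real (box c d) x *\<^sub>R h x) \<in> borel_measurable lborel"
        "(\<lambda>x. bump n c d x *\<^sub>R h x) \<in> borel_measurable lborel" for n
        using h(1) bm by auto
      show "AE x in lborel. (\<lambda>n. bump n c d x *\<^sub>R h x) \<longlonglongrightarrow> indicat_real (box c d) x *\<^sub>R h x"
        by (intro AE_I2 tendsto_scaleR bump_tendsto_indicator tendsto_const)
      show "AE x in lborel. norm (bump n c d x *\<^sub>R h x) \<le> norm (h x)" for n
        using bump_bounds[of n c d] by (auto intro!: mult_left_le_one_le)
    qed (use hi in simp)
    ultimately show ?thesis
      by (simp add: LIMSEQ_const_iff)
  qed
  \<comment> \<open>an arbitrary box may be cut down to the domain, whose frontier is a null set\<close>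
  have box': "(LINT x|lborel. indicator (box c d) x *\<^sub>R h x) = 0" for c d
  proof -
    have "negligible (frontier S)"
      unfolding S_def by (rule negligible_convex_frontier[OF convex_box(1)])
    then have "AE x in lebesgue. x \<notin> frontier S"
      by (intro AE_not_in) (simp add: negligible_iff_null_sets)
    then have "AE x in lborel. x \<notin> frontier S"
      by (simp only: AE_completion_iff)
    then have "AE x in lborel. indicator (box c d \<inter> box l u) x *\<^sub>R h x = indicator (box c d) x *\<^sub>R h x"
    proof eventually_elim
      case (elim x)
      then show ?case using h(2)[of x]
        by (auto simp: indicator_def S_def frontier_cbox)
    qed
    then have "(LINT x|lborel. indicator (box c d) x *\<^sub>R h x) = (LINT x|lborel. indicator (box c d \<inter> box l u) x *\<^sub>R h x)"
      using h(1) by (intro integral_cong_AE) auto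
    also have "\<dots> = 0"
      unfolding box_Int_box by (rule box) (auto simp: box_Int_box[symmetric] box_subset_cbox[THEN subsetD])
    finally show ?thesis .
  qed
  have all: "(LINT x|lborel. indicator A x *\<^sub>R h x) = 0" if A: "A \<in> sets borel" for A
  proof -
    have "Int_stable (range (\<lambda>(a, b). box a b :: 'a set))"
      by (auto simp: Int_stable_def box_Int_box)
    moreover have "range (\<lambda>(a, b). box a b :: 'a set) \<subseteq> Pow UNIV"
      by auto
    moreover have "A \<in> sigma_sets UNIV (range (\<lambda>(a, b). box a b))"
      using A unfolding borel_eq_box by simp
    ultimately show ?thesis
    proof (induction rule: sigma_sets_induct_disjoint)
      case (basic A)
      then show ?case using box' by auto
    next
      case empty
      then show ?case by simp
    next
      case (compl A)
      have [measurable]: "A \<in> sets borel"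
        using compl(1) by (simp add: borel_eq_box)
      \<comment> \<open>the total integral is the one over any box that contains the domain\<close>
      have UN: "(LINT x|lborel. h x) = 0"
      proof -
        have "(LINT x|lborel. h x) = (LINT x|lborel. indicator (box (l - One) (u + One)) x *\<^sub>R h x)"
        proof (intro Bochner_Integration.integral_cong refl)
          fix x
          have "x \<in> S \<Longrightarrow> x \<in> box (l - One) (u + One)"
            by (auto simp: S_def mem_box inner_diff_left inner_add_left intro: le_less_trans[of _ "_ \<bullet> _"] less_le_trans)
          then show "h x = indicator (box (l - One) (u + One)) x *\<^sub>R h x"
            using h(2)[of x] by (auto simp: indicator_def)
        qed
        then show ?thesis using box' by simp
      qed
      have "(LINT x|lborel. indicator (UNIV - A) x *\<^sub>R h x) = (LINT x|lborel. h x - indicator A x *\<^sub>R h x)"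
        by (intro Bochner_Integration.integral_cong) (auto simp: indicator_def)
      also have "\<dots> = 0"
        using hi compl UN by (subst Bochner_Integration.integral_diff) (auto intro: integrable_mult_indicator)
      finally show ?case .
    next
      case (union A)
      have [measurable]: "A i \<in> sets borel" for i
        using union(2) by (auto simp: borel_eq_box subset_eq)
      have "(LINT x|lborel. indicator (\<Union>i. A i) x *\<^sub>R h x) = (\<Sum>i. LINT x:A i|lborel. h x)"
        unfolding set_lebesgue_integral_def[symmetric]
        using union(1) hi by (intro lebesgue_integral_countable_add)
          (auto simp: disjoint_family_on_def set_integrable_def intro!: integrable_mult_indicator)
      then show ?case using union by (simp add: set_lebesgue_integral_def)
    qed
  qed
  have "AE x in lborel. h x = 0"
    by (rule sigma_finite_measure.density_unique_banach[OF sigma_finite_lborel hi])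
       (auto simp: set_lebesgue_integral_def all)
  then have "AE x in lebesgue_on S. h x = 0"
    unfolding AE_lebesgue_on_iff[OF S] by auto
  with h(3) show ?thesis
    unfolding S_def by auto
qed

section \<open>Fubini's theorem for Lebesgue measure on a product set\<close>

lemma borel_measurable_swap:
  "prod.swap \<in> borel_measurable (borel :: ('a::euclidean_space \<times> 'b::euclidean_space) measure)"
  by (intro borel_measurable_continuous_onI continuous_on_swap)

lemma swap_eq: "(\<lambda>(x, y). (y, x)) = prod.swap"
  by auto

lemma AE_lborel_pair_swap:
  fixes P :: "'a::euclidean_space \<times> 'b::euclidean_space \<Rightarrow> bool"
  assumes "AE p in lborel. P p"
  shows "AE q in lborel. P (prod.swap q)"
proof -
  have d: "(lborel :: ('a \<times> 'b) measure) = distr lborel lborel prod.swap"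
    using lborel_pair.distr_pair_swap[where 'a = 'a and 'b = 'b]
    unfolding lborel_prod swap_eq .
  have "prod.swap \<in> (lborel :: ('b \<times> 'a) measure) \<rightarrow>\<^sub>M (lborel :: ('a \<times> 'b) measure)"
    using borel_measurable_swap by simp
  moreover have "AE p in distr (lborel :: ('b \<times> 'a) measure) lborel prod.swap. P p"
    unfolding d[symmetric] by (rule assms)
  ultimately show ?thesis
    by (rule AE_distrD)
qed

lemma integral_lborel_swap:
  fixes f :: "'a::euclidean_space \<times> 'b::euclidean_space \<Rightarrow> 'c::euclidean_space"
  assumes "f \<in> borel_measurable borel"
  shows "(LINT q|lborel. f (prod.swap q)) = (LINT p|lborel. f p)"
  using lborel_pair.integral_product_swap[of f] assms
  by (simp add: lborel_prod case_prod_unfold prod.swap_def)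

lemma Times_in_borel:
  "S \<in> sets borel \<Longrightarrow> T \<in> sets borel \<Longrightarrow> S \<times> T \<in> sets (borel :: ('a::euclidean_space \<times> 'b::euclidean_space) measure)"
  by (simp add: borel_prod[symmetric])

text \<open>Exchanging the two factors preserves Lebesgue measure. Each statement about one coordinate below is
  proved for one of the two orders and transported to the other.\<close>

lemma AE_lebesgue_on_swap:
  fixes P :: "'a::euclidean_space \<times> 'b::euclidean_space \<Rightarrow> bool"
  assumes "S \<in> sets borel" "T \<in> sets borel" "AE p in lebesgue_on (S \<times> T). P p"
  shows "AE q in lebesgue_on (T \<times> S). P (prod.swap q)"
  using AE_lborel_pair_swap[of "\<lambda>p. p \<in> S \<times> T \<longrightarrow> P p"] assms
  by (simp add: AE_lebesgue_on_iff Times_in_borel mem_Times_iff conj_commute)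

lemma AE_lebesgue_on_pair:
  fixes P :: "'a::euclidean_space \<times> 'b::euclidean_space \<Rightarrow> bool"
  assumes S: "S \<in> sets borel" and T: "T \<in> sets borel" and ae: "AE p in lebesgue_on (S \<times> T). P p"
  shows "AE s in lebesgue_on S. AE x in lebesgue_on T. P (s, x)"
proof -
  have "AE p in lborel \<Otimes>\<^sub>M lborel. p \<in> S \<times> T \<longrightarrow> P p"
    using ae unfolding lborel_prod AE_lebesgue_on_iff[OF Times_in_borel[OF S T]] .
  then have "AE s in lborel. AE x in lborel. (s, x) \<in> S \<times> T \<longrightarrow> P (s, x)"
    by (rule lborel_pair.AE_pair)
  then show ?thesis
    unfolding AE_lebesgue_on_iff[OF S] AE_lebesgue_on_iff[OF T] by eventually_elim auto
qed

lemma AE_lebesgue_on_fst: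
  fixes S :: "'a::euclidean_space set" and T :: "'b::euclidean_space set"
  assumes S: "S \<in> sets borel" and T: "T \<in> sets borel" and ae: "AE s in lebesgue_on S. P s"
  shows "AE p in lebesgue_on (S \<times> T). P (fst p)"
proof -
  have "AE s in lborel. s \<in> S \<longrightarrow> P s"
    using ae by (simp add: AE_lebesgue_on_iff S)
  then obtain N where N: "{s \<in> space lborel. \<not> (s \<in> S \<longrightarrow> P s)} \<subseteq> N" "emeasure lborel N = 0" "N \<in> sets lborel"
    by (rule AE_E)
  have "emeasure (lborel \<Otimes>\<^sub>M lborel) (N \<times> (UNIV :: 'b set)) = 0"
    using N by (subst lborel.emeasure_pair_measure_Times) auto
  then have "N \<times> (UNIV :: 'b set) \<in> null_sets lborel"
    using N(3) by (auto simp: lborel_prod null_sets_def Times_in_borel)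
  then have "AE p in lborel. p \<notin> N \<times> (UNIV :: 'b set)"
    by (rule AE_not_in)
  then show ?thesis
    unfolding AE_lebesgue_on_iff[OF Times_in_borel[OF S T]]
    by eventually_elim (use N(1) in auto)
qed

lemma AE_lebesgue_on_snd:
  fixes S :: "'a::euclidean_space set" and T :: "'b::euclidean_space set"
  assumes S: "S \<in> sets borel" and T: "T \<in> sets borel" and ae: "AE x in lebesgue_on T. P x"
  shows "AE p in lebesgue_on (S \<times> T). P (snd p)"
  using AE_lebesgue_on_swap[OF T S AE_lebesgue_on_fst[OF T S ae]] by simp

text \<open>The same for measurability and integrals.\<close>

lemma borel_measurable_lebesgue_on_swap:
  fixes f :: "'a::euclidean_space \<times> 'b::euclidean_space \<Rightarrow> 'c::euclidean_space"
  assumes S: "S \<in> sets borel" and T: "T \<in> sets borel" and f: "f \<in> borel_measurable (lebesgue_on (S \<times> T))"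
  shows "(\<lambda>q. f (prod.swap q)) \<in> borel_measurable (lebesgue_on (T \<times> S))"
    and "(LINT q|lebesgue_on (T \<times> S). f (prod.swap q)) = (LINT p|lebesgue_on (S \<times> T). f p)"
    and "integrable (lebesgue_on (S \<times> T)) f \<Longrightarrow> integrable (lebesgue_on (T \<times> S)) (\<lambda>q. f (prod.swap q))"
proof -
  note ST = Times_in_borel[OF S T] and TS = Times_in_borel[OF T S]
  obtain g where g: "g \<in> borel_measurable borel" "\<And>x. x \<notin> S \<times> T \<Longrightarrow> g x = 0"
    "AE x in lebesgue_on (S \<times> T). f x = g x"
    using borel_representative[OF ST f] by blast
  have swap: "prod.swap \<in> borel_measurable (borel :: ('b \<times> 'a) measure)"
    by (rule borel_measurable_swap)
  have gs: "(\<lambda>q. g (prod.swap q)) \<in> borel_measurable borel" "\<And>x. x \<notin> T \<times> S \<Longrightarrow> g (prod.swap x) = 0"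
    by (rule measurable_compose[OF swap g(1)], rule g(2)) auto
  note gl = borel_measurable_lebesgue_onI[OF g(1)] borel_measurable_lebesgue_onI[OF gs(1)]
  have ae: "AE q in lebesgue_on (T \<times> S). f (prod.swap q) = g (prod.swap q)"
    using AE_lebesgue_on_swap[OF S T g(3)] .
  show m: "(\<lambda>q. f (prod.swap q)) \<in> borel_measurable (lebesgue_on (T \<times> S))"
    by (rule borel_measurable_lebesgue_on_AE[OF TS gl(2) ae])
  have "(LINT q|lebesgue_on (T \<times> S). f (prod.swap q)) = (LINT q|lebesgue_on (T \<times> S). g (prod.swap q))"
    by (rule integral_cong_AE[OF m gl(2) ae])
  also have "\<dots> = (LINT q|lborel. g (prod.swap q))"
    by (rule integral_lebesgue_on_lborel[OF TS gs])
  also have "\<dots> = (LINT p|lborel. g p)"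
    by (rule integral_lborel_swap[OF g(1)])
  also have "\<dots> = (LINT p|lebesgue_on (S \<times> T). g p)"
    by (rule integral_lebesgue_on_lborel[OF ST g(1,2), symmetric])
  also have "\<dots> = (LINT p|lebesgue_on (S \<times> T). f p)"
    using g(3) by (intro integral_cong_AE gl f) auto
  finally show "(LINT q|lebesgue_on (T \<times> S). f (prod.swap q)) = (LINT p|lebesgue_on (S \<times> T). f p)" .
  assume "integrable (lebesgue_on (S \<times> T)) f"
  then have "integrable (lebesgue_on (S \<times> T)) g"
    by (rule integrable_cong_AE_imp[OF _ gl(1)]) (use g(3) in auto)
  then have "integrable (lborel \<Otimes>\<^sub>M lborel) g"
    using integrable_lebesgue_on_lborel[OF ST g(1,2)] by (simp add: lborel_prod)
  then have "integrable (lborel \<Otimes>\<^sub>M lborel) (\<lambda>(x, y). g (y, x))"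
    by (rule lborel_pair.integrable_product_swap)
  then have "integrable lborel (\<lambda>q. g (prod.swap q))"
    by (simp add: lborel_prod case_prod_unfold prod.swap_def)
  then have "integrable (lebesgue_on (T \<times> S)) (\<lambda>q. g (prod.swap q))"
    using integrable_lebesgue_on_lborel[OF TS gs] by simp
  then show "integrable (lebesgue_on (T \<times> S)) (\<lambda>q. f (prod.swap q))"
    by (rule integrable_cong_AE_imp[OF _ m]) (use ae in auto)
qed

text \<open>Slices of a Lebesgue measurable function may fail to be measurable, but only on a null set of
  parameters: for almost every parameter the slice agrees almost everywhere with that of a Borel
  representative.\<close>

lemma
  fixes f :: "'a::euclidean_space \<times> 'b::euclidean_space \<Rightarrow> 'c::euclidean_space"
  assumes S: "S \<in> sets borel" and T: "T \<in> sets borel" and f: "integrable (lebesgue_on (S \<times> T)) f"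
  shows AE_integrable_lebesgue_on_slice: "AE s in lebesgue_on S. integrable (lebesgue_on T) (\<lambda>x. f (s, x))"
    and integrable_lebesgue_on_fst: "integrable (lebesgue_on S) (\<lambda>s. LINT x|lebesgue_on T. f (s, x))"
    and integral_lebesgue_on_fst: "(LINT s|lebesgue_on S. LINT x|lebesgue_on T. f (s, x)) = (LINT p|lebesgue_on (S \<times> T). f p)"
proof -
  note ST = Times_in_borel[OF S T]
  obtain g where g: "g \<in> borel_measurable borel" "\<And>x. x \<notin> S \<times> T \<Longrightarrow> g x = 0"
    "AE x in lebesgue_on (S \<times> T). f x = g x"
    using borel_representative[OF ST borel_measurable_integrable[OF f]] by blast
  note gl = borel_measurable_lebesgue_onI[OF g(1)]
  have "integrable (lebesgue_on (S \<times> T)) g"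
    by (rule integrable_cong_AE_imp[OF f gl]) (use g(3) in auto)
  then have gi: "integrable (lborel \<Otimes>\<^sub>M lborel) (\<lambda>(s, x). g (s, x))"
    using integrable_lebesgue_on_lborel[OF ST g(1,2)] by (simp add: lborel_prod)
  have gsl: "(\<lambda>x. g (s, x)) \<in> borel_measurable borel" for s
    using g(1) by measurable
  have gT: "(LINT x|lebesgue_on T. g (s, x)) = (LINT x|lborel. g (s, x))" for s
    using g(2) by (intro integral_lebesgue_on_lborel[OF T gsl]) auto
  have gTi: "integrable (lebesgue_on T) (\<lambda>x. g (s, x)) \<longleftrightarrow> integrable lborel (\<lambda>x. g (s, x))" for s
    using g(2) by (intro integrable_lebesgue_on_lborel[OF T gsl]) auto
  have ae: "AE s in lebesgue_on S. AE x in lebesgue_on T. f (s, x) = g (s, x)"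
    by (rule AE_lebesgue_on_pair[OF S T g(3)])
  have I1: "AE s in lebesgue_on S. integrable (lebesgue_on T) (\<lambda>x. g (s, x))"
    using lborel_pair.AE_integrable_fst[OF gi] unfolding gTi AE_lebesgue_on_iff[OF S] by auto
  have I2: "integrable lborel (\<lambda>s. LINT x|lebesgue_on T. g (s, x))"
    using lborel_pair.integrable_fst[OF gi] unfolding gT .
  have I2m: "(\<lambda>s. LINT x|lebesgue_on T. g (s, x)) \<in> borel_measurable borel"
    using borel_measurable_integrable[OF I2] by simp
  have I2z: "(LINT x|lebesgue_on T. g (s, x)) = 0" if "s \<notin> S" for s
    using g(2) that by simp
  have I2': "integrable (lebesgue_on S) (\<lambda>s. LINT x|lebesgue_on T. g (s, x))"
    using I2 integrable_lebesgue_on_lborel[OF S I2m I2z] by simp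
  have slice: "AE s in lebesgue_on S. integrable (lebesgue_on T) (\<lambda>x. f (s, x)) \<and>
      (LINT x|lebesgue_on T. f (s, x)) = (LINT x|lebesgue_on T. g (s, x))"
    using ae I1
  proof eventually_elim
    case (elim s)
    have m: "(\<lambda>x. f (s, x)) \<in> borel_measurable (lebesgue_on T)"
      by (rule borel_measurable_lebesgue_on_AE[OF T borel_measurable_lebesgue_onI[OF gsl] elim(1)])
    have "AE x in lebesgue_on T. g (s, x) = f (s, x)"
      using elim(1) by auto
    then show ?case
      using integrable_cong_AE_imp[OF elim(2) m] integral_cong_AE[OF m borel_measurable_lebesgue_onI[OF gsl] elim(1)] by simp
  qed
  then show "AE s in lebesgue_on S. integrable (lebesgue_on T) (\<lambda>x. f (s, x))"
    by auto
  have sm: "(\<lambda>s. LINT x|lebesgue_on T. f (s, x)) \<in> borel_measurable (lebesgue_on S)"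
    by (rule borel_measurable_lebesgue_on_AE[OF S borel_measurable_integrable[OF I2']]) (use slice in auto)
  show "integrable (lebesgue_on S) (\<lambda>s. LINT x|lebesgue_on T. f (s, x))"
    by (rule integrable_cong_AE_imp[OF I2' sm]) (use slice in auto)
  have "(LINT s|lebesgue_on S. LINT x|lebesgue_on T. f (s, x)) = (LINT s|lebesgue_on S. LINT x|lebesgue_on T. g (s, x))"
    by (rule integral_cong_AE[OF sm borel_measurable_integrable[OF I2']]) (use slice in auto)
  also have "\<dots> = (LINT s|lborel. LINT x|lborel. g (s, x))"
    using integral_lebesgue_on_lborel[OF S I2m I2z] unfolding gT .
  also have "\<dots> = (LINT p|lborel. g p)"
    using lborel_pair.integral_fst[OF gi] by (simp add: lborel_prod)
  also have "\<dots> = (LINT p|lebesgue_on (S \<times> T). g p)"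
    by (rule integral_lebesgue_on_lborel[OF ST g(1,2), symmetric])
  also have "\<dots> = (LINT p|lebesgue_on (S \<times> T). f p)"
    using g(3) by (intro integral_cong_AE gl borel_measurable_integrable[OF f]) auto
  finally show "(LINT s|lebesgue_on S. LINT x|lebesgue_on T. f (s, x)) = (LINT p|lebesgue_on (S \<times> T). f p)" .
qed

lemma
  fixes f :: "'a::euclidean_space \<times> 'b::euclidean_space \<Rightarrow> 'c::euclidean_space"
  assumes S: "S \<in> sets borel" and T: "T \<in> sets borel" and f: "integrable (lebesgue_on (S \<times> T)) f"
  shows AE_integrable_lebesgue_on_slice': "AE x in lebesgue_on T. integrable (lebesgue_on S) (\<lambda>s. f (s, x))"
    and integrable_lebesgue_on_snd: "integrable (lebesgue_on T) (\<lambda>x. LINT s|lebesgue_on S. f (s, x))"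
    and integral_lebesgue_on_snd: "(LINT x|lebesgue_on T. LINT s|lebesgue_on S. f (s, x)) = (LINT p|lebesgue_on (S \<times> T). f p)"
  using AE_integrable_lebesgue_on_slice[OF T S borel_measurable_lebesgue_on_swap(3)[OF S T borel_measurable_integrable[OF f] f]]
    integrable_lebesgue_on_fst[OF T S borel_measurable_lebesgue_on_swap(3)[OF S T borel_measurable_integrable[OF f] f]]
    integral_lebesgue_on_fst[OF T S borel_measurable_lebesgue_on_swap(3)[OF S T borel_measurable_integrable[OF f] f]]
    borel_measurable_lebesgue_on_swap(2)[OF S T borel_measurable_integrable[OF f]]
  by simp_all

lemma Fubini_integrable_lebesgue_on:
  fixes f :: "'a::euclidean_space \<times> 'b::euclidean_space \<Rightarrow> 'c::euclidean_space"
  assumes S: "S \<in> sets borel" and T: "T \<in> sets borel" and f: "f \<in> borel_measurable (lebesgue_on (S \<times> T))"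
    and slice: "AE s in lebesgue_on S. integrable (lebesgue_on T) (\<lambda>x. f (s, x))"
    and int: "integrable (lebesgue_on S) (\<lambda>s. LINT x|lebesgue_on T. norm (f (s, x)))"
  shows "integrable (lebesgue_on (S \<times> T)) f"
proof -
  note ST = Times_in_borel[OF S T]
  obtain g where g: "g \<in> borel_measurable borel" "\<And>x. x \<notin> S \<times> T \<Longrightarrow> g x = 0"
    "AE x in lebesgue_on (S \<times> T). f x = g x"
    using borel_representative[OF ST f] by blast
  note gl = borel_measurable_lebesgue_onI[OF g(1)]
  have gsl: "(\<lambda>x. g (s, x)) \<in> borel_measurable borel" for s
    using g(1) by measurable
  have gTi: "integrable (lebesgue_on T) (\<lambda>x. g (s, x)) \<longleftrightarrow> integrable lborel (\<lambda>x. g (s, x))" for s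
    using g(2) by (intro integrable_lebesgue_on_lborel[OF T gsl]) auto
  have gsl': "(\<lambda>x. norm (g (s, x))) \<in> borel_measurable borel" for s
    using gsl by simp
  have gT: "(LINT x|lebesgue_on T. norm (g (s, x))) = (LINT x|lborel. norm (g (s, x)))" for s
    using g(2) by (intro integral_lebesgue_on_lborel[OF T gsl']) auto
  have "AE s in lebesgue_on S. AE x in lebesgue_on T. f (s, x) = g (s, x)"
    by (rule AE_lebesgue_on_pair[OF S T g(3)])
  then have sl: "AE s in lebesgue_on S. integrable (lebesgue_on T) (\<lambda>x. g (s, x)) \<and>
      (LINT x|lebesgue_on T. norm (f (s, x))) = (LINT x|lebesgue_on T. norm (g (s, x)))"
    using slice
  proof eventually_elim
    case (elim s)
    note m = borel_measurable_lebesgue_onI[OF gsl]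
    have "AE x in lebesgue_on T. norm (f (s, x)) = norm (g (s, x))"
      using elim(1) by auto
    then show ?case
      using integrable_cong_AE_imp[OF elim(2) m] elim(1)
        integral_cong_AE[OF borel_measurable_integrable[OF integrable_norm[OF elim(2)]] borel_measurable_lebesgue_onI[OF gsl']] by simp
  qed
  have m2: "(\<lambda>s. LINT x|lborel. norm (g (s, x))) \<in> borel_measurable borel"
    using g(1) by measurable
  have z2: "(LINT x|lborel. norm (g (s, x))) = 0" if "s \<notin> S" for s
    using g(2) that by simp
  have "integrable (lebesgue_on S) (\<lambda>s. LINT x|lborel. norm (g (s, x)))"
    by (rule integrable_cong_AE_imp[OF int borel_measurable_lebesgue_onI[OF m2]]) (use sl gT in auto)
  then have 1: "integrable lborel (\<lambda>s. LINT x|lborel. norm (g (s, x)))"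
    using integrable_lebesgue_on_lborel[OF S m2 z2] by simp
  have 2: "AE s in lborel. integrable lborel (\<lambda>x. g (s, x))"
  proof -
    have "integrable lborel (\<lambda>x. g (s, x))" if "s \<notin> S" for s
      using g(2) that by simp
    then show ?thesis
      using sl unfolding AE_lebesgue_on_iff[OF S] gTi by fastforce
  qed
  have "integrable (lborel \<Otimes>\<^sub>M lborel) g"
    using g(1) 1 2 by (intro lborel_pair.Fubini_integrable) (simp_all add: lborel_prod)
  then have "integrable (lebesgue_on (S \<times> T)) g"
    using integrable_lebesgue_on_lborel[OF ST g(1,2)] by (simp add: lborel_prod)
  then show ?thesis
    by (rule integrable_cong_AE_imp[OF _ f]) (use g(3) in auto)
qed

section \<open>Square integrable functions\<close>

lemma L2_D: "f \<in> L2 \<Omega> \<Longrightarrow> f \<in> borel_measurable (lebesgue_on \<Omega>)"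
    "f \<in> L2 \<Omega> \<Longrightarrow> integrable (lebesgue_on \<Omega>) (\<lambda>x. (norm (f x))\<^sup>2)"
  by (auto simp: L2_def)

lemma finite_measure_lebesgue_on_cbox: "finite_measure (lebesgue_on (cbox l u))"
  by (rule finite_measure_lebesgue_on) simp

lemma finite_measure_lebesgue_on_Icc: "finite_measure (lebesgue_on {a..b::real})"
  using finite_measure_lebesgue_on_cbox[of a b] by simp

lemma L2_imp_integrable:
  fixes f :: "'a::euclidean_space \<Rightarrow> 'b::euclidean_space"
  assumes "f \<in> L2 (cbox l u)"
  shows "integrable (lebesgue_on (cbox l u)) f"
proof -
  interpret finite_measure "lebesgue_on (cbox l u)" by (rule finite_measure_lebesgue_on_cbox)
  show ?thesis
  proof (rule Bochner_Integration.integrable_bound)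
    show "integrable (lebesgue_on (cbox l u)) (\<lambda>x. 1 + (norm (f x))\<^sup>2)"
      using L2_D(2)[OF assms] by (intro Bochner_Integration.integrable_add integrable_const)
    have "norm (f x) \<le> 1 + (norm (f x))\<^sup>2" for x
      using sum_squares_bound[of 1 "norm (f x)"] norm_ge_zero[of "f x"] by (simp del: norm_ge_zero)
    then show "AE x in lebesgue_on (cbox l u). norm (f x) \<le> norm (1 + (norm (f x))\<^sup>2)"
      by (intro AE_I2) (simp add: abs_of_nonneg)
  qed (rule L2_D(1)[OF assms])
qed

lemma rect_eq_cbox: "{c..d} \<times> {a..b} = cbox (c, a) (d, b :: real)" for c d :: real
  by (simp add: cbox_Pair_eq)

lemma L2_imp_integrable_Icc:
  fixes f :: "real \<Rightarrow> 'b::euclidean_space"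
  shows "f \<in> L2 {a..b} \<Longrightarrow> integrable (lebesgue_on {a..b}) f"
  using L2_imp_integrable[of f a b] by simp

lemma L2_imp_integrable_rect:
  fixes f :: "real \<times> real \<Rightarrow> 'b::euclidean_space"
  shows "f \<in> L2 ({c..d} \<times> {a..b}) \<Longrightarrow> integrable (lebesgue_on ({c..d} \<times> {a..b})) f"
  unfolding rect_eq_cbox by (rule L2_imp_integrable)

text \<open>The criterion behind all membership and norm estimates: the pointwise square is dominated by an
  integrable function.\<close>

lemma L2_boundI:
  fixes f :: "'a::euclidean_space \<Rightarrow> 'b::euclidean_space"
  assumes "f \<in> borel_measurable (lebesgue_on \<Omega>)" and "integrable (lebesgue_on \<Omega>) m"
    and "AE x in lebesgue_on \<Omega>. (norm (f x))\<^sup>2 \<le> m x"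
  shows "f \<in> L2 \<Omega>" "(L2_nrm \<Omega> f)\<^sup>2 \<le> (LINT x|lebesgue_on \<Omega>. m x)"
proof -
  have i: "integrable (lebesgue_on \<Omega>) (\<lambda>x. (norm (f x))\<^sup>2)"
  proof (rule Bochner_Integration.integrable_bound[OF assms(2)])
    show "(\<lambda>x. (norm (f x))\<^sup>2) \<in> borel_measurable (lebesgue_on \<Omega>)"
      using assms(1) by simp
    show "AE x in lebesgue_on \<Omega>. norm ((norm (f x))\<^sup>2) \<le> norm (m x)"
      using assms(3) by eventually_elim simp
  qed
  then show "f \<in> L2 \<Omega>"
    using assms(1) by (simp add: L2_def)
  show "(L2_nrm \<Omega> f)\<^sup>2 \<le> (LINT x|lebesgue_on \<Omega>. m x)"
    unfolding L2_nrm_def using integral_mono_AE[OF i assms(2,3)]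
    by (simp add: integral_nonneg_AE)
qed

lemma L2_nrm_square: "(L2_nrm \<Omega> f)\<^sup>2 = (LINT x|lebesgue_on \<Omega>. (norm (f x))\<^sup>2)"
  unfolding L2_nrm_def by (simp add: integral_nonneg_AE)

lemma
  fixes f g :: "'a::euclidean_space \<Rightarrow> 'b::euclidean_space"
  assumes \<Omega>: "\<Omega> \<in> sets borel" and f: "f \<in> L2 \<Omega>" and ae: "ae_eq \<Omega> f g"
  shows L2_ae_eq: "g \<in> L2 \<Omega>" and L2_nrm_ae_eq: "L2_nrm \<Omega> g = L2_nrm \<Omega> f"
proof -
  have g: "g \<in> borel_measurable (lebesgue_on \<Omega>)"
    by (rule borel_measurable_lebesgue_on_AE[OF \<Omega> L2_D(1)[OF f]]) (use ae in \<open>auto simp: ae_eq_def\<close>)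
  show "g \<in> L2 \<Omega>"
    by (rule L2_boundI(1)[OF g L2_D(2)[OF f]]) (use ae in \<open>auto simp: ae_eq_def\<close>)
  have "(LINT x|lebesgue_on \<Omega>. (norm (g x))\<^sup>2) = (LINT x|lebesgue_on \<Omega>. (norm (f x))\<^sup>2)"
    by (rule integral_cong_AE) (use g L2_D(1)[OF f] ae in \<open>auto simp: ae_eq_def\<close>)
  then show "L2_nrm \<Omega> g = L2_nrm \<Omega> f"
    by (simp add: L2_nrm_def)
qed

text \<open>This replaces Minkowski's inequality; the constants do not matter for continuity arguments.\<close>

lemma norm_add_square_le: "(norm (x + y))\<^sup>2 \<le> 2 * (norm x)\<^sup>2 + 2 * (norm (y :: 'b::real_normed_vector))\<^sup>2"
proof -
  have "(norm (x + y))\<^sup>2 \<le> (norm x + norm y)\<^sup>2"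
    by (intro power_mono norm_triangle_ineq norm_ge_zero)
  also have "\<dots> \<le> 2 * (norm x)\<^sup>2 + 2 * (norm y)\<^sup>2"
    using sum_squares_bound[of "norm x" "norm y"] by (simp add: power2_sum)
  finally show ?thesis .
qed

lemma
  fixes f g :: "'a::euclidean_space \<Rightarrow> 'b::euclidean_space"
  assumes f: "f \<in> L2 \<Omega>" and g: "g \<in> L2 \<Omega>"
  shows L2_add: "(\<lambda>x. f x + g x) \<in> L2 \<Omega>"
    and L2_nrm_add: "(L2_nrm \<Omega> (\<lambda>x. f x + g x))\<^sup>2 \<le> 2 * (L2_nrm \<Omega> f)\<^sup>2 + 2 * (L2_nrm \<Omega> g)\<^sup>2"
proof -
  have m: "(\<lambda>x. f x + g x) \<in> borel_measurable (lebesgue_on \<Omega>)"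
    using L2_D(1)[OF f] L2_D(1)[OF g] by simp
  have i: "integrable (lebesgue_on \<Omega>) (\<lambda>x. 2 * (norm (f x))\<^sup>2 + 2 * (norm (g x))\<^sup>2)"
    using L2_D(2)[OF f] L2_D(2)[OF g] by simp
  note b = L2_boundI[OF m i AE_I2[OF norm_add_square_le]]
  show "(\<lambda>x. f x + g x) \<in> L2 \<Omega>" by (rule b)
  show "(L2_nrm \<Omega> (\<lambda>x. f x + g x))\<^sup>2 \<le> 2 * (L2_nrm \<Omega> f)\<^sup>2 + 2 * (L2_nrm \<Omega> g)\<^sup>2"
    using b(2) L2_D(2)[OF f] L2_D(2)[OF g] by (simp add: L2_nrm_square)
qed

lemma
  fixes f :: "'a::euclidean_space \<Rightarrow> 'b::euclidean_space"
  assumes f: "f \<in> L2 \<Omega>"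
  shows L2_scaleR: "(\<lambda>x. r *\<^sub>R f x) \<in> L2 \<Omega>"
    and L2_nrm_scaleR: "L2_nrm \<Omega> (\<lambda>x. r *\<^sub>R f x) = \<bar>r\<bar> * L2_nrm \<Omega> f"
proof -
  show "(\<lambda>x. r *\<^sub>R f x) \<in> L2 \<Omega>"
    using L2_D[OF f] by (simp add: L2_def power_mult_distrib)
  show "L2_nrm \<Omega> (\<lambda>x. r *\<^sub>R f x) = \<bar>r\<bar> * L2_nrm \<Omega> f"
    by (simp add: L2_nrm_def power_mult_distrib real_sqrt_mult)
qed

lemma L2_diff:
  fixes f g :: "'a::euclidean_space \<Rightarrow> 'b::euclidean_space"
  shows "f \<in> L2 \<Omega> \<Longrightarrow> g \<in> L2 \<Omega> \<Longrightarrow> (\<lambda>x. f x - g x) \<in> L2 \<Omega>"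
  using L2_add[of f \<Omega> "\<lambda>x. - 1 *\<^sub>R g x"] L2_scaleR[of g \<Omega> "-1"] by simp

lemma L2_const_Icc: "(\<lambda>_. v) \<in> L2 {a..b::real}"
  using finite_measure.integrable_const[OF finite_measure_lebesgue_on_Icc] by (simp add: L2_def)

lemma L2_const_rect: "(\<lambda>_. v) \<in> L2 ({c..d::real} \<times> {a..b::real})"
  unfolding rect_eq_cbox using finite_measure.integrable_const[OF finite_measure_lebesgue_on_cbox] by (simp add: L2_def)

lemma borel_Icc: "{a..b::real} \<in> sets borel" by simp

lemma borel_measurable_comp_snd:
  fixes g :: "real \<Rightarrow> 'b::euclidean_space" and c d :: real
  assumes "g \<in> borel_measurable (lebesgue_on {a..b})"
  shows "(\<lambda>p. g (snd p)) \<in> borel_measurable (lebesgue_on ({c..d} \<times> {a..b}))"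
proof -
  obtain h where h: "h \<in> borel_measurable borel" "AE x in lebesgue_on {a..b}. g x = h x"
    using borel_representative[OF borel_Icc assms] by blast
  have "(\<lambda>p :: real \<times> real. h (snd p)) \<in> borel_measurable borel"
    using h(1) by (simp add: borel_prod[symmetric])
  then show ?thesis
    using AE_lebesgue_on_snd[OF borel_Icc borel_Icc h(2)]
    by (intro borel_measurable_lebesgue_on_AE[OF Times_in_borel[OF borel_Icc borel_Icc] borel_measurable_lebesgue_onI])
qed

lemma integrable_comp_snd:
  fixes g :: "real \<Rightarrow> 'b::euclidean_space" and c d :: real
  assumes "integrable (lebesgue_on {a..b}) g"
  shows "integrable (lebesgue_on ({c..d} \<times> {a..b})) (\<lambda>p. g (snd p))"
  by (rule Fubini_integrable_lebesgue_on[OF borel_Icc borel_Icc borel_measurable_comp_snd[OF borel_measurable_integrable[OF assms]]])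
     (use assms finite_measure.integrable_const[OF finite_measure_lebesgue_on_Icc] in simp_all)

lemma integrable_comp_fst:
  fixes g :: "real \<Rightarrow> 'b::euclidean_space" and a b :: real
  assumes "integrable (lebesgue_on {c..d}) g"
  shows "integrable (lebesgue_on ({c..d} \<times> {a..b})) (\<lambda>p. g (fst p))"
  using borel_measurable_lebesgue_on_swap(3)[OF borel_Icc borel_Icc
      borel_measurable_comp_snd[OF borel_measurable_integrable[OF assms]] integrable_comp_snd[OF assms]] by simp

text \<open>An integral over one coordinate with a parameter in the kernel is measurable in the parameter and in
  the other coordinate jointly: for a Borel representative of \<open>\<psi>\<close> this is Fubini's theorem, and changing
  \<open>\<psi>\<close> on a null set changes the integral only for a null set of first coordinates.\<close>

lemma borel_measurable_fibre_integral:
  fixes \<psi> :: "real \<times> real \<Rightarrow> real^'n" and k :: "real \<Rightarrow> real \<Rightarrow> real^'n^'m" and a b c d :: real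
  assumes k: "(\<lambda>p. k (fst p) (snd p)) \<in> borel_measurable borel"
    and \<psi>: "\<psi> \<in> borel_measurable (lebesgue_on ({c..d} \<times> {a..b}))"
  shows "(\<lambda>p. LINT \<theta>|lebesgue_on {a..b}. k (snd p) \<theta> *v \<psi> (fst p, \<theta>))
    \<in> borel_measurable (lebesgue_on ({c..d} \<times> {a..b}))"
proof -
  note ST = Times_in_borel[OF borel_Icc[of c d] borel_Icc[of a b]]
  obtain g where g: "g \<in> borel_measurable borel" "\<And>p. p \<notin> {c..d} \<times> {a..b} \<Longrightarrow> g p = 0"
    "AE p in lebesgue_on ({c..d} \<times> {a..b}). \<psi> p = g p"
    using borel_representative[OF ST \<psi>] by blast
  have mv: "(\<lambda>p :: (real^'n^'m) \<times> (real^'n). fst p *v snd p) \<in> borel_measurable borel"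
    by (intro borel_measurable_continuous_onI) (auto intro!: continuous_intros simp: matrix_vector_mult_def continuous_on_vec_lambda)
  have kg: "(\<lambda>q. k (f1 q) (f2 q) *v g (f3 q)) \<in> borel_measurable M" if
    f: "f1 \<in> borel_measurable M" "f2 \<in> borel_measurable M" "f3 \<in> borel_measurable M"
    for f1 f2 :: "'x \<Rightarrow> real" and f3 :: "'x \<Rightarrow> real \<times> real" and M :: "'x measure"
  proof -
    have "(\<lambda>q. (f1 q, f2 q)) \<in> M \<rightarrow>\<^sub>M (borel :: (real \<times> real) measure)"
      using f unfolding borel_prod[symmetric] by simp
    from measurable_compose[OF this k] have 1: "(\<lambda>q. k (f1 q) (f2 q)) \<in> borel_measurable M" by simp
    have "(\<lambda>q. (k (f1 q) (f2 q), g (f3 q))) \<in> M \<rightarrow>\<^sub>M (borel :: ((real^'n^'m) \<times> (real^'n)) measure)"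
      using 1 measurable_compose[OF f(3) g(1)] unfolding borel_prod[symmetric] by simp
    from measurable_compose[OF this mv] show ?thesis by simp
  qed
  have eq: "(LINT \<theta>|lebesgue_on {a..b}. k x \<theta> *v g (s, \<theta>)) = (LINT \<theta>|lborel. k x \<theta> *v g (s, \<theta>))" for s x
  proof (rule integral_lebesgue_on_lborel[OF borel_Icc])
    show "(\<lambda>\<theta>. k x \<theta> *v g (s, \<theta>)) \<in> borel_measurable borel"
      by (rule kg) (simp_all add: borel_prod[symmetric])
  qed (use g(2) in simp)
  have "(\<lambda>q. k (snd (fst q)) (snd q) *v g (fst (fst q), snd q)) \<in> borel_measurable ((borel :: (real \<times> real) measure) \<Otimes>\<^sub>M (borel :: real measure))"
    by (rule kg) (simp_all add: borel_prod[symmetric])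
  then have "(\<lambda>q. k (snd (fst q)) (snd q) *v g (fst (fst q), snd q)) \<in> borel_measurable ((borel :: (real \<times> real) measure) \<Otimes>\<^sub>M (lborel :: real measure))"
    by (simp cong: measurable_cong_sets)
  then have m: "(\<lambda>p. LINT \<theta>|lborel. k (snd p) \<theta> *v g (fst p, \<theta>)) \<in> borel_measurable borel"
    by (intro lborel.borel_measurable_lebesgue_integral) (simp add: case_prod_unfold)
  have "AE s in lebesgue_on {c..d}. AE x in lebesgue_on {a..b}. \<psi> (s, x) = g (s, x)"
    by (rule AE_lebesgue_on_pair[OF borel_Icc borel_Icc g(3)])
  then have "AE s in lebesgue_on {c..d}. \<forall>x. (LINT \<theta>|lebesgue_on {a..b}. k x \<theta> *v \<psi> (s, \<theta>)) = (LINT \<theta>|lborel. k x \<theta> *v g (s, \<theta>))"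
  proof eventually_elim
    case (elim s)
    show ?case
    proof
      fix x
      have m1: "(\<lambda>\<theta>. k x \<theta> *v g (s, \<theta>)) \<in> borel_measurable (lebesgue_on {a..b})"
        by (rule borel_measurable_lebesgue_onI, rule kg) (simp_all add: borel_prod[symmetric])
      have ae: "AE \<theta> in lebesgue_on {a..b}. k x \<theta> *v \<psi> (s, \<theta>) = k x \<theta> *v g (s, \<theta>)"
        using elim by eventually_elim simp
      show "(LINT \<theta>|lebesgue_on {a..b}. k x \<theta> *v \<psi> (s, \<theta>)) = (LINT \<theta>|lborel. k x \<theta> *v g (s, \<theta>))"
        unfolding eq[symmetric]
        by (rule integral_cong_AE[OF borel_measurable_lebesgue_on_AE[OF borel_Icc m1 ae] m1 ae])
    qed
  qed
  from AE_lebesgue_on_fst[OF borel_Icc borel_Icc this, of a b]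
  show ?thesis
    by (intro borel_measurable_lebesgue_on_AE[OF ST borel_measurable_lebesgue_onI[OF m]]) auto
qed

section \<open>Calculus of test functions\<close>

lemma test_functionD:
  assumes "test_function \<Omega> \<eta>"
  shows "times_differentiable k \<eta>" "compact (closure {x. \<eta> x \<noteq> 0})"
    "closure {x. \<eta> x \<noteq> 0} \<subseteq> interior \<Omega>"
  using assms unfolding test_function_def by blast+

text \<open>It suffices to enclose the points where the function does not vanish in a compact subset of the
  interior.\<close>

lemma test_functionI:
  assumes td: "\<And>k. times_differentiable k \<eta>" and K: "compact K" "K \<subseteq> interior \<Omega>"
    and supp: "\<And>x. \<eta> x \<noteq> 0 \<Longrightarrow> x \<in> K"
  shows "test_function \<Omega> \<eta>"
proof -
  have cl: "closure {x. \<eta> x \<noteq> 0} \<subseteq> K"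
    by (rule closure_minimal[OF _ compact_imp_closed[OF K(1)]]) (use supp in blast)
  then have "bounded (closure {x. \<eta> x \<noteq> 0})"
    by (rule bounded_subset[OF compact_imp_bounded[OF K(1)]])
  then show ?thesis
    using cl K(2) td unfolding test_function_def compact_eq_bounded_closed by blast
qed

lemma test_function_lincomb:
  assumes "test_function \<Omega> f" "test_function \<Omega> g"
  shows "test_function \<Omega> (\<lambda>x. \<alpha> * f x + \<beta> * g x)"
proof (rule test_functionI)
  show "compact (closure {x. f x \<noteq> 0} \<union> closure {x. g x \<noteq> 0})"
    by (intro compact_Un test_functionD(2)[OF assms(1)] test_functionD(2)[OF assms(2)])
  show "closure {x. f x \<noteq> 0} \<union> closure {x. g x \<noteq> 0} \<subseteq> interior \<Omega>"
    using test_functionD(3)[OF assms(1)] test_functionD(3)[OF assms(2)] by blast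
  show "x \<in> closure {x. f x \<noteq> 0} \<union> closure {x. g x \<noteq> 0}" if "\<alpha> * f x + \<beta> * g x \<noteq> 0" for x
  proof -
    have "x \<in> {x. f x \<noteq> 0} \<union> {x. g x \<noteq> 0}" using that by auto
    then show ?thesis using closure_subset[of "{x. f x \<noteq> 0}"] closure_subset[of "{x. g x \<noteq> 0}"] by blast
  qed
qed (intro times_differentiable_add times_differentiable_mult times_differentiable_const test_functionD(1)[OF assms(1)] test_functionD(1)[OF assms(2)])

lemma test_function_derivative_real:
  fixes \<eta> :: "real \<Rightarrow> real"
  assumes "test_function \<Omega> \<eta>"
  shows "(\<eta> has_real_derivative frechet_derivative \<eta> (at x) 1) (at x)"
    and "continuous_on UNIV (\<lambda>x. frechet_derivative \<eta> (at x) 1)"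
proof -
  have td: "times_differentiable (Suc k) \<eta>" for k by (rule test_functionD(1)[OF assms])
  have d: "(\<eta> has_derivative frechet_derivative \<eta> (at x)) (at x)" for x
    by (rule times_differentiable_SucE(1)[OF td])
  have "frechet_derivative \<eta> (at x) = (*) (frechet_derivative \<eta> (at x) 1)"
  proof
    fix h
    show "frechet_derivative \<eta> (at x) h = frechet_derivative \<eta> (at x) 1 * h" for x
      using linear_cmul[OF has_derivative_linear[OF d], of x h 1] by (simp add: mult.commute)
  qed
  with d[of x] show "(\<eta> has_real_derivative frechet_derivative \<eta> (at x) 1) (at x)"
    unfolding has_field_derivative_def by simp
  show "continuous_on UNIV (\<lambda>x. frechet_derivative \<eta> (at x) 1)"
    using times_differentiable_SucE(2)[OF td[of 0], of 1] by simp
qed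

lemma test_function_outside:
  "test_function \<Omega> \<eta> \<Longrightarrow> x \<notin> interior \<Omega> \<Longrightarrow> \<eta> x = 0"
  using test_functionD(3)[of \<Omega> \<eta>] closure_subset[of "{x. \<eta> x \<noteq> 0}"] by auto

lemma integral_lebesgue_on_Icc_lborel:
  fixes f :: "real \<Rightarrow> real"
  assumes "continuous_on UNIV f"
  shows "(LINT x|lebesgue_on {a..b}. f x) = (LBINT x. indicator {a..b} x *\<^sub>R f x)"
proof -
  have "f \<in> borel_measurable borel" using assms by (rule borel_measurable_continuous_onI)
  then show ?thesis
    by (simp add: integral_restrict_space integral_completion)
qed

lemma integral_derivative_Icc:
  fixes F :: "real \<Rightarrow> real"
  assumes "a \<le> b" "\<And>x. (F has_real_derivative f x) (at x)" "continuous_on UNIV f"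
  shows "(LINT x|lebesgue_on {a..b}. f x) = F b - F a"
proof -
  have "(LBINT x. f x * indicator {a..b} x) = F b - F a"
    using assms by (intro integral_FTC_Icc_real) (auto simp: continuous_on_eq_continuous_at)
  then show ?thesis
    using integral_lebesgue_on_Icc_lborel[OF assms(3)] by (simp add: mult.commute)
qed

lemma continuous_antiderivative:
  fixes f :: "real \<Rightarrow> real"
  assumes "continuous_on UNIV f"
  shows "\<exists>F. F a = 0 \<and> (\<forall>x. (F has_real_derivative f x) (at x))"
proof -
  let ?F = "\<lambda>x :: real. LBINT y=ereal a..ereal x. f y"
  have d: "(?F has_real_derivative f x) (at x)" for x
  proof -
  \<comment> \<open>a window around \<open>a\<close> and \<open>x\<close> with \<open>x\<close> in its interior, so that the derivative is two-sided\<close>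
  define l u where "l = min a x - 1" and "u = max a x + 1"
  have "(?F has_vector_derivative f x) (at x within {l..u})"
    by (rule interval_integral_FTC2) (auto simp: l_def u_def intro: continuous_on_subset[OF assms])
  moreover have "at x within {l..u} = at x"
    by (rule at_within_interior) (auto simp: l_def u_def)
  ultimately show ?thesis
    by (simp add: has_real_derivative_iff_has_vector_derivative)
  qed
  show ?thesis
    by (rule exI[of _ ?F]) (simp add: d)
qed

text \<open>Left of its support the antiderivative starting at \<open>a\<close> vanishes, and right of it the value is the
  total integral, which is zero by hypothesis. So the support does not grow.\<close>

lemma test_function_antiderivative:
  fixes \<zeta> :: "real \<Rightarrow> real"
  assumes ab: "a < b" and \<zeta>: "test_function {a..b} \<zeta>" and zero: "(LINT x|lebesgue_on {a..b}. \<zeta> x) = 0"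
  shows "\<exists>H. test_function {a..b} H \<and> (\<forall>x. frechet_derivative H (at x) 1 = \<zeta> x)"
proof -
  have cont: "continuous_on UNIV \<zeta>"
    using test_functionD(1)[OF \<zeta>, of 0] by simp
  obtain H where H: "H a = 0" "\<And>x. (H has_real_derivative \<zeta> x) (at x)"
    using continuous_antiderivative[OF cont] by blast
  have Hx: "H y - H x = (LINT t|lebesgue_on {x..y}. \<zeta> t)" if "x \<le> y" for x y
    using integral_derivative_Icc[OF that H(2) cont] by simp
  have Hb: "H b = 0" using Hx[of a b] ab H(1) zero by simp
  let ?K = "closure {x. \<zeta> x \<noteq> 0}"
  have K: "compact ?K" "?K \<subseteq> {a<..<b}"
    using test_functionD(2,3)[OF \<zeta>] by simp_all
  have "\<exists>\<alpha> \<beta>. a < \<alpha> \<and> \<beta> < b \<and> ?K \<subseteq> {\<alpha>..\<beta>}"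
  proof (cases "?K = {}")
    case True
    then show ?thesis using ab by (intro exI[of _ b] exI[of _ a]) simp
  next
    case False
    obtain \<alpha> \<beta> where "\<alpha> \<in> ?K" "\<And>x. x \<in> ?K \<Longrightarrow> \<alpha> \<le> x" "\<beta> \<in> ?K" "\<And>x. x \<in> ?K \<Longrightarrow> x \<le> \<beta>"
      using compact_attains_inf[OF K(1) False] compact_attains_sup[OF K(1) False] by blast
    then show ?thesis using K(2) by (intro exI[of _ \<alpha>] exI[of _ \<beta>]) auto
  qed
  then obtain \<alpha> \<beta> where \<alpha>: "a < \<alpha>" "\<beta> < b" "?K \<subseteq> {\<alpha>..\<beta>}" by blast
  have \<zeta>0: "\<zeta> x = 0" if "x \<notin> {\<alpha>..\<beta>}" for x
    using that \<alpha>(3) closure_subset[of "{x. \<zeta> x \<noteq> 0}"] by auto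
  have left: "H x = 0" if "x < \<alpha>" for x
  proof -
    have "(LINT t|lebesgue_on {min a x..max a x}. \<zeta> t) = (LINT t|lebesgue_on {min a x..max a x}. 0)"
      by (rule Bochner_Integration.integral_cong) (use that \<alpha> in \<open>auto intro!: \<zeta>0\<close>)
    then show ?thesis using Hx[of "min a x" "max a x"] H(1) by (auto simp: min_def max_def split: if_splits)
  qed
  have right: "H x = 0" if "\<beta> < x" for x
  proof -
    have "(LINT t|lebesgue_on {min b x..max b x}. \<zeta> t) = (LINT t|lebesgue_on {min b x..max b x}. 0)"
      by (rule Bochner_Integration.integral_cong) (use that \<alpha> in \<open>auto intro!: \<zeta>0\<close>)
    then show ?thesis using Hx[of "min b x" "max b x"] Hb by (auto simp: min_def max_def split: if_splits)
  qed
  have "test_function {a..b} H"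
  proof (rule test_functionI)
    show "times_differentiable k H" for k
      by (rule times_differentiable_mono[OF times_differentiable_Suc_realI[OF H(2) test_functionD(1)[OF \<zeta>]]])
    show "compact {\<alpha>..\<beta>}" by simp
    show "{\<alpha>..\<beta>} \<subseteq> interior {a..b}" using \<alpha> by auto
    show "x \<in> {\<alpha>..\<beta>}" if "H x \<noteq> 0" for x using left[of x] right[of x] that by force
  qed
  moreover have "frechet_derivative H (at x) 1 = \<zeta> x" for x
    using frechet_derivative_at[OF H(2)[unfolded has_field_derivative_def]] by (metis mult.right_neutral)
  ultimately show ?thesis by blast
qed

lemma test_function_Times:
  fixes S T :: "real set"
  assumes f: "test_function S f" and g: "test_function T g"
  shows "test_function (S \<times> T) (\<lambda>p. f (fst p) * g (snd p))"
    and "frechet_derivative (\<lambda>p. f (fst p) * g (snd p)) (at p) (0, 1) = f (fst p) * frechet_derivative g (at (snd p)) 1"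
proof -
  have td: "times_differentiable k (\<lambda>p :: real \<times> real. f (fst p))" "times_differentiable k (\<lambda>p :: real \<times> real. g (snd p))" for k
    using times_differentiable_compose_inner[OF test_functionD(1)[OF f], of k "(1, 0) :: real \<times> real" 0]
      times_differentiable_compose_inner[OF test_functionD(1)[OF g], of k "(0, 1) :: real \<times> real" 0]
    by (simp_all add: inner_prod_def)
  let ?K = "closure {x. f x \<noteq> 0} \<times> closure {x. g x \<noteq> 0}"
  show "test_function (S \<times> T) (\<lambda>p. f (fst p) * g (snd p))"
  proof (rule test_functionI)
    show "compact ?K" by (intro compact_Times test_functionD(2)[OF f] test_functionD(2)[OF g])
    show "?K \<subseteq> interior (S \<times> T)"
      using test_functionD(3)[OF f] test_functionD(3)[OF g] by (auto simp: interior_Times)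
    show "p \<in> ?K" if "f (fst p) * g (snd p) \<noteq> 0" for p
      using that closure_subset[of "{x. f x \<noteq> 0}"] closure_subset[of "{x. g x \<noteq> 0}"] by (auto simp: mem_Times_iff)
  qed (intro times_differentiable_mult td)
  have df: "(f has_derivative (\<lambda>h. frechet_derivative f (at (fst p)) 1 * h)) (at (fst p))"
    using test_function_derivative_real(1)[OF f, of "fst p"] by (simp add: has_field_derivative_def)
  have dg: "(g has_derivative (\<lambda>h. frechet_derivative g (at (snd p)) 1 * h)) (at (snd p))"
    using test_function_derivative_real(1)[OF g, of "snd p"] by (simp add: has_field_derivative_def)
  have "((\<lambda>p. f (fst p) * g (snd p)) has_derivative
      (\<lambda>h. f (fst p) * (frechet_derivative g (at (snd p)) 1 * snd h) + (frechet_derivative f (at (fst p)) 1 * fst h) * g (snd p))) (at p)"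
    by (rule has_derivative_mult[OF has_derivative_compose[OF has_derivative_fst[OF has_derivative_ident] df]
          has_derivative_compose[OF has_derivative_snd[OF has_derivative_ident] dg]])
  note eq = frechet_derivative_at[OF this]
  show "frechet_derivative (\<lambda>p. f (fst p) * g (snd p)) (at p) (0, 1) = f (fst p) * frechet_derivative g (at (snd p)) 1"
    unfolding eq[symmetric] by simp
qed

lemma test_function_slice:
  fixes S T :: "real set"
  assumes \<eta>: "test_function (S \<times> T) \<eta>"
  shows "((\<lambda>x. \<eta> (s, x)) has_real_derivative frechet_derivative \<eta> (at (s, x)) (0, 1)) (at x)"
    and "continuous_on UNIV (\<lambda>p. frechet_derivative \<eta> (at p) (0, 1))"
proof -
  note td = test_functionD(1)[OF \<eta>, of "Suc 0"]
  note d = times_differentiable_SucE(1)[OF td]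
  have "((\<lambda>x. (s, x)) has_derivative (\<lambda>h. (0, h))) (at x)"
    by (auto intro!: derivative_eq_intros)
  from has_derivative_compose[OF this d]
  have 1: "((\<lambda>x. \<eta> (s, x)) has_derivative (\<lambda>h. frechet_derivative \<eta> (at (s, x)) (0, h))) (at x)" .
  have eq: "(\<lambda>h. frechet_derivative \<eta> (at (s, x)) (0, h)) = (*) (frechet_derivative \<eta> (at (s, x)) (0, 1))"
  proof
    show "frechet_derivative \<eta> (at (s, x)) (0, h) = frechet_derivative \<eta> (at (s, x)) (0, 1) * h" for h
      using linear_cmul[OF has_derivative_linear[OF d], of "(s, x)" h "(0, 1)"] by (simp add: mult.commute)
  qed
  show "((\<lambda>x. \<eta> (s, x)) has_real_derivative frechet_derivative \<eta> (at (s, x)) (0, 1)) (at x)"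
    using 1 unfolding has_field_derivative_def eq .
  show "continuous_on UNIV (\<lambda>p. frechet_derivative \<eta> (at p) (0, 1))"
    using times_differentiable_SucE(2)[OF td, of "(0, 1)"] by (simp add: Basis_prod_def)
qed

lemma times_differentiable_swap:
  fixes \<eta> :: "real \<times> real \<Rightarrow> real"
  shows "times_differentiable k \<eta> \<Longrightarrow> times_differentiable k (\<lambda>p. \<eta> (prod.swap p))"
proof (induction k arbitrary: \<eta>)
  case 0
  then show ?case
    using continuous_on_compose2[OF _ continuous_on_swap, of UNIV \<eta> UNIV] by simp
next
  case (Suc k)
  note d = times_differentiable_SucE[OF Suc.prems]
  have sw: "(prod.swap has_derivative prod.swap) (at p)" for p :: "real \<times> real"
    by (auto intro!: derivative_eq_intros simp: prod.swap_def[abs_def])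
  show ?case
  proof (rule times_differentiable_SucI[OF has_derivative_compose[OF sw d(1)]])
    fix i :: "real \<times> real" assume "i \<in> Basis"
    then have "prod.swap i \<in> Basis" by (auto simp: Basis_prod_def)
    then show "times_differentiable k (\<lambda>p. frechet_derivative \<eta> (at (prod.swap p)) (prod.swap i))"
      by (rule Suc.IH[OF d(2)])
  qed
qed

lemma test_function_swap:
  fixes S T :: "real set"
  assumes \<eta>: "test_function (S \<times> T) \<eta>"
  shows "test_function (T \<times> S) (\<lambda>p. \<eta> (prod.swap p))"
    and "frechet_derivative (\<lambda>p. \<eta> (prod.swap p)) (at p) i = frechet_derivative \<eta> (at (prod.swap p)) (prod.swap i)"
proof -
  note td = test_functionD(1)[OF \<eta>]
  let ?K = "prod.swap ` closure {p. \<eta> p \<noteq> 0}"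
  show "test_function (T \<times> S) (\<lambda>p. \<eta> (prod.swap p))"
  proof (rule test_functionI)
    show "compact ?K"
      by (intro compact_continuous_image test_functionD(2)[OF \<eta>] continuous_on_swap)
    show "?K \<subseteq> interior (T \<times> S)"
      using test_functionD(3)[OF \<eta>] by (auto simp: interior_Times)
    show "p \<in> ?K" if "\<eta> (prod.swap p) \<noteq> 0" for p
    proof (rule image_eqI)
      show "prod.swap p \<in> closure {p. \<eta> p \<noteq> 0}"
        using that by (intro subsetD[OF closure_subset]) simp
    qed simp
  qed (intro times_differentiable_swap td)
  have sw: "(prod.swap has_derivative prod.swap) (at p)"
    by (auto intro!: derivative_eq_intros simp: prod.swap_def[abs_def])
  have "((\<lambda>p. \<eta> (prod.swap p)) has_derivative (\<lambda>i. frechet_derivative \<eta> (at (prod.swap p)) (prod.swap i))) (at p)"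
    by (rule has_derivative_compose[OF sw times_differentiable_SucE(1)[OF td]])
  from frechet_derivative_at[OF this]
  show "frechet_derivative (\<lambda>p. \<eta> (prod.swap p)) (at p) i = frechet_derivative \<eta> (at (prod.swap p)) (prod.swap i)"
    by metis
qed

section \<open>Primitives and the du Bois-Reymond lemma\<close>

lemma integrable_continuous_scaleR:
  fixes f :: "'a::euclidean_space \<Rightarrow> 'b::euclidean_space" and e :: "'a \<Rightarrow> real"
  assumes e: "continuous_on UNIV e" and f: "integrable (lebesgue_on (cbox l u)) f"
  shows "integrable (lebesgue_on (cbox l u)) (\<lambda>x. e x *\<^sub>R f x)"
proof -
  have "compact (e ` cbox l u)"
    by (intro compact_continuous_image compact_cbox continuous_on_subset[OF e]) simp
  then obtain C where C: "\<And>x. x \<in> cbox l u \<Longrightarrow> \<bar>e x\<bar> \<le> C"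
    unfolding compact_eq_bounded_closed bounded_iff by auto
  show ?thesis
  proof (rule Bochner_Integration.integrable_bound)
    show "integrable (lebesgue_on (cbox l u)) (\<lambda>x. C * norm (f x))"
      using f by simp
    show "(\<lambda>x. e x *\<^sub>R f x) \<in> borel_measurable (lebesgue_on (cbox l u))"
      using borel_measurable_lebesgue_onI[OF borel_measurable_continuous_onI[OF e]] borel_measurable_integrable[OF f]
      by simp
    show "AE x in lebesgue_on (cbox l u). norm (e x *\<^sub>R f x) \<le> norm (C * norm (f x))"
    proof (rule AE_I2)
      fix x assume "x \<in> space (lebesgue_on (cbox l u))"
      then have "\<bar>e x\<bar> \<le> C" using C by simp
      then show "norm (e x *\<^sub>R f x) \<le> norm (C * norm (f x))"
        by (simp add: abs_mult mult_right_mono)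
    qed
  qed
qed

lemma integrable_continuous_scaleR_Icc:
  fixes f :: "real \<Rightarrow> 'b::euclidean_space"
  shows "continuous_on UNIV e \<Longrightarrow> integrable (lebesgue_on {a..b}) f \<Longrightarrow> integrable (lebesgue_on {a..b}) (\<lambda>x. e x *\<^sub>R f x)"
  using integrable_continuous_scaleR[of e a b f] by simp

lemma integrable_continuous_scaleR_rect:
  fixes f :: "real \<times> real \<Rightarrow> 'b::euclidean_space"
  shows "continuous_on UNIV e \<Longrightarrow> integrable (lebesgue_on ({c..d} \<times> {a..b})) f \<Longrightarrow>
    integrable (lebesgue_on ({c..d} \<times> {a..b})) (\<lambda>x. e x *\<^sub>R f x)"
  unfolding rect_eq_cbox by (rule integrable_continuous_scaleR)

text \<open>The domain of integration is empty for \<open>x < a\<close>, so this is the usual oriented integral only to the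
  right of \<open>a\<close>.\<close>

definition primitive :: "real \<Rightarrow> (real \<Rightarrow> 'b::euclidean_space) \<Rightarrow> real \<Rightarrow> 'b" where
  "primitive a g x = (LINT \<theta>|lebesgue_on {a..x}. g \<theta>)"

lemma integral_lebesgue_on_if_le:
  fixes f :: "real \<Rightarrow> 'b::euclidean_space"
  assumes "x \<le> b"
  shows "(LINT \<theta>|lebesgue_on {a..b}. (if \<theta> \<le> x then f \<theta> else 0)) = (LINT \<theta>|lebesgue_on {a..x}. f \<theta>)"
proof -
  have "indicator {a..b} \<theta> *\<^sub>R (if \<theta> \<le> x then f \<theta> else 0) = indicator {a..x} \<theta> *\<^sub>R f \<theta>" for \<theta>
    using assms by (auto simp: indicator_def)
  then show ?thesis
    by (simp add: integral_restrict_space)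
qed

lemma integral_lebesgue_on_if_ge:
  fixes f :: "real \<Rightarrow> 'b::euclidean_space"
  assumes "a \<le> x"
  shows "(LINT \<theta>|lebesgue_on {a..b}. (if x \<le> \<theta> then f \<theta> else 0)) = (LINT \<theta>|lebesgue_on {x..b}. f \<theta>)"
proof -
  have "indicator {a..b} \<theta> *\<^sub>R (if x \<le> \<theta> then f \<theta> else 0) = indicator {x..b} \<theta> *\<^sub>R f \<theta>" for \<theta>
    using assms by (auto simp: indicator_def)
  then show ?thesis
    by (simp add: integral_restrict_space)
qed

text \<open>Integration by parts for a primitive that is merely absolutely continuous: the double integral of
  \<open>\<eta>' x *\<^sub>R g \<theta>\<close> over the triangle \<open>\<theta> \<le> x\<close> is evaluated in both orders.\<close>

lemma
  fixes g :: "real \<Rightarrow> 'b::euclidean_space"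
  assumes g: "integrable (lebesgue_on {a..b}) g"
  shows integrable_primitive: "integrable (lebesgue_on {a..b}) (primitive a g)"
    and integral_deriv_primitive: "\<lbrakk>a \<le> b; \<And>x. (\<eta> has_real_derivative \<eta>' x) (at x); continuous_on UNIV \<eta>'; \<eta> b = 0\<rbrakk> \<Longrightarrow>
      (LINT x|lebesgue_on {a..b}. \<eta>' x *\<^sub>R primitive a g x) = - (LINT x|lebesgue_on {a..b}. \<eta> x *\<^sub>R g x)"
proof -
  have main: "integrable (lebesgue_on {a..b}) (\<lambda>x. \<eta>' x *\<^sub>R primitive a g x) \<and>
      (LINT x|lebesgue_on {a..b}. \<eta>' x *\<^sub>R primitive a g x) = (LINT \<theta>|lebesgue_on {a..b}. (LINT x|lebesgue_on {\<theta>..b}. \<eta>' x) *\<^sub>R g \<theta>)"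
    if \<eta>': "continuous_on UNIV \<eta>'" for \<eta>' :: "real \<Rightarrow> real"
  proof -
    let ?k = "\<lambda>p :: real \<times> real. if snd p \<le> fst p then 1 else 0 :: real"
    have k: "?k \<in> borel_measurable borel"
      unfolding borel_prod[symmetric] by measurable
    have i1: "integrable (lebesgue_on ({a..b} \<times> {a..b})) (\<lambda>p. \<eta>' (fst p) *\<^sub>R g (snd p))"
      by (rule integrable_continuous_scaleR_rect[OF _ integrable_comp_snd[OF g]])
         (rule continuous_on_compose2[OF \<eta>' continuous_on_fst[OF continuous_on_id]], simp)
    have i2: "integrable (lebesgue_on ({a..b} \<times> {a..b})) (\<lambda>p. ?k p *\<^sub>R (\<eta>' (fst p) *\<^sub>R g (snd p)))"
    proof (rule Bochner_Integration.integrable_bound[OF i1])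
      show "(\<lambda>p. ?k p *\<^sub>R (\<eta>' (fst p) *\<^sub>R g (snd p))) \<in> borel_measurable (lebesgue_on ({a..b} \<times> {a..b}))"
        by (rule borel_measurable_scaleR[OF borel_measurable_lebesgue_onI[OF k] borel_measurable_integrable[OF i1]])
    qed simp
    have in1: "(LINT \<theta>|lebesgue_on {a..b}. ?k (x, \<theta>) *\<^sub>R (\<eta>' (fst (x, \<theta>)) *\<^sub>R g (snd (x, \<theta>)))) = \<eta>' x *\<^sub>R primitive a g x"
      if "x \<in> {a..b}" for x
    proof -
      have "?k (x, \<theta>) *\<^sub>R (\<eta>' (fst (x, \<theta>)) *\<^sub>R g (snd (x, \<theta>))) = \<eta>' x *\<^sub>R (if \<theta> \<le> x then g \<theta> else 0)" for \<theta>
        by simp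
      then show ?thesis
        using that by (simp only: integral_scaleR_right integral_lebesgue_on_if_le primitive_def atLeastAtMost_iff)
    qed
    have in2: "(LINT x|lebesgue_on {a..b}. ?k (x, \<theta>) *\<^sub>R (\<eta>' (fst (x, \<theta>)) *\<^sub>R g (snd (x, \<theta>)))) = (LINT x|lebesgue_on {\<theta>..b}. \<eta>' x) *\<^sub>R g \<theta>"
      if "\<theta> \<in> {a..b}" for \<theta>
    proof -
      have "?k (x, \<theta>) *\<^sub>R (\<eta>' (fst (x, \<theta>)) *\<^sub>R g (snd (x, \<theta>))) = (if \<theta> \<le> x then \<eta>' x else 0) *\<^sub>R g \<theta>" for x
        by simp
      moreover have "integrable (lebesgue_on {a..b}) (\<lambda>x. if \<theta> \<le> x then \<eta>' x else 0)"
      proof (rule Bochner_Integration.integrable_bound)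
        show "integrable (lebesgue_on {a..b}) (\<lambda>x. \<eta>' x *\<^sub>R (1::real))"
          by (rule integrable_continuous_scaleR_Icc[OF \<eta>' finite_measure.integrable_const[OF finite_measure_lebesgue_on_Icc]])
        have "(\<lambda>x. if \<theta> \<le> x then \<eta>' x else 0) \<in> borel_measurable borel"
          using borel_measurable_continuous_onI[OF \<eta>'] by measurable
        then show "(\<lambda>x. if \<theta> \<le> x then \<eta>' x else 0) \<in> borel_measurable (lebesgue_on {a..b})"
          by (rule borel_measurable_lebesgue_onI)
      qed simp
      ultimately show ?thesis
        using that by (simp only: integral_scaleR_left integral_lebesgue_on_if_ge atLeastAtMost_iff)
    qed
    have "integrable (lebesgue_on {a..b}) (\<lambda>x. \<eta>' x *\<^sub>R primitive a g x)"
      using integrable_lebesgue_on_fst[OF borel_Icc borel_Icc i2] in1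
      by (subst Bochner_Integration.integrable_cong[OF refl]) (auto simp del: fst_conv snd_conv)
    moreover have "(LINT x|lebesgue_on {a..b}. \<eta>' x *\<^sub>R primitive a g x)
        = (LINT x|lebesgue_on {a..b}. LINT \<theta>|lebesgue_on {a..b}. ?k (x, \<theta>) *\<^sub>R (\<eta>' (fst (x, \<theta>)) *\<^sub>R g (snd (x, \<theta>))))"
      by (rule Bochner_Integration.integral_cong) (use in1 in simp_all)
    moreover have "\<dots> = (LINT \<theta>|lebesgue_on {a..b}. LINT x|lebesgue_on {a..b}. ?k (x, \<theta>) *\<^sub>R (\<eta>' (fst (x, \<theta>)) *\<^sub>R g (snd (x, \<theta>))))"
      using integral_lebesgue_on_fst[OF borel_Icc borel_Icc i2] integral_lebesgue_on_snd[OF borel_Icc borel_Icc i2] by simp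
    moreover have "\<dots> = (LINT \<theta>|lebesgue_on {a..b}. (LINT x|lebesgue_on {\<theta>..b}. \<eta>' x) *\<^sub>R g \<theta>)"
      by (rule Bochner_Integration.integral_cong) (use in2 in simp_all)
    ultimately show ?thesis by metis
  qed
  show "integrable (lebesgue_on {a..b}) (primitive a g)"
    using main[of "\<lambda>_. 1"] by simp
  assume ab: "a \<le> b" and \<eta>: "\<And>x. (\<eta> has_real_derivative \<eta>' x) (at x)" "continuous_on UNIV \<eta>'" "\<eta> b = 0"
  have "(LINT x|lebesgue_on {a..b}. \<eta>' x *\<^sub>R primitive a g x) = (LINT \<theta>|lebesgue_on {a..b}. - (\<eta> \<theta> *\<^sub>R g \<theta>))"
    unfolding main[OF \<eta>(2), THEN conjunct2] using integral_derivative_Icc[OF _ \<eta>(1,2), of _ b] \<eta>(3)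
    by (intro Bochner_Integration.integral_cong refl) simp
  then show "(LINT x|lebesgue_on {a..b}. \<eta>' x *\<^sub>R primitive a g x) = - (LINT x|lebesgue_on {a..b}. \<eta> x *\<^sub>R g x)"
    by simp
qed

lemma integral_by_parts_primitive:
  fixes g :: "real \<Rightarrow> 'b::euclidean_space"
  assumes g: "integrable (lebesgue_on {a..b}) g" and ab: "a \<le> b"
    and \<eta>: "\<And>x. (\<eta> has_real_derivative \<eta>' x) (at x)" "continuous_on UNIV \<eta>'" "\<eta> a = 0" "\<eta> b = 0"
  shows "(LINT x|lebesgue_on {a..b}. \<eta>' x *\<^sub>R (c + primitive a g x)) = - (LINT x|lebesgue_on {a..b}. \<eta> x *\<^sub>R g x)"
proof -
  have i: "integrable (lebesgue_on {a..b}) \<eta>'"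
    using integrable_continuous_scaleR_Icc[OF \<eta>(2) finite_measure.integrable_const[OF finite_measure_lebesgue_on_Icc, of a b "1 :: real"]]
    by simp
  have "(LINT x|lebesgue_on {a..b}. \<eta>' x *\<^sub>R c) = 0"
    using integral_derivative_Icc[OF ab \<eta>(1,2)] \<eta>(3,4) i by simp
  then show ?thesis
    using integral_deriv_primitive[OF g ab \<eta>(1,2,4)] i
      integrable_continuous_scaleR_Icc[OF \<eta>(2) integrable_primitive[OF g]]
    by (simp add: scaleR_add_right)
qed

text \<open>A function orthogonal to all derivatives of test functions is constant. A bump \<open>\<rho>\<close> is not a
  derivative of a test function, but \<open>J \<rho> - I \<omega>\<close> is, where \<open>\<omega>\<close> is another bump and \<open>I\<close>, \<open>J\<close> are the
  integrals of \<open>\<rho>\<close> and \<open>\<omega>\<close>. Letting \<open>\<omega>\<close> tend to the indicator of the whole interval identifies the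
  constant as the mean value.\<close>

lemma du_Bois_Reymond:
  fixes F :: "real \<Rightarrow> 'b::euclidean_space"
  assumes ab: "a < b" and F: "integrable (lebesgue_on {a..b}) F"
    and zero: "\<And>\<eta>. test_function {a..b} \<eta> \<Longrightarrow> (LINT x|lebesgue_on {a..b}. frechet_derivative \<eta> (at x) 1 *\<^sub>R F x) = 0"
  shows "AE x in lebesgue_on {a..b}. F x = (1 / (b - a)) *\<^sub>R (LINT x|lebesgue_on {a..b}. F x)"
proof -
  define m where "m = (1 / (b - a)) *\<^sub>R (LINT x|lebesgue_on {a..b}. F x)"
  have mi: "(b - a) *\<^sub>R m = (LINT x|lebesgue_on {a..b}. F x)"
    using ab by (simp add: m_def)
  have contb: "continuous_on UNIV (bump n c d)" for n and c d :: real
    using times_differentiable_bump[of 0 n c d] by simp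
  have ib: "integrable (lebesgue_on {a..b}) (bump n c d)" for n and c d :: real
    using integrable_continuous_scaleR_Icc[OF contb finite_measure.integrable_const[OF finite_measure_lebesgue_on_Icc, of a b "1 :: real"], of n c d]
    by simp
  define \<omega> where "\<omega> n = bump n a b" for n
  define J where "J n = (LINT x|lebesgue_on {a..b}. \<omega> n x)" for n
  have lim: "(\<lambda>n. LINT x|lebesgue_on {a..b}. \<omega> n x *\<^sub>R f x) \<longlonglongrightarrow> (LINT x|lebesgue_on {a..b}. f x)"
    if f: "integrable (lebesgue_on {a..b}) f" for f :: "real \<Rightarrow> 'c::euclidean_space"
  proof (rule integral_dominated_convergence[where w = "\<lambda>x. norm (f x)"])
    show "(\<lambda>x. \<omega> n x *\<^sub>R f x) \<in> borel_measurable (lebesgue_on {a..b})" for n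
      unfolding \<omega>_def using integrable_continuous_scaleR_Icc[OF contb f] by (rule borel_measurable_integrable)
    have "AE x in lborel. x \<noteq> a \<and> x \<noteq> b"
      using AE_lborel_singleton[of a] AE_lborel_singleton[of b] by eventually_elim simp
    then have "AE x in lebesgue_on {a..b}. x \<in> box a b"
      unfolding AE_lebesgue_on_iff[OF borel_Icc] by eventually_elim auto
    then show "AE x in lebesgue_on {a..b}. (\<lambda>n. \<omega> n x *\<^sub>R f x) \<longlonglongrightarrow> f x"
    proof eventually_elim
      case (elim x)
      have "(\<lambda>n. \<omega> n x *\<^sub>R f x) \<longlonglongrightarrow> indicator (box a b) x *\<^sub>R f x"
        unfolding \<omega>_def by (intro tendsto_scaleR bump_tendsto_indicator tendsto_const)
      then show ?case using elim by simp
    qed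
    show "AE x in lebesgue_on {a..b}. norm (\<omega> n x *\<^sub>R f x) \<le> norm (f x)" for n
      unfolding \<omega>_def using bump_bounds[of n a b] by (auto intro!: mult_left_le_one_le)
  qed (use f in \<open>auto dest: borel_measurable_integrable\<close>)
  have J: "J \<longlonglongrightarrow> b - a"
    using lim[of "\<lambda>_. 1 :: real"] ab by (simp add: J_def[abs_def] finite_measure.integrable_const[OF finite_measure_lebesgue_on_Icc] measure_restrict_space)
  have "(LINT x|lebesgue_on (cbox a b). bump n c d x *\<^sub>R (F x - m)) = 0" if cd: "box c d \<subseteq> cbox a b" for n c d
  proof -
    define \<rho> where "\<rho> = bump n c d"
    define I where "I = (LINT x|lebesgue_on {a..b}. \<rho> x)"
    have test: "test_function {a..b} \<rho>" "test_function {a..b} (\<omega> k)" for k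
      unfolding \<rho>_def \<omega>_def using cd by (auto intro!: test_function_bump)
    have irF: "integrable (lebesgue_on {a..b}) (\<lambda>x. \<rho> x *\<^sub>R F x)" "integrable (lebesgue_on {a..b}) (\<lambda>x. \<omega> k x *\<^sub>R F x)" for k
      unfolding \<rho>_def \<omega>_def by (intro integrable_continuous_scaleR_Icc contb F)+
    have "J k *\<^sub>R (LINT x|lebesgue_on {a..b}. \<rho> x *\<^sub>R F x) = I *\<^sub>R (LINT x|lebesgue_on {a..b}. \<omega> k x *\<^sub>R F x)" for k
    proof -
      let ?\<zeta> = "\<lambda>x. J k * \<rho> x + (- I) * \<omega> k x"
      have "(LINT x|lebesgue_on {a..b}. ?\<zeta> x) = J k * I + (- I) * J k"
        using ib unfolding J_def I_def \<rho>_def \<omega>_def by (subst Bochner_Integration.integral_add) auto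
      then have "\<exists>H. test_function {a..b} H \<and> (\<forall>x. frechet_derivative H (at x) 1 = ?\<zeta> x)"
        by (intro test_function_antiderivative[OF ab test_function_lincomb] test) (simp add: mult.commute)
      then obtain H where H: "test_function {a..b} H" "\<And>x. frechet_derivative H (at x) 1 = ?\<zeta> x" by blast
      have "0 = (LINT x|lebesgue_on {a..b}. ?\<zeta> x *\<^sub>R F x)"
        using zero[OF H(1)] unfolding H(2) by simp
      also have "\<dots> = (LINT x|lebesgue_on {a..b}. J k *\<^sub>R (\<rho> x *\<^sub>R F x) - I *\<^sub>R (\<omega> k x *\<^sub>R F x))"
        by (simp add: scaleR_left_distrib scaleR_left_diff_distrib)
      also have "\<dots> = J k *\<^sub>R (LINT x|lebesgue_on {a..b}. \<rho> x *\<^sub>R F x) - I *\<^sub>R (LINT x|lebesgue_on {a..b}. \<omega> k x *\<^sub>R F x)"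
        using irF by (subst Bochner_Integration.integral_diff) (simp_all only: integral_scaleR_right integrable_scaleR_right)
      finally show ?thesis by simp
    qed
    moreover have "(\<lambda>k. J k *\<^sub>R (LINT x|lebesgue_on {a..b}. \<rho> x *\<^sub>R F x)) \<longlonglongrightarrow> (b - a) *\<^sub>R (LINT x|lebesgue_on {a..b}. \<rho> x *\<^sub>R F x)"
      by (intro tendsto_intros J)
    moreover have "(\<lambda>k. I *\<^sub>R (LINT x|lebesgue_on {a..b}. \<omega> k x *\<^sub>R F x)) \<longlonglongrightarrow> I *\<^sub>R (LINT x|lebesgue_on {a..b}. F x)"
      by (intro tendsto_intros lim F)
    ultimately have "(b - a) *\<^sub>R (LINT x|lebesgue_on {a..b}. \<rho> x *\<^sub>R F x) = I *\<^sub>R (LINT x|lebesgue_on {a..b}. F x)"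
      using LIMSEQ_unique by simp
    also have "\<dots> = (b - a) *\<^sub>R (I *\<^sub>R m)"
      by (simp flip: mi)
    finally have "(LINT x|lebesgue_on {a..b}. \<rho> x *\<^sub>R F x) = I *\<^sub>R m"
      unfolding scaleR_cancel_left using ab by simp
    moreover have "(LINT x|lebesgue_on {a..b}. \<rho> x *\<^sub>R m) = I *\<^sub>R m" "integrable (lebesgue_on {a..b}) (\<lambda>x. \<rho> x *\<^sub>R m)"
      using ib by (simp_all add: I_def \<rho>_def)
    ultimately show ?thesis
      using irF(1) by (simp add: \<rho>_def scaleR_diff_right)
  qed
  moreover have "integrable (lebesgue_on (cbox a b)) (\<lambda>x. F x - m)"
    using F finite_measure.integrable_const[OF finite_measure_lebesgue_on_Icc] by simp
  ultimately have "AE x in lebesgue_on (cbox a b). F x - m = 0"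
    by (intro fundamental_lemma_variations)
  then show ?thesis unfolding m_def right_minus_eq cbox_interval .
qed

section \<open>Weak derivatives as primitives\<close>

lemma has_weak_derivativeD:
  "has_weak_derivative \<Omega> i f g \<Longrightarrow> test_function \<Omega> \<eta> \<Longrightarrow>
    (LINT x|lebesgue_on \<Omega>. frechet_derivative \<eta> (at x) i *\<^sub>R f x) = - (LINT x|lebesgue_on \<Omega>. \<eta> x *\<^sub>R g x)"
  by (simp add: has_weak_derivative_def)

lemma has_weak_derivative_unique:
  fixes f :: "'a::euclidean_space \<Rightarrow> 'b::euclidean_space"
  assumes g: "has_weak_derivative (cbox l u) i f g" and h: "has_weak_derivative (cbox l u) i f h"
  shows "ae_eq (cbox l u) g h"
proof -
  have L: "g \<in> L2 (cbox l u)" "h \<in> L2 (cbox l u)"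
    using g h by (auto simp: has_weak_derivative_def)
  note int = L2_imp_integrable[OF L(1)] L2_imp_integrable[OF L(2)]
  have "AE x in lebesgue_on (cbox l u). g x - h x = 0"
  proof (rule fundamental_lemma_variations)
    show "integrable (lebesgue_on (cbox l u)) (\<lambda>x. g x - h x)"
      using int by simp
    fix n and c d :: 'a
    assume "box c d \<subseteq> cbox l u"
    then have t: "test_function (cbox l u) (bump n c d)"
      by (rule test_function_bump)
    have cont: "continuous_on UNIV (bump n c d)"
      using times_differentiable_bump[of 0 n c d] by simp
    have "(LINT x|lebesgue_on (cbox l u). bump n c d x *\<^sub>R g x) = (LINT x|lebesgue_on (cbox l u). bump n c d x *\<^sub>R h x)"
    proof -
      have "- (LINT x|lebesgue_on (cbox l u). bump n c d x *\<^sub>R g x) = - (LINT x|lebesgue_on (cbox l u). bump n c d x *\<^sub>R h x)"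
        using has_weak_derivativeD[OF g t] has_weak_derivativeD[OF h t] by simp
      then show ?thesis by simp
    qed
    then show "(LINT x|lebesgue_on (cbox l u). bump n c d x *\<^sub>R (g x - h x)) = 0"
      using integrable_continuous_scaleR[OF cont int(1)] integrable_continuous_scaleR[OF cont int(2)]
      by (simp add: scaleR_diff_right)
  qed
  then show ?thesis by (simp add: ae_eq_def)
qed

lemma weak_derivative_ae_eq:
  fixes f :: "'a::euclidean_space \<Rightarrow> 'b::euclidean_space"
  assumes "has_weak_derivative (cbox l u) i f g"
  shows "ae_eq (cbox l u) (weak_derivative (cbox l u) i f) g"
    and "has_weak_derivative (cbox l u) i f (weak_derivative (cbox l u) i f)"
proof -
  show w: "has_weak_derivative (cbox l u) i f (weak_derivative (cbox l u) i f)"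
    unfolding weak_derivative_def by (rule someI[where P = "has_weak_derivative (cbox l u) i f", OF assms])
  show "ae_eq (cbox l u) (weak_derivative (cbox l u) i f) g"
    by (rule has_weak_derivative_unique[OF w assms])
qed

lemma ae_eq_sym: "ae_eq \<Omega> f g \<Longrightarrow> ae_eq \<Omega> g f"
  by (auto simp: ae_eq_def)

lemma ae_eq_trans: "ae_eq \<Omega> f g \<Longrightarrow> ae_eq \<Omega> g h \<Longrightarrow> ae_eq \<Omega> f h"
  by (auto simp: ae_eq_def)

lemma ae_eq_refl: "ae_eq \<Omega> f f"
  by (simp add: ae_eq_def)

lemma has_weak_derivative_ae_eq:
  fixes f :: "'a::euclidean_space \<Rightarrow> 'b::euclidean_space"
  assumes i: "i \<in> Basis" and f: "ae_eq (cbox l u) f f'" and g: "ae_eq (cbox l u) g g'" and fg: "has_weak_derivative (cbox l u) i f g"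
  shows "has_weak_derivative (cbox l u) i f' g'"
proof -
  have L: "f \<in> L2 (cbox l u)" "g \<in> L2 (cbox l u)"
    using fg by (auto simp: has_weak_derivative_def)
  have L': "f' \<in> L2 (cbox l u)" "g' \<in> L2 (cbox l u)"
    using L2_ae_eq[OF _ L(1) f] L2_ae_eq[OF _ L(2) g] by simp_all
  have swap: "(LINT x|lebesgue_on (cbox l u). e x *\<^sub>R h' x) = (LINT x|lebesgue_on (cbox l u). e x *\<^sub>R h x)"
    if e: "continuous_on UNIV e" and h: "h \<in> L2 (cbox l u)" "h' \<in> L2 (cbox l u)" "ae_eq (cbox l u) h h'"
    for e :: "'a \<Rightarrow> real" and h h' :: "'a \<Rightarrow> 'b"
    using integrable_continuous_scaleR[OF e L2_imp_integrable[OF h(1)]]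
      integrable_continuous_scaleR[OF e L2_imp_integrable[OF h(2)]] h(3)
    by (intro integral_cong_AE) (auto simp: ae_eq_def dest: borel_measurable_integrable)
  have "(LINT x|lebesgue_on (cbox l u). frechet_derivative \<eta> (at x) i *\<^sub>R f' x) = - (LINT x|lebesgue_on (cbox l u). \<eta> x *\<^sub>R g' x)"
    if t: "test_function (cbox l u) \<eta>" for \<eta>
  proof -
    have c: "continuous_on UNIV (\<lambda>x. frechet_derivative \<eta> (at x) i)" "continuous_on UNIV \<eta>"
      using times_differentiable_SucE(2)[OF test_functionD(1)[OF t, of 1, unfolded One_nat_def] i]
        test_functionD(1)[OF t, of 0] by simp_all
    show ?thesis
      using fg t swap[OF c(1) L(1) L'(1) f] swap[OF c(2) L(2) L'(2) g]
      unfolding has_weak_derivative_def by simp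
  qed
  with L' show ?thesis by (simp add: has_weak_derivative_def)
qed

text \<open>Functions that agree almost everywhere have the same set of weak derivatives, so the choice operator
  selects literally the same function. This makes later rewriting possible.\<close>

lemma weak_derivative_cong:
  fixes f :: "'a::euclidean_space \<Rightarrow> 'b::euclidean_space"
  assumes "i \<in> Basis" "ae_eq (cbox l u) f f'"
  shows "weak_derivative (cbox l u) i f = weak_derivative (cbox l u) i f'"
    and "weakly_differentiable (cbox l u) i f \<longleftrightarrow> weakly_differentiable (cbox l u) i f'"
proof -
  have "has_weak_derivative (cbox l u) i f = has_weak_derivative (cbox l u) i f'"
    using has_weak_derivative_ae_eq[OF assms(1) assms(2)] has_weak_derivative_ae_eq[OF assms(1) ae_eq_sym[OF assms(2)]]
    by (intro ext iffI) (blast intro: ae_eq_refl)+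
  then show "weak_derivative (cbox l u) i f = weak_derivative (cbox l u) i f'"
    "weakly_differentiable (cbox l u) i f \<longleftrightarrow> weakly_differentiable (cbox l u) i f'"
    by (simp_all add: weak_derivative_def weakly_differentiable_def)
qed

text \<open>From right to left this is integration by parts. From left to right, \<open>f\<close> minus the primitive of \<open>g\<close>
  is orthogonal to all derivatives of test functions.\<close>

lemma has_weak_derivative_Icc_iff:
  fixes f g :: "real \<Rightarrow> 'b::euclidean_space"
  assumes ab: "a < b"
  shows "has_weak_derivative {a..b} 1 f g \<longleftrightarrow> f \<in> L2 {a..b} \<and> g \<in> L2 {a..b} \<and>
    (\<exists>c. AE x in lebesgue_on {a..b}. f x = c + primitive a g x)" (is "?L \<longleftrightarrow> ?R")
proof (cases "f \<in> L2 {a..b} \<and> g \<in> L2 {a..b}")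
  case False
  then show ?thesis by (auto simp: has_weak_derivative_def)
next
  case True
  then have fi: "integrable (lebesgue_on {a..b}) f" and gi: "integrable (lebesgue_on {a..b}) g"
    by (auto intro: L2_imp_integrable_Icc)
  have parts: "(LINT x|lebesgue_on {a..b}. frechet_derivative \<eta> (at x) 1 *\<^sub>R (c + primitive a g x)) = - (LINT x|lebesgue_on {a..b}. \<eta> x *\<^sub>R g x)"
    if t: "test_function {a..b} \<eta>" for \<eta> c
    by (rule integral_by_parts_primitive[OF gi _ test_function_derivative_real[OF t]])
       (use ab in \<open>auto intro!: test_function_outside[OF t]\<close>)
  show ?thesis
  proof
    assume L: ?L
    have Fi: "integrable (lebesgue_on {a..b}) (\<lambda>x. f x - primitive a g x)"
      using fi integrable_primitive[OF gi] by simp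
    have zero: "(LINT x|lebesgue_on {a..b}. frechet_derivative \<eta> (at x) 1 *\<^sub>R (f x - primitive a g x)) = 0"
      if t: "test_function {a..b} \<eta>" for \<eta>
    proof -
      note c = test_function_derivative_real(2)[OF t]
      have "(LINT x|lebesgue_on {a..b}. frechet_derivative \<eta> (at x) 1 *\<^sub>R f x) = - (LINT x|lebesgue_on {a..b}. \<eta> x *\<^sub>R g x)"
        by (rule has_weak_derivativeD[OF L t])
      then show ?thesis
        using parts[OF t, of 0] integrable_continuous_scaleR_Icc[OF c fi]
          integrable_continuous_scaleR_Icc[OF c integrable_primitive[OF gi]]
        by (simp add: scaleR_diff_right)
    qed
    have "AE x in lebesgue_on {a..b}. f x - primitive a g x = (1 / (b - a)) *\<^sub>R (LINT x|lebesgue_on {a..b}. f x - primitive a g x)"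
      by (rule du_Bois_Reymond[OF ab Fi]) (rule zero)
    then have "AE x in lebesgue_on {a..b}. f x = (1 / (b - a)) *\<^sub>R (LINT x|lebesgue_on {a..b}. f x - primitive a g x) + primitive a g x"
      by eventually_elim (simp add: algebra_simps)
    with True show ?R by blast
  next
    assume ?R
    then obtain c where c: "AE x in lebesgue_on {a..b}. f x = c + primitive a g x" by blast
    have "(LINT x|lebesgue_on {a..b}. frechet_derivative \<eta> (at x) 1 *\<^sub>R f x) = - (LINT x|lebesgue_on {a..b}. \<eta> x *\<^sub>R g x)"
      if t: "test_function {a..b} \<eta>" for \<eta>
    proof -
      note cn = test_function_derivative_real(2)[OF t]
      have "integrable (lebesgue_on {a..b}) (\<lambda>x. c + primitive a g x)"
        using integrable_primitive[OF gi] finite_measure.integrable_const[OF finite_measure_lebesgue_on_Icc] by simp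
      from integrable_continuous_scaleR_Icc[OF cn this] integrable_continuous_scaleR_Icc[OF cn fi]
      have "(LINT x|lebesgue_on {a..b}. frechet_derivative \<eta> (at x) 1 *\<^sub>R f x)
          = (LINT x|lebesgue_on {a..b}. frechet_derivative \<eta> (at x) 1 *\<^sub>R (c + primitive a g x))"
        by (intro integral_cong_AE borel_measurable_integrable) (use c in auto)
      then show ?thesis using parts[OF t] by simp
    qed
    with True show ?L by (simp add: has_weak_derivative_def)
  qed
qed

lemma AE_slices_integrable:
  fixes f :: "real \<times> real \<Rightarrow> 'b::euclidean_space"
  assumes "integrable (lebesgue_on ({c..d} \<times> {a..b})) f"
  shows "AE s in lebesgue_on {c..d}. integrable (lebesgue_on {a..b}) (\<lambda>x. f (s, x))"
  by (rule AE_integrable_lebesgue_on_slice[OF borel_Icc borel_Icc assms])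

text \<open>The fibrewise primitive is bounded by the function \<open>s \<mapsto> \<integral>|g(s, \<theta>)| d\<theta>\<close> of the first coordinate alone.\<close>

lemma integrable_fibre_primitive:
  fixes g :: "real \<times> real \<Rightarrow> real^'n"
  assumes g: "integrable (lebesgue_on ({c..d} \<times> {a..b})) g"
  shows "integrable (lebesgue_on ({c..d} \<times> {a..b})) (\<lambda>p. primitive a (\<lambda>\<theta>. g (fst p, \<theta>)) (snd p))"
proof -
  let ?k = "\<lambda>x \<theta> :: real. if \<theta> \<le> x then mat 1 else 0 :: real^'n^'n"
  have k: "(\<lambda>p. ?k (fst p) (snd p)) \<in> borel_measurable borel"
    unfolding borel_prod[symmetric] by measurable
  have eq: "(LINT \<theta>|lebesgue_on {a..b}. ?k x \<theta> *v g (s, \<theta>)) = primitive a (\<lambda>\<theta>. g (s, \<theta>)) x" if "x \<le> b" for s x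
    unfolding primitive_def integral_lebesgue_on_if_le[OF that, symmetric]
    by (rule Bochner_Integration.integral_cong) simp_all
  have m: "(\<lambda>p. primitive a (\<lambda>\<theta>. g (fst p, \<theta>)) (snd p)) \<in> borel_measurable (lebesgue_on ({c..d} \<times> {a..b}))"
    using borel_measurable_fibre_integral[OF k borel_measurable_integrable[OF g]] eq
    by (subst measurable_cong) auto
  have ib: "integrable (lebesgue_on ({c..d} \<times> {a..b})) (\<lambda>p. LINT \<theta>|lebesgue_on {a..b}. norm (g (fst p, \<theta>)))"
    using integrable_comp_fst[OF integrable_lebesgue_on_fst[OF borel_Icc borel_Icc integrable_norm[OF g]]] .
  have "AE s in lebesgue_on {c..d}. \<forall>x\<in>{a..b}. norm (primitive a (\<lambda>\<theta>. g (s, \<theta>)) x) \<le> (LINT \<theta>|lebesgue_on {a..b}. norm (g (s, \<theta>)))"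
    using AE_slices_integrable[OF g]
  proof eventually_elim
    case (elim s)
    show ?case
    proof
      fix x assume x: "x \<in> {a..b}"
      have "(LINT \<theta>|lebesgue_on {a..b}. ?k x \<theta> *v g (s, \<theta>)) = primitive a (\<lambda>\<theta>. g (s, \<theta>)) x" using eq x by simp
      moreover have "norm (LINT \<theta>|lebesgue_on {a..b}. ?k x \<theta> *v g (s, \<theta>)) \<le> (LINT \<theta>|lebesgue_on {a..b}. norm (?k x \<theta> *v g (s, \<theta>)))"
        by (rule Bochner_Integration.integral_norm_bound)
      moreover have "\<dots> \<le> (LINT \<theta>|lebesgue_on {a..b}. norm (g (s, \<theta>)))"
        by (rule Bochner_Integration.integral_mono'[OF integrable_norm[OF elim]]) simp_all
      ultimately show "norm (primitive a (\<lambda>\<theta>. g (s, \<theta>)) x) \<le> (LINT \<theta>|lebesgue_on {a..b}. norm (g (s, \<theta>)))" by simp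
    qed
  qed
  from AE_lebesgue_on_fst[OF borel_Icc borel_Icc this, of a b]
  have "AE p in lebesgue_on ({c..d} \<times> {a..b}). norm (primitive a (\<lambda>\<theta>. g (fst p, \<theta>)) (snd p)) \<le> norm (LINT \<theta>|lebesgue_on {a..b}. norm (g (fst p, \<theta>)))"
    using AE_space by eventually_elim (force intro: order_trans)
  then show ?thesis
    by (rule Bochner_Integration.integrable_bound[OF ib m])
qed

lemma integral_test_fibre_primitive:
  fixes f g :: "real \<times> real \<Rightarrow> real^'n"
  assumes ab: "a \<le> b" and f: "integrable (lebesgue_on ({c..d} \<times> {a..b})) f"
    and g: "integrable (lebesgue_on ({c..d} \<times> {a..b})) g"
    and fg: "AE p in lebesgue_on ({c..d} \<times> {a..b}). f p = h (fst p) + primitive a (\<lambda>\<theta>. g (fst p, \<theta>)) (snd p)"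
    and t: "test_function ({c..d} \<times> {a..b}) \<eta>"
  shows "(LINT p|lebesgue_on ({c..d} \<times> {a..b}). frechet_derivative \<eta> (at p) (0, 1) *\<^sub>R f p)
    = - (LINT p|lebesgue_on ({c..d} \<times> {a..b}). \<eta> p *\<^sub>R g p)"
proof -
  let ?R = "{c..d} \<times> {a..b}"
  let ?e = "\<lambda>p. frechet_derivative \<eta> (at p) (0, 1)"
  note sl = test_function_slice[OF t]
  have e_slice: "continuous_on UNIV (\<lambda>x. ?e (s, x))" for s
    by (rule continuous_on_compose2[OF sl(2)]) (auto intro!: continuous_intros)
  have \<eta>c: "continuous_on UNIV \<eta>" using test_functionD(1)[OF t, of 0] by simp
  have ei: "integrable (lebesgue_on ?R) (\<lambda>p. ?e p *\<^sub>R f p)"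
    by (rule integrable_continuous_scaleR_rect[OF sl(2) f])
  have gi: "integrable (lebesgue_on ?R) (\<lambda>p. \<eta> p *\<^sub>R g p)"
    by (rule integrable_continuous_scaleR_rect[OF \<eta>c g])
  have "AE s in lebesgue_on {c..d}. (LINT x|lebesgue_on {a..b}. ?e (s, x) *\<^sub>R f (s, x)) = - (LINT x|lebesgue_on {a..b}. \<eta> (s, x) *\<^sub>R g (s, x))"
    using AE_lebesgue_on_pair[OF borel_Icc borel_Icc fg] AE_slices_integrable[OF g] AE_slices_integrable[OF f]
  proof eventually_elim
    case (elim s)
    have prim: "integrable (lebesgue_on {a..b}) (\<lambda>x. h s + primitive a (\<lambda>\<theta>. g (s, \<theta>)) x)"
      using integrable_primitive[OF elim(2)] finite_measure.integrable_const[OF finite_measure_lebesgue_on_Icc] by simp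
    have "(LINT x|lebesgue_on {a..b}. ?e (s, x) *\<^sub>R f (s, x)) = (LINT x|lebesgue_on {a..b}. ?e (s, x) *\<^sub>R (h s + primitive a (\<lambda>\<theta>. g (s, \<theta>)) x))"
      using elim(1) borel_measurable_integrable[OF integrable_continuous_scaleR_Icc[OF e_slice elim(3)]]
        borel_measurable_integrable[OF integrable_continuous_scaleR_Icc[OF e_slice prim]]
      by (intro integral_cong_AE) auto
    also have "\<dots> = - (LINT x|lebesgue_on {a..b}. \<eta> (s, x) *\<^sub>R g (s, x))"
      by (rule integral_by_parts_primitive[OF elim(2) ab sl(1) e_slice])
         (auto intro!: test_function_outside[OF t] simp: interior_Times)
    finally show ?case .
  qed
  then have "(LINT s|lebesgue_on {c..d}. LINT x|lebesgue_on {a..b}. ?e (s, x) *\<^sub>R f (s, x))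
      = (LINT s|lebesgue_on {c..d}. - (LINT x|lebesgue_on {a..b}. \<eta> (s, x) *\<^sub>R g (s, x)))"
    using integrable_lebesgue_on_fst[OF borel_Icc borel_Icc ei] integrable_lebesgue_on_fst[OF borel_Icc borel_Icc gi]
    by (intro integral_cong_AE borel_measurable_integrable) auto
  then show ?thesis
    using integral_lebesgue_on_fst[OF borel_Icc borel_Icc ei] integral_lebesgue_on_fst[OF borel_Icc borel_Icc gi] by simp
qed

lemma bump_Pair:
  fixes c\<^sub>1 c\<^sub>2 d\<^sub>1 d\<^sub>2 :: real
  shows "bump n (c\<^sub>1, c\<^sub>2) (d\<^sub>1, d\<^sub>2) p = bump n c\<^sub>1 d\<^sub>1 (fst p) * bump n c\<^sub>2 d\<^sub>2 (snd p)"
  by (cases p) (simp add: bump_def Basis_prod_def mult.commute)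

text \<open>Integrating \<open>F\<close> in the first coordinate against a fixed bump \<open>\<beta>\<close> gives a function of the second
  coordinate to which the one-dimensional lemma applies, because \<open>\<beta>(s) \<eta>(x)\<close> is a test function on the
  rectangle. This avoids the exceptional null set of parameters that a slicewise argument
  would produce for each test function separately. Products of bumps suffice for the fundamental lemma
  since a bump on a rectangle is such a product.\<close>

lemma du_Bois_Reymond_fibre:
  fixes F :: "real \<times> real \<Rightarrow> 'b::euclidean_space"
  assumes ab: "a < b" and F: "integrable (lebesgue_on ({c..d} \<times> {a..b})) F"
    and zero: "\<And>\<eta>. test_function ({c..d} \<times> {a..b}) \<eta> \<Longrightarrow>
      (LINT p|lebesgue_on ({c..d} \<times> {a..b}). frechet_derivative \<eta> (at p) (0, 1) *\<^sub>R F p) = 0"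
  shows "AE p in lebesgue_on ({c..d} \<times> {a..b}). F p = (1 / (b - a)) *\<^sub>R (LINT x|lebesgue_on {a..b}. F (fst p, x))"
proof -
  let ?R = "{c..d} \<times> {a..b}"
  define h where "h s = (1 / (b - a)) *\<^sub>R (LINT x|lebesgue_on {a..b}. F (s, x))" for s
  have hi: "integrable (lebesgue_on {c..d}) h"
    unfolding h_def[abs_def] by (intro integrable_scaleR_right integrable_lebesgue_on_fst[OF borel_Icc borel_Icc F])
  have hi2: "integrable (lebesgue_on ?R) (\<lambda>p. h (fst p))"
    by (rule integrable_comp_fst[OF hi])
  have contb: "continuous_on UNIV (bump n e1 e2)" for n and e1 e2 :: real
    using times_differentiable_bump[of 0 n e1 e2] by simp
  have contf: "continuous_on UNIV (\<lambda>p :: real \<times> real. bump n e1 e2 (fst p))" for n e1 e2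
    by (rule continuous_on_compose2[OF contb continuous_on_fst[OF continuous_on_id]]) simp
  have conts: "continuous_on UNIV (\<lambda>p :: real \<times> real. bump n e1 e2 (snd p))" for n e1 e2
    by (rule continuous_on_compose2[OF contb continuous_on_snd[OF continuous_on_id]]) simp
  have "AE p in lebesgue_on (cbox (c, a) (d, b)). F p - h (fst p) = 0"
  proof (rule fundamental_lemma_variations)
    show "integrable (lebesgue_on (cbox (c, a) (d, b))) (\<lambda>p. F p - h (fst p))"
      using F hi2 by (simp add: rect_eq_cbox)
    fix n and e1 e2 :: "real \<times> real"
    assume sub: "box e1 e2 \<subseteq> cbox (c, a) (d, b)"
    define \<beta> where "\<beta> = bump n (fst e1) (fst e2)"
    define \<rho> where "\<rho> = bump n (snd e1) (snd e2)"
    have split: "bump n e1 e2 p = \<beta> (fst p) * \<rho> (snd p)" for p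
      using bump_Pair[of n "fst e1" "snd e1" "fst e2" "snd e2" p] by (simp add: \<beta>_def \<rho>_def)
    note cont = contf[of n "fst e1" "fst e2", folded \<beta>_def] conts[of n "snd e1" "snd e2", folded \<rho>_def]
      contb[of n "fst e1" "fst e2", folded \<beta>_def] contb[of n "snd e1" "snd e2", folded \<rho>_def]
    show "(LINT p|lebesgue_on (cbox (c, a) (d, b)). bump n e1 e2 p *\<^sub>R (F p - h (fst p))) = 0"
    proof (cases "box e1 e2 = {}")
      case True
      then have "bump n e1 e2 p = 0" for p
        using closure_support_bump[of n e1 e2] closure_subset[of "{p. bump n e1 e2 p \<noteq> 0}"]
        by (cases p) auto
      then show ?thesis by simp
    next
      case False
      have prod: "box e1 e2 = {fst e1<..<fst e2} \<times> {snd e1<..<snd e2}"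
        by (cases e1; cases e2) (auto simp: box_def Basis_prod_def)
      have "{fst e1<..<fst e2} \<subseteq> {c..d}" "{snd e1<..<snd e2} \<subseteq> {a..b}"
        using sub False unfolding prod by (auto simp: cbox_Pair_eq times_subset_iff)
      then have test: "test_function {c..d} \<beta>" "test_function {a..b} \<rho>"
        unfolding \<beta>_def \<rho>_def by (auto intro!: test_function_bump)
      have \<beta>F: "integrable (lebesgue_on ?R) (\<lambda>p. \<beta> (fst p) *\<^sub>R F p)"
        by (rule integrable_continuous_scaleR_rect[OF cont(1) F])
      have \<beta>h: "integrable (lebesgue_on ?R) (\<lambda>p. \<beta> (fst p) *\<^sub>R h (fst p))"
        by (rule integrable_continuous_scaleR_rect[OF cont(1) hi2])
      have \<rho>F: "integrable (lebesgue_on ?R) (\<lambda>p. \<rho> (snd p) *\<^sub>R \<beta> (fst p) *\<^sub>R F p)"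
        by (rule integrable_continuous_scaleR_rect[OF cont(2) \<beta>F])
      have \<rho>h: "integrable (lebesgue_on ?R) (\<lambda>p. \<rho> (snd p) *\<^sub>R \<beta> (fst p) *\<^sub>R h (fst p))"
        by (rule integrable_continuous_scaleR_rect[OF cont(2) \<beta>h])
      define F\<^sub>\<beta> where "F\<^sub>\<beta> x = (LINT s|lebesgue_on {c..d}. \<beta> s *\<^sub>R F (s, x))" for x
      have Fi: "integrable (lebesgue_on {a..b}) F\<^sub>\<beta>"
        using integrable_lebesgue_on_snd[OF borel_Icc borel_Icc \<beta>F] by (simp add: F\<^sub>\<beta>_def[abs_def])
      have "AE x in lebesgue_on {a..b}. F\<^sub>\<beta> x = (1 / (b - a)) *\<^sub>R (LINT x|lebesgue_on {a..b}. F\<^sub>\<beta> x)"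
      proof (rule du_Bois_Reymond[OF ab Fi])
        fix \<eta> assume \<eta>: "test_function {a..b} \<eta>"
        note dc = test_function_derivative_real(2)[OF \<eta>]
        have dc': "continuous_on UNIV (\<lambda>p :: real \<times> real. frechet_derivative \<eta> (at (snd p)) 1)"
          by (rule continuous_on_compose2[OF dc continuous_on_snd[OF continuous_on_id]]) simp
        have i: "integrable (lebesgue_on ?R) (\<lambda>p. frechet_derivative \<eta> (at (snd p)) 1 *\<^sub>R \<beta> (fst p) *\<^sub>R F p)"
          by (rule integrable_continuous_scaleR_rect[OF dc' \<beta>F])
        have "(LINT x|lebesgue_on {a..b}. frechet_derivative \<eta> (at x) 1 *\<^sub>R F\<^sub>\<beta> x)
            = (LINT x|lebesgue_on {a..b}. LINT s|lebesgue_on {c..d}. frechet_derivative \<eta> (at x) 1 *\<^sub>R \<beta> s *\<^sub>R F (s, x))"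
          by (simp only: F\<^sub>\<beta>_def integral_scaleR_right)
        also have "\<dots> = (LINT p|lebesgue_on ?R. frechet_derivative \<eta> (at (snd p)) 1 *\<^sub>R \<beta> (fst p) *\<^sub>R F p)"
          using integral_lebesgue_on_snd[OF borel_Icc borel_Icc i] by (simp only: fst_conv snd_conv)
        also have "\<dots> = (LINT p|lebesgue_on ?R. frechet_derivative (\<lambda>p. \<beta> (fst p) * \<eta> (snd p)) (at p) (0, 1) *\<^sub>R F p)"
          by (simp add: test_function_Times(2)[OF test(1) \<eta>] mult.commute)
        also have "\<dots> = 0"
          by (rule zero[OF test_function_Times(1)[OF test(1) \<eta>]])
        finally show "(LINT x|lebesgue_on {a..b}. frechet_derivative \<eta> (at x) 1 *\<^sub>R F\<^sub>\<beta> x) = 0" .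
      qed
      moreover have "(1 / (b - a)) *\<^sub>R (LINT x|lebesgue_on {a..b}. F\<^sub>\<beta> x) = (LINT s|lebesgue_on {c..d}. \<beta> s *\<^sub>R h s)"
      proof -
        have "(LINT x|lebesgue_on {a..b}. F\<^sub>\<beta> x) = (LINT s|lebesgue_on {c..d}. LINT x|lebesgue_on {a..b}. \<beta> s *\<^sub>R F (s, x))"
          using integral_lebesgue_on_snd[OF borel_Icc borel_Icc \<beta>F] integral_lebesgue_on_fst[OF borel_Icc borel_Icc \<beta>F]
          by (simp add: F\<^sub>\<beta>_def)
        then have "(1 / (b - a)) *\<^sub>R (LINT x|lebesgue_on {a..b}. F\<^sub>\<beta> x)
            = (LINT s|lebesgue_on {c..d}. (1 / (b - a)) *\<^sub>R \<beta> s *\<^sub>R (LINT x|lebesgue_on {a..b}. F (s, x)))"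
          by (simp only: integral_scaleR_right)
        then show ?thesis
          by (simp add: h_def mult.commute)
      qed
      ultimately have "AE x in lebesgue_on {a..b}. F\<^sub>\<beta> x = (LINT s|lebesgue_on {c..d}. \<beta> s *\<^sub>R h s)"
        by simp
      then have ae: "AE x in lebesgue_on {a..b}. \<rho> x *\<^sub>R F\<^sub>\<beta> x = \<rho> x *\<^sub>R (LINT s|lebesgue_on {c..d}. \<beta> s *\<^sub>R h s)"
        by eventually_elim simp
      have "(LINT p|lebesgue_on ?R. \<rho> (snd p) *\<^sub>R \<beta> (fst p) *\<^sub>R F p) = (LINT x|lebesgue_on {a..b}. \<rho> x *\<^sub>R F\<^sub>\<beta> x)"
        using integral_lebesgue_on_snd[OF borel_Icc borel_Icc \<rho>F] by (simp only: F\<^sub>\<beta>_def fst_conv snd_conv integral_scaleR_right)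
      also have "\<dots> = (LINT x|lebesgue_on {a..b}. \<rho> x *\<^sub>R (LINT s|lebesgue_on {c..d}. \<beta> s *\<^sub>R h s))"
        using ae integrable_continuous_scaleR_Icc[OF cont(4) Fi]
          integrable_continuous_scaleR_Icc[OF cont(4) finite_measure.integrable_const[OF finite_measure_lebesgue_on_Icc]]
        by (intro integral_cong_AE borel_measurable_integrable) auto
      also have "\<dots> = (LINT p|lebesgue_on ?R. \<rho> (snd p) *\<^sub>R \<beta> (fst p) *\<^sub>R h (fst p))"
        using integral_lebesgue_on_snd[OF borel_Icc borel_Icc \<rho>h] by (simp only: fst_conv snd_conv integral_scaleR_right)
      finally have "(LINT p|lebesgue_on ?R. \<rho> (snd p) *\<^sub>R \<beta> (fst p) *\<^sub>R F p) = (LINT p|lebesgue_on ?R. \<rho> (snd p) *\<^sub>R \<beta> (fst p) *\<^sub>R h (fst p))" .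
      then have "(LINT p|lebesgue_on ?R. \<rho> (snd p) *\<^sub>R \<beta> (fst p) *\<^sub>R F p - \<rho> (snd p) *\<^sub>R \<beta> (fst p) *\<^sub>R h (fst p)) = 0"
        by (subst Bochner_Integration.integral_diff[OF \<rho>F \<rho>h]) simp
      moreover have "bump n e1 e2 p *\<^sub>R (F p - h (fst p)) = \<rho> (snd p) *\<^sub>R \<beta> (fst p) *\<^sub>R F p - \<rho> (snd p) *\<^sub>R \<beta> (fst p) *\<^sub>R h (fst p)" for p
        by (simp add: split scaleR_diff_right mult.commute)
      ultimately show ?thesis
        by (simp only: rect_eq_cbox)
    qed
  qed
  then show ?thesis
    unfolding right_minus_eq rect_eq_cbox h_def .
qed

text \<open>The two-dimensional version: the constant of integration becomes a function \<open>h\<close> of the other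
  coordinate.\<close>

lemma has_weak_derivative_snd_iff:
  fixes f g :: "real \<times> real \<Rightarrow> real^'n"
  assumes ab: "a < b"
  shows "has_weak_derivative ({c..d} \<times> {a..b}) (0, 1) f g \<longleftrightarrow>
    f \<in> L2 ({c..d} \<times> {a..b}) \<and> g \<in> L2 ({c..d} \<times> {a..b}) \<and>
    (\<exists>h. AE p in lebesgue_on ({c..d} \<times> {a..b}). f p = h (fst p) + primitive a (\<lambda>\<theta>. g (fst p, \<theta>)) (snd p))"
    (is "?L \<longleftrightarrow> ?R")
proof (cases "f \<in> L2 ({c..d} \<times> {a..b}) \<and> g \<in> L2 ({c..d} \<times> {a..b})")
  case False
  then show ?thesis by (auto simp: has_weak_derivative_def)
next
  case True
  then have fi: "integrable (lebesgue_on ({c..d} \<times> {a..b})) f" and gi: "integrable (lebesgue_on ({c..d} \<times> {a..b})) g"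
    by (auto intro: L2_imp_integrable_rect)
  note pi = integrable_fibre_primitive[OF gi]
  show ?thesis
  proof
    assume L: ?L
    let ?F = "\<lambda>p. f p - primitive a (\<lambda>\<theta>. g (fst p, \<theta>)) (snd p)"
    have "AE p in lebesgue_on ({c..d} \<times> {a..b}). ?F p = (1 / (b - a)) *\<^sub>R (LINT x|lebesgue_on {a..b}. ?F (fst p, x))"
    proof (rule du_Bois_Reymond_fibre[OF ab])
      show "integrable (lebesgue_on ({c..d} \<times> {a..b})) ?F"
        using fi pi by simp
      fix \<eta> assume t: "test_function ({c..d} \<times> {a..b}) \<eta>"
      note e = test_function_slice(2)[OF t]
      have "(LINT p|lebesgue_on ({c..d} \<times> {a..b}). frechet_derivative \<eta> (at p) (0, 1) *\<^sub>R primitive a (\<lambda>\<theta>. g (fst p, \<theta>)) (snd p))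
        = - (LINT p|lebesgue_on ({c..d} \<times> {a..b}). \<eta> p *\<^sub>R g p)"
        by (rule integral_test_fibre_primitive[OF less_imp_le[OF ab] pi gi _ t, of "\<lambda>_. 0"]) simp
      then show "(LINT p|lebesgue_on ({c..d} \<times> {a..b}). frechet_derivative \<eta> (at p) (0, 1) *\<^sub>R ?F p) = 0"
        using has_weak_derivativeD[OF L t] integrable_continuous_scaleR_rect[OF e fi] integrable_continuous_scaleR_rect[OF e pi]
        by (simp add: scaleR_diff_right)
    qed
    then have "AE p in lebesgue_on ({c..d} \<times> {a..b}). f p = (1 / (b - a)) *\<^sub>R (LINT x|lebesgue_on {a..b}. ?F (fst p, x)) + primitive a (\<lambda>\<theta>. g (fst p, \<theta>)) (snd p)"
      by eventually_elim (simp add: algebra_simps)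
    with True show ?R
      by (intro conjI exI[of _ "\<lambda>s. (1 / (b - a)) *\<^sub>R (LINT x|lebesgue_on {a..b}. ?F (s, x))"]) auto
  next
    assume ?R
    then obtain h where h: "AE p in lebesgue_on ({c..d} \<times> {a..b}). f p = h (fst p) + primitive a (\<lambda>\<theta>. g (fst p, \<theta>)) (snd p)"
      by blast
    show ?L
      unfolding has_weak_derivative_def
      using True integral_test_fibre_primitive[OF less_imp_le[OF ab] fi gi h] by blast
  qed
qed

lemma
  fixes f :: "real \<times> real \<Rightarrow> 'b::euclidean_space"
  assumes "f \<in> L2 ({c..d} \<times> {a..b})"
  shows L2_swap: "(\<lambda>p. f (prod.swap p)) \<in> L2 ({a..b} \<times> {c..d})"
    and L2_nrm_swap: "L2_nrm ({a..b} \<times> {c..d}) (\<lambda>p. f (prod.swap p)) = L2_nrm ({c..d} \<times> {a..b}) f"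
proof -
  note d = L2_D[OF assms]
  show "(\<lambda>p. f (prod.swap p)) \<in> L2 ({a..b} \<times> {c..d})"
    using borel_measurable_lebesgue_on_swap(1)[OF borel_Icc borel_Icc d(1)]
      borel_measurable_lebesgue_on_swap(3)[OF borel_Icc borel_Icc borel_measurable_integrable[OF d(2)] d(2)]
    by (simp add: L2_def)
  show "L2_nrm ({a..b} \<times> {c..d}) (\<lambda>p. f (prod.swap p)) = L2_nrm ({c..d} \<times> {a..b}) f"
    unfolding L2_nrm_def
    using borel_measurable_lebesgue_on_swap(2)[OF borel_Icc borel_Icc borel_measurable_integrable[OF d(2)]] by simp
qed

lemma has_weak_derivative_swap:
  fixes f g :: "real \<times> real \<Rightarrow> 'b::euclidean_space"
  assumes w: "has_weak_derivative ({c..d} \<times> {a..b}) i f g" and i: "i \<in> Basis"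
  shows "has_weak_derivative ({a..b} \<times> {c..d}) (prod.swap i) (\<lambda>p. f (prod.swap p)) (\<lambda>p. g (prod.swap p))"
proof -
  have L: "f \<in> L2 ({c..d} \<times> {a..b})" "g \<in> L2 ({c..d} \<times> {a..b})"
    using w by (auto simp: has_weak_derivative_def)
  have "(LINT p|lebesgue_on ({a..b} \<times> {c..d}). frechet_derivative \<eta> (at p) (prod.swap i) *\<^sub>R f (prod.swap p))
      = - (LINT p|lebesgue_on ({a..b} \<times> {c..d}). \<eta> p *\<^sub>R g (prod.swap p))"
    if t: "test_function ({a..b} \<times> {c..d}) \<eta>" for \<eta>
  proof -
    note ts = test_function_swap[OF t]
    have c: "continuous_on UNIV (\<lambda>p. frechet_derivative \<eta> (at (prod.swap p)) (prod.swap i))"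
      using times_differentiable_SucE(2)[OF test_functionD(1)[OF ts(1), of "Suc 0"] i] unfolding ts(2) by simp
    have c0: "continuous_on UNIV (\<lambda>p. \<eta> (prod.swap p))"
      using test_functionD(1)[OF ts(1), of 0] by simp
    have 1: "(LINT p|lebesgue_on ({a..b} \<times> {c..d}). frechet_derivative \<eta> (at p) (prod.swap i) *\<^sub>R f (prod.swap p))
      = (LINT p|lebesgue_on ({c..d} \<times> {a..b}). frechet_derivative \<eta> (at (prod.swap p)) (prod.swap i) *\<^sub>R f p)"
      using borel_measurable_lebesgue_on_swap(2)[OF borel_Icc borel_Icc
        borel_measurable_integrable[OF integrable_continuous_scaleR_rect[OF c L2_imp_integrable_rect[OF L(1)]]]] by simp
    have 2: "(LINT p|lebesgue_on ({a..b} \<times> {c..d}). \<eta> p *\<^sub>R g (prod.swap p)) = (LINT p|lebesgue_on ({c..d} \<times> {a..b}). \<eta> (prod.swap p) *\<^sub>R g p)"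
      using borel_measurable_lebesgue_on_swap(2)[OF borel_Icc borel_Icc
        borel_measurable_integrable[OF integrable_continuous_scaleR_rect[OF c0 L2_imp_integrable_rect[OF L(2)]]]] by simp
    show ?thesis
      unfolding 1 2 using has_weak_derivativeD[OF w ts(1)] unfolding ts(2) .
  qed
  with L show ?thesis
    by (simp add: has_weak_derivative_def L2_swap)
qed

lemma has_weak_derivative_fst_iff:
  fixes f g :: "real \<times> real \<Rightarrow> real^'n"
  assumes cd: "c < d"
  shows "has_weak_derivative ({c..d} \<times> {a..b}) (1, 0) f g \<longleftrightarrow>
    f \<in> L2 ({c..d} \<times> {a..b}) \<and> g \<in> L2 ({c..d} \<times> {a..b}) \<and>
    (\<exists>h. AE p in lebesgue_on ({c..d} \<times> {a..b}). f p = h (snd p) + primitive c (\<lambda>\<sigma>. g (\<sigma>, snd p)) (fst p))"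
    (is "?L \<longleftrightarrow> ?R")
proof -
  let ?f = "\<lambda>p. f (prod.swap p)" and ?g = "\<lambda>p. g (prod.swap p)"
  have "?L \<longleftrightarrow> has_weak_derivative ({a..b} \<times> {c..d}) (0, 1) ?f ?g"
    using has_weak_derivative_swap[of c d a b "(1, 0)" f g] has_weak_derivative_swap[of a b c d "(0, 1)" ?f ?g]
    by (auto simp: Basis_prod_def)
  also have "\<dots> \<longleftrightarrow> ?f \<in> L2 ({a..b} \<times> {c..d}) \<and> ?g \<in> L2 ({a..b} \<times> {c..d}) \<and>
    (\<exists>h. AE p in lebesgue_on ({a..b} \<times> {c..d}). ?f p = h (fst p) + primitive c (\<lambda>\<theta>. ?g (fst p, \<theta>)) (snd p))"
    by (rule has_weak_derivative_snd_iff[OF cd])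
  also have "\<dots> \<longleftrightarrow> ?R"
  proof -
    have "?f \<in> L2 ({a..b} \<times> {c..d}) \<longleftrightarrow> f \<in> L2 ({c..d} \<times> {a..b})"
      using L2_swap[of f c d a b] L2_swap[of ?f a b c d] by auto
    moreover have "?g \<in> L2 ({a..b} \<times> {c..d}) \<longleftrightarrow> g \<in> L2 ({c..d} \<times> {a..b})"
      using L2_swap[of g c d a b] L2_swap[of ?g a b c d] by auto
    moreover have "(AE p in lebesgue_on ({a..b} \<times> {c..d}). ?f p = h (fst p) + primitive c (\<lambda>\<theta>. ?g (fst p, \<theta>)) (snd p)) \<longleftrightarrow>
      (AE p in lebesgue_on ({c..d} \<times> {a..b}). f p = h (snd p) + primitive c (\<lambda>\<sigma>. g (\<sigma>, snd p)) (fst p))" for h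
      using AE_lebesgue_on_swap[OF borel_Icc[of a b] borel_Icc[of c d], of "\<lambda>p. ?f p = h (fst p) + primitive c (\<lambda>\<theta>. ?g (fst p, \<theta>)) (snd p)"]
        AE_lebesgue_on_swap[OF borel_Icc[of c d] borel_Icc[of a b], of "\<lambda>p. f p = h (snd p) + primitive c (\<lambda>\<sigma>. g (\<sigma>, snd p)) (fst p)"]
      by auto
    ultimately show ?thesis by simp
  qed
  finally show ?thesis .
qed

section \<open>Estimates and continuity of primitives\<close>

lemma measure_lebesgue_on_Icc: "a \<le> b \<Longrightarrow> measure (lebesgue_on {a..b::real}) {a..b} = b - a"
  by (simp add: measure_restrict_space)

lemma
  fixes f :: "'a::euclidean_space \<Rightarrow> 'b::euclidean_space"
  assumes S: "S \<in> sets borel" and T: "T \<in> sets borel" and sub: "S \<subseteq> T"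
  shows integrable_lebesgue_on_subset: "integrable (lebesgue_on T) f \<Longrightarrow> integrable (lebesgue_on S) f"
    and AE_lebesgue_on_subset: "(AE x in lebesgue_on T. P x) \<Longrightarrow> (AE x in lebesgue_on S. P x)"
proof -
  assume f: "integrable (lebesgue_on T) f"
  have "integrable lebesgue (\<lambda>x. indicator S x *\<^sub>R (indicator T x *\<^sub>R f x))"
    using f S T by (intro integrable_mult_indicator[of S]) (simp_all add: integrable_restrict_space)
  moreover have "indicator S x *\<^sub>R (indicator T x *\<^sub>R f x) = indicator S x *\<^sub>R f x" for x
    using sub by (auto simp: indicator_def)
  ultimately have "integrable lebesgue (\<lambda>x. indicator S x *\<^sub>R f x)"
    by (simp only:)
  then show "integrable (lebesgue_on S) f"
    using S by (simp add: integrable_restrict_space)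
next
  assume "AE x in lebesgue_on T. P x"
  then show "AE x in lebesgue_on S. P x"
    unfolding AE_lebesgue_on_iff[OF S] AE_lebesgue_on_iff[OF T] by eventually_elim (use sub in auto)
qed

lemma integrable_Icc_subset:
  fixes f :: "real \<Rightarrow> 'b::euclidean_space"
  shows "integrable (lebesgue_on {a..b}) f \<Longrightarrow> x \<le> b \<Longrightarrow> integrable (lebesgue_on {a..x}) f"
  by (rule integrable_lebesgue_on_subset[OF borel_Icc borel_Icc]) auto

lemma primitive_cong_AE:
  fixes f g :: "real \<Rightarrow> 'b::euclidean_space"
  assumes f: "integrable (lebesgue_on {a..b}) f" and ae: "AE \<theta> in lebesgue_on {a..b}. f \<theta> = g \<theta>" and x: "x \<le> b"
  shows "primitive a f x = primitive a g x"
proof -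
  have ae': "AE \<theta> in lebesgue_on {a..x}. f \<theta> = g \<theta>"
    by (rule AE_lebesgue_on_subset[OF borel_Icc borel_Icc _ ae]) (use x in auto)
  note m = borel_measurable_integrable[OF integrable_Icc_subset[OF f x]]
  have "g \<in> borel_measurable (lebesgue_on {a..x})"
    by (rule borel_measurable_lebesgue_on_AE[OF borel_Icc m]) (use ae' in auto)
  then show ?thesis
    unfolding primitive_def by (rule integral_cong_AE[OF m _ ae'])
qed

lemma primitive_cong:
  "(\<And>\<theta>. a \<le> \<theta> \<Longrightarrow> \<theta> \<le> x \<Longrightarrow> f \<theta> = g \<theta>) \<Longrightarrow> primitive a f x = primitive a g x"
  unfolding primitive_def by (rule Bochner_Integration.integral_cong) simp_all

lemma primitive_add:
  fixes f g :: "real \<Rightarrow> 'b::euclidean_space"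
  assumes "integrable (lebesgue_on {a..b}) f" "integrable (lebesgue_on {a..b}) g" "x \<le> b"
  shows "primitive a (\<lambda>\<theta>. f \<theta> + g \<theta>) x = primitive a f x + primitive a g x"
  unfolding primitive_def
  by (intro Bochner_Integration.integral_add integrable_Icc_subset[OF assms(1,3)] integrable_Icc_subset[OF assms(2,3)])

lemma primitive_bounded_linear:
  fixes f :: "real \<Rightarrow> 'b::euclidean_space" and L :: "'b \<Rightarrow> 'c::euclidean_space"
  assumes "bounded_linear L" "integrable (lebesgue_on {a..b}) f" "x \<le> b"
  shows "primitive a (\<lambda>\<theta>. L (f \<theta>)) x = L (primitive a f x)"
  unfolding primitive_def
  by (rule integral_bounded_linear[OF assms(1) integrable_Icc_subset[OF assms(2,3)]])

lemma primitive_const: "a \<le> x \<Longrightarrow> primitive a (\<lambda>_. c) x = (x - a) *\<^sub>R c"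
  by (simp add: primitive_def measure_lebesgue_on_Icc)

lemma primitive_at_start: "primitive a (f :: real \<Rightarrow> 'b::euclidean_space) a = 0"
proof -
  have "AE x in lborel. x \<noteq> a" by (rule AE_lborel_singleton)
  then have "AE x in lebesgue_on {a..a}. False"
    unfolding AE_lebesgue_on_iff[OF borel_Icc] by eventually_elim auto
  then have "(LINT x|lebesgue_on {a..a}. f x) = 0"
    by (intro integral_eq_zero_AE) auto
  then show ?thesis by (simp add: primitive_def)
qed

lemma norm_primitive_le:
  fixes f :: "real \<Rightarrow> 'b::euclidean_space"
  assumes f: "integrable (lebesgue_on {a..b}) f" and x: "x \<le> b"
  shows "norm (primitive a f x) \<le> (LINT \<theta>|lebesgue_on {a..b}. norm (f \<theta>))"
proof -
  have "norm (primitive a f x) \<le> (LINT \<theta>|lebesgue_on {a..b}. norm (if \<theta> \<le> x then f \<theta> else 0))"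
    unfolding primitive_def integral_lebesgue_on_if_le[OF x, symmetric] by (rule Bochner_Integration.integral_norm_bound)
  also have "\<dots> \<le> (LINT \<theta>|lebesgue_on {a..b}. norm (f \<theta>))"
    by (rule Bochner_Integration.integral_mono'[OF integrable_norm[OF f]]) simp_all
  finally show ?thesis .
qed

text \<open>Cauchy's formula for the iterated integral; it is integration by parts with \<open>\<eta> y = x - y\<close>.\<close>

lemma primitive_primitive:
  fixes f :: "real \<Rightarrow> 'b::euclidean_space"
  assumes "integrable (lebesgue_on {a..b}) f" "a \<le> x" "x \<le> b"
  shows "primitive a (primitive a f) x = (LINT \<theta>|lebesgue_on {a..x}. (x - \<theta>) *\<^sub>R f \<theta>)"
proof -
  have "(LINT y|lebesgue_on {a..x}. (- 1) *\<^sub>R primitive a f y) = - (LINT y|lebesgue_on {a..x}. (x - y) *\<^sub>R f y)"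
    by (rule integral_deriv_primitive[OF integrable_Icc_subset[OF assms(1,3)] assms(2)])
       (auto intro!: derivative_eq_intros)
  then show ?thesis by (simp add: primitive_def)
qed

lemma continuous_on_primitive:
  fixes f :: "real \<Rightarrow> 'b::euclidean_space"
  assumes f: "integrable (lebesgue_on {a..b}) f"
  shows "continuous_on {a..b} (primitive a f)"
proof -
  have "continuous_on {a..b} (\<lambda>x. LINT \<theta>|lebesgue_on {a..b}. (if \<theta> \<le> x then f \<theta> else 0))"
    unfolding continuous_on_sequentially
  proof (intro allI ballI impI)
    fix X :: "nat \<Rightarrow> real" and x assume X: "(\<forall>n. X n \<in> {a..b}) \<and> X \<longlonglongrightarrow> x"
    have m: "(\<lambda>\<theta>. if \<theta> \<le> y then f \<theta> else 0) \<in> borel_measurable (lebesgue_on {a..b})" for y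
    proof -
      have "(\<lambda>\<theta>. indicat_real {..y} \<theta> *\<^sub>R f \<theta>) \<in> borel_measurable (lebesgue_on {a..b})"
        by (intro borel_measurable_scaleR borel_measurable_lebesgue_onI borel_measurable_integrable[OF f]
            borel_measurable_indicator) simp
      moreover have "indicat_real {..y} \<theta> *\<^sub>R f \<theta> = (if \<theta> \<le> y then f \<theta> else 0)" for \<theta>
        by simp
      ultimately show ?thesis by simp
    qed
    have "(\<lambda>n. LINT \<theta>|lebesgue_on {a..b}. (if \<theta> \<le> X n then f \<theta> else 0)) \<longlonglongrightarrow> (LINT \<theta>|lebesgue_on {a..b}. (if \<theta> \<le> x then f \<theta> else 0))"
    proof (rule integral_dominated_convergence[where w = "\<lambda>\<theta>. norm (f \<theta>)"])
      have "AE \<theta> in lebesgue_on {a..b}. \<theta> \<noteq> x"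
        using AE_lborel_singleton[of x] unfolding AE_lebesgue_on_iff[OF borel_Icc] by auto
      then show "AE \<theta> in lebesgue_on {a..b}. (\<lambda>n. if \<theta> \<le> X n then f \<theta> else 0) \<longlonglongrightarrow> (if \<theta> \<le> x then f \<theta> else 0)"
      proof eventually_elim
        case (elim \<theta>)
        have "\<forall>\<^sub>F n in sequentially. X n < \<theta> \<longleftrightarrow> x < \<theta>"
          using elim order_tendstoD[OF X[THEN conjunct2], of \<theta>] by (cases "x < \<theta>") (auto elim!: eventually_mono)
        then have "\<forall>\<^sub>F n in sequentially. (if \<theta> \<le> X n then f \<theta> else 0) = (if \<theta> \<le> x then f \<theta> else 0)"
          by eventually_elim (auto simp: not_less[symmetric])
        then show ?case by (rule tendsto_eventually)
      qed
    qed (use m integrable_norm[OF f] in auto)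
    then show "((\<lambda>x. LINT \<theta>|lebesgue_on {a..b}. (if \<theta> \<le> x then f \<theta> else 0)) \<circ> X) \<longlonglongrightarrow> (LINT \<theta>|lebesgue_on {a..b}. (if \<theta> \<le> x then f \<theta> else 0))"
      by (simp add: o_def)
  qed
  then show ?thesis
    by (rule continuous_on_eq) (simp add: integral_lebesgue_on_if_le primitive_def)
qed

text \<open>Fubini's theorem in the form used from here on. The two equations together give the double primitive
  as an integral over a rectangle.\<close>

lemma primitive_commute:
  fixes \<psi> :: "real \<times> real \<Rightarrow> 'b::euclidean_space"
  assumes \<psi>: "integrable (lebesgue_on ({c..d} \<times> {a..b})) \<psi>" and s: "s \<le> d" and x: "x \<le> b"
  shows "primitive a (\<lambda>\<theta>. primitive c (\<lambda>\<sigma>. \<psi> (\<sigma>, \<theta>)) s) x = primitive c (\<lambda>\<sigma>. primitive a (\<lambda>\<theta>. \<psi> (\<sigma>, \<theta>)) x) s"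
    and "primitive c (\<lambda>\<sigma>. primitive a (\<lambda>\<theta>. \<psi> (\<sigma>, \<theta>)) x) s = (LINT p|lebesgue_on ({c..s} \<times> {a..x}). \<psi> p)"
proof -
  have i: "integrable (lebesgue_on ({c..s} \<times> {a..x})) \<psi>"
    by (rule integrable_lebesgue_on_subset[OF Times_in_borel[OF borel_Icc borel_Icc] Times_in_borel[OF borel_Icc borel_Icc] _ \<psi>])
       (use s x in auto)
  show "primitive a (\<lambda>\<theta>. primitive c (\<lambda>\<sigma>. \<psi> (\<sigma>, \<theta>)) s) x = primitive c (\<lambda>\<sigma>. primitive a (\<lambda>\<theta>. \<psi> (\<sigma>, \<theta>)) x) s"
    "primitive c (\<lambda>\<sigma>. primitive a (\<lambda>\<theta>. \<psi> (\<sigma>, \<theta>)) x) s = (LINT p|lebesgue_on ({c..s} \<times> {a..x}). \<psi> p)"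
    unfolding primitive_def integral_lebesgue_on_snd[OF borel_Icc borel_Icc i] integral_lebesgue_on_fst[OF borel_Icc borel_Icc i]
    by simp_all
qed

text \<open>The integral over \<open>[c, s] \<times> [a, x]\<close> depends continuously on the corner \<open>(s, x)\<close>, by dominated
  convergence. This is the only source of joint continuity in the development, and it replaces
  a Sobolev embedding theorem.\<close>

lemma continuous_on_double_primitive:
  fixes \<psi> :: "real \<times> real \<Rightarrow> 'b::euclidean_space"
  assumes \<psi>: "integrable (lebesgue_on ({c..d} \<times> {a..b})) \<psi>"
  shows "continuous_on ({c..d} \<times> {a..b}) (\<lambda>p. primitive c (\<lambda>\<sigma>. primitive a (\<lambda>\<theta>. \<psi> (\<sigma>, \<theta>)) (snd p)) (fst p))"
proof -
  let ?R = "{c..d} \<times> {a..b}"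
  have R: "?R \<in> sets borel" by (rule Times_in_borel[OF borel_Icc borel_Icc])
  let ?G = "\<lambda>p q. indicator ({c..fst p} \<times> {a..snd p}) q *\<^sub>R \<psi> q"
  have eq: "primitive c (\<lambda>\<sigma>. primitive a (\<lambda>\<theta>. \<psi> (\<sigma>, \<theta>)) (snd p)) (fst p) = (LINT q|lebesgue_on ?R. ?G p q)"
    if "p \<in> ?R" for p
  proof -
    have "indicator ?R q *\<^sub>R ?G p q = ?G p q" for q
      using that by (auto simp: indicator_def)
    note res = this
    have "(LINT q|lebesgue_on ?R. ?G p q) = (LINT q|lebesgue. indicator ?R q *\<^sub>R ?G p q)"
      by (rule integral_restrict_space) (use R in simp)
    also have "\<dots> = (LINT q|lebesgue. ?G p q)"
      by (simp only: res)
    also have "\<dots> = (LINT q|lebesgue_on ({c..fst p} \<times> {a..snd p}). \<psi> q)"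
      by (rule integral_restrict_space[symmetric]) (use Times_in_borel[OF borel_Icc[of c "fst p"] borel_Icc[of a "snd p"]] in simp)
    finally have "(LINT q|lebesgue_on ?R. ?G p q) = (LINT q|lebesgue_on ({c..fst p} \<times> {a..snd p}). \<psi> q)" .
    then show ?thesis
      using primitive_commute(2)[OF \<psi>, of "fst p" "snd p"] that by auto
  qed
  have "continuous_on ?R (\<lambda>p. LINT q|lebesgue_on ?R. ?G p q)"
    unfolding continuous_on_sequentially
  proof (intro allI ballI impI)
    fix X :: "nat \<Rightarrow> real \<times> real" and p assume p: "p \<in> ?R" and X: "(\<forall>n. X n \<in> ?R) \<and> X \<longlonglongrightarrow> p"
    have lf: "(\<lambda>n. fst (X n)) \<longlonglongrightarrow> fst p" and ls: "(\<lambda>n. snd (X n)) \<longlonglongrightarrow> snd p"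
      using X by (auto intro: tendsto_fst tendsto_snd)
    have mG: "(\<lambda>q. ?G r q) \<in> borel_measurable (lebesgue_on ?R)" for r
      by (intro borel_measurable_scaleR borel_measurable_lebesgue_onI borel_measurable_integrable[OF \<psi>]
          borel_measurable_indicator Times_in_borel borel_Icc)
    have "(\<lambda>n. LINT q|lebesgue_on ?R. ?G (X n) q) \<longlonglongrightarrow> (LINT q|lebesgue_on ?R. ?G p q)"
    proof (rule integral_dominated_convergence[where w = "\<lambda>q. norm (\<psi> q)"])
      have n1: "AE \<sigma> in lebesgue_on {c..d}. \<sigma> \<noteq> fst p" and n2: "AE \<theta> in lebesgue_on {a..b}. \<theta> \<noteq> snd p"
        using AE_lborel_singleton[of "fst p"] AE_lborel_singleton[of "snd p"]
        unfolding AE_lebesgue_on_iff[OF borel_Icc] by auto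
      show "AE q in lebesgue_on ?R. (\<lambda>n. ?G (X n) q) \<longlonglongrightarrow> ?G p q"
        using AE_lebesgue_on_fst[OF borel_Icc borel_Icc n1] AE_lebesgue_on_snd[OF borel_Icc borel_Icc n2]
      proof eventually_elim
        case (elim q)
        have "\<forall>\<^sub>F n in sequentially. fst (X n) < fst q \<longleftrightarrow> fst p < fst q"
          using elim(1) order_tendstoD[OF lf, of "fst q"] by (cases "fst p < fst q") (auto elim!: eventually_mono)
        moreover have "\<forall>\<^sub>F n in sequentially. snd (X n) < snd q \<longleftrightarrow> snd p < snd q"
          using elim(2) order_tendstoD[OF ls, of "snd q"] by (cases "snd p < snd q") (auto elim!: eventually_mono)
        ultimately have "\<forall>\<^sub>F n in sequentially. ?G (X n) q = ?G p q"
          by eventually_elim (auto simp: indicator_def mem_Times_iff not_less[symmetric])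
        then show ?case by (rule tendsto_eventually)
      qed
      show "AE q in lebesgue_on ?R. norm (?G (X n) q) \<le> norm (\<psi> q)" for n
        by (auto simp: indicator_def)
    qed (use mG integrable_norm[OF \<psi>] in auto)
    then show "((\<lambda>p. LINT q|lebesgue_on ?R. ?G p q) \<circ> X) \<longlonglongrightarrow> (LINT q|lebesgue_on ?R. ?G p q)"
      by (simp add: o_def)
  qed
  then show ?thesis
    using eq by (simp cong: continuous_on_cong)
qed

lemma integral_square_le:
  fixes f :: "real \<Rightarrow> real"
  assumes ab: "a < b" and f: "integrable (lebesgue_on {a..b}) f" "integrable (lebesgue_on {a..b}) (\<lambda>x. (f x)\<^sup>2)"
  shows "(LINT x|lebesgue_on {a..b}. f x)\<^sup>2 \<le> (b - a) * (LINT x|lebesgue_on {a..b}. (f x)\<^sup>2)"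
proof -
  define I where "I = (LINT x|lebesgue_on {a..b}. f x)"
  define m where "m = I / (b - a)"
  have mI: "m * (b - a) = I" using ab by (simp add: m_def)
  have c: "integrable (lebesgue_on {a..b}) (\<lambda>_. r)" "(LINT x|lebesgue_on {a..b}. r) = (b - a) * r" for r :: real
    using ab finite_measure.integrable_const[OF finite_measure_lebesgue_on_Icc] by (simp_all add: measure_lebesgue_on_Icc)
  \<comment> \<open>the Cauchy-Schwarz inequality as nonnegativity of the variance\<close>
  have "0 \<le> (LINT x|lebesgue_on {a..b}. (f x - m)\<^sup>2)"
    by (intro integral_nonneg_AE) simp
  also have "\<dots> = (LINT x|lebesgue_on {a..b}. ((f x)\<^sup>2 - (2 * m) * f x) + m\<^sup>2)"
    by (intro Bochner_Integration.integral_cong refl) (simp add: power2_diff)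
  also have "\<dots> = (LINT x|lebesgue_on {a..b}. (f x)\<^sup>2) - 2 * m * I + (b - a) * m\<^sup>2"
    using f c by (simp add: I_def)
  also have "\<dots> = (LINT x|lebesgue_on {a..b}. (f x)\<^sup>2) - m * I"
    unfolding mI[symmetric] by (simp add: algebra_simps power2_eq_square)
  finally have "(b - a) * (m * I) \<le> (b - a) * (LINT x|lebesgue_on {a..b}. (f x)\<^sup>2)"
    using ab by (intro mult_left_mono) auto
  then show ?thesis
    using ab by (simp add: m_def I_def power2_eq_square)
qed

text \<open>An operator that acts in the second coordinate only, and whose values are bounded by the L1 norm of
  the slice, is bounded on L2 of the rectangle, by the Cauchy-Schwarz inequality on each slice.\<close>

lemma L2_fibre_bound:
  fixes F :: "real \<times> real \<Rightarrow> 'b::euclidean_space" and \<psi> :: "real \<times> real \<Rightarrow> 'c::euclidean_space"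
  assumes ab: "a < b" and F: "F \<in> borel_measurable (lebesgue_on ({c..d} \<times> {a..b}))"
    and \<psi>: "\<psi> \<in> L2 ({c..d} \<times> {a..b})" and C: "0 \<le> C"
    and bound: "AE s in lebesgue_on {c..d}. \<forall>x\<in>{a..b}. norm (F (s, x)) \<le> C * (LINT \<theta>|lebesgue_on {a..b}. norm (\<psi> (s, \<theta>)))"
  shows "F \<in> L2 ({c..d} \<times> {a..b})"
    and "(L2_nrm ({c..d} \<times> {a..b}) F)\<^sup>2 \<le> (C * (b - a))\<^sup>2 * (L2_nrm ({c..d} \<times> {a..b}) \<psi>)\<^sup>2"
proof -
  let ?R = "{c..d} \<times> {a..b}"
  note i1 = L2_imp_integrable_rect[OF \<psi>] and i2 = L2_D(2)[OF \<psi>]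
  define M where "M s = (LINT \<theta>|lebesgue_on {a..b}. (norm (\<psi> (s, \<theta>)))\<^sup>2)" for s
  have Mi: "integrable (lebesgue_on {c..d}) M"
    unfolding M_def[abs_def] by (rule integrable_lebesgue_on_fst[OF borel_Icc borel_Icc i2])
  have mi: "integrable (lebesgue_on ?R) (\<lambda>p. C\<^sup>2 * (b - a) * M (fst p))"
    by (intro integrable_mult_right integrable_comp_fst Mi)
  have "AE s in lebesgue_on {c..d}. \<forall>x\<in>{a..b}. (norm (F (s, x)))\<^sup>2 \<le> C\<^sup>2 * (b - a) * M s"
    using bound AE_slices_integrable[OF i1] AE_slices_integrable[OF i2]
  proof eventually_elim
    case (elim s)
    show ?case
    proof
      fix x assume "x \<in> {a..b}"
      then have "(norm (F (s, x)))\<^sup>2 \<le> (C * (LINT \<theta>|lebesgue_on {a..b}. norm (\<psi> (s, \<theta>))))\<^sup>2"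
        using elim(1) by (intro power_mono) auto
      also have "\<dots> = C\<^sup>2 * (LINT \<theta>|lebesgue_on {a..b}. norm (\<psi> (s, \<theta>)))\<^sup>2"
        by (rule power_mult_distrib)
      also have "\<dots> \<le> C\<^sup>2 * ((b - a) * M s)"
        unfolding M_def using integral_square_le[OF ab integrable_norm[OF elim(2)] elim(3)]
        by (intro mult_left_mono) auto
      finally show "(norm (F (s, x)))\<^sup>2 \<le> C\<^sup>2 * (b - a) * M s" by (simp add: mult.assoc)
    qed
  qed
  from AE_lebesgue_on_fst[OF borel_Icc borel_Icc this, of a b]
  have ae: "AE p in lebesgue_on ?R. (norm (F p))\<^sup>2 \<le> C\<^sup>2 * (b - a) * M (fst p)"
    using AE_space by eventually_elim auto
  note L = L2_boundI[OF F mi ae]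
  show "F \<in> L2 ?R" by (rule L(1))
  have "(LINT p|lebesgue_on ?R. C\<^sup>2 * (b - a) * M (fst p)) = (LINT s|lebesgue_on {c..d}. LINT x|lebesgue_on {a..b}. C\<^sup>2 * (b - a) * M s)"
    using integral_lebesgue_on_fst[OF borel_Icc borel_Icc mi] by (simp only: fst_conv)
  also have "\<dots> = (LINT s|lebesgue_on {c..d}. (C * (b - a))\<^sup>2 * M s)"
    using ab by (intro Bochner_Integration.integral_cong refl) (simp add: measure_lebesgue_on_Icc power2_eq_square)
  also have "\<dots> = (C * (b - a))\<^sup>2 * (L2_nrm ?R \<psi>)\<^sup>2"
    using integral_lebesgue_on_fst[OF borel_Icc borel_Icc i2] by (simp add: L2_nrm_square M_def)
  finally show "(L2_nrm ?R F)\<^sup>2 \<le> (C * (b - a))\<^sup>2 * (L2_nrm ?R \<psi>)\<^sup>2"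
    using L(2) by simp
qed

text \<open>Functions of \<open>x\<close> are functions on a rectangle that do not depend on the first coordinate. For
  the unit interval of delays this embedding is isometric, which reduces one-dimensional estimates to
  two-dimensional ones.\<close>

lemma
  fixes v :: "real \<Rightarrow> 'b::euclidean_space"
  assumes v: "v \<in> L2 {a..b}" and cd: "c \<le> d"
  shows L2_comp_snd: "(\<lambda>p. v (snd p)) \<in> L2 ({c..d} \<times> {a..b})"
    and L2_nrm_comp_snd: "(L2_nrm ({c..d} \<times> {a..b}) (\<lambda>p. v (snd p)))\<^sup>2 = (d - c) * (L2_nrm {a..b} v)\<^sup>2"
proof -
  have i: "integrable (lebesgue_on ({c..d} \<times> {a..b})) (\<lambda>p. (norm (v (snd p)))\<^sup>2)"
    by (rule integrable_comp_snd[OF L2_D(2)[OF v]])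
  show "(\<lambda>p. v (snd p)) \<in> L2 ({c..d} \<times> {a..b})"
    using borel_measurable_comp_snd[OF L2_D(1)[OF v]] i by (simp add: L2_def)
  show "(L2_nrm ({c..d} \<times> {a..b}) (\<lambda>p. v (snd p)))\<^sup>2 = (d - c) * (L2_nrm {a..b} v)\<^sup>2"
    using integral_lebesgue_on_fst[OF borel_Icc borel_Icc i] cd
    by (simp add: L2_nrm_square measure_lebesgue_on_Icc)
qed

lemma L2_comp_sndD:
  fixes v :: "real \<Rightarrow> 'b::euclidean_space" and c d :: real
  assumes v: "(\<lambda>p. v (snd p)) \<in> L2 ({c..d} \<times> {a..b})" and cd: "c < d"
  shows "v \<in> L2 {a..b}"
proof -
  have nz: "\<not> (AE s in lebesgue_on {c..d}. False)"
  proof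
    assume "AE s in lebesgue_on {c..d}. False"
    then have "(LINT s|lebesgue_on {c..d}. 1 :: real) = 0"
      by (intro integral_eq_zero_AE) auto
    moreover have "(LINT s|lebesgue_on {c..d}. 1 :: real) = d - c"
      using measure_lebesgue_on_Icc[of c d] cd by simp
    ultimately show False using cd by simp
  qed
  have "AE s in lebesgue_on {c..d}. v \<in> L2 {a..b}"
    using AE_slices_integrable[OF L2_imp_integrable_rect[OF v]] AE_slices_integrable[OF L2_D(2)[OF v]]
    by eventually_elim (auto simp: L2_def dest: borel_measurable_integrable)
  then show ?thesis using nz by (cases "v \<in> L2 {a..b}") simp_all
qed

lemma L2_bound_Icc:
  fixes F :: "real \<Rightarrow> 'b::euclidean_space" and \<psi> :: "real \<Rightarrow> 'c::euclidean_space"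
  assumes ab: "a < b" and F: "F \<in> borel_measurable (lebesgue_on {a..b})"
    and \<psi>: "\<psi> \<in> L2 {a..b}" and C: "0 \<le> C"
    and bound: "\<And>x. x \<in> {a..b} \<Longrightarrow> norm (F x) \<le> C * (LINT \<theta>|lebesgue_on {a..b}. norm (\<psi> \<theta>))"
  shows "F \<in> L2 {a..b}"
proof -
  have b: "AE s in lebesgue_on {0..1}. \<forall>x\<in>{a..b}. norm (F (snd (s, x))) \<le> C * (LINT \<theta>|lebesgue_on {a..b}. norm (\<psi> (snd (s, \<theta>))))"
    using bound by simp
  note L = L2_fibre_bound[OF ab borel_measurable_comp_snd[OF F] L2_comp_snd[OF \<psi>, of 0 1] C b]
  show "F \<in> L2 {a..b}"
    by (rule L2_comp_sndD[OF L(1)]) simp_all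
qed

section \<open>Reconstruction of a function from its second derivative\<close>

lemma integrable_primitive_param:
  fixes \<psi> :: "real \<times> real \<Rightarrow> 'b::euclidean_space"
  assumes \<psi>: "integrable (lebesgue_on ({c..d} \<times> {a..b})) \<psi>"
  shows "x \<le> b \<Longrightarrow> integrable (lebesgue_on {c..d}) (\<lambda>\<sigma>. primitive a (\<lambda>\<theta>. \<psi> (\<sigma>, \<theta>)) x)"
    and "s \<le> d \<Longrightarrow> integrable (lebesgue_on {a..b}) (\<lambda>\<theta>. primitive c (\<lambda>\<sigma>. \<psi> (\<sigma>, \<theta>)) s)"
proof -
  assume x: "x \<le> b"
  have "integrable (lebesgue_on ({c..d} \<times> {a..x})) \<psi>"
    by (rule integrable_lebesgue_on_subset[OF Times_in_borel[OF borel_Icc borel_Icc] Times_in_borel[OF borel_Icc borel_Icc] _ \<psi>])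
       (use x in auto)
  from integrable_lebesgue_on_fst[OF borel_Icc borel_Icc this]
  show "integrable (lebesgue_on {c..d}) (\<lambda>\<sigma>. primitive a (\<lambda>\<theta>. \<psi> (\<sigma>, \<theta>)) x)"
    by (simp add: primitive_def)
next
  assume s: "s \<le> d"
  have "integrable (lebesgue_on ({c..s} \<times> {a..b})) \<psi>"
    by (rule integrable_lebesgue_on_subset[OF Times_in_borel[OF borel_Icc borel_Icc] Times_in_borel[OF borel_Icc borel_Icc] _ \<psi>])
       (use s in auto)
  from integrable_lebesgue_on_snd[OF borel_Icc borel_Icc this]
  show "integrable (lebesgue_on {a..b}) (\<lambda>\<theta>. primitive c (\<lambda>\<sigma>. \<psi> (\<sigma>, \<theta>)) s)"
    by (simp add: primitive_def)
qed

lemma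
  fixes \<psi> :: "real \<times> real \<Rightarrow> real^'n"
  assumes \<psi>: "\<psi> \<in> L2 ({c..d} \<times> {a..b})"
  shows L2_fibre_primitive: "a < b \<Longrightarrow> (\<lambda>p. primitive a (\<lambda>\<theta>. \<psi> (fst p, \<theta>)) (snd p)) \<in> L2 ({c..d} \<times> {a..b})"
    and L2_nrm_fibre_primitive: "a < b \<Longrightarrow> (L2_nrm ({c..d} \<times> {a..b}) (\<lambda>p. primitive a (\<lambda>\<theta>. \<psi> (fst p, \<theta>)) (snd p)))\<^sup>2
        \<le> (b - a)\<^sup>2 * (L2_nrm ({c..d} \<times> {a..b}) \<psi>)\<^sup>2"
proof -
  assume ab: "a < b"
  note i = L2_imp_integrable_rect[OF \<psi>]
  have b: "AE s in lebesgue_on {c..d}. \<forall>x\<in>{a..b}. norm (primitive a (\<lambda>\<theta>. \<psi> (fst (s, x), \<theta>)) (snd (s, x)))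
      \<le> 1 * (LINT \<theta>|lebesgue_on {a..b}. norm (\<psi> (s, \<theta>)))"
    using AE_slices_integrable[OF i] by eventually_elim (auto intro: norm_primitive_le)
  note L = L2_fibre_bound[OF ab borel_measurable_integrable[OF integrable_fibre_primitive[OF i]] \<psi> _ b]
  show "(\<lambda>p. primitive a (\<lambda>\<theta>. \<psi> (fst p, \<theta>)) (snd p)) \<in> L2 ({c..d} \<times> {a..b})"
    by (rule L(1)) simp
  show "(L2_nrm ({c..d} \<times> {a..b}) (\<lambda>p. primitive a (\<lambda>\<theta>. \<psi> (fst p, \<theta>)) (snd p)))\<^sup>2
        \<le> (b - a)\<^sup>2 * (L2_nrm ({c..d} \<times> {a..b}) \<psi>)\<^sup>2"
    using L(2) by simp
qed

lemma
  fixes \<psi> :: "real \<times> real \<Rightarrow> real^'n"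
  assumes \<psi>: "\<psi> \<in> L2 ({c..d} \<times> {a..b})" and cd: "c < d"
  shows L2_fibre_primitive_fst: "(\<lambda>p. primitive c (\<lambda>\<sigma>. \<psi> (\<sigma>, snd p)) (fst p)) \<in> L2 ({c..d} \<times> {a..b})"
    and L2_nrm_fibre_primitive_fst: "(L2_nrm ({c..d} \<times> {a..b}) (\<lambda>p. primitive c (\<lambda>\<sigma>. \<psi> (\<sigma>, snd p)) (fst p)))\<^sup>2
        \<le> (d - c)\<^sup>2 * (L2_nrm ({c..d} \<times> {a..b}) \<psi>)\<^sup>2"
proof -
  let ?g = "\<lambda>p. primitive c (\<lambda>\<theta>. \<psi> (prod.swap (fst p, \<theta>))) (snd p)"
  have g: "?g \<in> L2 ({a..b} \<times> {c..d})"
    by (rule L2_fibre_primitive[OF L2_swap[OF \<psi>] cd])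
  show "(\<lambda>p. primitive c (\<lambda>\<sigma>. \<psi> (\<sigma>, snd p)) (fst p)) \<in> L2 ({c..d} \<times> {a..b})"
    using L2_swap[OF g] by simp
  show "(L2_nrm ({c..d} \<times> {a..b}) (\<lambda>p. primitive c (\<lambda>\<sigma>. \<psi> (\<sigma>, snd p)) (fst p)))\<^sup>2
        \<le> (d - c)\<^sup>2 * (L2_nrm ({c..d} \<times> {a..b}) \<psi>)\<^sup>2"
    using L2_nrm_fibre_primitive[OF L2_swap[OF \<psi>] cd] L2_nrm_swap[OF g] L2_nrm_swap[OF \<psi>] by simp
qed

text \<open>The values at \<open>b\<close> of the primitive and of the iterated primitive of \<open>w\<close>: what the second derivative
  \<open>w\<close> contributes to \<open>u'(b)\<close> and to \<open>u(b)\<close>.\<close>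

definition end_moments :: "real \<Rightarrow> real \<Rightarrow> (real \<Rightarrow> real^'n) \<Rightarrow> (real^'n) \<times> (real^'n)" where
  "end_moments a b w = (primitive a w b, primitive a (primitive a w) b)"

text \<open>The affine part of a function with second derivative \<open>w\<close> is prescribed by a linear map \<open>\<Lambda>\<close> from the end
  moments of \<open>w\<close> to the pair \<open>(u(a), u'(a))\<close>.\<close>

locale reconstruction =
  fixes a b :: real and \<Lambda> :: "(real^'n::finite) \<times> (real^'n) \<Rightarrow> (real^'n) \<times> (real^'n)"
  assumes ab: "a < b" and linear_\<Lambda>: "linear \<Lambda>"
begin

text \<open>Taylor's formula at \<open>a\<close>, with the initial values supplied by \<open>\<Lambda>\<close>; \<open>drecon\<close> is its derivative.\<close>

definition recon :: "(real \<Rightarrow> real^'n) \<Rightarrow> real \<Rightarrow> real^'n" where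
  "recon w x = fst (\<Lambda> (end_moments a b w)) + (x - a) *\<^sub>R snd (\<Lambda> (end_moments a b w)) + primitive a (primitive a w) x"

definition drecon :: "(real \<Rightarrow> real^'n) \<Rightarrow> real \<Rightarrow> real^'n" where
  "drecon w x = snd (\<Lambda> (end_moments a b w)) + primitive a w x"

lemma bounded_linear_\<Lambda>: "bounded_linear \<Lambda>"
  using linear_\<Lambda> by (simp add: linear_conv_bounded_linear)

lemma \<Lambda>_split: "\<Lambda> (y, z) = \<Lambda> (y, 0) + \<Lambda> (0, z)"
  using linear_add[OF linear_\<Lambda>, of "(y, 0)" "(0, z)"] by simp

lemma primitive_primitive_add:
  fixes v w :: "real \<Rightarrow> real^'n"
  assumes "integrable (lebesgue_on {a..b}) v" "integrable (lebesgue_on {a..b}) w" "x \<le> b"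
  shows "primitive a (primitive a (\<lambda>\<theta>. v \<theta> + w \<theta>)) x = primitive a (primitive a v) x + primitive a (primitive a w) x"
proof -
  have "primitive a (primitive a (\<lambda>\<theta>. v \<theta> + w \<theta>)) x = primitive a (\<lambda>y. primitive a v y + primitive a w y) x"
    by (rule primitive_cong) (use assms in \<open>auto intro: primitive_add\<close>)
  then show ?thesis
    using assms by (simp add: primitive_add[OF integrable_primitive integrable_primitive])
qed

lemma
  assumes "integrable (lebesgue_on {a..b}) v" "integrable (lebesgue_on {a..b}) w" "x \<le> b"
  shows recon_add: "recon (\<lambda>\<theta>. v \<theta> + w \<theta>) x = recon v x + recon w x"
    and drecon_add: "drecon (\<lambda>\<theta>. v \<theta> + w \<theta>) x = drecon v x + drecon w x"
proof -
  have "end_moments a b (\<lambda>\<theta>. v \<theta> + w \<theta>) = end_moments a b v + end_moments a b w"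
    using assms by (simp add: end_moments_def primitive_add[OF assms(1,2)] primitive_primitive_add)
  then show "recon (\<lambda>\<theta>. v \<theta> + w \<theta>) x = recon v x + recon w x" "drecon (\<lambda>\<theta>. v \<theta> + w \<theta>) x = drecon v x + drecon w x"
    using primitive_primitive_add[OF assms] primitive_add[OF assms]
    by (simp_all add: recon_def drecon_def linear_add[OF linear_\<Lambda>] scaleR_add_right)
qed

lemma recon_scaleR:
  assumes w: "integrable (lebesgue_on {a..b}) w" and x: "x \<le> b"
  shows "recon (\<lambda>\<theta>. r *\<^sub>R w \<theta>) x = r *\<^sub>R recon w x"
proof -
  have p: "primitive a (\<lambda>\<theta>. r *\<^sub>R f \<theta>) y = r *\<^sub>R primitive a f y"
    if "integrable (lebesgue_on {a..b}) f" "y \<le> b" for f :: "real \<Rightarrow> real^'n" and y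
    by (rule primitive_bounded_linear[OF bounded_linear_scaleR_right that])
  have pp: "primitive a (primitive a (\<lambda>\<theta>. r *\<^sub>R w \<theta>)) y = r *\<^sub>R primitive a (primitive a w) y" if "y \<le> b" for y
  proof -
    have "primitive a (primitive a (\<lambda>\<theta>. r *\<^sub>R w \<theta>)) y = primitive a (\<lambda>y. r *\<^sub>R primitive a w y) y"
      by (rule primitive_cong) (use w that in \<open>auto intro: p\<close>)
    then show ?thesis using p[OF integrable_primitive[OF w] that] by simp
  qed
  have "end_moments a b (\<lambda>\<theta>. r *\<^sub>R w \<theta>) = r *\<^sub>R end_moments a b w"
    by (simp add: end_moments_def p[OF w] pp)
  then show ?thesis
    using pp[OF x] by (simp add: recon_def linear_cmul[OF linear_\<Lambda>] scaleR_add_right)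
qed

lemma recon_cong_AE:
  assumes w: "integrable (lebesgue_on {a..b}) w" and ae: "AE x in lebesgue_on {a..b}. w x = w' x" and x: "x \<le> b"
  shows "recon w x = recon w' x"
proof -
  have p: "primitive a w y = primitive a w' y" if "y \<le> b" for y
    by (rule primitive_cong_AE[OF w ae that])
  have pp: "primitive a (primitive a w) y = primitive a (primitive a w') y" if "y \<le> b" for y
    by (rule primitive_cong) (use p that in auto)
  show ?thesis
    using x by (simp add: recon_def end_moments_def p pp)
qed

lemma recon_eq_primitive:
  assumes w: "integrable (lebesgue_on {a..b}) w" and x: "x \<in> {a..b}"
  shows "recon w x = fst (\<Lambda> (end_moments a b w)) + primitive a (drecon w) x"
proof -
  have "primitive a (drecon w) x = (x - a) *\<^sub>R snd (\<Lambda> (end_moments a b w)) + primitive a (primitive a w) x"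
    unfolding drecon_def[abs_def] using x
    by (subst primitive_add[OF finite_measure.integrable_const[OF finite_measure_lebesgue_on_Icc] integrable_primitive[OF w]])
       (auto simp: primitive_const)
  then show ?thesis by (simp add: recon_def)
qed

lemma continuous_on_drecon: "integrable (lebesgue_on {a..b}) w \<Longrightarrow> continuous_on {a..b} (drecon w)"
  unfolding drecon_def[abs_def] by (intro continuous_intros continuous_on_primitive)

lemma continuous_on_recon: "integrable (lebesgue_on {a..b}) w \<Longrightarrow> continuous_on {a..b} (recon w)"
  unfolding recon_def[abs_def] by (intro continuous_intros continuous_on_primitive integrable_primitive)

text \<open>Pointwise bounds by the L1 norm, which is the form required by \<open>L2_fibre_bound\<close>.\<close>

lemma recon_bound:
  "\<exists>K\<ge>0. \<forall>w x. integrable (lebesgue_on {a..b}) w \<longrightarrow> x \<in> {a..b} \<longrightarrow>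
    norm (recon w x) \<le> K * (LINT \<theta>|lebesgue_on {a..b}. norm (w \<theta>)) \<and>
    norm (drecon w x) \<le> K * (LINT \<theta>|lebesgue_on {a..b}. norm (w \<theta>))"
proof -
  obtain C where C: "0 \<le> C" "\<And>y. norm (\<Lambda> y) \<le> norm y * C"
    using bounded_linear.nonneg_bounded[OF bounded_linear_\<Lambda>] by blast
  define D where "D = C * (1 + (b - a))"
  have D: "0 \<le> D" using C(1) ab by (simp add: D_def)
  define K where "K = D + (b - a) * D + (1 + (b - a))"
  have "norm (recon w x) \<le> K * I \<and> norm (drecon w x) \<le> K * I"
    if w: "integrable (lebesgue_on {a..b}) w" and x: "x \<in> {a..b}" and I: "I = (LINT \<theta>|lebesgue_on {a..b}. norm (w \<theta>))" for w x I
  proof -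
    have I0: "0 \<le> I" unfolding I by (intro integral_nonneg_AE) simp
    have p: "norm (primitive a w y) \<le> I" if "y \<le> b" for y
      unfolding I by (rule norm_primitive_le[OF w that])
    have pp: "norm (primitive a (primitive a w) y) \<le> (b - a) * I" if "y \<le> b" for y
    proof -
      have "norm (primitive a (primitive a w) y) \<le> (LINT \<theta>|lebesgue_on {a..b}. norm (primitive a w \<theta>))"
        by (rule norm_primitive_le[OF integrable_primitive[OF w] that])
      also have "\<dots> \<le> (LINT \<theta>|lebesgue_on {a..b}. I)"
        by (intro integral_mono integrable_norm integrable_primitive w finite_measure.integrable_const[OF finite_measure_lebesgue_on_Icc] p) simp
      also have "\<dots> = (b - a) * I"
        using ab by (simp add: measure_lebesgue_on_Icc)
      finally show ?thesis .
    qed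
    have "norm (end_moments a b w) \<le> I + (b - a) * I"
      unfolding end_moments_def by (rule order_trans[OF norm_Pair_le add_mono]) (use p pp in auto)
    then have "norm (\<Lambda> (end_moments a b w)) \<le> (I + (b - a) * I) * C"
      using C by (meson order_trans mult_right_mono)
    then have \<Lambda>: "norm (\<Lambda> (end_moments a b w)) \<le> D * I"
      by (simp add: D_def algebra_simps)
    have f: "norm (fst (\<Lambda> (end_moments a b w))) \<le> D * I" "norm (snd (\<Lambda> (end_moments a b w))) \<le> D * I"
      using \<Lambda> norm_fst_le[of "fst (\<Lambda> (end_moments a b w))" "snd (\<Lambda> (end_moments a b w))"]
        norm_snd_le[of "snd (\<Lambda> (end_moments a b w))" "fst (\<Lambda> (end_moments a b w))"] by simp_all
    have s: "norm ((x - a) *\<^sub>R snd (\<Lambda> (end_moments a b w))) \<le> (b - a) * (D * I)"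
      using x f(2) by (auto intro!: mult_mono)
    have "norm (recon w x) \<le> D * I + (b - a) * (D * I) + (b - a) * I"
      unfolding recon_def using x by (intro order_trans[OF norm_triangle_ineq] add_mono f s pp) auto
    also have "\<dots> \<le> K * I" using I0 by (simp add: K_def algebra_simps)
    finally have 1: "norm (recon w x) \<le> K * I" .
    have "norm (drecon w x) \<le> D * I + I"
      unfolding drecon_def using x by (intro order_trans[OF norm_triangle_ineq] add_mono f p) auto
    also have "\<dots> \<le> D * I + I + ((b - a) * D + (b - a)) * I"
      using I0 D ab by simp
    also have "\<dots> = K * I" by (simp add: K_def algebra_simps)
    finally show ?thesis using 1 by simp
  qed
  moreover have "0 \<le> K" using D ab by (simp add: K_def)
  ultimately show ?thesis by blast
qed

end

section \<open>Fibrewise reconstruction on the rectangle\<close>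

context reconstruction
begin

lemma
  assumes w: "w \<in> L2 {a..b}"
  shows L2_recon: "recon w \<in> L2 {a..b}" and L2_drecon: "drecon w \<in> L2 {a..b}"
    and has_weak_derivative_recon: "has_weak_derivative {a..b} 1 (recon w) (drecon w)"
    and has_weak_derivative_drecon: "has_weak_derivative {a..b} 1 (drecon w) w"
proof -
  note i = L2_imp_integrable_Icc[OF w]
  obtain K where K: "0 \<le> K" "\<And>w x. integrable (lebesgue_on {a..b}) w \<Longrightarrow> x \<in> {a..b} \<Longrightarrow>
    norm (recon w x) \<le> K * (LINT \<theta>|lebesgue_on {a..b}. norm (w \<theta>)) \<and>
    norm (drecon w x) \<le> K * (LINT \<theta>|lebesgue_on {a..b}. norm (w \<theta>))"
    using recon_bound by blast
  have m: "f \<in> borel_measurable (lebesgue_on {a..b})" if "continuous_on {a..b} f" for f :: "real \<Rightarrow> real^'n"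
    using that by (rule continuous_imp_measurable_on_sets_lebesgue) simp
  show r: "recon w \<in> L2 {a..b}"
    using K by (intro L2_bound_Icc[OF ab m[OF continuous_on_recon[OF i]] w K(1)]) (use i in auto)
  show d: "drecon w \<in> L2 {a..b}"
    using K by (intro L2_bound_Icc[OF ab m[OF continuous_on_drecon[OF i]] w K(1)]) (use i in auto)
  have "AE x in lebesgue_on {a..b}. recon w x = fst (\<Lambda> (end_moments a b w)) + primitive a (drecon w) x"
    by (rule AE_I2) (simp add: recon_eq_primitive[OF i])
  then show "has_weak_derivative {a..b} 1 (recon w) (drecon w)"
    unfolding has_weak_derivative_Icc_iff[OF ab] using r d by blast
  have "AE x in lebesgue_on {a..b}. drecon w x = snd (\<Lambda> (end_moments a b w)) + primitive a w x"
    by (rule AE_I2) (simp add: drecon_def)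
  then show "has_weak_derivative {a..b} 1 (drecon w) w"
    unfolding has_weak_derivative_Icc_iff[OF ab] using w d by blast
qed

abbreviation fibre_recon :: "(real \<times> real \<Rightarrow> real^'n) \<Rightarrow> real \<times> real \<Rightarrow> real^'n" where
  "fibre_recon \<psi> p \<equiv> recon (\<lambda>\<theta>. \<psi> (fst p, \<theta>)) (snd p)"

abbreviation fibre_drecon :: "(real \<times> real \<Rightarrow> real^'n) \<Rightarrow> real \<times> real \<Rightarrow> real^'n" where
  "fibre_drecon \<psi> p \<equiv> drecon (\<lambda>\<theta>. \<psi> (fst p, \<theta>)) (snd p)"

lemma
  fixes c d :: real
  assumes \<psi>: "integrable (lebesgue_on ({c..d} \<times> {a..b})) \<psi>"
  shows integrable_end_moments: "integrable (lebesgue_on {c..d}) (\<lambda>s. \<Lambda> (end_moments a b (\<lambda>\<theta>. \<psi> (s, \<theta>))))"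
    and integrable_primitive_primitive_param: "x \<le> b \<Longrightarrow> integrable (lebesgue_on {c..d}) (\<lambda>s. primitive a (primitive a (\<lambda>\<theta>. \<psi> (s, \<theta>))) x)"
proof -
  note p = integrable_fibre_primitive[OF \<psi>]
  have pp: "integrable (lebesgue_on {c..d}) (\<lambda>s. primitive a (primitive a (\<lambda>\<theta>. \<psi> (s, \<theta>))) x)" if "x \<le> b" for x
    using integrable_primitive_param(1)[OF p that] by simp
  then show "x \<le> b \<Longrightarrow> integrable (lebesgue_on {c..d}) (\<lambda>s. primitive a (primitive a (\<lambda>\<theta>. \<psi> (s, \<theta>))) x)" .
  have 1: "integrable (lebesgue_on {c..d}) (\<lambda>s. \<Lambda> (primitive a (\<lambda>\<theta>. \<psi> (s, \<theta>)) b, 0))"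
    by (rule integrable_bounded_linear[OF bounded_linear_compose[OF bounded_linear_\<Lambda>
          bounded_linear_Pair[OF bounded_linear_ident bounded_linear_zero]] integrable_primitive_param(1)[OF \<psi> order_refl]])
  have 2: "integrable (lebesgue_on {c..d}) (\<lambda>s. \<Lambda> (0, primitive a (primitive a (\<lambda>\<theta>. \<psi> (s, \<theta>))) b))"
    by (rule integrable_bounded_linear[OF bounded_linear_compose[OF bounded_linear_\<Lambda>
          bounded_linear_Pair[OF bounded_linear_zero bounded_linear_ident]] pp[OF order_refl]])
  have "\<Lambda> (end_moments a b (\<lambda>\<theta>. \<psi> (s, \<theta>))) = \<Lambda> (primitive a (\<lambda>\<theta>. \<psi> (s, \<theta>)) b, 0) + \<Lambda> (0, primitive a (primitive a (\<lambda>\<theta>. \<psi> (s, \<theta>))) b)" for s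
    unfolding end_moments_def by (rule \<Lambda>_split)
  then show "integrable (lebesgue_on {c..d}) (\<lambda>s. \<Lambda> (end_moments a b (\<lambda>\<theta>. \<psi> (s, \<theta>))))"
    using Bochner_Integration.integrable_add[OF 1 2] by simp
qed

text \<open>Reconstruction acts in \<open>x\<close> and integration over the delay acts in \<open>s\<close>; they commute by Fubini's
  theorem. Since \<open>\<Lambda>\<close> is linear, it suffices to check this for the two moments.\<close>

lemma end_moments_primitive:
  fixes c d :: real
  assumes \<psi>: "integrable (lebesgue_on ({c..d} \<times> {a..b})) \<psi>" and s: "s \<le> d"
  shows "\<Lambda> (end_moments a b (\<lambda>\<theta>. primitive c (\<lambda>\<sigma>. \<psi> (\<sigma>, \<theta>)) s)) = primitive c (\<lambda>\<sigma>. \<Lambda> (end_moments a b (\<lambda>\<theta>. \<psi> (\<sigma>, \<theta>)))) s"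
    and "x \<le> b \<Longrightarrow> primitive a (primitive a (\<lambda>\<theta>. primitive c (\<lambda>\<sigma>. \<psi> (\<sigma>, \<theta>)) s)) x
      = primitive c (\<lambda>\<sigma>. primitive a (primitive a (\<lambda>\<theta>. \<psi> (\<sigma>, \<theta>))) x) s"
proof -
  note p = integrable_fibre_primitive[OF \<psi>]
  have pp: "primitive a (primitive a (\<lambda>\<theta>. primitive c (\<lambda>\<sigma>. \<psi> (\<sigma>, \<theta>)) s)) x
      = primitive c (\<lambda>\<sigma>. primitive a (primitive a (\<lambda>\<theta>. \<psi> (\<sigma>, \<theta>))) x) s" if "x \<le> b" for x
  proof -
    have "primitive a (primitive a (\<lambda>\<theta>. primitive c (\<lambda>\<sigma>. \<psi> (\<sigma>, \<theta>)) s)) x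
        = primitive a (\<lambda>y. primitive c (\<lambda>\<sigma>. primitive a (\<lambda>\<theta>. \<psi> (\<sigma>, \<theta>)) y) s) x"
      by (rule primitive_cong) (use that in \<open>auto intro!: primitive_commute(1)[OF \<psi> s]\<close>)
    also have "\<dots> = primitive c (\<lambda>\<sigma>. primitive a (primitive a (\<lambda>\<theta>. \<psi> (\<sigma>, \<theta>))) x) s"
      using primitive_commute(1)[OF p s that] by simp
    finally show ?thesis .
  qed
  then show "x \<le> b \<Longrightarrow> primitive a (primitive a (\<lambda>\<theta>. primitive c (\<lambda>\<sigma>. \<psi> (\<sigma>, \<theta>)) s)) x
      = primitive c (\<lambda>\<sigma>. primitive a (primitive a (\<lambda>\<theta>. \<psi> (\<sigma>, \<theta>))) x) s" .
  note L1 = bounded_linear_compose[OF bounded_linear_\<Lambda> bounded_linear_Pair[OF bounded_linear_ident bounded_linear_zero]]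
  note L2 = bounded_linear_compose[OF bounded_linear_\<Lambda> bounded_linear_Pair[OF bounded_linear_zero bounded_linear_ident]]
  note i1 = integrable_primitive_param(1)[OF \<psi> order_refl]
  note i2 = integrable_primitive_primitive_param[OF \<psi> order_refl]
  have "\<Lambda> (end_moments a b (\<lambda>\<theta>. primitive c (\<lambda>\<sigma>. \<psi> (\<sigma>, \<theta>)) s))
      = \<Lambda> (primitive c (\<lambda>\<sigma>. primitive a (\<lambda>\<theta>. \<psi> (\<sigma>, \<theta>)) b) s, 0) + \<Lambda> (0, primitive c (\<lambda>\<sigma>. primitive a (primitive a (\<lambda>\<theta>. \<psi> (\<sigma>, \<theta>))) b) s)"
    unfolding end_moments_def pp[OF order_refl] primitive_commute(1)[OF \<psi> s order_refl] by (rule \<Lambda>_split)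
  also have "\<dots> = primitive c (\<lambda>\<sigma>. \<Lambda> (primitive a (\<lambda>\<theta>. \<psi> (\<sigma>, \<theta>)) b, 0) + \<Lambda> (0, primitive a (primitive a (\<lambda>\<theta>. \<psi> (\<sigma>, \<theta>))) b)) s"
    unfolding primitive_bounded_linear[OF L1 i1 s, symmetric] primitive_bounded_linear[OF L2 i2 s, symmetric]
    by (rule primitive_add[OF integrable_bounded_linear[OF L1 i1] integrable_bounded_linear[OF L2 i2] s, symmetric])
  also have "\<dots> = primitive c (\<lambda>\<sigma>. \<Lambda> (end_moments a b (\<lambda>\<theta>. \<psi> (\<sigma>, \<theta>)))) s"
    by (simp only: end_moments_def \<Lambda>_split[symmetric])
  finally show "\<Lambda> (end_moments a b (\<lambda>\<theta>. primitive c (\<lambda>\<sigma>. \<psi> (\<sigma>, \<theta>)) s)) = primitive c (\<lambda>\<sigma>. \<Lambda> (end_moments a b (\<lambda>\<theta>. \<psi> (\<sigma>, \<theta>)))) s" .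
qed

text \<open>The last equation separates the variables, which makes joint continuity visible.\<close>

lemma
  fixes c d :: real
  assumes \<psi>: "integrable (lebesgue_on ({c..d} \<times> {a..b})) \<psi>" and s: "s \<le> d" and x: "x \<le> b"
  shows recon_primitive: "recon (\<lambda>\<theta>. primitive c (\<lambda>\<sigma>. \<psi> (\<sigma>, \<theta>)) s) x = primitive c (\<lambda>\<sigma>. recon (\<lambda>\<theta>. \<psi> (\<sigma>, \<theta>)) x) s"
    and drecon_primitive: "drecon (\<lambda>\<theta>. primitive c (\<lambda>\<sigma>. \<psi> (\<sigma>, \<theta>)) s) x = primitive c (\<lambda>\<sigma>. drecon (\<lambda>\<theta>. \<psi> (\<sigma>, \<theta>)) x) s"
    and recon_primitive_split: "primitive c (\<lambda>\<sigma>. recon (\<lambda>\<theta>. \<psi> (\<sigma>, \<theta>)) x) s =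
      fst (primitive c (\<lambda>\<sigma>. \<Lambda> (end_moments a b (\<lambda>\<theta>. \<psi> (\<sigma>, \<theta>)))) s)
      + (x - a) *\<^sub>R snd (primitive c (\<lambda>\<sigma>. \<Lambda> (end_moments a b (\<lambda>\<theta>. \<psi> (\<sigma>, \<theta>)))) s)
      + primitive c (\<lambda>\<sigma>. primitive a (primitive a (\<lambda>\<theta>. \<psi> (\<sigma>, \<theta>))) x) s"
proof -
  note i = integrable_end_moments[OF \<psi>]
  have bl: "bounded_linear (\<lambda>z. (x - a) *\<^sub>R snd z :: real^'n)" "bounded_linear (fst :: (real^'n) \<times> (real^'n) \<Rightarrow> _)" "bounded_linear (snd :: (real^'n) \<times> (real^'n) \<Rightarrow> _)"
    by (intro bounded_linear_intros)+
  note i3 = integrable_bounded_linear[OF bl(1) i] integrable_bounded_linear[OF bl(2) i] integrable_bounded_linear[OF bl(3) i]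
  show split: "primitive c (\<lambda>\<sigma>. recon (\<lambda>\<theta>. \<psi> (\<sigma>, \<theta>)) x) s =
      fst (primitive c (\<lambda>\<sigma>. \<Lambda> (end_moments a b (\<lambda>\<theta>. \<psi> (\<sigma>, \<theta>)))) s)
      + (x - a) *\<^sub>R snd (primitive c (\<lambda>\<sigma>. \<Lambda> (end_moments a b (\<lambda>\<theta>. \<psi> (\<sigma>, \<theta>)))) s)
      + primitive c (\<lambda>\<sigma>. primitive a (primitive a (\<lambda>\<theta>. \<psi> (\<sigma>, \<theta>))) x) s"
    unfolding recon_def primitive_bounded_linear[OF bl(1) i s, symmetric] primitive_bounded_linear[OF bl(2) i s, symmetric]
      primitive_add[OF i3(2,1) s, symmetric]
    by (rule primitive_add[OF Bochner_Integration.integrable_add[OF i3(2,1)] integrable_primitive_primitive_param[OF \<psi> x] s])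
  show "recon (\<lambda>\<theta>. primitive c (\<lambda>\<sigma>. \<psi> (\<sigma>, \<theta>)) s) x = primitive c (\<lambda>\<sigma>. recon (\<lambda>\<theta>. \<psi> (\<sigma>, \<theta>)) x) s"
    unfolding split by (simp add: recon_def end_moments_primitive[OF \<psi> s] x)
  show "drecon (\<lambda>\<theta>. primitive c (\<lambda>\<sigma>. \<psi> (\<sigma>, \<theta>)) s) x = primitive c (\<lambda>\<sigma>. drecon (\<lambda>\<theta>. \<psi> (\<sigma>, \<theta>)) x) s"
    unfolding drecon_def end_moments_primitive(1)[OF \<psi> s] primitive_commute(1)[OF \<psi> s x]
      primitive_bounded_linear[OF bl(3) i s, symmetric]
    by (rule primitive_add[OF i3(3) integrable_primitive_param(1)[OF \<psi> x] s, symmetric])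
qed

lemma
  fixes c d :: real
  assumes \<psi>: "integrable (lebesgue_on ({c..d} \<times> {a..b})) \<psi>"
  shows borel_measurable_fibre_recon: "fibre_recon \<psi> \<in> borel_measurable (lebesgue_on ({c..d} \<times> {a..b}))"
    and borel_measurable_fibre_drecon: "fibre_drecon \<psi> \<in> borel_measurable (lebesgue_on ({c..d} \<times> {a..b}))"
proof -
  have bl: "bounded_linear (fst :: (real^'n) \<times> (real^'n) \<Rightarrow> _)" "bounded_linear (snd :: (real^'n) \<times> (real^'n) \<Rightarrow> _)"
    by (intro bounded_linear_intros)+
  note i = integrable_end_moments[OF \<psi>]
  note f = borel_measurable_integrable[OF integrable_comp_fst[OF integrable_bounded_linear[OF bl(1) i]]]
    borel_measurable_integrable[OF integrable_comp_fst[OF integrable_bounded_linear[OF bl(2) i]]]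
  note p = integrable_fibre_primitive[OF \<psi>]
  have x: "(\<lambda>p. snd p - a) \<in> borel_measurable (lebesgue_on ({c..d} \<times> {a..b}))"
    by (intro borel_measurable_lebesgue_onI borel_measurable_continuous_onI continuous_intros)
  have pp: "(\<lambda>p. primitive a (primitive a (\<lambda>\<theta>. \<psi> (fst p, \<theta>))) (snd p)) \<in> borel_measurable (lebesgue_on ({c..d} \<times> {a..b}))"
    using borel_measurable_integrable[OF integrable_fibre_primitive[OF p]] by simp
  show "fibre_recon \<psi> \<in> borel_measurable (lebesgue_on ({c..d} \<times> {a..b}))"
    unfolding recon_def by (intro borel_measurable_add borel_measurable_scaleR f x pp)
  show "fibre_drecon \<psi> \<in> borel_measurable (lebesgue_on ({c..d} \<times> {a..b}))"
    unfolding drecon_def by (intro borel_measurable_add f borel_measurable_integrable[OF p])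
qed

lemma fibre_recon_L2:
  "\<exists>K\<ge>0. \<forall>(c::real) d \<psi>. \<psi> \<in> L2 ({c..d} \<times> {a..b}) \<longrightarrow>
    fibre_recon \<psi> \<in> L2 ({c..d} \<times> {a..b}) \<and> fibre_drecon \<psi> \<in> L2 ({c..d} \<times> {a..b}) \<and>
    (L2_nrm ({c..d} \<times> {a..b}) (fibre_recon \<psi>))\<^sup>2 \<le> K * (L2_nrm ({c..d} \<times> {a..b}) \<psi>)\<^sup>2 \<and>
    (L2_nrm ({c..d} \<times> {a..b}) (fibre_drecon \<psi>))\<^sup>2 \<le> K * (L2_nrm ({c..d} \<times> {a..b}) \<psi>)\<^sup>2"
proof -
  obtain K where K: "0 \<le> K" "\<And>w x. integrable (lebesgue_on {a..b}) w \<Longrightarrow> x \<in> {a..b} \<Longrightarrow>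
    norm (recon w x) \<le> K * (LINT \<theta>|lebesgue_on {a..b}. norm (w \<theta>)) \<and>
    norm (drecon w x) \<le> K * (LINT \<theta>|lebesgue_on {a..b}. norm (w \<theta>))"
    using recon_bound by blast
  show ?thesis
  proof (intro exI[of _ "(K * (b - a))\<^sup>2"] conjI allI impI)
    fix c d :: real and \<psi> :: "real \<times> real \<Rightarrow> real^'n" assume \<psi>: "\<psi> \<in> L2 ({c..d} \<times> {a..b})"
    note i = L2_imp_integrable_rect[OF \<psi>]
    have b1: "AE s in lebesgue_on {c..d}. \<forall>x\<in>{a..b}. norm (fibre_recon \<psi> (s, x)) \<le> K * (LINT \<theta>|lebesgue_on {a..b}. norm (\<psi> (s, \<theta>)))"
      using AE_slices_integrable[OF i] by eventually_elim (use K(2) in auto)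
    have b2: "AE s in lebesgue_on {c..d}. \<forall>x\<in>{a..b}. norm (fibre_drecon \<psi> (s, x)) \<le> K * (LINT \<theta>|lebesgue_on {a..b}. norm (\<psi> (s, \<theta>)))"
      using AE_slices_integrable[OF i] by eventually_elim (use K(2) in auto)
    note L = L2_fibre_bound[OF ab borel_measurable_fibre_recon[OF i] \<psi> K(1) b1]
      L2_fibre_bound[OF ab borel_measurable_fibre_drecon[OF i] \<psi> K(1) b2]
    show "fibre_recon \<psi> \<in> L2 ({c..d} \<times> {a..b})" "fibre_drecon \<psi> \<in> L2 ({c..d} \<times> {a..b})"
      "(L2_nrm ({c..d} \<times> {a..b}) (fibre_recon \<psi>))\<^sup>2 \<le> (K * (b - a))\<^sup>2 * (L2_nrm ({c..d} \<times> {a..b}) \<psi>)\<^sup>2"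
      "(L2_nrm ({c..d} \<times> {a..b}) (fibre_drecon \<psi>))\<^sup>2 \<le> (K * (b - a))\<^sup>2 * (L2_nrm ({c..d} \<times> {a..b}) \<psi>)\<^sup>2"
      by (rule L)+
  qed simp
qed

lemma
  fixes c d :: real
  assumes \<psi>: "\<psi> \<in> L2 ({c..d} \<times> {a..b})"
  shows L2_fibre_recon: "fibre_recon \<psi> \<in> L2 ({c..d} \<times> {a..b})"
    and L2_fibre_drecon: "fibre_drecon \<psi> \<in> L2 ({c..d} \<times> {a..b})"
  using fibre_recon_L2 \<psi> by blast+

text \<open>In the \<open>x\<close> direction, the reconstruction is a primitive by construction.\<close>

lemma has_weak_derivative_fibre_recon:
  fixes c d :: real
  assumes \<omega>: "\<omega> \<in> L2 ({c..d} \<times> {a..b})"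
  shows "has_weak_derivative ({c..d} \<times> {a..b}) (0, 1) (fibre_recon \<omega>) (fibre_drecon \<omega>)"
    and "has_weak_derivative ({c..d} \<times> {a..b}) (0, 1) (fibre_drecon \<omega>) \<omega>"
proof -
  note i = L2_imp_integrable_rect[OF \<omega>]
  have "AE s in lebesgue_on {c..d}. \<forall>x\<in>{a..b}. recon (\<lambda>\<theta>. \<omega> (s, \<theta>)) x = fst (\<Lambda> (end_moments a b (\<lambda>\<theta>. \<omega> (s, \<theta>)))) + primitive a (drecon (\<lambda>\<theta>. \<omega> (s, \<theta>))) x"
    using AE_slices_integrable[OF i] by eventually_elim (simp add: recon_eq_primitive)
  from AE_lebesgue_on_fst[OF borel_Icc borel_Icc this, of a b]
  have "AE p in lebesgue_on ({c..d} \<times> {a..b}). fibre_recon \<omega> p = fst (\<Lambda> (end_moments a b (\<lambda>\<theta>. \<omega> (fst p, \<theta>)))) + primitive a (\<lambda>\<theta>. fibre_drecon \<omega> (fst p, \<theta>)) (snd p)"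
    using AE_space by eventually_elim auto
  then show "has_weak_derivative ({c..d} \<times> {a..b}) (0, 1) (fibre_recon \<omega>) (fibre_drecon \<omega>)"
    unfolding has_weak_derivative_snd_iff[OF ab]
    using L2_fibre_recon[OF \<omega>] L2_fibre_drecon[OF \<omega>]
    by (intro conjI exI[of _ "\<lambda>s. fst (\<Lambda> (end_moments a b (\<lambda>\<theta>. \<omega> (s, \<theta>))))"])
  show "has_weak_derivative ({c..d} \<times> {a..b}) (0, 1) (fibre_drecon \<omega>) \<omega>"
    unfolding has_weak_derivative_snd_iff[OF ab]
    using L2_fibre_drecon[OF \<omega>] \<omega>
    by (intro conjI exI[of _ "\<lambda>s. snd (\<Lambda> (end_moments a b (\<lambda>\<theta>. \<omega> (s, \<theta>))))"]) (auto simp: drecon_def)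
qed

text \<open>The function with initial slice \<open>v\<close> at \<open>s = c\<close> and \<open>s\<close>-derivative \<open>\<psi>\<close>. For a state \<open>(v, \<psi>)\<close> it is the
  second \<open>x\<close>-derivative of the delayed variable.\<close>

definition history :: "real \<Rightarrow> (real \<Rightarrow> real^'n) \<Rightarrow> (real \<times> real \<Rightarrow> real^'n) \<Rightarrow> real \<times> real \<Rightarrow> real^'n" where
  "history c v \<psi> p = v (snd p) + primitive c (\<lambda>\<sigma>. \<psi> (\<sigma>, snd p)) (fst p)"

lemma history_slice_integrable:
  fixes c d :: real
  assumes v: "integrable (lebesgue_on {a..b}) v" and \<psi>: "integrable (lebesgue_on ({c..d} \<times> {a..b})) \<psi>" and s: "s \<le> d"
  shows "integrable (lebesgue_on {a..b}) (\<lambda>\<theta>. history c v \<psi> (s, \<theta>))"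
  unfolding history_def using v integrable_primitive_param(2)[OF \<psi> s] by simp

lemma
  fixes c d :: real
  assumes v: "integrable (lebesgue_on {a..b}) v" and \<psi>: "integrable (lebesgue_on ({c..d} \<times> {a..b})) \<psi>"
    and s: "s \<le> d" and x: "x \<le> b"
  shows recon_history: "recon (\<lambda>\<theta>. history c v \<psi> (s, \<theta>)) x = recon v x + primitive c (\<lambda>\<sigma>. recon (\<lambda>\<theta>. \<psi> (\<sigma>, \<theta>)) x) s"
    and drecon_history: "drecon (\<lambda>\<theta>. history c v \<psi> (s, \<theta>)) x = drecon v x + primitive c (\<lambda>\<sigma>. drecon (\<lambda>\<theta>. \<psi> (\<sigma>, \<theta>)) x) s"
  unfolding history_def fst_conv snd_conv
    recon_add[OF v integrable_primitive_param(2)[OF \<psi> s] x] drecon_add[OF v integrable_primitive_param(2)[OF \<psi> s] x]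
    recon_primitive[OF \<psi> s x] drecon_primitive[OF \<psi> s x]
  by (rule refl)+

lemma
  fixes c d :: real
  assumes v: "v \<in> L2 {a..b}" and \<psi>: "\<psi> \<in> L2 ({c..d} \<times> {a..b})" and cd: "c < d"
  shows L2_history: "history c v \<psi> \<in> L2 ({c..d} \<times> {a..b})"
    and L2_nrm_history: "(L2_nrm ({c..d} \<times> {a..b}) (history c v \<psi>))\<^sup>2 \<le>
      2 * ((d - c) * (L2_nrm {a..b} v)\<^sup>2) + 2 * ((d - c)\<^sup>2 * (L2_nrm ({c..d} \<times> {a..b}) \<psi>)\<^sup>2)"
proof -
  note c = L2_comp_snd[OF v less_imp_le[OF cd]] and p = L2_fibre_primitive_fst[OF \<psi> cd]
  show "history c v \<psi> \<in> L2 ({c..d} \<times> {a..b})"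
    unfolding history_def[abs_def] by (rule L2_add[OF c p])
  show "(L2_nrm ({c..d} \<times> {a..b}) (history c v \<psi>))\<^sup>2 \<le>
      2 * ((d - c) * (L2_nrm {a..b} v)\<^sup>2) + 2 * ((d - c)\<^sup>2 * (L2_nrm ({c..d} \<times> {a..b}) \<psi>)\<^sup>2)"
    unfolding history_def[abs_def]
    using L2_nrm_add[OF c p] L2_nrm_fibre_primitive_fst[OF \<psi> cd] unfolding L2_nrm_comp_snd[OF v less_imp_le[OF cd]] by linarith
qed

text \<open>In the \<open>s\<close> direction, all three functions are primitives because reconstruction commutes with
  integration over the delay.\<close>

lemma has_weak_derivative_history:
  fixes c d :: real
  assumes v: "v \<in> L2 {a..b}" and \<psi>: "\<psi> \<in> L2 ({c..d} \<times> {a..b})" and cd: "c < d"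
  shows "has_weak_derivative ({c..d} \<times> {a..b}) (1, 0) (fibre_recon (history c v \<psi>)) (fibre_recon \<psi>)"
    and "has_weak_derivative ({c..d} \<times> {a..b}) (1, 0) (fibre_drecon (history c v \<psi>)) (fibre_drecon \<psi>)"
    and "has_weak_derivative ({c..d} \<times> {a..b}) (1, 0) (history c v \<psi>) \<psi>"
proof -
  note iv = L2_imp_integrable_Icc[OF v] and ip = L2_imp_integrable_rect[OF \<psi>]
  note h = L2_history[OF v \<psi> cd]
  have 1: "AE p in lebesgue_on ({c..d} \<times> {a..b}). fibre_recon (history c v \<psi>) p = recon v (snd p) + primitive c (\<lambda>\<sigma>. fibre_recon \<psi> (\<sigma>, snd p)) (fst p)"
    by (rule AE_I2) (auto simp: recon_history[OF iv ip])
  have 2: "AE p in lebesgue_on ({c..d} \<times> {a..b}). fibre_drecon (history c v \<psi>) p = drecon v (snd p) + primitive c (\<lambda>\<sigma>. fibre_drecon \<psi> (\<sigma>, snd p)) (fst p)"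
    by (rule AE_I2) (auto simp: drecon_history[OF iv ip])
  show "has_weak_derivative ({c..d} \<times> {a..b}) (1, 0) (fibre_recon (history c v \<psi>)) (fibre_recon \<psi>)"
    unfolding has_weak_derivative_fst_iff[OF cd] using L2_fibre_recon[OF h] L2_fibre_recon[OF \<psi>] 1 by blast
  show "has_weak_derivative ({c..d} \<times> {a..b}) (1, 0) (fibre_drecon (history c v \<psi>)) (fibre_drecon \<psi>)"
    unfolding has_weak_derivative_fst_iff[OF cd] using L2_fibre_drecon[OF h] L2_fibre_drecon[OF \<psi>] 2 by blast
  show "has_weak_derivative ({c..d} \<times> {a..b}) (1, 0) (history c v \<psi>) \<psi>"
    unfolding has_weak_derivative_fst_iff[OF cd] using h \<psi>
    by (intro conjI exI[of _ v]) (auto simp: history_def)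
qed

lemma continuous_on_fibre_recon_history:
  fixes c d :: real
  assumes v: "integrable (lebesgue_on {a..b}) v" and \<psi>: "integrable (lebesgue_on ({c..d} \<times> {a..b})) \<psi>"
  shows "continuous_on ({c..d} \<times> {a..b}) (fibre_recon (history c v \<psi>))"
proof -
  let ?R = "{c..d} \<times> {a..b}"
  let ?e = "primitive c (\<lambda>\<sigma>. \<Lambda> (end_moments a b (\<lambda>\<theta>. \<psi> (\<sigma>, \<theta>))))"
  have e: "continuous_on ?R (\<lambda>p. ?e (fst p))"
    by (rule continuous_on_compose2[OF continuous_on_primitive[OF integrable_end_moments[OF \<psi>]] continuous_on_fst[OF continuous_on_id]]) auto
  have r: "continuous_on ?R (\<lambda>p. recon v (snd p))"
    by (rule continuous_on_compose2[OF continuous_on_recon[OF v] continuous_on_snd[OF continuous_on_id]]) auto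
  have pp: "continuous_on ?R (\<lambda>p. primitive c (\<lambda>\<sigma>. primitive a (primitive a (\<lambda>\<theta>. \<psi> (\<sigma>, \<theta>))) (snd p)) (fst p))"
    using continuous_on_double_primitive[OF integrable_fibre_primitive[OF \<psi>]] by simp
  have "continuous_on ?R (\<lambda>p. recon v (snd p) + (fst (?e (fst p)) + (snd p - a) *\<^sub>R snd (?e (fst p))
      + primitive c (\<lambda>\<sigma>. primitive a (primitive a (\<lambda>\<theta>. \<psi> (\<sigma>, \<theta>))) (snd p)) (fst p)))"
    by (intro continuous_intros e r pp)
  then show ?thesis
    by (rule continuous_on_eq) (auto simp: recon_history[OF v \<psi>] recon_primitive_split[OF \<psi>])
qed

end

section \<open>Continuous representatives and boundary conditions\<close>

text \<open>The set where two continuous functions agree is closed, and an open set that it almost covers is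
  contained in it.\<close>

lemma continuous_eq_if_AE_eq:
  fixes f g :: "'a::euclidean_space \<Rightarrow> 'b::euclidean_space"
  assumes ne: "box l u \<noteq> {}" and f: "continuous_on (cbox l u) f" and g: "continuous_on (cbox l u) g"
    and ae: "ae_eq (cbox l u) f g" and x: "x \<in> cbox l u"
  shows "f x = g x"
proof -
  let ?C = "{x \<in> cbox l u. f x - g x = 0}"
  have C: "closed ?C"
    using continuous_closed_preimage_constant[OF continuous_on_diff[OF f g] closed_cbox, of 0] by simp
  have "AE x in lebesgue. x \<in> cbox l u \<longrightarrow> f x = g x"
    using ae by (simp add: ae_eq_def AE_restrict_space_iff)
  then have "AE x in lebesgue. x \<in> box l u \<longrightarrow> x \<in> ?C"
    by eventually_elim (use box_subset_cbox[of l u] in auto)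
  then have "box l u \<subseteq> ?C"
    using mem_closed_if_AE_lebesgue_open[OF open_box C] by blast
  then have "closure (box l u) \<subseteq> ?C"
    by (rule closure_minimal[OF _ C])
  then show ?thesis using x closure_box[OF ne] by auto
qed

text \<open>Point values are computed by exhibiting any continuous function in the class.\<close>

lemma cont_rep_eq:
  fixes f g :: "'a::euclidean_space \<Rightarrow> 'b::euclidean_space"
  assumes ne: "box l u \<noteq> {}" and f: "continuous_on (cbox l u) f" and ae: "ae_eq (cbox l u) g f" and x: "x \<in> cbox l u"
  shows "cont_rep (cbox l u) g x = f x"
proof -
  have "continuous_on (cbox l u) (cont_rep (cbox l u) g) \<and> ae_eq (cbox l u) (cont_rep (cbox l u) g) g"
    unfolding cont_rep_def by (rule someI[where x = f]) (use f ae_eq_sym[OF ae] in blast)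
  then show ?thesis
    using continuous_eq_if_AE_eq[OF ne _ f _ x] ae_eq_trans[OF _ ae] by blast
qed

lemma cont_rep_Icc_eq:
  fixes f g :: "real \<Rightarrow> 'b::euclidean_space"
  assumes "a < b" "continuous_on {a..b} f" "ae_eq {a..b} g f" "x \<in> {a..b}"
  shows "cont_rep {a..b} g x = f x"
  using cont_rep_eq[of a b f g x] assms by simp

lemma cont_rep_rect_eq:
  fixes f g :: "real \<times> real \<Rightarrow> 'b::euclidean_space"
  assumes "a < b" "c < d" "continuous_on ({c..d} \<times> {a..b}) f" "ae_eq ({c..d} \<times> {a..b}) g f" "p \<in> {c..d} \<times> {a..b}"
  shows "cont_rep ({c..d} \<times> {a..b}) g p = f p"
proof -
  have "box (c, a) (d, b) \<noteq> {}"
    using assms(1,2) by (auto simp: box_ne_empty Basis_prod_def)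
  then show ?thesis
    using cont_rep_eq[of "(c, a)" "(d, b)" f g p] assms(3-5) unfolding rect_eq_cbox by blast
qed

lemma cont_rep_cong:
  assumes "ae_eq \<Omega> g g'"
  shows "cont_rep \<Omega> g = cont_rep \<Omega> g'"
proof -
  have "ae_eq \<Omega> h g = ae_eq \<Omega> h g'" for h
    using ae_eq_trans[OF _ assms, of h] ae_eq_trans[OF _ ae_eq_sym[OF assms], of h] by (rule iffI)
  then show ?thesis unfolding cont_rep_def by (simp only:)
qed

lemma
  fixes f :: "real \<Rightarrow> 'b::euclidean_space"
  shows dX_ae_eq: "has_weak_derivative {a..b} 1 f g \<Longrightarrow> ae_eq {a..b} (dX a b f) g"
    and dX_cong: "ae_eq {a..b} f f' \<Longrightarrow> dX a b f = dX a b f'"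
    and weakly_differentiable_Icc_cong: "ae_eq {a..b} f f' \<Longrightarrow> weakly_differentiable {a..b} 1 f \<longleftrightarrow> weakly_differentiable {a..b} 1 f'"
    and has_weak_derivative_dX: "weakly_differentiable {a..b} 1 f \<Longrightarrow> has_weak_derivative {a..b} 1 f (dX a b f)"
  using weak_derivative_ae_eq[of a b 1 f] weak_derivative_cong[of 1 a b f f']
  unfolding cbox_interval by (simp_all add: weakly_differentiable_def) blast

lemma
  fixes f :: "real \<times> real \<Rightarrow> 'b::euclidean_space"
  assumes i: "i \<in> Basis"
  shows rect_weak_derivative_ae_eq: "has_weak_derivative (rect a b) i f g \<Longrightarrow> ae_eq (rect a b) (weak_derivative (rect a b) i f) g"
    and rect_weak_derivative_cong: "ae_eq (rect a b) f f' \<Longrightarrow> weak_derivative (rect a b) i f = weak_derivative (rect a b) i f'"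
    and rect_weakly_differentiable_cong: "ae_eq (rect a b) f f' \<Longrightarrow> weakly_differentiable (rect a b) i f \<longleftrightarrow> weakly_differentiable (rect a b) i f'"
    and rect_has_weak_derivative: "weakly_differentiable (rect a b) i f \<Longrightarrow> has_weak_derivative (rect a b) i f (weak_derivative (rect a b) i f)"
  unfolding rect_eq_cbox
  using weak_derivative_ae_eq[of "(0, a)" "(1, b)" i f] weak_derivative_cong[OF i, of "(0, a)" "(1, b)" f f']
  by (simp_all add: weakly_differentiable_def) blast

lemma Basis_real2: "(1, 0) \<in> (Basis :: (real \<times> real) set)" "(0, 1) \<in> (Basis :: (real \<times> real) set)"
  by (auto simp: Basis_prod_def)

lemma less_2_cases_all: "(\<forall>\<beta><2. P \<beta>) \<longleftrightarrow> P 0 \<and> P (Suc 0)"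
  by (auto simp: numeral_2_eq_2 less_Suc_eq)

lemma le_2_cases_all: "(\<forall>\<beta>\<le>2. P \<beta>) \<longleftrightarrow> P 0 \<and> P (Suc 0) \<and> P (2::nat)"
  by (auto simp: numeral_2_eq_2 le_Suc_eq)

lemma H2_iff: "u \<in> H2 a b \<longleftrightarrow> weakly_differentiable {a..b} 1 u \<and> weakly_differentiable {a..b} 1 (dX a b u)"
  by (simp add: H2_def less_2_cases_all)

lemma H12_iff: "\<phi> \<in> H12 a b \<longleftrightarrow>
    weakly_differentiable (rect a b) (0, 1) \<phi> \<and> weakly_differentiable (rect a b) (0, 1) (dx a b \<phi>) \<and>
    weakly_differentiable (rect a b) (1, 0) \<phi> \<and> weakly_differentiable (rect a b) (1, 0) (dx a b \<phi>) \<and>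
    weakly_differentiable (rect a b) (1, 0) (dx a b (dx a b \<phi>))"
  unfolding H12_def less_2_cases_all le_2_cases_all by (simp add: numeral_2_eq_2)

lemma weakly_differentiableI: "has_weak_derivative \<Omega> i f g \<Longrightarrow> weakly_differentiable \<Omega> i f"
  by (auto simp: weakly_differentiable_def)

text \<open>This holds for every \<open>s\<close>, not merely for almost every \<open>s\<close>; membership of each slice in the
  domain of the boundary conditions requires it.\<close>

lemma L2_primitive_slice:
  fixes \<psi> :: "real \<times> real \<Rightarrow> 'b::euclidean_space"
  assumes \<psi>: "\<psi> \<in> L2 ({c..d} \<times> {a..b})" and cd: "c < d" and s: "s \<le> d"
  shows "(\<lambda>\<theta>. primitive c (\<lambda>\<sigma>. \<psi> (\<sigma>, \<theta>)) s) \<in> L2 {a..b}"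
proof (rule L2_boundI(1))
  note i = L2_imp_integrable_rect[OF \<psi>]
  show "(\<lambda>\<theta>. primitive c (\<lambda>\<sigma>. \<psi> (\<sigma>, \<theta>)) s) \<in> borel_measurable (lebesgue_on {a..b})"
    by (rule borel_measurable_integrable[OF integrable_primitive_param(2)[OF i s]])
  show "integrable (lebesgue_on {a..b}) (\<lambda>\<theta>. (d - c) * (LINT \<sigma>|lebesgue_on {c..d}. (norm (\<psi> (\<sigma>, \<theta>)))\<^sup>2))"
    by (rule integrable_mult_right[OF integrable_lebesgue_on_snd[OF borel_Icc borel_Icc L2_D(2)[OF \<psi>]]])
  show "AE \<theta> in lebesgue_on {a..b}. (norm (primitive c (\<lambda>\<sigma>. \<psi> (\<sigma>, \<theta>)) s))\<^sup>2 \<le> (d - c) * (LINT \<sigma>|lebesgue_on {c..d}. (norm (\<psi> (\<sigma>, \<theta>)))\<^sup>2)"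
    using AE_integrable_lebesgue_on_slice'[OF borel_Icc borel_Icc i] AE_integrable_lebesgue_on_slice'[OF borel_Icc borel_Icc L2_D(2)[OF \<psi>]]
  proof eventually_elim
    case (elim \<theta>)
    have "(norm (primitive c (\<lambda>\<sigma>. \<psi> (\<sigma>, \<theta>)) s))\<^sup>2 \<le> (LINT \<sigma>|lebesgue_on {c..d}. norm (\<psi> (\<sigma>, \<theta>)))\<^sup>2"
      by (intro power_mono norm_primitive_le[OF elim(1) s]) simp
    also have "\<dots> \<le> (d - c) * (LINT \<sigma>|lebesgue_on {c..d}. (norm (\<psi> (\<sigma>, \<theta>)))\<^sup>2)"
      by (rule integral_square_le[OF cd integrable_norm[OF elim(1)] elim(2)])
    finally show ?case .
  qed
qed

text \<open>The assumption says that a function with second derivative \<open>w\<close>, end moments \<open>(J\<^sub>0, J\<^sub>1)\<close> and initial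
  values \<open>(c\<^sub>0, c\<^sub>1)\<close> at \<open>a\<close> satisfies the boundary conditions iff its initial values are those chosen
  by \<open>\<Lambda>\<close>. The stacked vector lists its values at \<open>a\<close> and \<open>b\<close> and those of its derivative.\<close>

locale boundary_reconstruction = reconstruction a b \<Lambda>
  for a b :: real and \<Lambda> :: "(real^'n::finite) \<times> (real^'n) \<Rightarrow> (real^'n) \<times> (real^'n)" +
  fixes B :: "real^(4 \<times> 'n)^(2 \<times> 'n)"
  assumes key: "\<And>c\<^sub>0 c\<^sub>1 J\<^sub>0 J\<^sub>1. B *v stack (vector [c\<^sub>0, c\<^sub>0 + (b - a) *\<^sub>R c\<^sub>1 + J\<^sub>1, c\<^sub>1, c\<^sub>1 + J\<^sub>0]) = 0 \<longleftrightarrow> (c\<^sub>0, c\<^sub>1) = \<Lambda> (J\<^sub>0, J\<^sub>1)"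
begin

lemma boundary_values_eq:
  assumes w: "integrable (lebesgue_on {a..b}) w"
    and u: "ae_eq {a..b} u (\<lambda>x. c\<^sub>0 + (x - a) *\<^sub>R c\<^sub>1 + primitive a (primitive a w) x)"
    and u': "ae_eq {a..b} (dX a b u) (\<lambda>x. c\<^sub>1 + primitive a w x)"
  shows "B *v boundary_values a b u = 0 \<longleftrightarrow> (c\<^sub>0, c\<^sub>1) = \<Lambda> (end_moments a b w)"
proof -
  have 1: "continuous_on {a..b} (\<lambda>x. c\<^sub>0 + (x - a) *\<^sub>R c\<^sub>1 + primitive a (primitive a w) x)"
    by (intro continuous_intros continuous_on_primitive integrable_primitive w)
  have 2: "continuous_on {a..b} (\<lambda>x. c\<^sub>1 + primitive a w x)"
    by (intro continuous_intros continuous_on_primitive w)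
  have "a \<in> {a..b}" "b \<in> {a..b}" using ab by auto
  note c = cont_rep_Icc_eq[OF ab 1 u this(1)] cont_rep_Icc_eq[OF ab 1 u this(2)] cont_rep_Icc_eq[OF ab 2 u' this(1)] cont_rep_Icc_eq[OF ab 2 u' this(2)]
  show ?thesis
    unfolding boundary_values_def c end_moments_def
    using key[of c\<^sub>0 c\<^sub>1 "primitive a (primitive a w) b" "primitive a w b"]
    by (simp add: primitive_at_start)
qed

text \<open>Reconstructed functions satisfy the boundary conditions, and reconstruction is inverted by the second
  weak derivative.\<close>

lemma X_dom_recon:
  assumes w: "w \<in> L2 {a..b}" and u: "ae_eq {a..b} u (recon w)"
  shows "u \<in> X_dom a b B" and "ae_eq {a..b} (dX a b u) (drecon w)" and "ae_eq {a..b} (dX a b (dX a b u)) w"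
proof -
  note h = has_weak_derivative_recon[OF w] has_weak_derivative_drecon[OF w]
  show u': "ae_eq {a..b} (dX a b u) (drecon w)"
    unfolding dX_cong[OF u] by (rule dX_ae_eq[OF h(1)])
  show "ae_eq {a..b} (dX a b (dX a b u)) w"
    unfolding dX_cong[OF u'] by (rule dX_ae_eq[OF h(2)])
  have "u \<in> H2 a b"
    unfolding H2_iff weakly_differentiable_Icc_cong[OF u] weakly_differentiable_Icc_cong[OF u']
    using h by (auto intro: weakly_differentiableI)
  moreover have "B *v boundary_values a b u = 0"
    using boundary_values_eq[OF L2_imp_integrable_Icc[OF w], of u "fst (\<Lambda> (end_moments a b w))" "snd (\<Lambda> (end_moments a b w))"] u u'
    by (simp add: recon_def[abs_def] drecon_def[abs_def])
  ultimately show "u \<in> X_dom a b B" by (simp add: X_dom_def)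
qed

text \<open>The boundary conditions determine the affine part. The coefficients are arbitrary here because the
  slices of a history are first known only in this form.\<close>

lemma X_dom_affine_eq_recon:
  assumes u: "u \<in> X_dom a b B" and w: "w \<in> L2 {a..b}"
    and eq: "ae_eq {a..b} u (\<lambda>x. c\<^sub>0 + (x - a) *\<^sub>R c\<^sub>1 + primitive a (primitive a w) x)"
  shows "(c\<^sub>0, c\<^sub>1) = \<Lambda> (end_moments a b w)"
proof -
  note iw = L2_imp_integrable_Icc[OF w]
  have pr: "primitive a (\<lambda>x. c\<^sub>1 + primitive a w x) x = (x - a) *\<^sub>R c\<^sub>1 + primitive a (primitive a w) x"
    if "x \<in> {a..b}" for x
    using that by (subst primitive_add[OF finite_measure.integrable_const[OF finite_measure_lebesgue_on_Icc] integrable_primitive[OF iw]])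
      (auto simp: primitive_const)
  have "u \<in> L2 {a..b}"
    using u by (auto simp: X_dom_def H2_iff weakly_differentiable_def has_weak_derivative_def)
  moreover have "(\<lambda>x. c\<^sub>1 + primitive a w x) \<in> L2 {a..b}"
    using L2_add[OF L2_const_Icc[of "c\<^sub>1 - snd (\<Lambda> (end_moments a b w))"] L2_drecon[OF w]] by (simp add: drecon_def)
  moreover have "AE x in lebesgue_on {a..b}. u x = c\<^sub>0 + primitive a (\<lambda>x. c\<^sub>1 + primitive a w x) x"
    using eq AE_space unfolding ae_eq_def by eventually_elim (simp add: pr)
  ultimately have "has_weak_derivative {a..b} 1 u (\<lambda>x. c\<^sub>1 + primitive a w x)"
    unfolding has_weak_derivative_Icc_iff[OF ab] by blast
  from boundary_values_eq[OF iw eq dX_ae_eq[OF this]] show ?thesis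
    using u by (simp add: X_dom_def)
qed

lemma X_dom_imp_recon:
  assumes u: "u \<in> X_dom a b B"
  shows "dX a b (dX a b u) \<in> L2 {a..b}" and "ae_eq {a..b} u (recon (dX a b (dX a b u)))"
proof -
  let ?w = "dX a b (dX a b u)"
  have h1: "has_weak_derivative {a..b} 1 u (dX a b u)" and h2: "has_weak_derivative {a..b} 1 (dX a b u) ?w"
    using u by (auto simp: X_dom_def H2_iff intro: has_weak_derivative_dX)
  then show w: "?w \<in> L2 {a..b}" by (auto simp: has_weak_derivative_def)
  note iw = L2_imp_integrable_Icc[OF w]
  obtain c\<^sub>0 where c0: "AE x in lebesgue_on {a..b}. u x = c\<^sub>0 + primitive a (dX a b u) x"
    using h1 unfolding has_weak_derivative_Icc_iff[OF ab] by blast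
  obtain c\<^sub>1 where c1: "AE x in lebesgue_on {a..b}. dX a b u x = c\<^sub>1 + primitive a ?w x"
    using h2 unfolding has_weak_derivative_Icc_iff[OF ab] by blast
  have i1: "integrable (lebesgue_on {a..b}) (dX a b u)"
    using h1 by (auto simp: has_weak_derivative_def intro: L2_imp_integrable_Icc)
  have pr: "primitive a (dX a b u) x = (x - a) *\<^sub>R c\<^sub>1 + primitive a (primitive a ?w) x" if "x \<in> {a..b}" for x
  proof -
    have "primitive a (dX a b u) x = primitive a (\<lambda>x. c\<^sub>1 + primitive a ?w x) x"
      by (rule primitive_cong_AE[OF i1 c1]) (use that in auto)
    also have "\<dots> = (x - a) *\<^sub>R c\<^sub>1 + primitive a (primitive a ?w) x"
      using that by (subst primitive_add[OF finite_measure.integrable_const[OF finite_measure_lebesgue_on_Icc] integrable_primitive[OF iw]])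
        (auto simp: primitive_const)
    finally show ?thesis .
  qed
  have eq: "ae_eq {a..b} u (\<lambda>x. c\<^sub>0 + (x - a) *\<^sub>R c\<^sub>1 + primitive a (primitive a ?w) x)"
    unfolding ae_eq_def using c0 AE_space by eventually_elim (simp add: pr)
  have "(c\<^sub>0, c\<^sub>1) = \<Lambda> (end_moments a b ?w)"
    using boundary_values_eq[OF iw eq] c1 u by (simp add: ae_eq_def X_dom_def)
  then show "ae_eq {a..b} u (recon ?w)"
    using eq by (simp add: recon_def[abs_def] flip: \<open>(c\<^sub>0, c\<^sub>1) = _\<close>)
qed

end

section \<open>Histories in mixed Sobolev spaces\<close>

text \<open>The integration constant of an \<open>s\<close>-primitive inherits square integrability, being a difference of
  two square integrable functions that depends on one coordinate only.\<close>

lemma L2_remainder: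
  fixes f q :: "real \<times> real \<Rightarrow> real^'n"
  assumes cd: "c < d" and f: "f \<in> L2 ({c..d} \<times> {a..b})" and q: "q \<in> L2 ({c..d} \<times> {a..b})"
    and eq: "AE p in lebesgue_on ({c..d} \<times> {a..b}). f p = h (snd p) + primitive c (\<lambda>\<sigma>. q (\<sigma>, snd p)) (fst p)"
  shows "h \<in> L2 {a..b}"
proof (rule L2_comp_sndD[OF _ cd])
  have 1: "(\<lambda>p. f p - primitive c (\<lambda>\<sigma>. q (\<sigma>, snd p)) (fst p)) \<in> L2 ({c..d} \<times> {a..b})"
    by (rule L2_diff[OF f L2_fibre_primitive_fst[OF q cd]])
  show "(\<lambda>p. h (snd p)) \<in> L2 ({c..d} \<times> {a..b})"
    by (rule L2_ae_eq[OF Times_in_borel[OF borel_Icc borel_Icc] 1])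
       (use eq in \<open>auto simp: ae_eq_def\<close>)
qed

text \<open>The integration constant \<open>\<gamma>\<close> of an \<open>x\<close>-primitive is a priori only a function class in \<open>s\<close>. If the function
  and its \<open>x\<close>-derivative are also primitives in \<open>s\<close>, then averaging the identity for \<open>\<gamma>\<close> over \<open>x\<close>
  exhibits \<open>\<gamma>\<close> as a primitive in \<open>s\<close>, hence as a continuous function.\<close>

lemma continuous_fibre_constant:
  fixes f p q\<^sub>0 q\<^sub>1 :: "real \<times> real \<Rightarrow> real^'n" and \<gamma> h\<^sub>0 h\<^sub>1 :: "real \<Rightarrow> real^'n"
  assumes ab: "a < b" and cd: "c < d"
    and L: "f \<in> L2 ({c..d} \<times> {a..b})" "p \<in> L2 ({c..d} \<times> {a..b})" "q\<^sub>0 \<in> L2 ({c..d} \<times> {a..b})" "q\<^sub>1 \<in> L2 ({c..d} \<times> {a..b})"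
    and f\<gamma>: "AE z in lebesgue_on ({c..d} \<times> {a..b}). f z = \<gamma> (fst z) + primitive a (\<lambda>\<theta>. p (fst z, \<theta>)) (snd z)"
    and fh: "AE z in lebesgue_on ({c..d} \<times> {a..b}). f z = h\<^sub>0 (snd z) + primitive c (\<lambda>\<sigma>. q\<^sub>0 (\<sigma>, snd z)) (fst z)"
    and ph: "AE z in lebesgue_on ({c..d} \<times> {a..b}). p z = h\<^sub>1 (snd z) + primitive c (\<lambda>\<sigma>. q\<^sub>1 (\<sigma>, snd z)) (fst z)"
  shows "\<exists>\<gamma>'. continuous_on {c..d} \<gamma>' \<and> (AE s in lebesgue_on {c..d}. \<gamma> s = \<gamma>' s)"
proof -
  have h: "integrable (lebesgue_on {a..b}) h\<^sub>0" "integrable (lebesgue_on {a..b}) h\<^sub>1"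
    using L2_remainder[OF cd L(1,3) fh] L2_remainder[OF cd L(2,4) ph] by (auto intro: L2_imp_integrable_Icc)
  note i = L[THEN L2_imp_integrable_rect]
  note v1 = integrable_fibre_primitive[OF i(4)]
  define r where "r = (LINT x|lebesgue_on {a..b}. h\<^sub>0 x - primitive a h\<^sub>1 x)"
  let ?P0 = "primitive c (\<lambda>\<sigma>. primitive a (\<lambda>\<theta>. q\<^sub>0 (\<sigma>, \<theta>)) b)"
  let ?P1 = "primitive c (\<lambda>\<sigma>. primitive a (primitive a (\<lambda>\<theta>. q\<^sub>1 (\<sigma>, \<theta>))) b)"
  define \<gamma>' where "\<gamma>' s = (1 / (b - a)) *\<^sub>R (r + ?P0 s - ?P1 s)" for s
  have i1: "integrable (lebesgue_on {c..d}) (\<lambda>\<sigma>. primitive a (primitive a (\<lambda>\<theta>. q\<^sub>1 (\<sigma>, \<theta>))) b)"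
    using integrable_primitive_param(1)[OF v1 order_refl] by simp
  have "continuous_on {c..d} \<gamma>'"
    unfolding \<gamma>'_def[abs_def]
    by (intro continuous_intros continuous_on_primitive[OF integrable_primitive_param(1)[OF i(3) order_refl]] continuous_on_primitive[OF i1])
  moreover have "AE s in lebesgue_on {c..d}. \<gamma> s = \<gamma>' s"
    using AE_lebesgue_on_pair[OF borel_Icc borel_Icc f\<gamma>] AE_lebesgue_on_pair[OF borel_Icc borel_Icc fh]
      AE_lebesgue_on_pair[OF borel_Icc borel_Icc ph] AE_slices_integrable[OF i(2)] AE_space
  proof eventually_elim
    case (elim s)
    then have s: "s \<le> d" by simp
    have pr: "primitive a (\<lambda>\<theta>. p (s, \<theta>)) x = primitive a h\<^sub>1 x + primitive c (\<lambda>\<sigma>. primitive a (\<lambda>\<theta>. q\<^sub>1 (\<sigma>, \<theta>)) x) s" if x: "x \<le> b" for x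
    proof -
      have "primitive a (\<lambda>\<theta>. p (s, \<theta>)) x = primitive a (\<lambda>\<theta>. h\<^sub>1 \<theta> + primitive c (\<lambda>\<sigma>. q\<^sub>1 (\<sigma>, \<theta>)) s) x"
        by (rule primitive_cong_AE[OF elim(4) _ x]) (use elim(3) in simp)
      then show ?thesis
        by (simp add: primitive_add[OF h(2) integrable_primitive_param(2)[OF i(4) s] x] primitive_commute(1)[OF i(4) s x])
    qed
    let ?S0 = "\<lambda>x. primitive c (\<lambda>\<sigma>. q\<^sub>0 (\<sigma>, x)) s" and ?S1 = "\<lambda>x. primitive c (\<lambda>\<sigma>. primitive a (\<lambda>\<theta>. q\<^sub>1 (\<sigma>, \<theta>)) x) s"
    have iS: "integrable (lebesgue_on {a..b}) ?S0" "integrable (lebesgue_on {a..b}) ?S1"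
      using integrable_primitive_param(2)[OF i(3) s] integrable_primitive_param(2)[OF v1 s] by simp_all
    have ir: "integrable (lebesgue_on {a..b}) (\<lambda>x. h\<^sub>0 x - primitive a h\<^sub>1 x)"
      using h(1) integrable_primitive[OF h(2)] by simp
    have "AE x in lebesgue_on {a..b}. \<gamma> s = (h\<^sub>0 x - primitive a h\<^sub>1 x) + ?S0 x - ?S1 x"
      using elim(1,2) AE_space
    proof eventually_elim
      case (elim x)
      then have "\<gamma> s + primitive a (\<lambda>\<theta>. p (s, \<theta>)) x = h\<^sub>0 x + ?S0 x" by simp
      then show ?case using pr[of x] elim(3) by (simp add: algebra_simps)
    qed
    then have "(LINT x|lebesgue_on {a..b}. \<gamma> s) = (LINT x|lebesgue_on {a..b}. (h\<^sub>0 x - primitive a h\<^sub>1 x) + ?S0 x - ?S1 x)"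
      using ir iS by (intro integral_cong_AE borel_measurable_integrable finite_measure.integrable_const[OF finite_measure_lebesgue_on_Icc]) auto
    also have "\<dots> = r + primitive a ?S0 b - primitive a ?S1 b"
      using ir iS unfolding r_def primitive_def[of a ?S0] primitive_def[of a ?S1]
      by (simp only: Bochner_Integration.integral_add Bochner_Integration.integral_diff Bochner_Integration.integrable_add)
    also have "\<dots> = r + ?P0 s - ?P1 s"
      using primitive_commute(1)[OF i(3) s order_refl] primitive_commute(1)[OF v1 s order_refl] by simp
    finally have "(b - a) *\<^sub>R \<gamma> s = r + ?P0 s - ?P1 s"
      using ab by (simp add: measure_lebesgue_on_Icc)
    then have "(1 / (b - a)) *\<^sub>R ((b - a) *\<^sub>R \<gamma> s) = \<gamma>' s"
      unfolding \<gamma>'_def by (simp only:)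
    then show ?case using ab by simp
  qed
  ultimately show ?thesis by blast
qed

context reconstruction
begin

lemma primitive_primitive_history:
  assumes v: "integrable (lebesgue_on {a..b}) v" and \<psi>: "integrable (lebesgue_on ({c..d::real} \<times> {a..b})) \<psi>" and s: "s \<le> d" and x: "x \<le> b"
  shows "primitive a (primitive a (\<lambda>\<theta>. history c v \<psi> (s, \<theta>))) x =
    primitive a (primitive a v) x + primitive c (\<lambda>\<sigma>. primitive a (primitive a (\<lambda>\<theta>. \<psi> (\<sigma>, \<theta>))) x) s"
  unfolding history_def fst_conv snd_conv primitive_primitive_add[OF v integrable_primitive_param(2)[OF \<psi> s] x]
    end_moments_primitive(2)[OF \<psi> s x] ..

lemma continuous_on_primitive_primitive_history:
  assumes v: "integrable (lebesgue_on {a..b}) v" and \<psi>: "integrable (lebesgue_on ({c..d::real} \<times> {a..b})) \<psi>"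
  shows "continuous_on ({c..d} \<times> {a..b}) (\<lambda>p. primitive a (primitive a (\<lambda>\<theta>. history c v \<psi> (fst p, \<theta>))) (snd p))"
proof -
  let ?R = "{c..d} \<times> {a..b}"
  have 1: "continuous_on ?R (\<lambda>p. primitive a (primitive a v) (snd p))"
    by (rule continuous_on_compose2[OF continuous_on_primitive[OF integrable_primitive[OF v]] continuous_on_snd[OF continuous_on_id]]) auto
  have 2: "continuous_on ?R (\<lambda>p. primitive c (\<lambda>\<sigma>. primitive a (primitive a (\<lambda>\<theta>. \<psi> (\<sigma>, \<theta>))) (snd p)) (fst p))"
    using continuous_on_double_primitive[OF integrable_fibre_primitive[OF \<psi>]] by simp
  show ?thesis
    by (rule continuous_on_eq[OF continuous_on_add[OF 1 2]]) (auto simp: primitive_primitive_history[OF v \<psi>])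
qed

text \<open>Integrating \<open>\<partial>\<^sub>x\<partial>\<^sub>x\<phi>\<close> twice produces two integration constants depending on \<open>s\<close>. Both are continuous by
  the preceding lemma, and \<open>\<partial>\<^sub>x\<partial>\<^sub>x\<phi>\<close> itself is a history. So \<open>\<phi>\<close> has a continuous representative, each
  of whose slices is an affine function plus an iterated primitive.\<close>

lemma H12_structure:
  fixes \<phi> :: "real \<times> real \<Rightarrow> real^'n"
  assumes \<phi>: "\<phi> \<in> H12 a b"
  defines "\<psi> \<equiv> ds a b (dx a b (dx a b \<phi>))"
  shows "\<psi> \<in> L2 (rect a b)"
    and "\<exists>g \<alpha> \<beta>. g \<in> L2 {a..b} \<and> continuous_on {0..1} \<alpha> \<and> continuous_on {0..1} \<beta> \<and>
      ae_eq (rect a b) \<phi> (\<lambda>p. \<beta> (fst p) + (snd p - a) *\<^sub>R \<alpha> (fst p) + primitive a (primitive a (\<lambda>\<theta>. history 0 g \<psi> (fst p, \<theta>))) (snd p))"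
proof -
  let ?p1 = "dx a b \<phi>" and ?p2 = "dx a b (dx a b \<phi>)"
  note H = \<phi>[unfolded H12_iff]
  have w: "has_weak_derivative (rect a b) (0, 1) \<phi> ?p1" "has_weak_derivative (rect a b) (0, 1) ?p1 ?p2"
    "has_weak_derivative (rect a b) (1, 0) \<phi> (ds a b \<phi>)" "has_weak_derivative (rect a b) (1, 0) ?p1 (ds a b ?p1)"
    "has_weak_derivative (rect a b) (1, 0) ?p2 \<psi>"
    using H unfolding \<psi>_def by (simp_all add: rect_has_weak_derivative[OF Basis_real2(1)] rect_has_weak_derivative[OF Basis_real2(2)])
  note ws = w(3-5)[unfolded has_weak_derivative_fst_iff[OF zero_less_one]]
  note wx = w(1,2)[unfolded has_weak_derivative_snd_iff[OF ab]]
  have L: "\<phi> \<in> L2 (rect a b)" "?p1 \<in> L2 (rect a b)" "?p2 \<in> L2 (rect a b)" "ds a b \<phi> \<in> L2 (rect a b)"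
    "ds a b ?p1 \<in> L2 (rect a b)" "\<psi> \<in> L2 (rect a b)"
    using ws by auto
  show "\<psi> \<in> L2 (rect a b)" by (rule L(6))
  obtain \<beta> where \<beta>: "AE z in lebesgue_on (rect a b). \<phi> z = \<beta> (fst z) + primitive a (\<lambda>\<theta>. ?p1 (fst z, \<theta>)) (snd z)"
    using wx(1) by blast
  obtain \<alpha> where \<alpha>: "AE z in lebesgue_on (rect a b). ?p1 z = \<alpha> (fst z) + primitive a (\<lambda>\<theta>. ?p2 (fst z, \<theta>)) (snd z)"
    using wx(2) by blast
  obtain h0 where h0: "AE z in lebesgue_on (rect a b). \<phi> z = h0 (snd z) + primitive 0 (\<lambda>\<sigma>. ds a b \<phi> (\<sigma>, snd z)) (fst z)"
    using ws(1) by blast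
  obtain h1 where h1: "AE z in lebesgue_on (rect a b). ?p1 z = h1 (snd z) + primitive 0 (\<lambda>\<sigma>. ds a b ?p1 (\<sigma>, snd z)) (fst z)"
    using ws(2) by blast
  obtain g where g: "AE z in lebesgue_on (rect a b). ?p2 z = g (snd z) + primitive 0 (\<lambda>\<sigma>. \<psi> (\<sigma>, snd z)) (fst z)"
    using ws(3) by blast
  have gL: "g \<in> L2 {a..b}" by (rule L2_remainder[OF zero_less_one L(3,6) g])
  obtain \<beta>' where \<beta>': "continuous_on {0..1} \<beta>'" "AE s in lebesgue_on {0..1}. \<beta> s = \<beta>' s"
    using continuous_fibre_constant[OF ab zero_less_one L(1,2,4,5) \<beta> h0 h1] by blast
  obtain \<alpha>' where \<alpha>': "continuous_on {0..1} \<alpha>'" "AE s in lebesgue_on {0..1}. \<alpha> s = \<alpha>' s"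
    using continuous_fibre_constant[OF ab zero_less_one L(2,3,5,6) \<alpha> h1 g] by blast
  note i = L2_imp_integrable_rect[OF L(2)] L2_imp_integrable_rect[OF L(3)]
  have "AE s in lebesgue_on {0..1}. \<forall>x\<in>{a..b}. primitive a (\<lambda>\<theta>. ?p1 (s, \<theta>)) x = (x - a) *\<^sub>R \<alpha>' s + primitive a (primitive a (\<lambda>\<theta>. history 0 g \<psi> (s, \<theta>))) x"
    using AE_lebesgue_on_pair[OF borel_Icc borel_Icc \<alpha>] AE_lebesgue_on_pair[OF borel_Icc borel_Icc g] \<alpha>'(2)
      AE_slices_integrable[OF i(1)] AE_slices_integrable[OF i(2)]
  proof eventually_elim
    case (elim s)
    show ?case
    proof
      fix x assume x: "x \<in> {a..b}"
      have p2: "primitive a (\<lambda>\<theta>. ?p2 (s, \<theta>)) y = primitive a (\<lambda>\<theta>. history 0 g \<psi> (s, \<theta>)) y" if "y \<le> b" for y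
        by (rule primitive_cong_AE[OF elim(5) _ that]) (use elim(2) in \<open>simp add: history_def\<close>)
      have "primitive a (\<lambda>\<theta>. ?p1 (s, \<theta>)) x = primitive a (\<lambda>\<theta>. \<alpha>' s + primitive a (\<lambda>\<theta>. ?p2 (s, \<theta>)) \<theta>) x"
        by (rule primitive_cong_AE[OF elim(4)]) (use elim(1,3) x in auto)
      also have "\<dots> = (x - a) *\<^sub>R \<alpha>' s + primitive a (primitive a (\<lambda>\<theta>. ?p2 (s, \<theta>))) x"
        using x by (subst primitive_add[OF finite_measure.integrable_const[OF finite_measure_lebesgue_on_Icc] integrable_primitive[OF elim(5)]])
          (auto simp: primitive_const)
      also have "primitive a (primitive a (\<lambda>\<theta>. ?p2 (s, \<theta>))) x = primitive a (primitive a (\<lambda>\<theta>. history 0 g \<psi> (s, \<theta>))) x"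
        by (rule primitive_cong) (use p2 x in auto)
      finally show "primitive a (\<lambda>\<theta>. ?p1 (s, \<theta>)) x = (x - a) *\<^sub>R \<alpha>' s + primitive a (primitive a (\<lambda>\<theta>. history 0 g \<psi> (s, \<theta>))) x" .
    qed
  qed
  from AE_lebesgue_on_fst[OF borel_Icc borel_Icc this, of a b] AE_lebesgue_on_fst[OF borel_Icc borel_Icc \<beta>'(2), of a b] \<beta>
  have "ae_eq (rect a b) \<phi> (\<lambda>p. \<beta>' (fst p) + (snd p - a) *\<^sub>R \<alpha>' (fst p) + primitive a (primitive a (\<lambda>\<theta>. history 0 g \<psi> (fst p, \<theta>))) (snd p))"
    unfolding ae_eq_def using AE_space by eventually_elim (auto simp: add.assoc)
  with gL \<alpha>'(1) \<beta>'(1)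
  show "\<exists>g \<alpha> \<beta>. g \<in> L2 {a..b} \<and> continuous_on {0..1} \<alpha> \<and> continuous_on {0..1} \<beta> \<and>
      ae_eq (rect a b) \<phi> (\<lambda>p. \<beta> (fst p) + (snd p - a) *\<^sub>R \<alpha> (fst p) + primitive a (primitive a (\<lambda>\<theta>. history 0 g \<psi> (fst p, \<theta>))) (snd p))"
    by blast
qed

lemma history_slice_L2:
  assumes v: "v \<in> L2 {a..b}" and \<psi>: "\<psi> \<in> L2 ({c..d::real} \<times> {a..b})" and cd: "c < d" and s: "s \<le> d"
  shows "(\<lambda>\<theta>. history c v \<psi> (s, \<theta>)) \<in> L2 {a..b}"
  unfolding history_def fst_conv snd_conv by (rule L2_add[OF v L2_primitive_slice[OF \<psi> cd s]])

lemma history_start: "history c v \<psi> (c, \<theta>) = v \<theta>"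
  by (simp add: history_def primitive_at_start)

text \<open>Differentiating in \<open>s\<close> removes the outer integral and differentiating in \<open>x\<close> turns \<open>recon\<close> into \<open>drecon\<close>
  and then into the density itself; the two operations commute because \<open>recon\<close> is linear in its density.\<close>

lemma
  assumes v: "v \<in> L2 {a..b}" and \<psi>: "\<psi> \<in> L2 (rect a b)" and \<phi>: "ae_eq (rect a b) \<phi> (fibre_recon (history 0 v \<psi>))"
  shows fibre_recon_H12: "\<phi> \<in> H12 a b"
    and dx_fibre_recon: "ae_eq (rect a b) (dx a b \<phi>) (fibre_drecon (history 0 v \<psi>))"
    and dxdx_fibre_recon: "ae_eq (rect a b) (dx a b (dx a b \<phi>)) (history 0 v \<psi>)"
    and ds_fibre_recon: "ae_eq (rect a b) (ds a b \<phi>) (fibre_recon \<psi>)"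
    and dsdx_fibre_recon: "ae_eq (rect a b) (ds a b (dx a b \<phi>)) (fibre_drecon \<psi>)"
    and dsdxdx_fibre_recon: "ae_eq (rect a b) (ds a b (dx a b (dx a b \<phi>))) \<psi>"
    and slice_fibre_recon: "\<lbrakk>s \<in> {0..1}; x \<in> {a..b}\<rbrakk> \<Longrightarrow> slice a b \<phi> s x = recon (\<lambda>\<theta>. history 0 v \<psi> (s, \<theta>)) x"
proof -
  let ?h = "history 0 v \<psi>"
  note h = L2_history[OF v \<psi> zero_less_one]
  note wx = has_weak_derivative_fibre_recon[OF h]
  note ws = has_weak_derivative_history[OF v \<psi> zero_less_one]
  note ix = Basis_real2(2) and iS = Basis_real2(1)
  show 1: "ae_eq (rect a b) (dx a b \<phi>) (fibre_drecon ?h)"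
    unfolding rect_weak_derivative_cong[OF ix \<phi>] by (rule rect_weak_derivative_ae_eq[OF ix wx(1)])
  show 2: "ae_eq (rect a b) (dx a b (dx a b \<phi>)) ?h"
    unfolding rect_weak_derivative_cong[OF ix 1] by (rule rect_weak_derivative_ae_eq[OF ix wx(2)])
  show "ae_eq (rect a b) (ds a b \<phi>) (fibre_recon \<psi>)"
    unfolding rect_weak_derivative_cong[OF iS \<phi>] by (rule rect_weak_derivative_ae_eq[OF iS ws(1)])
  show "ae_eq (rect a b) (ds a b (dx a b \<phi>)) (fibre_drecon \<psi>)"
    unfolding rect_weak_derivative_cong[OF iS 1] by (rule rect_weak_derivative_ae_eq[OF iS ws(2)])
  show "ae_eq (rect a b) (ds a b (dx a b (dx a b \<phi>))) \<psi>"
    unfolding rect_weak_derivative_cong[OF iS 2] by (rule rect_weak_derivative_ae_eq[OF iS ws(3)])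
  show "\<phi> \<in> H12 a b"
    unfolding H12_iff rect_weakly_differentiable_cong[OF ix \<phi>] rect_weakly_differentiable_cong[OF ix 1]
      rect_weakly_differentiable_cong[OF iS \<phi>] rect_weakly_differentiable_cong[OF iS 1] rect_weakly_differentiable_cong[OF iS 2]
    by (intro conjI weakly_differentiableI[OF wx(1)] weakly_differentiableI[OF wx(2)]
        weakly_differentiableI[OF ws(1)] weakly_differentiableI[OF ws(2)] weakly_differentiableI[OF ws(3)])
  assume "s \<in> {0..1}" "x \<in> {a..b}"
  then show "slice a b \<phi> s x = recon (\<lambda>\<theta>. ?h (s, \<theta>)) x"
    unfolding slice_def
    using cont_rep_rect_eq[OF ab zero_less_one continuous_on_fibre_recon_history[OF L2_imp_integrable_Icc[OF v] L2_imp_integrable_rect[OF \<psi>]] \<phi>, of "(s, x)"]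
    by simp
qed

end

context boundary_reconstruction
begin

lemma Y_dom_fibre_recon:
  assumes v: "v \<in> L2 {a..b}" and \<psi>: "\<psi> \<in> L2 (rect a b)" and u: "ae_eq {a..b} u (recon v)"
    and \<phi>: "ae_eq (rect a b) \<phi> (fibre_recon (history 0 v \<psi>))"
  shows "\<phi> \<in> Y_dom a b B u"
proof -
  have sl: "ae_eq {a..b} (slice a b \<phi> s) (recon (\<lambda>\<theta>. history 0 v \<psi> (s, \<theta>)))" if "s \<in> {0..1}" for s
    unfolding ae_eq_def by (rule AE_I2) (use slice_fibre_recon[OF v \<psi> \<phi> that] in simp)
  have "slice a b \<phi> s \<in> X_dom a b B" if s: "s \<in> {0..1}" for s
    by (rule X_dom_recon(1)[OF history_slice_L2[OF v \<psi> zero_less_one] sl[OF s]]) (use s in simp)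
  moreover have "ae_eq {a..b} (slice a b \<phi> 0) u"
    using ae_eq_trans[OF sl[of 0], of u] ae_eq_sym[OF u] by (simp add: history_start)
  ultimately show ?thesis
    using fibre_recon_H12[OF v \<psi> \<phi>] by (simp add: Y_dom_def)
qed

text \<open>The boundary conditions on every slice fix the affine parts found in \<open>H12_structure\<close>, so \<open>\<phi>\<close> is a
  reconstructed history for some initial slice \<open>g\<close>; the condition on the slice at \<open>s = 0\<close> identifies \<open>g\<close>
  with the second derivative of \<open>u\<close>.\<close>

lemma Y_dom_imp_fibre_recon:
  assumes u: "u \<in> X_dom a b B" and \<phi>: "\<phi> \<in> Y_dom a b B u"
  defines "v \<equiv> dX a b (dX a b u)" and "\<psi> \<equiv> ds a b (dx a b (dx a b \<phi>))"
  shows "\<psi> \<in> L2 (rect a b)" and "ae_eq (rect a b) \<phi> (fibre_recon (history 0 v \<psi>))"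
proof -
  have H: "\<phi> \<in> H12 a b" and sX: "\<And>s. s \<in> {0..1} \<Longrightarrow> slice a b \<phi> s \<in> X_dom a b B" and s0: "ae_eq {a..b} (slice a b \<phi> 0) u"
    using \<phi> by (auto simp: Y_dom_def)
  show \<psi>: "\<psi> \<in> L2 (rect a b)"
    unfolding \<psi>_def by (rule H12_structure(1)[OF H])
  obtain g \<alpha> \<beta> where g: "g \<in> L2 {a..b}" and c: "continuous_on {0..1} \<alpha>" "continuous_on {0..1} \<beta>"
    and eq: "ae_eq (rect a b) \<phi> (\<lambda>p. \<beta> (fst p) + (snd p - a) *\<^sub>R \<alpha> (fst p) + primitive a (primitive a (\<lambda>\<theta>. history 0 g \<psi> (fst p, \<theta>))) (snd p))"
    using H12_structure(2)[OF H] unfolding \<psi>_def by blast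
  note ig = L2_imp_integrable_Icc[OF g] and ip = L2_imp_integrable_rect[OF \<psi>]
  have "continuous_on (rect a b) (\<lambda>p. \<alpha> (fst p))" "continuous_on (rect a b) (\<lambda>p. \<beta> (fst p))"
    by (rule continuous_on_compose2[OF c(1) continuous_on_fst[OF continuous_on_id]], force,
        rule continuous_on_compose2[OF c(2) continuous_on_fst[OF continuous_on_id]], force)
  then have cont: "continuous_on (rect a b) (\<lambda>p. \<beta> (fst p) + (snd p - a) *\<^sub>R \<alpha> (fst p) + primitive a (primitive a (\<lambda>\<theta>. history 0 g \<psi> (fst p, \<theta>))) (snd p))"
    by (intro continuous_intros continuous_on_primitive_primitive_history[OF ig ip])
  have sl: "slice a b \<phi> s x = \<beta> s + (x - a) *\<^sub>R \<alpha> s + primitive a (primitive a (\<lambda>\<theta>. history 0 g \<psi> (s, \<theta>))) x"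
    if "s \<in> {0..1}" "x \<in> {a..b}" for s x
    unfolding slice_def using cont_rep_rect_eq[OF ab zero_less_one cont eq, of "(s, x)"] that by simp
  \<comment> \<open>every slice satisfies the boundary conditions, so its affine part is the reconstructed one\<close>
  have rec: "\<beta> s + (x - a) *\<^sub>R \<alpha> s + primitive a (primitive a (\<lambda>\<theta>. history 0 g \<psi> (s, \<theta>))) x = recon (\<lambda>\<theta>. history 0 g \<psi> (s, \<theta>)) x"
    if s: "s \<in> {0..1}" for s x
  proof -
    have "(\<beta> s, \<alpha> s) = \<Lambda> (end_moments a b (\<lambda>\<theta>. history 0 g \<psi> (s, \<theta>)))"
      by (rule X_dom_affine_eq_recon[OF sX[OF s] history_slice_L2[OF g \<psi> zero_less_one]])
         (use s sl[OF s] in \<open>auto simp: ae_eq_def\<close>)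
    then show ?thesis by (simp add: recon_def flip: \<open>(\<beta> s, \<alpha> s) = _\<close>)
  qed
  have "ae_eq {a..b} (slice a b \<phi> 0) (recon g)"
    unfolding ae_eq_def by (rule AE_I2) (use sl[of 0] rec[of 0] in \<open>simp add: history_start\<close>)
  then have "ae_eq {a..b} u (recon g)"
    by (rule ae_eq_trans[OF ae_eq_sym[OF s0]])
  from X_dom_recon(3)[OF g this] have vg: "ae_eq {a..b} v g"
    unfolding v_def .
  have "recon (\<lambda>\<theta>. history 0 g \<psi> (s, \<theta>)) x = recon (\<lambda>\<theta>. history 0 v \<psi> (s, \<theta>)) x" if "s \<in> {0..1}" "x \<in> {a..b}" for s x
    by (rule recon_cong_AE[OF history_slice_integrable[OF ig ip]]) (use vg that in \<open>auto simp: ae_eq_def history_def\<close>)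
  note cong = this
  show "ae_eq (rect a b) \<phi> (fibre_recon (history 0 v \<psi>))"
    using eq AE_space unfolding ae_eq_def by eventually_elim (auto simp: rec cong)
qed

end

section \<open>The kernels of the integral operators\<close>

lemma vector_4:
  "(vector [w, x, y, z] :: 'a::zero^4) $ 1 = w"
  "(vector [w, x, y, z] :: 'a::zero^4) $ 2 = x"
  "(vector [w, x, y, z] :: 'a::zero^4) $ 3 = y"
  "(vector [w, x, y, z] :: 'a::zero^4) $ 4 = z"
  unfolding vector_def by simp_all

lemma stack_nth: "stack M $ (k, j) = M $ k $ j"
  by (simp add: stack_def)

lemma stack_eq_iff: "stack M = stack N \<longleftrightarrow> M = N"
  by (auto simp: vec_eq_iff stack_def)

lemma stack_mult_vec: "stack M *v w = stack (\<chi> k. M $ k *v w)"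
  by (simp add: vec_eq_iff stack_def matrix_vector_mult_def)

lemma blockrow_mult_vec: "blockrow M *v y = (\<Sum>k\<in>UNIV. M $ k *v (\<chi> j. y $ (k, j)))"
proof -
  have "(blockrow M *v y) $ i = (\<Sum>k\<in>UNIV. M $ k *v (\<chi> j. y $ (k, j))) $ i" for i
  proof -
    have "(blockrow M *v y) $ i = (\<Sum>p\<in>UNIV \<times> UNIV. M $ fst p $ i $ snd p * y $ p)"
      by (simp add: blockrow_def matrix_vector_mult_def)
    also have "\<dots> = (\<Sum>k\<in>UNIV. \<Sum>j\<in>UNIV. M $ k $ i $ j * y $ (k, j))"
      by (simp add: sum.cartesian_product case_prod_unfold)
    finally show ?thesis by (simp add: matrix_vector_mult_def)
  qed
  then show ?thesis by (simp add: vec_eq_iff)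
qed

lemma matrix_inv_inverse:
  fixes M :: "real^'m::finite^'m"
  assumes "invertible M"
  shows "matrix_inv M ** M = mat 1" "M ** matrix_inv M = mat 1"
  using someI_ex[OF assms[unfolded invertible_def]] by (simp_all add: matrix_inv_def)

lemma scaleR_mat_mult_vec: "(r *\<^sub>R mat 1 :: real^'n^'n) *v w = r *\<^sub>R w"
  by (simp add: scaleR_matrix_vector_assoc[symmetric])

abbreviation block :: "real^('k::finite \<times> 'n::finite) \<Rightarrow> 'k \<Rightarrow> real^'n" where
  "block y k \<equiv> (\<chi> j. y $ (k, j))"

lemma H_mat_mult_vec:
  "H_mat a b *v y = stack (vector [block y 1, block y 1 + (b - a) *\<^sub>R block y 2, block y 2, block y 2])"
  unfolding H_mat_def stack_mult_vec stack_eq_iff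
  by (simp add: vec_eq_iff[of "vec_lambda _"] forall_4 vector_4 blockrow_mult_vec sum_2 scaleR_mat_mult_vec)

lemma K_mat_mult_vec: "K_mat a x *v y = block y 1 + (x - a) *\<^sub>R block y 2"
  by (simp add: K_mat_def blockrow_mult_vec sum_2 scaleR_mat_mult_vec)

lemma Q_mat_mult_vec: "Q_mat b x \<theta> *v w = stack (vector [0, (b - \<theta>) *\<^sub>R w, 0, w])"
  unfolding Q_mat_def stack_mult_vec stack_eq_iff
  by (simp add: vec_eq_iff[of "vec_lambda _"] forall_4 vector_4 scaleR_mat_mult_vec)

text \<open>The solution \<open>y = (c\<^sub>0, c\<^sub>1)\<close> of the linear system \<open>B (H y + q) = 0\<close>, where \<open>q\<close> collects the end moments:
  this is the map \<open>\<Lambda>\<close> given by the boundary conditions.\<close>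

definition bc_coeffs :: "real \<Rightarrow> real \<Rightarrow> real^(4 \<times> 'n::finite)^(2 \<times> 'n) \<Rightarrow> (real^'n) \<times> (real^'n) \<Rightarrow> (real^'n) \<times> (real^'n)" where
  "bc_coeffs a b B J = (let y = - (matrix_inv (B ** H_mat a b) *v (B *v stack (vector [0, snd J, 0, fst J])))
     in (block y 1, block y 2))"

lemma linear_bc_coeffs: "linear (bc_coeffs a b B)"
proof (rule linearI)
  have *: "stack (vector [0, snd (x + y), 0, fst (x + y)]) = (stack (vector [0, snd x, 0, fst x]) + stack (vector [0, snd y, 0, fst y]) :: real^(4 \<times> 'n))"
    for x y :: "(real^'n) \<times> (real^'n)"
    by (simp add: vec_eq_iff stack_def forall_4 vector_4)
  show "bc_coeffs a b B (x + y) = bc_coeffs a b B x + bc_coeffs a b B y" for x y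
    unfolding bc_coeffs_def Let_def * by (simp add: matrix_vector_right_distrib vec_eq_iff)
  have *: "stack (vector [0, snd (r *\<^sub>R x), 0, fst (r *\<^sub>R x)]) = (r *\<^sub>R stack (vector [0, snd x, 0, fst x]) :: real^(4 \<times> 'n))"
    for r and x :: "(real^'n) \<times> (real^'n)"
    by (simp add: vec_eq_iff stack_def forall_4 vector_4)
  show "bc_coeffs a b B (r *\<^sub>R x) = r *\<^sub>R bc_coeffs a b B x" for r x
    unfolding bc_coeffs_def Let_def * by (simp add: matrix_vector_mult_scaleR vec_eq_iff)
qed

lemma bc_coeffs_key:
  fixes B :: "real^(4 \<times> 'n::finite)^(2 \<times> 'n)"
  assumes inv: "invertible (B ** H_mat a b)"
  shows "B *v stack (vector [c\<^sub>0, c\<^sub>0 + (b - a) *\<^sub>R c\<^sub>1 + J\<^sub>1, c\<^sub>1, c\<^sub>1 + J\<^sub>0]) = 0 \<longleftrightarrow> (c\<^sub>0, c\<^sub>1) = bc_coeffs a b B (J\<^sub>0, J\<^sub>1)"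
proof -
  define y :: "real^(2 \<times> 'n)" where "y = stack (vector [c\<^sub>0, c\<^sub>1])"
  define q :: "real^(4 \<times> 'n)" where "q = stack (vector [0, J\<^sub>1, 0, J\<^sub>0])"
  let ?M = "matrix_inv (B ** H_mat a b)"
  have blk: "block y 1 = c\<^sub>0" "block y 2 = c\<^sub>1"
    by (simp_all add: y_def stack_nth vec_eq_iff)
  have "stack (vector [c\<^sub>0, c\<^sub>0 + (b - a) *\<^sub>R c\<^sub>1 + J\<^sub>1, c\<^sub>1, c\<^sub>1 + J\<^sub>0]) = H_mat a b *v y + q"
    unfolding H_mat_mult_vec blk q_def by (simp add: vec_eq_iff stack_def forall_4 vector_4)
  then have 1: "B *v stack (vector [c\<^sub>0, c\<^sub>0 + (b - a) *\<^sub>R c\<^sub>1 + J\<^sub>1, c\<^sub>1, c\<^sub>1 + J\<^sub>0]) = (B ** H_mat a b) *v y + B *v q"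
    by (simp add: matrix_vector_right_distrib matrix_vector_mul_assoc)
  have 2: "(B ** H_mat a b) *v y + B *v q = 0 \<longleftrightarrow> y = - (?M *v (B *v q))"
  proof
    assume "(B ** H_mat a b) *v y + B *v q = 0"
    then have "?M *v ((B ** H_mat a b) *v y + B *v q) = 0" by simp
    then have "y + ?M *v (B *v q) = 0"
      unfolding matrix_vector_right_distrib matrix_vector_mul_assoc[of ?M "B ** H_mat a b" y] matrix_inv_inverse[OF inv] matrix_vector_mul_lid .
    then show "y = - (?M *v (B *v q))" by (simp add: eq_neg_iff_add_eq_0)
  next
    assume y: "y = - (?M *v (B *v q))"
    have "(B ** H_mat a b) *v (?M *v (B *v q)) = B *v q"
      unfolding matrix_vector_mul_assoc[of "B ** H_mat a b" ?M] matrix_inv_inverse[OF inv] matrix_vector_mul_lid ..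
    then show "(B ** H_mat a b) *v y + B *v q = 0"
      unfolding y by (simp add: linear_neg[OF matrix_vector_mul_linear])
  qed
  have 3: "y = z \<longleftrightarrow> (c\<^sub>0, c\<^sub>1) = (block z 1, block z 2)" for z
    unfolding blk[symmetric] by (auto simp: vec_eq_iff forall_2)
  show ?thesis
    unfolding 1 2 unfolding 3 bc_coeffs_def Let_def q_def fst_conv snd_conv ..
qed

text \<open>The kernel is the contribution of a point mass at \<open>\<theta>\<close> to the affine part: such a mass \<open>w\<close> has end moments
  \<open>(w, (b - \<theta>) w)\<close>.\<close>

lemma T2_ker_mult_vec:
  fixes B :: "real^(4 \<times> 'n::finite)^(2 \<times> 'n)"
  shows "T2_ker a b B x \<theta> *v w = fst (bc_coeffs a b B (w, (b - \<theta>) *\<^sub>R w)) + (x - a) *\<^sub>R snd (bc_coeffs a b B (w, (b - \<theta>) *\<^sub>R w))"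
proof -
  have "T2_ker a b B x \<theta> *v w = - (K_mat a x *v (matrix_inv (B ** H_mat a b) *v (B *v (Q_mat b x \<theta> *v w))))"
  proof -
    have "(- M) *v w = - (M *v w)" for M :: "real^'n^'n"
      by (simp add: vec_eq_iff matrix_vector_mult_def sum_negf)
    then show ?thesis
      unfolding T2_ker_def by (simp add: matrix_vector_mul_assoc matrix_mul_assoc)
  qed
  then show ?thesis
    by (simp add: K_mat_mult_vec Q_mat_mult_vec bc_coeffs_def Let_def vec_eq_iff)
qed

lemma T1_ker_mult_vec: "T1_ker a b B x \<theta> *v w = (x - \<theta>) *\<^sub>R w + T2_ker a b B x \<theta> *v w"
  by (simp add: T1_ker_def matrix_vector_mult_add_rdistrib scaleR_mat_mult_vec)

text \<open>The kernel is affine in its first argument.\<close>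

lemma has_vector_derivative_T2_ker:
  "\<exists>D. ((\<lambda>y. T2_ker a b B y \<theta>) has_vector_derivative D) (at x) \<and>
    (\<forall>w. D *v w = snd (bc_coeffs a b B (w, (b - \<theta>) *\<^sub>R w)))"
proof -
  \<comment> \<open>the slope of an affine function, read off from two points at unit distance\<close>
  define D where "D = T2_ker a b B (a + 1) \<theta> - T2_ker a b B a \<theta>"
  have Dw: "D *v w = snd (bc_coeffs a b B (w, (b - \<theta>) *\<^sub>R w))" for w
    by (simp add: D_def matrix_vector_mult_diff_rdistrib T2_ker_mult_vec)
  have "T2_ker a b B y \<theta> = T2_ker a b B a \<theta> + (y - a) *\<^sub>R D" for y
    unfolding matrix_eq
    by (simp add: matrix_vector_mult_add_rdistrib scaleR_matrix_vector_assoc[symmetric] Dw T2_ker_mult_vec)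
  then have "(\<lambda>y. T2_ker a b B y \<theta>) = (\<lambda>y. T2_ker a b B a \<theta> + (y - a) *\<^sub>R D)" by blast
  then have "((\<lambda>y. T2_ker a b B y \<theta>) has_vector_derivative D) (at x)"
    by (auto intro!: derivative_eq_intros)
  with Dw show ?thesis by blast
qed

lemma vector_derivative_ker:
  shows "vector_derivative (\<lambda>y. T2_ker a b B y \<theta>) (at x) *v w = snd (bc_coeffs a b B (w, (b - \<theta>) *\<^sub>R w))"
    and "vector_derivative (\<lambda>y. T1_ker a b B y \<theta>) (at x) *v w = w + snd (bc_coeffs a b B (w, (b - \<theta>) *\<^sub>R w))"
proof -
  obtain D where D: "((\<lambda>y. T2_ker a b B y \<theta>) has_vector_derivative D) (at x)"
    "\<And>w. D *v w = snd (bc_coeffs a b B (w, (b - \<theta>) *\<^sub>R w))"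
    using has_vector_derivative_T2_ker by blast
  show "vector_derivative (\<lambda>y. T2_ker a b B y \<theta>) (at x) *v w = snd (bc_coeffs a b B (w, (b - \<theta>) *\<^sub>R w))"
    unfolding vector_derivative_at[OF D(1)] by (rule D(2))
  have "((\<lambda>y. T1_ker a b B y \<theta>) has_vector_derivative (mat 1 + D)) (at x)"
    unfolding T1_ker_def by (auto intro!: derivative_eq_intros D(1))
  then show "vector_derivative (\<lambda>y. T1_ker a b B y \<theta>) (at x) *v w = w + snd (bc_coeffs a b B (w, (b - \<theta>) *\<^sub>R w))"
    by (simp add: vector_derivative_at matrix_vector_mult_add_rdistrib D(2))
qed

lemma vector_3_mult_vec: "stack (vector [M, N, P] :: _^3) *v w = stack (vector [M *v w, N *v w, P *v w] :: _^3)"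
  unfolding stack_mult_vec stack_eq_iff by (simp add: vec_eq_iff[of "vec_lambda _"] forall_3)

lemma A_ker_mult_vec:
  "A_ker A T x \<theta> *v w = A x *v stack (vector [T x \<theta> *v w, vector_derivative (\<lambda>y. T y \<theta>) (at x) *v w, 0])"
  unfolding A_ker_def by (simp add: matrix_vector_mul_assoc[symmetric] vector_3_mult_vec)

lemma integral_Icc_split:
  fixes f :: "real \<Rightarrow> 'b::euclidean_space"
  assumes f: "integrable (lebesgue_on {a..b}) f" and x: "x \<in> {a..b}"
  shows "(LINT \<theta>|lebesgue_on {a..x}. f \<theta>) + (LINT \<theta>|lebesgue_on {x..b}. f \<theta>) = (LINT \<theta>|lebesgue_on {a..b}. f \<theta>)"
proof -
  have i: "integrable (lebesgue_on {a..b}) (\<lambda>\<theta>. if P \<theta> then f \<theta> else 0)" if "Measurable.pred borel P" for P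
  proof (rule Bochner_Integration.integrable_bound[OF f])
    have "(\<lambda>\<theta>. (if P \<theta> then 1 else 0 :: real) *\<^sub>R f \<theta>) \<in> borel_measurable (lebesgue_on {a..b})"
      using that by (intro borel_measurable_scaleR borel_measurable_lebesgue_onI borel_measurable_integrable[OF f]) measurable
    moreover have "(if P \<theta> then 1 else 0 :: real) *\<^sub>R f \<theta> = (if P \<theta> then f \<theta> else 0)" for \<theta> by simp
    ultimately show "(\<lambda>\<theta>. if P \<theta> then f \<theta> else 0) \<in> borel_measurable (lebesgue_on {a..b})" by simp
  qed simp
  have i2: "integrable (lebesgue_on {a..b}) (\<lambda>\<theta>. if \<theta> \<le> x then f \<theta> else 0)" "integrable (lebesgue_on {a..b}) (\<lambda>\<theta>. if x \<le> \<theta> then f \<theta> else 0)"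
    by (rule i, measurable)+
  have "AE \<theta> in lebesgue_on {a..b}. \<theta> \<noteq> x"
    using AE_lborel_singleton[of x] unfolding AE_lebesgue_on_iff[OF borel_Icc] by auto
  then have "AE \<theta> in lebesgue_on {a..b}. (if \<theta> \<le> x then f \<theta> else 0) + (if x \<le> \<theta> then f \<theta> else 0) = f \<theta>"
    by eventually_elim auto
  then have "(LINT \<theta>|lebesgue_on {a..b}. (if \<theta> \<le> x then f \<theta> else 0) + (if x \<le> \<theta> then f \<theta> else 0)) = (LINT \<theta>|lebesgue_on {a..b}. f \<theta>)"
    using i2 f by (intro integral_cong_AE borel_measurable_integrable Bochner_Integration.integrable_add) auto
  then show ?thesis
    using i2 x integral_lebesgue_on_if_le[of x b a f] integral_lebesgue_on_if_ge[of a x b f] by simp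
qed

context
  fixes a b :: real and B :: "real^(4 \<times> 'n::finite)^(2 \<times> 'n)"
  assumes ab: "a < b" and inv: "invertible (B ** H_mat a b)"
begin

interpretation boundary_reconstruction a b "bc_coeffs a b B" B
  by (intro boundary_reconstruction.intro reconstruction.intro boundary_reconstruction_axioms.intro
      ab linear_bc_coeffs bc_coeffs_key[OF inv])

text \<open>Superposition of the point masses: integrating their end moments yields the end moments of \<open>w\<close>.\<close>

lemma moments_integral:
  assumes w: "integrable (lebesgue_on {a..b}) w"
  shows "integrable (lebesgue_on {a..b}) (\<lambda>\<theta>. bc_coeffs a b B (w \<theta>, (b - \<theta>) *\<^sub>R w \<theta>))"
    and "(LINT \<theta>|lebesgue_on {a..b}. bc_coeffs a b B (w \<theta>, (b - \<theta>) *\<^sub>R w \<theta>)) = bc_coeffs a b B (end_moments a b w)"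
proof -
  have w': "integrable (lebesgue_on {a..b}) (\<lambda>\<theta>. (b - \<theta>) *\<^sub>R w \<theta>)"
    by (rule integrable_continuous_scaleR_Icc[OF _ w]) (intro continuous_intros)
  note L1 = bounded_linear_compose[OF bounded_linear_\<Lambda> bounded_linear_Pair[OF bounded_linear_ident bounded_linear_zero]]
  note L2 = bounded_linear_compose[OF bounded_linear_\<Lambda> bounded_linear_Pair[OF bounded_linear_zero bounded_linear_ident]]
  note i = integrable_bounded_linear[OF L1 w] integrable_bounded_linear[OF L2 w']
  have s: "bc_coeffs a b B (w \<theta>, (b - \<theta>) *\<^sub>R w \<theta>) = bc_coeffs a b B (w \<theta>, 0) + bc_coeffs a b B (0, (b - \<theta>) *\<^sub>R w \<theta>)" for \<theta>
    by (rule \<Lambda>_split)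
  show "integrable (lebesgue_on {a..b}) (\<lambda>\<theta>. bc_coeffs a b B (w \<theta>, (b - \<theta>) *\<^sub>R w \<theta>))"
    unfolding s by (rule Bochner_Integration.integrable_add[OF i])
  have "(LINT \<theta>|lebesgue_on {a..b}. bc_coeffs a b B (w \<theta>, (b - \<theta>) *\<^sub>R w \<theta>))
      = bc_coeffs a b B (LINT \<theta>|lebesgue_on {a..b}. w \<theta>, 0) + bc_coeffs a b B (0, LINT \<theta>|lebesgue_on {a..b}. (b - \<theta>) *\<^sub>R w \<theta>)"
    unfolding s Bochner_Integration.integral_add[OF i] integral_bounded_linear[OF L1 w] integral_bounded_linear[OF L2 w'] ..
  also have "\<dots> = bc_coeffs a b B (LINT \<theta>|lebesgue_on {a..b}. w \<theta>, LINT \<theta>|lebesgue_on {a..b}. (b - \<theta>) *\<^sub>R w \<theta>)"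
    by (rule \<Lambda>_split[symmetric])
  also have "\<dots> = bc_coeffs a b B (end_moments a b w)"
    using primitive_primitive[OF w less_imp_le[OF ab] order_refl] by (simp add: end_moments_def primitive_def)
  finally show "(LINT \<theta>|lebesgue_on {a..b}. bc_coeffs a b B (w \<theta>, (b - \<theta>) *\<^sub>R w \<theta>)) = bc_coeffs a b B (end_moments a b w)" .
qed

text \<open>Both \<open>T1_op\<close> and \<open>A11_op\<close> are sums of a Volterra part with density \<open>e\<close> and of a linear image of the
  affine coefficients that is integrated over the whole interval. The second part occurs in both
  integrals of the definition and recombines.\<close>

lemma split_kernel_integral:
  fixes L :: "(real^'n) \<times> (real^'n) \<Rightarrow> 'c::euclidean_space" and V :: "real^'n \<Rightarrow> 'c"
  assumes w: "integrable (lebesgue_on {a..b}) w" and x: "x \<in> {a..b}"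
    and L: "bounded_linear L" and e: "integrable (lebesgue_on {a..b}) e"
  shows "(LINT \<theta>|lebesgue_on {a..x}. e \<theta> + L (bc_coeffs a b B (w \<theta>, (b - \<theta>) *\<^sub>R w \<theta>)))
      + (LINT \<theta>|lebesgue_on {x..b}. L (bc_coeffs a b B (w \<theta>, (b - \<theta>) *\<^sub>R w \<theta>)))
      = primitive a e x + L (bc_coeffs a b B (end_moments a b w))"
proof -
  have iL: "integrable (lebesgue_on {a..b}) (\<lambda>\<theta>. L (bc_coeffs a b B (w \<theta>, (b - \<theta>) *\<^sub>R w \<theta>)))"
    by (rule integrable_bounded_linear[OF L moments_integral(1)[OF w]])
  have xb: "x \<le> b" using x by simp
  have "(LINT \<theta>|lebesgue_on {a..x}. e \<theta> + L (bc_coeffs a b B (w \<theta>, (b - \<theta>) *\<^sub>R w \<theta>)))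
      = primitive a e x + (LINT \<theta>|lebesgue_on {a..x}. L (bc_coeffs a b B (w \<theta>, (b - \<theta>) *\<^sub>R w \<theta>)))"
    unfolding primitive_def
    by (rule Bochner_Integration.integral_add[OF integrable_Icc_subset[OF e xb] integrable_Icc_subset[OF iL xb]])
  then show ?thesis
    using integral_Icc_split[OF iL x] integral_bounded_linear[OF L moments_integral(1)[OF w]] moments_integral(2)[OF w]
    by (simp add: add.assoc)
qed

lemma T1_op_eq_recon:
  assumes w: "integrable (lebesgue_on {a..b}) w" and x: "x \<in> {a..b}"
  shows "T1_op a b B w x = recon w x"
proof -
  let ?L = "\<lambda>z :: (real^'n) \<times> (real^'n). fst z + (x - a) *\<^sub>R snd z"
  have L: "bounded_linear ?L" by (intro bounded_linear_intros)
  have e: "integrable (lebesgue_on {a..b}) (\<lambda>\<theta>. (x - \<theta>) *\<^sub>R w \<theta>)"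
    by (rule integrable_continuous_scaleR_Icc[OF _ w]) (intro continuous_intros)
  have "T1_op a b B w x = primitive a (\<lambda>\<theta>. (x - \<theta>) *\<^sub>R w \<theta>) x + ?L (bc_coeffs a b B (end_moments a b w))"
    unfolding T1_op_def T1_ker_mult_vec T2_ker_mult_vec by (rule split_kernel_integral[OF w x L e])
  also have "primitive a (\<lambda>\<theta>. (x - \<theta>) *\<^sub>R w \<theta>) x = primitive a (primitive a w) x"
    using primitive_primitive[OF w, of x] x by (simp add: primitive_def)
  finally show ?thesis by (simp add: recon_def)
qed

lemma A11_op_eq:
  fixes A :: "real \<Rightarrow> real^(3 \<times> 'n)^'n"
  assumes w: "integrable (lebesgue_on {a..b}) w" and x: "x \<in> {a..b}"
  shows "A11_op a b B A w x = A x *v stack (vector [recon w x, drecon w x, w x])"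
proof -
  let ?S = "\<lambda>z :: (real^'n) \<times> (real^'n). A x *v stack (vector [fst z, snd z, 0])"
  have lin: "linear (\<lambda>z :: (real^'n) \<times> (real^'n). stack (vector [fst z, snd z, 0]) :: real^(3 \<times> 'n))"
    by (rule linearI) (simp_all add: vec_eq_iff stack_def forall_3)
  have S: "bounded_linear ?S"
    using linear_compose[OF lin matrix_vector_mul_linear[of "A x"]] by (simp add: linear_conv_bounded_linear o_def)
  let ?K = "\<lambda>z :: (real^'n) \<times> (real^'n). (fst z + (x - a) *\<^sub>R snd z, snd z)"
  have K: "bounded_linear ?K" by (intro bounded_linear_intros bounded_linear_Pair)
  let ?E = "\<lambda>\<theta>. ((x - \<theta>) *\<^sub>R w \<theta>, w \<theta>)"
  have e1: "integrable (lebesgue_on {a..b}) (\<lambda>\<theta>. (x - \<theta>) *\<^sub>R w \<theta>)"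
    by (rule integrable_continuous_scaleR_Icc[OF _ w]) (intro continuous_intros)
  have E: "integrable (lebesgue_on {a..b}) ?E"
    using Bochner_Integration.integrable_add[OF
        integrable_bounded_linear[OF bounded_linear_Pair[OF bounded_linear_ident bounded_linear_zero] e1]
        integrable_bounded_linear[OF bounded_linear_Pair[OF bounded_linear_zero bounded_linear_ident] w]] by simp
  note SK = bounded_linear_compose[OF S K]
  have xb: "x \<le> b" using x by simp
  have k1: "A_ker A (T1_ker a b B) x \<theta> *v w \<theta> = ?S (?E \<theta>) + ?S (?K (bc_coeffs a b B (w \<theta>, (b - \<theta>) *\<^sub>R w \<theta>)))" for \<theta>
    unfolding A_ker_mult_vec vector_derivative_ker T1_ker_mult_vec T2_ker_mult_vec linear_add[OF bounded_linear.linear[OF S], symmetric] by simp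
  have k2: "A_ker A (T2_ker a b B) x \<theta> *v w \<theta> = ?S (?K (bc_coeffs a b B (w \<theta>, (b - \<theta>) *\<^sub>R w \<theta>)))" for \<theta>
    unfolding A_ker_mult_vec vector_derivative_ker T2_ker_mult_vec by simp
  have "(LINT \<theta>|lebesgue_on {a..x}. A_ker A (T1_ker a b B) x \<theta> *v w \<theta>) + (LINT \<theta>|lebesgue_on {x..b}. A_ker A (T2_ker a b B) x \<theta> *v w \<theta>)
      = primitive a (\<lambda>\<theta>. ?S (?E \<theta>)) x + ?S (?K (bc_coeffs a b B (end_moments a b w)))"
    unfolding k1 k2 by (rule split_kernel_integral[OF w x SK integrable_bounded_linear[OF S E]])
  also have "primitive a (\<lambda>\<theta>. ?S (?E \<theta>)) x = ?S (primitive a ?E x)"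
    by (rule primitive_bounded_linear[OF S E xb])
  also have "primitive a ?E x = (primitive a (\<lambda>\<theta>. (x - \<theta>) *\<^sub>R w \<theta>) x, primitive a w x)"
    using primitive_bounded_linear[OF bounded_linear_fst E xb] primitive_bounded_linear[OF bounded_linear_snd E xb]
    by (simp add: prod_eq_iff)
  also have "primitive a (\<lambda>\<theta>. (x - \<theta>) *\<^sub>R w \<theta>) x = primitive a (primitive a w) x"
    using primitive_primitive[OF w, of x] x by (simp add: primitive_def)
  also have "?S (primitive a (primitive a w) x, primitive a w x) + ?S (?K (bc_coeffs a b B (end_moments a b w)))
      = A x *v stack (vector [recon w x, drecon w x, 0])"
    unfolding linear_add[OF bounded_linear.linear[OF S], symmetric] by (simp add: recon_def drecon_def add_ac)
  finally have "A11_op a b B A w x = (A x ** stack (vector [0, 0, mat 1])) *v w x + A x *v stack (vector [recon w x, drecon w x, 0])"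
    by (simp add: A11_op_def add.assoc)
  also have "\<dots> = A x *v (stack (vector [0, 0, w x]) + stack (vector [recon w x, drecon w x, 0]))"
    by (simp add: matrix_vector_mul_assoc[symmetric] vector_3_mult_vec matrix_vector_right_distrib)
  also have "stack (vector [0, 0, w x]) + stack (vector [recon w x, drecon w x, 0] :: _^3) = stack (vector [recon w x, drecon w x, w x])"
    by (simp add: vec_eq_iff stack_def forall_3)
  finally show ?thesis .
qed

end

section \<open>Linearity and boundedness of the state maps\<close>

lemma L2_residual:
  fixes f g h :: "'a::euclidean_space \<Rightarrow> 'b::euclidean_space"
  shows "f \<in> L2 \<Omega> \<Longrightarrow> g \<in> L2 \<Omega> \<Longrightarrow> h \<in> L2 \<Omega> \<Longrightarrow> (\<lambda>x. f x - g x - r *\<^sub>R h x) \<in> L2 \<Omega>"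
  by (intro L2_diff L2_scaleR)

text \<open>Weak derivatives are linear. The combination is the one that appears in difference quotients, see
  \<open>residual\<close> below.\<close>

lemma has_weak_derivative_residual:
  fixes f\<^sub>1 f\<^sub>2 f\<^sub>3 :: "'a::euclidean_space \<Rightarrow> 'b::euclidean_space"
  assumes i: "i \<in> Basis" and w: "has_weak_derivative (cbox l u) i f\<^sub>1 g\<^sub>1" "has_weak_derivative (cbox l u) i f\<^sub>2 g\<^sub>2"
    "has_weak_derivative (cbox l u) i f\<^sub>3 g\<^sub>3"
  shows "has_weak_derivative (cbox l u) i (\<lambda>x. f\<^sub>1 x - f\<^sub>2 x - r *\<^sub>R f\<^sub>3 x) (\<lambda>x. g\<^sub>1 x - g\<^sub>2 x - r *\<^sub>R g\<^sub>3 x)"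
proof -
  have L: "f\<^sub>1 \<in> L2 (cbox l u)" "f\<^sub>2 \<in> L2 (cbox l u)" "f\<^sub>3 \<in> L2 (cbox l u)" "g\<^sub>1 \<in> L2 (cbox l u)" "g\<^sub>2 \<in> L2 (cbox l u)" "g\<^sub>3 \<in> L2 (cbox l u)"
    using w by (auto simp: has_weak_derivative_def)
  have lin: "(LINT x|lebesgue_on (cbox l u). e x *\<^sub>R (f x - g x - r *\<^sub>R h x)) =
      (LINT x|lebesgue_on (cbox l u). e x *\<^sub>R f x) - (LINT x|lebesgue_on (cbox l u). e x *\<^sub>R g x) - r *\<^sub>R (LINT x|lebesgue_on (cbox l u). e x *\<^sub>R h x)"
    if e: "continuous_on UNIV e" and f: "f \<in> L2 (cbox l u)" "g \<in> L2 (cbox l u)" "h \<in> L2 (cbox l u)" for e and f g h :: "'a \<Rightarrow> 'b"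
  proof -
    note I = integrable_continuous_scaleR[OF e L2_imp_integrable[OF f(1)]] integrable_continuous_scaleR[OF e L2_imp_integrable[OF f(2)]]
      integrable_continuous_scaleR[OF e L2_imp_integrable[OF f(3)]]
    have "(LINT x|lebesgue_on (cbox l u). e x *\<^sub>R (f x - g x - r *\<^sub>R h x)) =
      (LINT x|lebesgue_on (cbox l u). e x *\<^sub>R f x - e x *\<^sub>R g x - r *\<^sub>R (e x *\<^sub>R h x))"
      by (simp add: scaleR_diff_right mult.commute)
    then show ?thesis
      unfolding Bochner_Integration.integral_diff[OF Bochner_Integration.integrable_diff[OF I(1,2)] integrable_scaleR_right[OF I(3)]]
        Bochner_Integration.integral_diff[OF I(1,2)] integral_scaleR_right .
  qed
  have "(LINT x|lebesgue_on (cbox l u). frechet_derivative \<eta> (at x) i *\<^sub>R (f\<^sub>1 x - f\<^sub>2 x - r *\<^sub>R f\<^sub>3 x))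
      = - (LINT x|lebesgue_on (cbox l u). \<eta> x *\<^sub>R (g\<^sub>1 x - g\<^sub>2 x - r *\<^sub>R g\<^sub>3 x))" if t: "test_function (cbox l u) \<eta>" for \<eta>
  proof -
    have c: "continuous_on UNIV (\<lambda>x. frechet_derivative \<eta> (at x) i)" "continuous_on UNIV \<eta>"
      using times_differentiable_SucE(2)[OF test_functionD(1)[OF t, of 1, unfolded One_nat_def] i]
        test_functionD(1)[OF t, of 0] by simp_all
    show ?thesis
      unfolding lin[OF c(1) L(1-3)] lin[OF c(2) L(4-6)] has_weak_derivativeD[OF w(1) t] has_weak_derivativeD[OF w(2) t] has_weak_derivativeD[OF w(3) t]
      by simp
  qed
  then show ?thesis
    using L unfolding has_weak_derivative_def by (auto intro: L2_residual)
qed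

lemma
  fixes f\<^sub>1 f\<^sub>2 f\<^sub>3 :: "'a::euclidean_space \<Rightarrow> 'b::euclidean_space"
  assumes i: "i \<in> Basis" and w: "weakly_differentiable (cbox l u) i f\<^sub>1" "weakly_differentiable (cbox l u) i f\<^sub>2"
    "weakly_differentiable (cbox l u) i f\<^sub>3"
  shows weakly_differentiable_residual: "weakly_differentiable (cbox l u) i (\<lambda>x. f\<^sub>1 x - f\<^sub>2 x - r *\<^sub>R f\<^sub>3 x)"
    and weak_derivative_residual: "ae_eq (cbox l u) (weak_derivative (cbox l u) i (\<lambda>x. f\<^sub>1 x - f\<^sub>2 x - r *\<^sub>R f\<^sub>3 x))
      (\<lambda>x. weak_derivative (cbox l u) i f\<^sub>1 x - weak_derivative (cbox l u) i f\<^sub>2 x - r *\<^sub>R weak_derivative (cbox l u) i f\<^sub>3 x)"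
proof -
  have "has_weak_derivative (cbox l u) i f (weak_derivative (cbox l u) i f)" if "weakly_differentiable (cbox l u) i f" for f :: "'a \<Rightarrow> 'b"
    using that weak_derivative_ae_eq(2) by (auto simp: weakly_differentiable_def)
  from has_weak_derivative_residual[OF i this[OF w(1)] this[OF w(2)] this[OF w(3)]]
  show "weakly_differentiable (cbox l u) i (\<lambda>x. f\<^sub>1 x - f\<^sub>2 x - r *\<^sub>R f\<^sub>3 x)"
    "ae_eq (cbox l u) (weak_derivative (cbox l u) i (\<lambda>x. f\<^sub>1 x - f\<^sub>2 x - r *\<^sub>R f\<^sub>3 x))
      (\<lambda>x. weak_derivative (cbox l u) i f\<^sub>1 x - weak_derivative (cbox l u) i f\<^sub>2 x - r *\<^sub>R weak_derivative (cbox l u) i f\<^sub>3 x)"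
    by (rule weakly_differentiableI, rule weak_derivative_ae_eq(1))
qed

lemmas weakly_differentiable_residual_Icc = weakly_differentiable_residual[of 1 "a :: real" b for a b, unfolded cbox_interval]
lemmas dX_residual = weak_derivative_residual[of 1 "a :: real" b for a b, unfolded cbox_interval]

lemma
  fixes f\<^sub>1 f\<^sub>2 f\<^sub>3 :: "real \<times> real \<Rightarrow> 'b::euclidean_space"
  assumes i: "i \<in> Basis" and w: "weakly_differentiable (rect a b) i f\<^sub>1" "weakly_differentiable (rect a b) i f\<^sub>2"
    "weakly_differentiable (rect a b) i f\<^sub>3"
  shows weakly_differentiable_residual_rect: "weakly_differentiable (rect a b) i (\<lambda>x. f\<^sub>1 x - f\<^sub>2 x - r *\<^sub>R f\<^sub>3 x)"
    and rect_weak_derivative_residual: "ae_eq (rect a b) (weak_derivative (rect a b) i (\<lambda>x. f\<^sub>1 x - f\<^sub>2 x - r *\<^sub>R f\<^sub>3 x))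
      (\<lambda>x. weak_derivative (rect a b) i f\<^sub>1 x - weak_derivative (rect a b) i f\<^sub>2 x - r *\<^sub>R weak_derivative (rect a b) i f\<^sub>3 x)"
  using weakly_differentiable_residual[OF i w[unfolded rect_eq_cbox]] weak_derivative_residual[OF i w[unfolded rect_eq_cbox]]
  unfolding rect_eq_cbox by blast+

lemma H2_residual:
  assumes u: "u\<^sub>1 \<in> H2 a b" "u\<^sub>2 \<in> H2 a b" "u\<^sub>3 \<in> H2 a b"
  shows "(\<lambda>x. u\<^sub>1 x - u\<^sub>2 x - r *\<^sub>R u\<^sub>3 x) \<in> H2 a b"
    and "ae_eq {a..b} (dX a b (dX a b (\<lambda>x. u\<^sub>1 x - u\<^sub>2 x - r *\<^sub>R u\<^sub>3 x)))
      (\<lambda>x. dX a b (dX a b u\<^sub>1) x - dX a b (dX a b u\<^sub>2) x - r *\<^sub>R dX a b (dX a b u\<^sub>3) x)"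
proof -
  note w = u[unfolded H2_iff]
  have 1: "ae_eq {a..b} (dX a b (\<lambda>x. u\<^sub>1 x - u\<^sub>2 x - r *\<^sub>R u\<^sub>3 x)) (\<lambda>x. dX a b u\<^sub>1 x - dX a b u\<^sub>2 x - r *\<^sub>R dX a b u\<^sub>3 x)"
    using w by (intro dX_residual) simp_all
  show "(\<lambda>x. u\<^sub>1 x - u\<^sub>2 x - r *\<^sub>R u\<^sub>3 x) \<in> H2 a b"
    unfolding H2_iff weakly_differentiable_Icc_cong[OF 1]
    using w by (intro conjI weakly_differentiable_residual_Icc) simp_all
  show "ae_eq {a..b} (dX a b (dX a b (\<lambda>x. u\<^sub>1 x - u\<^sub>2 x - r *\<^sub>R u\<^sub>3 x)))
      (\<lambda>x. dX a b (dX a b u\<^sub>1) x - dX a b (dX a b u\<^sub>2) x - r *\<^sub>R dX a b (dX a b u\<^sub>3) x)"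
    unfolding dX_cong[OF 1] using w by (intro dX_residual) simp_all
qed

lemma H12_residual:
  assumes u: "u\<^sub>1 \<in> H12 a b" "u\<^sub>2 \<in> H12 a b" "u\<^sub>3 \<in> H12 a b"
  shows "(\<lambda>x. u\<^sub>1 x - u\<^sub>2 x - r *\<^sub>R u\<^sub>3 x) \<in> H12 a b"
    and "ae_eq (rect a b) (ds a b (dx a b (dx a b (\<lambda>x. u\<^sub>1 x - u\<^sub>2 x - r *\<^sub>R u\<^sub>3 x))))
      (\<lambda>x. ds a b (dx a b (dx a b u\<^sub>1)) x - ds a b (dx a b (dx a b u\<^sub>2)) x - r *\<^sub>R ds a b (dx a b (dx a b u\<^sub>3)) x)"
proof -
  note w = u[unfolded H12_iff]
  note c = rect_weakly_differentiable_cong[OF Basis_real2(1)] rect_weakly_differentiable_cong[OF Basis_real2(2)]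
  note d = rect_weak_derivative_cong[OF Basis_real2(1)] rect_weak_derivative_cong[OF Basis_real2(2)]
  have 1: "ae_eq (rect a b) (dx a b (\<lambda>x. u\<^sub>1 x - u\<^sub>2 x - r *\<^sub>R u\<^sub>3 x)) (\<lambda>x. dx a b u\<^sub>1 x - dx a b u\<^sub>2 x - r *\<^sub>R dx a b u\<^sub>3 x)"
    by (rule rect_weak_derivative_residual[OF Basis_real2(2)]) (use w in simp_all)
  have 2: "ae_eq (rect a b) (dx a b (dx a b (\<lambda>x. u\<^sub>1 x - u\<^sub>2 x - r *\<^sub>R u\<^sub>3 x)))
      (\<lambda>x. dx a b (dx a b u\<^sub>1) x - dx a b (dx a b u\<^sub>2) x - r *\<^sub>R dx a b (dx a b u\<^sub>3) x)"
    unfolding d(2)[OF 1] by (rule rect_weak_derivative_residual[OF Basis_real2(2)]) (use w in simp_all)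
  show "(\<lambda>x. u\<^sub>1 x - u\<^sub>2 x - r *\<^sub>R u\<^sub>3 x) \<in> H12 a b"
    unfolding H12_iff c(1)[OF 1] c(2)[OF 1] c(1)[OF 2]
    using w by (intro conjI weakly_differentiable_residual_rect Basis_real2) simp_all
  show "ae_eq (rect a b) (ds a b (dx a b (dx a b (\<lambda>x. u\<^sub>1 x - u\<^sub>2 x - r *\<^sub>R u\<^sub>3 x))))
      (\<lambda>x. ds a b (dx a b (dx a b u\<^sub>1)) x - ds a b (dx a b (dx a b u\<^sub>2)) x - r *\<^sub>R ds a b (dx a b (dx a b u\<^sub>3)) x)"
    unfolding d(1)[OF 2] by (rule rect_weak_derivative_residual[OF Basis_real2(1)]) (use w in simp_all)
qed

lemma H2_nrm_square: "(H2_nrm a b u)\<^sup>2 = (L2_nrm {a..b} u)\<^sup>2 + (L2_nrm {a..b} (dX a b u))\<^sup>2 + (L2_nrm {a..b} (dX a b (dX a b u)))\<^sup>2"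
proof -
  have "(\<Sum>\<beta>\<le>2. (L2_nrm {a..b} ((dX a b ^^ \<beta>) u))\<^sup>2) = (L2_nrm {a..b} u)\<^sup>2 + (L2_nrm {a..b} (dX a b u))\<^sup>2 + (L2_nrm {a..b} (dX a b (dX a b u)))\<^sup>2"
    by (simp add: numeral_2_eq_2)
  then show ?thesis unfolding H2_nrm_def by simp
qed

lemma H12_nrm_square: "(H12_nrm a b \<phi>)\<^sup>2 =
    (L2_nrm (rect a b) \<phi>)\<^sup>2 + (L2_nrm (rect a b) (dx a b \<phi>))\<^sup>2 + (L2_nrm (rect a b) (dx a b (dx a b \<phi>)))\<^sup>2 +
    (L2_nrm (rect a b) (ds a b \<phi>))\<^sup>2 + (L2_nrm (rect a b) (ds a b (dx a b \<phi>)))\<^sup>2 + (L2_nrm (rect a b) (ds a b (dx a b (dx a b \<phi>))))\<^sup>2"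
proof -
  have "(\<Sum>\<alpha>\<le>1. \<Sum>\<beta>\<le>2. (L2_nrm (rect a b) ((ds a b ^^ \<alpha>) ((dx a b ^^ \<beta>) \<phi>)))\<^sup>2) =
    (L2_nrm (rect a b) \<phi>)\<^sup>2 + (L2_nrm (rect a b) (dx a b \<phi>))\<^sup>2 + (L2_nrm (rect a b) (dx a b (dx a b \<phi>)))\<^sup>2 +
    (L2_nrm (rect a b) (ds a b \<phi>))\<^sup>2 + (L2_nrm (rect a b) (ds a b (dx a b \<phi>)))\<^sup>2 + (L2_nrm (rect a b) (ds a b (dx a b (dx a b \<phi>))))\<^sup>2"
    by (simp add: numeral_2_eq_2)
  then show ?thesis unfolding H12_nrm_def by (simp add: add_nonneg_nonneg)
qed

lemma L2_states_nrm_square: "(L2_states_nrm a b w)\<^sup>2 = (L2_nrm {a..b} (fst w))\<^sup>2 + (L2_nrm (rect a b) (snd w))\<^sup>2"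
  by (simp add: L2_states_nrm_def)

lemma H_states_nrm_square: "(H_states_nrm a b z)\<^sup>2 = (H2_nrm a b (fst z))\<^sup>2 + (H12_nrm a b (snd z))\<^sup>2"
  by (simp add: H_states_nrm_def)

lemma nrm_nonneg: "0 \<le> L2_states_nrm a b w" "0 \<le> H_states_nrm a b z"
  by (simp_all add: L2_states_nrm_def H_states_nrm_def)

lemma state_eq_sym: "state_eq a b w z \<Longrightarrow> state_eq a b z w"
  by (auto simp: state_eq_def intro: ae_eq_sym)

lemma state_eq_trans: "state_eq a b w z \<Longrightarrow> state_eq a b z y \<Longrightarrow> state_eq a b w y"
  by (auto simp: state_eq_def intro: ae_eq_trans)

lemma rect_borel: "rect a b \<in> sets borel"
  by (rule Times_in_borel[OF borel_Icc borel_Icc])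

lemma
  assumes "w \<in> L2_states a b" "state_eq a b w w'"
  shows L2_states_cong: "w' \<in> L2_states a b" and L2_states_nrm_cong: "L2_states_nrm a b w' = L2_states_nrm a b w"
  using assms L2_ae_eq[OF borel_Icc, of "fst w" a b "fst w'"] L2_ae_eq[OF rect_borel, of "snd w" a b "snd w'"]
    L2_nrm_ae_eq[OF borel_Icc, of "fst w" a b "fst w'"] L2_nrm_ae_eq[OF rect_borel, of "snd w" a b "snd w'"]
  by (auto simp: L2_states_def state_eq_def L2_states_nrm_def mem_Times_iff)

lemma H_states_L2: "z \<in> H_states a b \<Longrightarrow> z \<in> L2_states a b"
  by (auto simp: H_states_def L2_states_def H2_iff H12_iff weakly_differentiable_def has_weak_derivative_def)

lemma D_op_eq: "D_op a b z = (dX a b (dX a b (fst z)), ds a b (dx a b (dx a b (snd z))))"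
  by (simp add: D_op_def case_prod_unfold)

lemma
  assumes z: "state_eq a b z z'"
  shows D_op_cong: "D_op a b z = D_op a b z'"
    and H_states_nrm_cong: "z \<in> H_states a b \<Longrightarrow> H_states_nrm a b z = H_states_nrm a b z'"
proof -
  have f: "ae_eq {a..b} (fst z) (fst z')" and s: "ae_eq (rect a b) (snd z) (snd z')"
    using z by (auto simp: state_eq_def)
  note c = rect_weakly_differentiable_cong[OF Basis_real2(1) s] rect_weakly_differentiable_cong[OF Basis_real2(2) s]
    rect_weak_derivative_cong[OF Basis_real2(1) s] rect_weak_derivative_cong[OF Basis_real2(2) s]
    dX_cong[OF f] weakly_differentiable_Icc_cong[OF f]
  show "D_op a b z = D_op a b z'"
    unfolding D_op_eq c ..
  assume "z \<in> H_states a b"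
  then have "fst z \<in> L2 {a..b}" "snd z \<in> L2 (rect a b)"
    using H_states_L2[of z a b] by (auto simp: L2_states_def)
  from L2_nrm_ae_eq[OF borel_Icc this(1) f] L2_nrm_ae_eq[OF rect_borel this(2) s]
  have "(H_states_nrm a b z)\<^sup>2 = (H_states_nrm a b z')\<^sup>2"
    unfolding H_states_nrm_square H2_nrm_square H12_nrm_square c by simp
  then show "H_states_nrm a b z = H_states_nrm a b z'"
    using nrm_nonneg(2)[of a b z] nrm_nonneg(2)[of a b z'] by (simp add: power2_eq_iff_nonneg)
qed

lemma D_op_L2: "z \<in> H_states a b \<Longrightarrow> D_op a b z \<in> L2_states a b"
  using rect_has_weak_derivative[OF Basis_real2(1), of a b "dx a b (dx a b (snd z))"] has_weak_derivative_dX[of a b "dX a b (fst z)"]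
  by (auto simp: D_op_eq H_states_def L2_states_def H2_iff H12_iff has_weak_derivative_def mem_Times_iff)

lemma D_op_nrm_le: "L2_states_nrm a b (D_op a b z) \<le> H_states_nrm a b z"
  and L2_states_nrm_le: "L2_states_nrm a b z \<le> H_states_nrm a b z"
proof -
  have le: "(L2_states_nrm a b (D_op a b z))\<^sup>2 \<le> (H_states_nrm a b z)\<^sup>2" "(L2_states_nrm a b z)\<^sup>2 \<le> (H_states_nrm a b z)\<^sup>2"
    unfolding L2_states_nrm_square H_states_nrm_square H2_nrm_square H12_nrm_square D_op_eq fst_conv snd_conv
    using zero_le_power2[of "L2_nrm {a..b} (fst z)"] zero_le_power2[of "L2_nrm {a..b} (dX a b (fst z))"] zero_le_power2[of "L2_nrm {a..b} (dX a b (dX a b (fst z)))"]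
      zero_le_power2[of "L2_nrm (rect a b) (snd z)"]
      zero_le_power2[of "L2_nrm (rect a b) (dx a b (snd z))"]
      zero_le_power2[of "L2_nrm (rect a b) (dx a b (dx a b (snd z)))"]
      zero_le_power2[of "L2_nrm (rect a b) (ds a b (snd z))"]
      zero_le_power2[of "L2_nrm (rect a b) (ds a b (dx a b (snd z)))"]
      zero_le_power2[of "L2_nrm (rect a b) (ds a b (dx a b (dx a b (snd z))))"]
    by linarith+
  show "L2_states_nrm a b (D_op a b z) \<le> H_states_nrm a b z" "L2_states_nrm a b z \<le> H_states_nrm a b z"
    by (rule power2_le_imp_le[OF le(1) nrm_nonneg(2)], rule power2_le_imp_le[OF le(2) nrm_nonneg(2)])
qed

text \<open>The numerator of the difference quotient of a curve: with \<open>r\<close> the time increment, \<open>z\<^sub>1\<close> and \<open>z\<^sub>2\<close> two values of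
  the curve and \<open>z\<^sub>3\<close> the candidate derivative.\<close>

definition residual :: "real \<Rightarrow> 'n::finite state \<Rightarrow> 'n state \<Rightarrow> 'n state \<Rightarrow> 'n state" where
  "residual r z\<^sub>1 z\<^sub>2 z\<^sub>3 = ((\<lambda>x. fst z\<^sub>1 x - fst z\<^sub>2 x - r *\<^sub>R fst z\<^sub>3 x), (\<lambda>p. snd z\<^sub>1 p - snd z\<^sub>2 p - r *\<^sub>R snd z\<^sub>3 p))"

lemma has_frechet_derivative_residual:
  "has_frechet_derivative N w w' t \<longleftrightarrow> ((\<lambda>r. N (residual (r - t) (w r) (w t) w') / \<bar>r - t\<bar>) \<longlongrightarrow> 0) (at t within {0..})"
  by (simp add: has_frechet_derivative_def residual_def)

lemma residual_cong:
  "state_eq a b z\<^sub>1 y\<^sub>1 \<Longrightarrow> state_eq a b z\<^sub>2 y\<^sub>2 \<Longrightarrow> state_eq a b z\<^sub>3 y\<^sub>3 \<Longrightarrow> state_eq a b (residual r z\<^sub>1 z\<^sub>2 z\<^sub>3) (residual r y\<^sub>1 y\<^sub>2 y\<^sub>3)"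
  by (auto simp: state_eq_def ae_eq_def residual_def)

lemma residual_L2: "z\<^sub>1 \<in> L2_states a b \<Longrightarrow> z\<^sub>2 \<in> L2_states a b \<Longrightarrow> z\<^sub>3 \<in> L2_states a b \<Longrightarrow> residual r z\<^sub>1 z\<^sub>2 z\<^sub>3 \<in> L2_states a b"
  by (auto simp: L2_states_def residual_def intro: L2_residual)

lemma
  assumes "z\<^sub>1 \<in> H_states a b" "z\<^sub>2 \<in> H_states a b" "z\<^sub>3 \<in> H_states a b"
  shows residual_H: "residual r z\<^sub>1 z\<^sub>2 z\<^sub>3 \<in> H_states a b"
    and D_op_residual: "state_eq a b (D_op a b (residual r z\<^sub>1 z\<^sub>2 z\<^sub>3)) (residual r (D_op a b z\<^sub>1) (D_op a b z\<^sub>2) (D_op a b z\<^sub>3))"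
  using assms H2_residual[of "fst z\<^sub>1" a b "fst z\<^sub>2" "fst z\<^sub>3" r] H12_residual[of "snd z\<^sub>1" a b "snd z\<^sub>2" "snd z\<^sub>3" r]
  by (auto simp: H_states_def residual_def D_op_eq state_eq_def mem_Times_iff)

definition delay_rhs :: "real \<Rightarrow> real \<Rightarrow> (real \<Rightarrow> real^(3 \<times> 'n)^'n) \<Rightarrow> (real \<Rightarrow> real^(3 \<times> 'n)^'n) \<Rightarrow> real \<Rightarrow>
    'n::finite state \<Rightarrow> 'n state" where
  "delay_rhs a b A Ad \<tau> z =
    ((\<lambda>x. pde_rhs a b A (fst z) x + pde_rhs a b Ad (slice a b (snd z) 1) x), (\<lambda>p. - (1 / \<tau>) *\<^sub>R ds a b (snd z) p))"

lemma dpde_solution_iff: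
  "dpde_solution a b A Ad B \<tau> z0 z \<longleftrightarrow> z0 \<in> dpde_states a b B \<and> state_eq a b (z 0) z0 \<and>
    (\<exists>z'. \<forall>t\<ge>0. z t \<in> dpde_states a b B \<and> z' t \<in> H_states a b \<and>
      has_frechet_derivative (H_states_nrm a b) z (z' t) t \<and> state_eq a b (z' t) (delay_rhs a b A Ad \<tau> (z t)))"
  by (simp add: dpde_solution_def delay_rhs_def state_eq_def)

lemma delay_rhs_cong:
  assumes "state_eq a b z z'"
  shows "state_eq a b (delay_rhs a b A Ad \<tau> z) (delay_rhs a b A Ad \<tau> z')"
proof -
  have f: "ae_eq {a..b} (fst z) (fst z')" and s: "ae_eq (rect a b) (snd z) (snd z')"
    using assms by (auto simp: state_eq_def)
  have "slice a b (snd z) = slice a b (snd z')"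
    unfolding slice_def[abs_def] cont_rep_cong[OF s] ..
  then show ?thesis
    using f by (auto simp: state_eq_def ae_eq_def delay_rhs_def pde_rhs_def dX_cong[OF f]
        rect_weak_derivative_cong[OF Basis_real2(1) s])
qed

lemma dpde_states_H_states: "z \<in> dpde_states a b B \<Longrightarrow> z \<in> H_states a b"
  by (auto simp: dpde_states_def H_states_def X_dom_def Y_dom_def)

text \<open>Bounded maps preserve Frechet derivatives of curves.\<close>

lemma tendsto_quotient_bound:
  fixes f g :: "real \<Rightarrow> real"
  assumes g: "((\<lambda>r. g r / \<bar>r - t\<bar>) \<longlongrightarrow> 0) (at t within {0..})"
    and b: "\<And>r. 0 \<le> r \<Longrightarrow> \<bar>f r\<bar> \<le> C * g r"
  shows "((\<lambda>r. f r / \<bar>r - t\<bar>) \<longlongrightarrow> 0) (at t within {0..})"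
proof (rule Lim_null_comparison)
  show "((\<lambda>r. C * (g r / \<bar>r - t\<bar>)) \<longlongrightarrow> 0) (at t within {0..})"
    using tendsto_mult_right_zero[OF g, of C] .
  have "norm (f r / \<bar>r - t\<bar>) \<le> C * (g r / \<bar>r - t\<bar>)" if "0 \<le> r" for r
    using divide_right_mono[OF b[OF that], of "\<bar>r - t\<bar>"] by simp
  then show "\<forall>\<^sub>F r in at t within {0..}. norm (f r / \<bar>r - t\<bar>) \<le> C * (g r / \<bar>r - t\<bar>)"
    by (auto simp: eventually_at_filter)
qed

context reconstruction
begin

lemma integrable_recon_param:
  assumes \<psi>: "integrable (lebesgue_on ({c..d::real} \<times> {a..b})) \<psi>" and x: "x \<le> b"
  shows "integrable (lebesgue_on {c..d}) (\<lambda>\<sigma>. recon (\<lambda>\<theta>. \<psi> (\<sigma>, \<theta>)) x)"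
    and "integrable (lebesgue_on {c..d}) (\<lambda>\<sigma>. drecon (\<lambda>\<theta>. \<psi> (\<sigma>, \<theta>)) x)"
proof -
  have bl: "bounded_linear (\<lambda>z. fst z + (x - a) *\<^sub>R snd z :: real^'n)" "bounded_linear (snd :: (real^'n) \<times> (real^'n) \<Rightarrow> _)"
    by (intro bounded_linear_intros)+
  note i = integrable_end_moments[OF \<psi>]
  show "integrable (lebesgue_on {c..d}) (\<lambda>\<sigma>. recon (\<lambda>\<theta>. \<psi> (\<sigma>, \<theta>)) x)"
    unfolding recon_def
    by (rule Bochner_Integration.integrable_add[OF integrable_bounded_linear[OF bl(1) i] integrable_primitive_primitive_param[OF \<psi> x]])
  show "integrable (lebesgue_on {c..d}) (\<lambda>\<sigma>. drecon (\<lambda>\<theta>. \<psi> (\<sigma>, \<theta>)) x)"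
    unfolding drecon_def
    by (rule Bochner_Integration.integrable_add[OF integrable_bounded_linear[OF bl(2) i] integrable_primitive_param(1)[OF \<psi> x]])
qed

lemma recon_residual:
  assumes v: "integrable (lebesgue_on {a..b}) v\<^sub>1" "integrable (lebesgue_on {a..b}) v\<^sub>2" "integrable (lebesgue_on {a..b}) v\<^sub>3" and x: "x \<le> b"
  shows "recon (\<lambda>\<theta>. v\<^sub>1 \<theta> - v\<^sub>2 \<theta> - r *\<^sub>R v\<^sub>3 \<theta>) x = recon v\<^sub>1 x - recon v\<^sub>2 x - r *\<^sub>R recon v\<^sub>3 x"
proof -
  note s = integrable_scaleR_right[OF v(2), of "- 1"] integrable_scaleR_right[OF v(3), of "- r"]
  have "recon (\<lambda>\<theta>. v\<^sub>1 \<theta> - v\<^sub>2 \<theta> - r *\<^sub>R v\<^sub>3 \<theta>) x = recon (\<lambda>\<theta>. (v\<^sub>1 \<theta> + (- 1) *\<^sub>R v\<^sub>2 \<theta>) + (- r) *\<^sub>R v\<^sub>3 \<theta>) x"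
    by simp
  also have "\<dots> = recon v\<^sub>1 x + (- 1) *\<^sub>R recon v\<^sub>2 x + (- r) *\<^sub>R recon v\<^sub>3 x"
    unfolding recon_add[OF Bochner_Integration.integrable_add[OF v(1) s(1)] s(2) x] recon_add[OF v(1) s(1) x]
      recon_scaleR[OF v(2) x] recon_scaleR[OF v(3) x] ..
  finally show ?thesis by simp
qed

end

context
  fixes a b :: real and B :: "real^(4 \<times> 'n::finite)^(2 \<times> 'n)"
  assumes ab: "a < b" and inv: "invertible (B ** H_mat a b)"
begin

interpretation boundary_reconstruction a b "bc_coeffs a b B" B
  by (intro boundary_reconstruction.intro reconstruction.intro boundary_reconstruction_axioms.intro
      ab linear_bc_coeffs bc_coeffs_key[OF inv])

lemma T1_op_slices:
  assumes \<psi>: "integrable (lebesgue_on (rect a b)) \<psi>"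
  shows "AE s in lebesgue_on {0..1}. \<forall>x\<in>{a..b}. T1_op a b B (\<lambda>y. \<psi> (s, y)) x = recon (\<lambda>\<theta>. \<psi> (s, \<theta>)) x"
  using AE_slices_integrable[OF \<psi>] by eventually_elim (simp add: T1_op_eq_recon[OF ab inv])

text \<open>The second form, with the integral over the delay outside, is pointwise linear in \<open>w\<close> and depends only on its
  class; the third one connects to the Sobolev theory above.\<close>

lemma T_op_eq:
  assumes w: "w \<in> L2_states a b"
  shows "x \<in> {a..b} \<Longrightarrow> fst (T_op a b B w) x = recon (fst w) x"
    and "p \<in> rect a b \<Longrightarrow> snd (T_op a b B w) p = recon (fst w) (snd p) + primitive 0 (\<lambda>\<sigma>. recon (\<lambda>\<theta>. snd w (\<sigma>, \<theta>)) (snd p)) (fst p)"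
    and "p \<in> rect a b \<Longrightarrow> snd (T_op a b B w) p = fibre_recon (history 0 (fst w) (snd w)) p"
proof -
  have i: "integrable (lebesgue_on {a..b}) (fst w)" "integrable (lebesgue_on (rect a b)) (snd w)"
    using w by (auto simp: L2_states_def intro: L2_imp_integrable_Icc L2_imp_integrable_rect)
  show "fst (T_op a b B w) x = recon (fst w) x" if "x \<in> {a..b}"
    using T1_op_eq_recon[OF ab inv i(1) that] by (simp add: T_op_def case_prod_unfold)
  show 2: "snd (T_op a b B w) p = recon (fst w) (snd p) + primitive 0 (\<lambda>\<sigma>. recon (\<lambda>\<theta>. snd w (\<sigma>, \<theta>)) (snd p)) (fst p)"
    if p: "p \<in> rect a b"
  proof -
    have x: "snd p \<in> {a..b}" "fst p \<le> 1" using p by auto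
    have ae: "AE \<sigma> in lebesgue_on {0..1}. recon (\<lambda>\<theta>. snd w (\<sigma>, \<theta>)) (snd p) = T1_op a b B (\<lambda>y. snd w (\<sigma>, y)) (snd p)"
      using T1_op_slices[OF i(2)] by eventually_elim (use x(1) in simp)
    have "T2_op a b B (snd w) p = primitive 0 (\<lambda>\<sigma>. recon (\<lambda>\<theta>. snd w (\<sigma>, \<theta>)) (snd p)) (fst p)"
      using primitive_cong_AE[OF integrable_recon_param(1)[OF i(2)] ae x(2)] x(1)
      by (simp add: T2_op_def primitive_def case_prod_unfold)
    then show ?thesis
      using T1_op_eq_recon[OF ab inv i(1) x(1)] by (simp add: T_op_def case_prod_unfold)
  qed
  show "snd (T_op a b B w) p = fibre_recon (history 0 (fst w) (snd w)) p" if p: "p \<in> rect a b"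
    unfolding 2[OF p] by (rule recon_history[OF i, symmetric]) (use p in auto)
qed

lemma T_op_ae_eq:
  assumes w: "w \<in> L2_states a b"
  shows "ae_eq {a..b} (fst (T_op a b B w)) (recon (fst w))"
    and "ae_eq (rect a b) (snd (T_op a b B w)) (fibre_recon (history 0 (fst w) (snd w)))"
  unfolding ae_eq_def by (auto intro!: AE_I2 simp: T_op_eq(1)[OF w] T_op_eq(3)[OF w])

lemma T_op_cong:
  assumes w: "w \<in> L2_states a b" and eq: "state_eq a b w w'"
  shows "state_eq a b (T_op a b B w) (T_op a b B w')"
proof -
  have w': "w' \<in> L2_states a b" by (rule L2_states_cong[OF w eq])
  have i: "integrable (lebesgue_on {a..b}) (fst w)" "integrable (lebesgue_on (rect a b)) (snd w)"
    using w by (auto simp: L2_states_def intro: L2_imp_integrable_Icc L2_imp_integrable_rect)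
  have ef: "AE x in lebesgue_on {a..b}. fst w x = fst w' x" and es: "AE p in lebesgue_on (rect a b). snd w p = snd w' p"
    using eq by (auto simp: state_eq_def ae_eq_def)
  have r: "recon (fst w) x = recon (fst w') x" if "x \<in> {a..b}" for x
    by (rule recon_cong_AE[OF i(1) ef]) (use that in simp)
  have p: "primitive 0 (\<lambda>\<sigma>. recon (\<lambda>\<theta>. snd w (\<sigma>, \<theta>)) x) s = primitive 0 (\<lambda>\<sigma>. recon (\<lambda>\<theta>. snd w' (\<sigma>, \<theta>)) x) s"
    if x: "x \<in> {a..b}" and s: "s \<in> {0..1}" for s x
  proof (rule primitive_cong_AE[OF integrable_recon_param(1)[OF i(2)]])
    show "AE \<sigma> in lebesgue_on {0..1}. recon (\<lambda>\<theta>. snd w (\<sigma>, \<theta>)) x = recon (\<lambda>\<theta>. snd w' (\<sigma>, \<theta>)) x"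
      using AE_lebesgue_on_pair[OF borel_Icc borel_Icc es] AE_slices_integrable[OF i(2)]
    proof eventually_elim
      case (elim \<sigma>)
      show ?case by (rule recon_cong_AE[OF elim(2,1)]) (use x in simp)
    qed
  qed (use x s in auto)
  have "AE x in lebesgue_on {a..b}. fst (T_op a b B w) x = fst (T_op a b B w') x"
    by (rule AE_I2) (simp add: T_op_eq(1)[OF w] T_op_eq(1)[OF w'] r)
  moreover have "AE q in lebesgue_on (rect a b). snd (T_op a b B w) q = snd (T_op a b B w') q"
  proof (rule AE_I2)
    fix q assume "q \<in> space (lebesgue_on (rect a b))"
    then have q: "q \<in> rect a b" by simp
    then show "snd (T_op a b B w) q = snd (T_op a b B w') q"
      unfolding T_op_eq(2)[OF w q] T_op_eq(2)[OF w' q] using r[of "snd q"] p[of "snd q" "fst q"] by auto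
  qed
  ultimately show ?thesis by (simp add: state_eq_def ae_eq_def)
qed

lemma T_op_residual:
  assumes w: "w\<^sub>1 \<in> L2_states a b" "w\<^sub>2 \<in> L2_states a b" "w\<^sub>3 \<in> L2_states a b"
  shows "state_eq a b (T_op a b B (residual r w\<^sub>1 w\<^sub>2 w\<^sub>3)) (residual r (T_op a b B w\<^sub>1) (T_op a b B w\<^sub>2) (T_op a b B w\<^sub>3))"
proof -
  have i: "integrable (lebesgue_on {a..b}) (fst w)" "integrable (lebesgue_on (rect a b)) (snd w)" if "w \<in> L2_states a b" for w :: "'n state"
    using that by (auto simp: L2_states_def intro: L2_imp_integrable_Icc L2_imp_integrable_rect)
  note i1 = i[OF w(1)] and i2 = i[OF w(2)] and i3 = i[OF w(3)]
  let ?w = "residual r w\<^sub>1 w\<^sub>2 w\<^sub>3"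
  have W: "?w \<in> L2_states a b" by (rule residual_L2[OF w])
  have r: "recon (fst ?w) x = recon (fst w\<^sub>1) x - recon (fst w\<^sub>2) x - r *\<^sub>R recon (fst w\<^sub>3) x" if "x \<le> b" for x
    unfolding residual_def fst_conv by (rule recon_residual[OF i1(1) i2(1) i3(1) that])
  let ?R = "\<lambda>w x \<sigma>. recon (\<lambda>\<theta>. snd w (\<sigma>, \<theta>)) x"
  have p: "primitive 0 (?R ?w x) s = primitive 0 (?R w\<^sub>1 x) s - primitive 0 (?R w\<^sub>2 x) s - r *\<^sub>R primitive 0 (?R w\<^sub>3 x) s"
    if x: "x \<le> b" and s: "s \<le> 1" for s x
  proof -
    have ae: "AE \<sigma> in lebesgue_on {0..1}. ?R ?w x \<sigma> = (?R w\<^sub>1 x \<sigma> + (- 1) *\<^sub>R ?R w\<^sub>2 x \<sigma>) + (- r) *\<^sub>R ?R w\<^sub>3 x \<sigma>"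
      using AE_slices_integrable[OF i1(2)] AE_slices_integrable[OF i2(2)] AE_slices_integrable[OF i3(2)]
    proof eventually_elim
      case (elim \<sigma>)
      show ?case
        using recon_residual[OF elim x, of r] by (simp add: residual_def)
    qed
    note I = integrable_recon_param(1)[OF i1(2) x] integrable_recon_param(1)[OF i2(2) x] integrable_recon_param(1)[OF i3(2) x]
    note s2 = integrable_scaleR_right[OF I(2), of "- 1"] and s3 = integrable_scaleR_right[OF I(3), of "- r"]
    have "primitive 0 (?R ?w x) s = primitive 0 (\<lambda>\<sigma>. (?R w\<^sub>1 x \<sigma> + (- 1) *\<^sub>R ?R w\<^sub>2 x \<sigma>) + (- r) *\<^sub>R ?R w\<^sub>3 x \<sigma>) s"
      by (rule primitive_cong_AE[OF integrable_recon_param(1)[OF i(2)[OF W] x] ae s])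
    also have "\<dots> = primitive 0 (?R w\<^sub>1 x) s + (- 1) *\<^sub>R primitive 0 (?R w\<^sub>2 x) s + (- r) *\<^sub>R primitive 0 (?R w\<^sub>3 x) s"
      unfolding primitive_add[OF Bochner_Integration.integrable_add[OF I(1) s2] s3 s] primitive_add[OF I(1) s2 s]
        primitive_bounded_linear[OF bounded_linear_scaleR_right I(2) s] primitive_bounded_linear[OF bounded_linear_scaleR_right I(3) s] ..
    finally show ?thesis by simp
  qed
  have "AE x in lebesgue_on {a..b}. fst (T_op a b B ?w) x = fst (residual r (T_op a b B w\<^sub>1) (T_op a b B w\<^sub>2) (T_op a b B w\<^sub>3)) x"
    by (rule AE_I2) (simp add: T_op_eq(1)[OF W] T_op_eq(1)[OF w(1)] T_op_eq(1)[OF w(2)] T_op_eq(1)[OF w(3)] r residual_def[of r "T_op a b B w\<^sub>1"])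
  moreover have "AE q in lebesgue_on (rect a b). snd (T_op a b B ?w) q = snd (residual r (T_op a b B w\<^sub>1) (T_op a b B w\<^sub>2) (T_op a b B w\<^sub>3)) q"
  proof (rule AE_I2)
    fix q assume "q \<in> space (lebesgue_on (rect a b))"
    then have q: "q \<in> rect a b" by simp
    then have "snd q \<le> b" "fst q \<le> 1" by auto
    then show "snd (T_op a b B ?w) q = snd (residual r (T_op a b B w\<^sub>1) (T_op a b B w\<^sub>2) (T_op a b B w\<^sub>3)) q"
      unfolding residual_def[of r "T_op a b B w\<^sub>1"] snd_conv T_op_eq(2)[OF W q] T_op_eq(2)[OF w(1) q] T_op_eq(2)[OF w(2) q] T_op_eq(2)[OF w(3) q]
      by (simp add: r p algebra_simps)
  qed
  ultimately show ?thesis by (simp add: state_eq_def ae_eq_def)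
qed

text \<open>One half of the bijection: \<open>D_op\<close> is a left inverse of \<open>T_op\<close>.\<close>

lemma T_op_dpde_states:
  assumes w: "w \<in> L2_states a b"
  shows "T_op a b B w \<in> dpde_states a b B" and "state_eq a b (D_op a b (T_op a b B w)) w"
proof -
  have L: "fst w \<in> L2 {a..b}" "snd w \<in> L2 (rect a b)"
    using w by (auto simp: L2_states_def)
  note e = T_op_ae_eq[OF w]
  have "fst (T_op a b B w) \<in> X_dom a b B" by (rule X_dom_recon(1)[OF L(1) e(1)])
  moreover have "snd (T_op a b B w) \<in> Y_dom a b B (fst (T_op a b B w))"
    by (rule Y_dom_fibre_recon[OF L e])
  ultimately show "T_op a b B w \<in> dpde_states a b B"
    unfolding dpde_states_def by (metis SigmaI prod.collapse)
  show "state_eq a b (D_op a b (T_op a b B w)) w"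
    unfolding state_eq_def D_op_eq fst_conv snd_conv
    using X_dom_recon(3)[OF L(1) e(1)] dsdxdx_fibre_recon[OF L e(2)] by blast
qed

text \<open>The other half, on states satisfying all constraints.\<close>

lemma T_op_D_op:
  assumes z: "z \<in> dpde_states a b B"
  shows "D_op a b z \<in> L2_states a b" and "state_eq a b (T_op a b B (D_op a b z)) z"
proof -
  have X: "fst z \<in> X_dom a b B" and Y: "snd z \<in> Y_dom a b B (fst z)"
    using z by (auto simp: dpde_states_def)
  show D: "D_op a b z \<in> L2_states a b"
    by (rule D_op_L2[OF dpde_states_H_states[OF z]])
  have "ae_eq {a..b} (fst z) (recon (fst (D_op a b z)))"
    using X_dom_imp_recon(2)[OF X] by (simp add: D_op_eq)
  moreover have "ae_eq (rect a b) (snd z) (fibre_recon (history 0 (fst (D_op a b z)) (snd (D_op a b z))))"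
    using Y_dom_imp_fibre_recon(2)[OF X Y] by (simp add: D_op_eq)
  ultimately show "state_eq a b (T_op a b B (D_op a b z)) z"
    unfolding state_eq_def
    using ae_eq_trans[OF T_op_ae_eq(1)[OF D] ae_eq_sym] ae_eq_trans[OF T_op_ae_eq(2)[OF D] ae_eq_sym] by blast
qed

text \<open>Each of the nine terms of the Sobolev norm of \<open>T_op w\<close> is the L2 norm of \<open>w\<close> or of a history, possibly
  after a reconstruction.\<close>

lemma T_op_bounded:
  "\<exists>C\<ge>0. \<forall>w\<in>L2_states a b. H_states_nrm a b (T_op a b B w) \<le> C * L2_states_nrm a b w"
proof -
  obtain K where K: "0 \<le> K" and bound: "\<And>c d \<psi>. \<psi> \<in> L2 ({c..d::real} \<times> {a..b}) \<Longrightarrow>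
    (L2_nrm ({c..d} \<times> {a..b}) (fibre_recon \<psi>))\<^sup>2 \<le> K * (L2_nrm ({c..d} \<times> {a..b}) \<psi>)\<^sup>2 \<and>
    (L2_nrm ({c..d} \<times> {a..b}) (fibre_drecon \<psi>))\<^sup>2 \<le> K * (L2_nrm ({c..d} \<times> {a..b}) \<psi>)\<^sup>2"
    using fibre_recon_L2 by blast
  let ?M = "2 * K + 1"
  have sq: "(H_states_nrm a b (T_op a b B w))\<^sup>2 \<le> (4 * ?M) * (L2_states_nrm a b w)\<^sup>2" if w: "w \<in> L2_states a b" for w
  proof -
    let ?z = "T_op a b B w" and ?v = "fst w" and ?\<psi> = "snd w"
    have L: "?v \<in> L2 {a..b}" "?\<psi> \<in> L2 (rect a b)"
      using w by (auto simp: L2_states_def)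
    note e = T_op_ae_eq[OF w]
    note hL = L2_history[OF L zero_less_one]
    have ev: "(\<lambda>p. ?v (snd p)) \<in> L2 (rect a b)" by (rule L2_comp_snd[OF L(1)]) simp
    have n: "(L2_nrm {a..b} (fst ?z))\<^sup>2 = (L2_nrm {a..b} (recon ?v))\<^sup>2"
        "(L2_nrm {a..b} (dX a b (fst ?z)))\<^sup>2 = (L2_nrm {a..b} (drecon ?v))\<^sup>2"
        "(L2_nrm {a..b} (dX a b (dX a b (fst ?z))))\<^sup>2 = (L2_nrm {a..b} ?v)\<^sup>2"
      using L2_nrm_ae_eq[OF borel_Icc L2_recon[OF L(1)] ae_eq_sym[OF e(1)]]
        L2_nrm_ae_eq[OF borel_Icc L2_drecon[OF L(1)] ae_eq_sym[OF X_dom_recon(2)[OF L(1) e(1)]]]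
        L2_nrm_ae_eq[OF borel_Icc L(1) ae_eq_sym[OF X_dom_recon(3)[OF L(1) e(1)]]] by simp_all
    have v: "(L2_nrm {a..b} (recon ?v))\<^sup>2 \<le> K * (L2_nrm {a..b} ?v)\<^sup>2" "(L2_nrm {a..b} (drecon ?v))\<^sup>2 \<le> K * (L2_nrm {a..b} ?v)\<^sup>2"
      using bound[OF ev] L2_nrm_comp_snd[OF L(1), of 0 1] L2_nrm_comp_snd[OF L2_recon[OF L(1)], of 0 1] L2_nrm_comp_snd[OF L2_drecon[OF L(1)], of 0 1]
      by simp_all
    have H2: "(H2_nrm a b (fst ?z))\<^sup>2 \<le> ?M * (L2_nrm {a..b} ?v)\<^sup>2"
      unfolding H2_nrm_square n using v by (simp add: algebra_simps)
    have m: "(L2_nrm (rect a b) (snd ?z))\<^sup>2 = (L2_nrm (rect a b) (fibre_recon (history 0 ?v ?\<psi>)))\<^sup>2"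
        "(L2_nrm (rect a b) (dx a b (snd ?z)))\<^sup>2 = (L2_nrm (rect a b) (fibre_drecon (history 0 ?v ?\<psi>)))\<^sup>2"
        "(L2_nrm (rect a b) (dx a b (dx a b (snd ?z))))\<^sup>2 = (L2_nrm (rect a b) (history 0 ?v ?\<psi>))\<^sup>2"
        "(L2_nrm (rect a b) (ds a b (snd ?z)))\<^sup>2 = (L2_nrm (rect a b) (fibre_recon ?\<psi>))\<^sup>2"
        "(L2_nrm (rect a b) (ds a b (dx a b (snd ?z))))\<^sup>2 = (L2_nrm (rect a b) (fibre_drecon ?\<psi>))\<^sup>2"
        "(L2_nrm (rect a b) (ds a b (dx a b (dx a b (snd ?z)))))\<^sup>2 = (L2_nrm (rect a b) ?\<psi>)\<^sup>2"
      using L2_nrm_ae_eq[OF rect_borel L2_fibre_recon[OF hL] ae_eq_sym[OF e(2)]]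
        L2_nrm_ae_eq[OF rect_borel L2_fibre_drecon[OF hL] ae_eq_sym[OF dx_fibre_recon[OF L e(2)]]]
        L2_nrm_ae_eq[OF rect_borel hL ae_eq_sym[OF dxdx_fibre_recon[OF L e(2)]]]
        L2_nrm_ae_eq[OF rect_borel L2_fibre_recon[OF L(2)] ae_eq_sym[OF ds_fibre_recon[OF L e(2)]]]
        L2_nrm_ae_eq[OF rect_borel L2_fibre_drecon[OF L(2)] ae_eq_sym[OF dsdx_fibre_recon[OF L e(2)]]]
        L2_nrm_ae_eq[OF rect_borel L(2) ae_eq_sym[OF dsdxdx_fibre_recon[OF L e(2)]]] by simp_all
    have hn: "(L2_nrm (rect a b) (history 0 ?v ?\<psi>))\<^sup>2 \<le> 2 * (L2_nrm {a..b} ?v)\<^sup>2 + 2 * (L2_nrm (rect a b) ?\<psi>)\<^sup>2"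
      using L2_nrm_history[OF L zero_less_one] by simp
    have H12: "(H12_nrm a b (snd ?z))\<^sup>2 \<le> ?M * (L2_nrm (rect a b) (history 0 ?v ?\<psi>))\<^sup>2 + ?M * (L2_nrm (rect a b) ?\<psi>)\<^sup>2"
      unfolding H12_nrm_square m using bound[OF hL] bound[OF L(2)] by (simp add: algebra_simps)
    also have "\<dots> \<le> ?M * (2 * (L2_nrm {a..b} ?v)\<^sup>2 + 2 * (L2_nrm (rect a b) ?\<psi>)\<^sup>2) + ?M * (L2_nrm (rect a b) ?\<psi>)\<^sup>2"
      using K by (intro add_right_mono mult_left_mono hn) simp
    finally have "(H_states_nrm a b ?z)\<^sup>2 \<le> ?M * (3 * (L2_nrm {a..b} ?v)\<^sup>2 + 3 * (L2_nrm (rect a b) ?\<psi>)\<^sup>2)"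
      using H2 unfolding H_states_nrm_square by (simp add: algebra_simps)
    also have "\<dots> \<le> ?M * (4 * (L2_states_nrm a b w)\<^sup>2)"
      unfolding L2_states_nrm_square using K by (intro mult_left_mono) auto
    finally show ?thesis by (simp add: algebra_simps)
  qed
  have "H_states_nrm a b (T_op a b B w) \<le> sqrt (4 * ?M) * L2_states_nrm a b w" if "w \<in> L2_states a b" for w
    using real_le_rsqrt[OF sq[OF that]] nrm_nonneg(1)[of a b w]
    by (simp only: real_sqrt_mult[of "4 * ?M"] real_sqrt_abs abs_of_nonneg)
  then show ?thesis
    using K by (intro exI[of _ "sqrt (4 * ?M)"]) auto
qed

end

section \<open>Equivalence of the two evolution problems\<close>

lemma L2_nrm_eq_0_imp:
  assumes "L2_nrm \<Omega> f = 0" "f \<in> L2 \<Omega>"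
  shows "AE x in lebesgue_on \<Omega>. f x = 0"
proof -
  have "(LINT x|lebesgue_on \<Omega>. (norm (f x))\<^sup>2) = 0"
    using assms(1) L2_nrm_square[of \<Omega> f] by simp
  then have "AE x in lebesgue_on \<Omega>. (norm (f x))\<^sup>2 = 0"
    using integral_nonneg_eq_0_iff_AE[OF L2_D(2)[OF assms(2)]] by simp
  then show ?thesis by eventually_elim simp
qed

context
  fixes a b \<tau> :: real and B :: "real^(4 \<times> 'n::finite)^(2 \<times> 'n)" and A Ad :: "real \<Rightarrow> real^(3 \<times> 'n)^'n"
  assumes ab: "a < b" and inv: "invertible (B ** H_mat a b)"
begin

interpretation boundary_reconstruction a b "bc_coeffs a b B" B
  by (intro boundary_reconstruction.intro reconstruction.intro boundary_reconstruction_axioms.intro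
      ab linear_bc_coeffs bc_coeffs_key[OF inv])

lemma pde_rhs_eq_A11_op:
  fixes M :: "real \<Rightarrow> real^(3 \<times> 'n)^'n"
  assumes v: "v \<in> L2 {a..b}" and u: "ae_eq {a..b} u (recon v)"
  shows "ae_eq {a..b} (pde_rhs a b M u) (A11_op a b B M v)"
proof -
  have "AE x in lebesgue_on {a..b}. x \<in> {a..b}" by (rule AE_I2) simp
  then show ?thesis
    using u X_dom_recon(2)[OF v u] X_dom_recon(3)[OF v u] unfolding ae_eq_def
    by eventually_elim (simp add: pde_rhs_def A11_op_eq[OF ab inv L2_imp_integrable_Icc[OF v]])
qed

text \<open>At delay \<open>1\<close> the second \<open>x\<close>-derivative of the delayed variable is \<open>v + \<integral>\<psi>(s, \<cdot>) ds\<close>. Reconstruction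
  commutes with this integral, and so does the coefficient matrix at a fixed point \<open>x\<close>.\<close>

lemma A11_op_history:
  assumes v: "v \<in> L2 {a..b}" and \<psi>: "\<psi> \<in> L2 (rect a b)"
  shows "ae_eq {a..b} (A11_op a b B Ad (\<lambda>\<theta>. history 0 v \<psi> (1, \<theta>))) (\<lambda>x. A11_op a b B Ad v x + A12_op a b B Ad \<psi> x)"
proof -
  note iv = L2_imp_integrable_Icc[OF v] and ip = L2_imp_integrable_rect[OF \<psi>]
  let ?S = "\<lambda>x z. Ad x *v stack (vector [fst z, fst (snd z), snd (snd z)])"
  have lin: "linear (\<lambda>z :: (real^'n) \<times> (real^'n) \<times> (real^'n). stack (vector [fst z, fst (snd z), snd (snd z)]) :: real^(3 \<times> 'n))"
    by (rule linearI) (simp_all add: vec_eq_iff stack_def forall_3)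
  have S: "bounded_linear (?S x)" for x
    using linear_compose[OF lin matrix_vector_mul_linear[of "Ad x"]] by (simp add: linear_conv_bounded_linear o_def)
  have "AE x in lebesgue_on {a..b}. integrable (lebesgue_on {0..1}) (\<lambda>s. \<psi> (s, x)) \<and> x \<in> {a..b}"
    using AE_integrable_lebesgue_on_slice'[OF borel_Icc borel_Icc ip] AE_space by eventually_elim simp
  then show ?thesis
    unfolding ae_eq_def
  proof eventually_elim
    case (elim x)
    then have x: "x \<in> {a..b}" "x \<le> b" and sl: "integrable (lebesgue_on {0..1}) (\<lambda>s. \<psi> (s, x))" by auto
    let ?t = "\<lambda>s. (recon (\<lambda>\<theta>. \<psi> (s, \<theta>)) x, drecon (\<lambda>\<theta>. \<psi> (s, \<theta>)) x, \<psi> (s, x))"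
    note I = integrable_recon_param[OF ip x(2)]
    have t: "integrable (lebesgue_on {0..1}) ?t"
      using Bochner_Integration.integrable_add[OF Bochner_Integration.integrable_add[OF
          integrable_bounded_linear[OF bounded_linear_Pair[OF bounded_linear_ident bounded_linear_zero] I(1)]
          integrable_bounded_linear[OF bounded_linear_Pair[OF bounded_linear_zero bounded_linear_Pair[OF bounded_linear_ident bounded_linear_zero]] I(2)]]
          integrable_bounded_linear[OF bounded_linear_Pair[OF bounded_linear_zero bounded_linear_Pair[OF bounded_linear_zero bounded_linear_ident]] sl]]
      by simp
    have pt: "primitive 0 ?t 1 = (primitive 0 (\<lambda>s. recon (\<lambda>\<theta>. \<psi> (s, \<theta>)) x) 1, primitive 0 (\<lambda>s. drecon (\<lambda>\<theta>. \<psi> (s, \<theta>)) x) 1, primitive 0 (\<lambda>s. \<psi> (s, x)) 1)"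
      using primitive_bounded_linear[OF bounded_linear_fst t order_refl]
        primitive_bounded_linear[OF bounded_linear_compose[OF bounded_linear_fst bounded_linear_snd] t order_refl]
        primitive_bounded_linear[OF bounded_linear_compose[OF bounded_linear_snd bounded_linear_snd] t order_refl]
      by (simp add: prod_eq_iff)
    have "A12_op a b B Ad \<psi> x = primitive 0 (\<lambda>s. ?S x (?t s)) 1"
      unfolding A12_op_def primitive_def[of 0 _ 1, symmetric]
    proof (rule primitive_cong_AE[symmetric, OF integrable_bounded_linear[OF S t]])
      show "AE s in lebesgue_on {0..1}. ?S x (?t s) = A11_op a b B Ad (\<lambda>y. \<psi> (s, y)) x"
        using AE_slices_integrable[OF ip] by eventually_elim (simp add: A11_op_eq[OF ab inv _ x(1)])
    qed simp
    also have "\<dots> = ?S x (primitive 0 ?t 1)"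
      by (rule primitive_bounded_linear[OF S t order_refl])
    finally have 12: "A12_op a b B Ad \<psi> x = ?S x (primitive 0 ?t 1)" .
    have "A11_op a b B Ad (\<lambda>\<theta>. history 0 v \<psi> (1, \<theta>)) x
        = ?S x ((recon v x, drecon v x, v x) + primitive 0 ?t 1)"
      unfolding A11_op_eq[OF ab inv history_slice_integrable[OF iv ip order_refl] x(1)] pt
        recon_history[OF iv ip order_refl x(2)] drecon_history[OF iv ip order_refl x(2)]
      by (simp add: history_def)
    also have "\<dots> = A11_op a b B Ad v x + A12_op a b B Ad \<psi> x"
      unfolding linear_add[OF bounded_linear.linear[OF S]] 12 A11_op_eq[OF ab inv iv x(1)] by simp
    finally show ?case .
  qed
qed

lemma A_op_eq_delay_rhs:
  assumes w: "w \<in> L2_states a b"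
  shows "state_eq a b (A_op a b A Ad B \<tau> w) (delay_rhs a b A Ad \<tau> (T_op a b B w))"
proof -
  have L: "fst w \<in> L2 {a..b}" "snd w \<in> L2 (rect a b)"
    using w by (auto simp: L2_states_def)
  note e = T_op_ae_eq[OF ab inv w]
  let ?h = "\<lambda>\<theta>. history 0 (fst w) (snd w) (1, \<theta>)"
  have h: "?h \<in> L2 {a..b}" by (rule history_slice_L2[OF L zero_less_one order_refl])
  have sl: "ae_eq {a..b} (slice a b (snd (T_op a b B w)) 1) (recon ?h)"
    unfolding ae_eq_def by (rule AE_I2) (simp add: slice_fibre_recon[OF L e(2)])
  have "AE x in lebesgue_on {a..b}. A11_op a b B A (fst w) x + A11_op a b B Ad (fst w) x + A12_op a b B Ad (snd w) x =
      pde_rhs a b A (fst (T_op a b B w)) x + pde_rhs a b Ad (slice a b (snd (T_op a b B w)) 1) x"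
    using pde_rhs_eq_A11_op[OF L(1) e(1), of A] pde_rhs_eq_A11_op[OF h sl, of Ad] A11_op_history[OF L]
    unfolding ae_eq_def by eventually_elim simp
  moreover have "AE p in lebesgue_on (rect a b). - (1 / \<tau>) *\<^sub>R T1_op a b B (\<lambda>y. snd w (fst p, y)) (snd p) = - (1 / \<tau>) *\<^sub>R ds a b (snd (T_op a b B w)) p"
    using ds_fibre_recon[OF L e(2)] AE_lebesgue_on_fst[OF borel_Icc borel_Icc T1_op_slices[OF ab inv L2_imp_integrable_rect[OF L(2)]], of a b] AE_space
    unfolding ae_eq_def by eventually_elim auto
  ultimately show ?thesis
    by (simp add: state_eq_def ae_eq_def A_op_def A22_op_def delay_rhs_def case_prod_unfold)
qed

text \<open>Let \<open>e r\<close> be the numerator of the difference quotient. Since \<open>T \<circ> D\<close> fixes the values of the curve,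
  \<open>e r - T (D (e r))\<close> equals \<open>(r - t) (T (D z') - z')\<close>. The left-hand side is \<open>o(r - t)\<close> in L2 because \<open>T \<circ> D\<close>
  is bounded, so the fixed element \<open>T (D z') - z'\<close> has norm zero.\<close>

lemma T_D_of_limit:
  assumes z: "\<And>r. 0 \<le> r \<Longrightarrow> z r \<in> dpde_states a b B" and z': "z' \<in> H_states a b" and t: "0 \<le> t"
    and lim: "has_frechet_derivative (H_states_nrm a b) z z' t"
  shows "state_eq a b (T_op a b B (D_op a b z')) z'"
proof -
  obtain C where C: "0 \<le> C" "\<And>w. w \<in> L2_states a b \<Longrightarrow> H_states_nrm a b (T_op a b B w) \<le> C * L2_states_nrm a b w"
    using T_op_bounded[OF ab inv] by blast
  let ?T = "T_op a b B" and ?D = "D_op a b" and ?N = "L2_states_nrm a b"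
  let ?d = "residual 1 (?T (?D z')) (\<lambda>_. 0, \<lambda>_. 0) z'"
  have Dz': "?D z' \<in> L2_states a b" by (rule D_op_L2[OF z'])
  have TDz': "?T (?D z') \<in> L2_states a b"
    by (rule H_states_L2[OF dpde_states_H_states[OF T_op_dpde_states(1)[OF ab inv Dz']]])
  have z'L: "z' \<in> L2_states a b" by (rule H_states_L2[OF z'])
  have "?d \<in> L2_states a b"
    by (rule residual_L2[OF TDz' _ z'L]) (simp add: L2_states_def L2_const_Icc L2_const_rect)
  then have d12: "fst ?d \<in> L2 {a..b}" "snd ?d \<in> L2 (rect a b)"
    unfolding L2_states_def mem_Times_iff by blast+
  \<comment> \<open>\<open>?d\<close> is the state \<open>T (D z') - z'\<close>, written as a residual to reuse its closure properties\<close>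
  define e where "e r = residual (r - t) (z r) (z t) z'" for r
  have bound: "((r - t) * ?N ?d)\<^sup>2 \<le> (2 + 2 * C\<^sup>2) * (H_states_nrm a b (e r))\<^sup>2" if r: "0 \<le> r" for r
  proof -
    have zr: "z r \<in> dpde_states a b B" "z t \<in> dpde_states a b B" using z r t by auto
    note zH = dpde_states_H_states[OF zr(1)] dpde_states_H_states[OF zr(2)]
    have eH: "e r \<in> H_states a b" unfolding e_def by (rule residual_H[OF zH z'])
    have De: "?D (e r) \<in> L2_states a b" by (rule D_op_L2[OF eH])
    have eL: "e r \<in> L2_states a b" by (rule H_states_L2[OF eH])
    have TDe: "?T (?D (e r)) \<in> L2_states a b"
      by (rule H_states_L2[OF dpde_states_H_states[OF T_op_dpde_states(1)[OF ab inv De]]])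
    have "state_eq a b (?T (?D (e r))) (residual (r - t) (?T (?D (z r))) (?T (?D (z t))) (?T (?D z')))"
      unfolding e_def
      by (rule state_eq_trans[OF T_op_cong[OF ab inv De[unfolded e_def] D_op_residual[OF zH z']]
            T_op_residual[OF ab inv D_op_L2[OF zH(1)] D_op_L2[OF zH(2)] Dz']])
    then have TDe_eq: "state_eq a b (?T (?D (e r))) (residual (r - t) (z r) (z t) (?T (?D z')))"
      by (rule state_eq_trans[OF _ residual_cong[OF T_op_D_op(2)[OF ab inv zr(1)] T_op_D_op(2)[OF ab inv zr(2)]]])
         (simp add: state_eq_def ae_eq_refl)
    let ?g = "((\<lambda>x. fst (e r) x + - fst (?T (?D (e r))) x), (\<lambda>p. snd (e r) p + - snd (?T (?D (e r))) p))"
    have g: "state_eq a b ?g ((\<lambda>x. (r - t) *\<^sub>R fst ?d x), (\<lambda>p. (r - t) *\<^sub>R snd ?d p))"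
    proof -
      have ex: "fst (e r) x = fst (z r) x - fst (z t) x - (r - t) *\<^sub>R fst z' x" for x
        by (simp add: e_def residual_def)
      have ep: "snd (e r) p = snd (z r) p - snd (z t) p - (r - t) *\<^sub>R snd z' p" for p
        by (simp add: e_def residual_def)
      have 1: "AE x in lebesgue_on {a..b}. fst (?T (?D (e r))) x = fst (z r) x - fst (z t) x - (r - t) *\<^sub>R fst (?T (?D z')) x"
        and 2: "AE p in lebesgue_on (rect a b). snd (?T (?D (e r))) p = snd (z r) p - snd (z t) p - (r - t) *\<^sub>R snd (?T (?D z')) p"
        using TDe_eq by (simp_all only: state_eq_def ae_eq_def residual_def fst_conv snd_conv)
      have "AE x in lebesgue_on {a..b}. fst (e r) x + - fst (?T (?D (e r))) x = (r - t) *\<^sub>R fst ?d x"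
        using 1 by eventually_elim (simp add: ex residual_def scaleR_diff_right)
      moreover have "AE p in lebesgue_on (rect a b). snd (e r) p + - snd (?T (?D (e r))) p = (r - t) *\<^sub>R snd ?d p"
        using 2 by eventually_elim (simp add: ep residual_def scaleR_diff_right)
      ultimately show ?thesis
        by (simp only: state_eq_def ae_eq_def fst_conv snd_conv)
    qed
    have m: "(\<lambda>x. - fst (?T (?D (e r))) x) \<in> L2 {a..b}" "(\<lambda>p. - snd (?T (?D (e r))) p) \<in> L2 (rect a b)"
      "L2_nrm {a..b} (\<lambda>x. - fst (?T (?D (e r))) x) = L2_nrm {a..b} (fst (?T (?D (e r))))"
      "L2_nrm (rect a b) (\<lambda>p. - snd (?T (?D (e r))) p) = L2_nrm (rect a b) (snd (?T (?D (e r))))"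
      using TDe L2_scaleR[of "fst (?T (?D (e r)))" "{a..b}" "- 1"] L2_scaleR[of "snd (?T (?D (e r)))" "rect a b" "- 1"]
      by (auto simp: L2_states_def mem_Times_iff L2_nrm_def)
    have e12: "fst (e r) \<in> L2 {a..b}" "snd (e r) \<in> L2 (rect a b)" using eL by (auto simp: L2_states_def)
    have gL: "?g \<in> L2_states a b"
      unfolding L2_states_def using L2_add[OF e12(1) m(1)] L2_add[OF e12(2) m(2)] by simp
    have "((r - t) * ?N ?d)\<^sup>2 = (?N ((\<lambda>x. (r - t) *\<^sub>R fst ?d x), (\<lambda>p. (r - t) *\<^sub>R snd ?d p)))\<^sup>2"
      unfolding power_mult_distrib L2_states_nrm_square fst_conv snd_conv L2_nrm_scaleR[OF d12(1)] L2_nrm_scaleR[OF d12(2)]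
      by (simp add: algebra_simps)
    also have "\<dots> = (?N ?g)\<^sup>2" using L2_states_nrm_cong[OF gL g] by simp
    also have "\<dots> \<le> 2 * (?N (e r))\<^sup>2 + 2 * (?N (?T (?D (e r))))\<^sup>2"
      unfolding L2_states_nrm_square fst_conv snd_conv
    proof -
      have arith: "p \<le> 2 * q + 2 * s \<Longrightarrow> p' \<le> 2 * q' + 2 * s' \<Longrightarrow> p + p' \<le> 2 * (q + q') + 2 * (s + s')"
        for p q s p' q' s' :: real by simp
      show "(L2_nrm {a..b} (\<lambda>x. fst (e r) x + - fst (?T (?D (e r))) x))\<^sup>2 + (L2_nrm (rect a b) (\<lambda>p. snd (e r) p + - snd (?T (?D (e r))) p))\<^sup>2
          \<le> 2 * ((L2_nrm {a..b} (fst (e r)))\<^sup>2 + (L2_nrm (rect a b) (snd (e r)))\<^sup>2)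
            + 2 * ((L2_nrm {a..b} (fst (?T (?D (e r)))))\<^sup>2 + (L2_nrm (rect a b) (snd (?T (?D (e r)))))\<^sup>2)"
        by (rule arith[OF L2_nrm_add[OF e12(1) m(1), unfolded m(3)] L2_nrm_add[OF e12(2) m(2), unfolded m(4)]])
    qed
    also have "(?N (e r))\<^sup>2 \<le> (H_states_nrm a b (e r))\<^sup>2"
      by (rule power_mono[OF L2_states_nrm_le nrm_nonneg(1)])
    also have "?N (?T (?D (e r))) \<le> C * H_states_nrm a b (e r)"
      using L2_states_nrm_le[of a b "?T (?D (e r))"] C(2)[OF De] mult_left_mono[OF D_op_nrm_le[of a b "e r"] C(1)] by linarith
    then have "(?N (?T (?D (e r))))\<^sup>2 \<le> (C * H_states_nrm a b (e r))\<^sup>2"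
      by (rule power_mono[OF _ nrm_nonneg(1)])
    finally show ?thesis by (simp add: power_mult_distrib algebra_simps)
  qed
  have lim0: "((\<lambda>r. H_states_nrm a b (e r) / \<bar>r - t\<bar>) \<longlongrightarrow> 0) (at t within {0..})"
    using lim unfolding has_frechet_derivative_residual e_def .
  have le: "\<bar>(r - t) * ?N ?d\<bar> \<le> sqrt (2 + 2 * C\<^sup>2) * H_states_nrm a b (e r)" if "0 \<le> r" for r
  proof -
    have "sqrt (((r - t) * ?N ?d)\<^sup>2) \<le> sqrt ((2 + 2 * C\<^sup>2) * (H_states_nrm a b (e r))\<^sup>2)"
      by (rule real_sqrt_le_mono[OF bound[OF that]])
    then show ?thesis
      by (simp only: real_sqrt_mult real_sqrt_abs abs_of_nonneg[OF nrm_nonneg(2)])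
  qed
  have "((\<lambda>r. (\<bar>r - t\<bar> * ?N ?d) / \<bar>r - t\<bar>) \<longlongrightarrow> 0) (at t within {0..})"
    by (rule tendsto_quotient_bound[OF lim0]) (use le in \<open>simp add: abs_mult\<close>)
  moreover have "\<forall>\<^sub>F r in at t within {0..}. (\<bar>r - t\<bar> * ?N ?d) / \<bar>r - t\<bar> = ?N ?d"
    by (auto simp: eventually_at_filter)
  ultimately have "((\<lambda>_. ?N ?d) \<longlongrightarrow> 0) (at t within {0..})"
    by (rule Lim_transform_eventually)
  moreover have "at t within {0..} \<noteq> bot"
  proof
    assume bot: "at t within {0..} = bot"
    have "at_right t \<le> at t within {0..}" by (rule at_le) (use t in auto)
    then show False using trivial_limit_at_right_real[of t] unfolding bot by (simp add: bot_unique)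
  qed
  ultimately have "?N ?d = 0"
    by (simp add: tendsto_const_iff)
  then have "(?N ?d)\<^sup>2 = 0" by simp
  then have "(L2_nrm {a..b} (fst ?d))\<^sup>2 + (L2_nrm (rect a b) (snd ?d))\<^sup>2 = 0"
    unfolding L2_states_nrm_square .
  then have "L2_nrm {a..b} (fst ?d) = 0" "L2_nrm (rect a b) (snd ?d) = 0"
    by (simp_all add: add_nonneg_eq_0_iff)
  moreover note d12
  ultimately have "AE x in lebesgue_on {a..b}. fst ?d x = 0" "AE p in lebesgue_on (rect a b). snd ?d p = 0"
    by (auto intro: L2_nrm_eq_0_imp)
  then show ?thesis
    by (simp add: state_eq_def ae_eq_def residual_def)
qed

text \<open>In both directions the derivative of the transformed curve is the transform of the derivative. The
  equations then correspond through \<open>A_op_eq_delay_rhs\<close>; from right to left, \<open>T_D_of_limit\<close> supplies the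
  identity of \<open>z'\<close> with \<open>T (D z')\<close>.\<close>

lemma pie_iff_dpde:
  assumes w0: "w0 \<in> L2_states a b" and w: "\<And>t. 0 \<le> t \<Longrightarrow> w t \<in> L2_states a b"
  shows "pie_solution a b (T_op a b B) (A_op a b A Ad B \<tau>) w0 w \<longleftrightarrow>
    dpde_solution a b A Ad B \<tau> (T_op a b B w0) (\<lambda>t. T_op a b B (w t))" (is "?P \<longleftrightarrow> ?Q")
proof
  let ?T = "T_op a b B" and ?D = "D_op a b"
  assume ?P
  then obtain w' where init: "state_eq a b (w 0) w0" and w': "\<And>t. 0 \<le> t \<Longrightarrow> w' t \<in> L2_states a b"
    "\<And>t. 0 \<le> t \<Longrightarrow> has_frechet_derivative (L2_states_nrm a b) w (w' t) t"
    "\<And>t. 0 \<le> t \<Longrightarrow> state_eq a b (?T (w' t)) (A_op a b A Ad B \<tau> (w t))"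
    unfolding pie_solution_def by blast
  obtain C where C: "0 \<le> C" "\<And>w. w \<in> L2_states a b \<Longrightarrow> H_states_nrm a b (?T w) \<le> C * L2_states_nrm a b w"
    using T_op_bounded[OF ab inv] by blast
  have deriv: "has_frechet_derivative (H_states_nrm a b) (\<lambda>t. ?T (w t)) (?T (w' t)) t" if t: "0 \<le> t" for t
    unfolding has_frechet_derivative_residual
  proof (rule tendsto_quotient_bound[OF w'(2)[OF t, unfolded has_frechet_derivative_residual]])
    fix r :: real assume r: "0 \<le> r"
    note L = w[OF r] w[OF t] w'(1)[OF t]
    note R = residual_L2[OF L, of "r - t"]
    have "H_states_nrm a b (residual (r - t) (?T (w r)) (?T (w t)) (?T (w' t))) = H_states_nrm a b (?T (residual (r - t) (w r) (w t) (w' t)))"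
      by (rule H_states_nrm_cong[OF T_op_residual[OF ab inv L] dpde_states_H_states[OF T_op_dpde_states(1)[OF ab inv R]], symmetric])
    then show "\<bar>H_states_nrm a b (residual (r - t) (?T (w r)) (?T (w t)) (?T (w' t)))\<bar> \<le> C * L2_states_nrm a b (residual (r - t) (w r) (w t) (w' t))"
      using C(2)[OF R] by (simp only: abs_of_nonneg[OF nrm_nonneg(2)])
  qed
  show ?Q
    unfolding dpde_solution_iff
  proof (intro conjI exI[of _ "\<lambda>t. ?T (w' t)"] allI impI)
    show "?T w0 \<in> dpde_states a b B" by (rule T_op_dpde_states(1)[OF ab inv w0])
    show "state_eq a b (?T (w 0)) (?T w0)" by (rule T_op_cong[OF ab inv w[OF order_refl] init])
    fix t :: real assume t: "0 \<le> t"
    show "?T (w t) \<in> dpde_states a b B" by (rule T_op_dpde_states(1)[OF ab inv w[OF t]])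
    show "?T (w' t) \<in> H_states a b" by (rule dpde_states_H_states[OF T_op_dpde_states(1)[OF ab inv w'(1)[OF t]]])
    show "has_frechet_derivative (H_states_nrm a b) (\<lambda>t. ?T (w t)) (?T (w' t)) t" by (rule deriv[OF t])
    show "state_eq a b (?T (w' t)) (delay_rhs a b A Ad \<tau> (?T (w t)))"
      by (rule state_eq_trans[OF w'(3)[OF t] A_op_eq_delay_rhs[OF w[OF t]]])
  qed
next
  let ?T = "T_op a b B" and ?D = "D_op a b"
  assume ?Q
  then obtain z' where init: "state_eq a b (?T (w 0)) (?T w0)" and z': "\<And>t. 0 \<le> t \<Longrightarrow> z' t \<in> H_states a b"
    "\<And>t. 0 \<le> t \<Longrightarrow> has_frechet_derivative (H_states_nrm a b) (\<lambda>t. ?T (w t)) (z' t) t"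
    "\<And>t. 0 \<le> t \<Longrightarrow> state_eq a b (z' t) (delay_rhs a b A Ad \<tau> (?T (w t)))"
    unfolding dpde_solution_iff by blast
  have TH: "?T (w t) \<in> dpde_states a b B" if "0 \<le> t" for t
    by (rule T_op_dpde_states(1)[OF ab inv w[OF that]])
  have init': "state_eq a b (w 0) w0"
    using state_eq_sym[OF T_op_dpde_states(2)[OF ab inv w[OF order_refl]]] T_op_dpde_states(2)[OF ab inv w0] D_op_cong[OF init]
    by (metis state_eq_trans)
  have deriv: "has_frechet_derivative (L2_states_nrm a b) w (?D (z' t)) t" if t: "0 \<le> t" for t
    unfolding has_frechet_derivative_residual
  proof (rule tendsto_quotient_bound[OF z'(2)[OF t, unfolded has_frechet_derivative_residual]])
    fix r :: real assume r: "0 \<le> r"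
    note H = dpde_states_H_states[OF TH[OF r]] dpde_states_H_states[OF TH[OF t]] z'(1)[OF t]
    let ?e = "residual (r - t) (?T (w r)) (?T (w t)) (z' t)"
    have "state_eq a b (?D ?e) (residual (r - t) (w r) (w t) (?D (z' t)))"
      by (rule state_eq_trans[OF D_op_residual[OF H] residual_cong[OF T_op_dpde_states(2)[OF ab inv w[OF r]] T_op_dpde_states(2)[OF ab inv w[OF t]]]])
         (simp add: state_eq_def ae_eq_refl)
    from L2_states_nrm_cong[OF D_op_L2[OF residual_H[OF H]] this]
    show "\<bar>L2_states_nrm a b (residual (r - t) (w r) (w t) (?D (z' t)))\<bar> \<le> 1 * H_states_nrm a b ?e"
      using D_op_nrm_le[of a b ?e] by (simp only: abs_of_nonneg[OF nrm_nonneg(1)] mult_1)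
  qed
  show ?P
    unfolding pie_solution_def
  proof (intro conjI exI[of _ "\<lambda>t. ?D (z' t)"] allI impI w0 init')
    fix t :: real assume t: "0 \<le> t"
    show "w t \<in> L2_states a b" by (rule w[OF t])
    show "?D (z' t) \<in> L2_states a b" by (rule D_op_L2[OF z'(1)[OF t]])
    show "has_frechet_derivative (L2_states_nrm a b) w (?D (z' t)) t" by (rule deriv[OF t])
    show "state_eq a b (?T (?D (z' t))) (A_op a b A Ad B \<tau> (w t))"
      by (rule state_eq_trans[OF T_D_of_limit[OF TH z'(1)[OF t] t z'(2)[OF t]]
            state_eq_trans[OF z'(3)[OF t] state_eq_sym[OF A_op_eq_delay_rhs[OF w[OF t]]]]])
  qed
qed

end

text \<open>Solutions are defined up to equality almost everywhere at each time. A curve \<open>z\<close> of admissible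
  states can therefore be replaced by \<open>T (D z)\<close>.\<close>

lemma dpde_solution_cong:
  assumes z0: "z0' \<in> dpde_states a b B" "state_eq a b z0 z0'"
    and z: "\<And>t. 0 \<le> t \<Longrightarrow> z t \<in> dpde_states a b B" "\<And>t. 0 \<le> t \<Longrightarrow> y t \<in> dpde_states a b B" "\<And>t. 0 \<le> t \<Longrightarrow> state_eq a b (z t) (y t)"
    and sol: "dpde_solution a b A Ad B \<tau> z0 z"
  shows "dpde_solution a b A Ad B \<tau> z0' y"
proof -
  obtain z' where init: "state_eq a b (z 0) z0" and z': "\<And>t. 0 \<le> t \<Longrightarrow> z' t \<in> H_states a b"
    "\<And>t. 0 \<le> t \<Longrightarrow> has_frechet_derivative (H_states_nrm a b) z (z' t) t"
    "\<And>t. 0 \<le> t \<Longrightarrow> state_eq a b (z' t) (delay_rhs a b A Ad \<tau> (z t))"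
    using sol unfolding dpde_solution_iff by blast
  have deriv: "has_frechet_derivative (H_states_nrm a b) y (z' t) t" if t: "0 \<le> t" for t
    unfolding has_frechet_derivative_residual
  proof (rule tendsto_quotient_bound[OF z'(2)[OF t, unfolded has_frechet_derivative_residual]])
    fix r :: real assume r: "0 \<le> r"
    have "H_states_nrm a b (residual (r - t) (z r) (z t) (z' t)) = H_states_nrm a b (residual (r - t) (y r) (y t) (z' t))"
      by (rule H_states_nrm_cong[OF residual_cong[OF z(3)[OF r] z(3)[OF t]]])
         (simp add: state_eq_def ae_eq_refl, rule residual_H[OF dpde_states_H_states[OF z(1)[OF r]] dpde_states_H_states[OF z(1)[OF t]] z'(1)[OF t]])
    then show "\<bar>H_states_nrm a b (residual (r - t) (y r) (y t) (z' t))\<bar> \<le> 1 * H_states_nrm a b (residual (r - t) (z r) (z t) (z' t))"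
      by (simp only: abs_of_nonneg[OF nrm_nonneg(2)] mult_1)
  qed
  show ?thesis
    unfolding dpde_solution_iff
  proof (intro conjI exI[of _ z'] allI impI z0(1))
    show "state_eq a b (y 0) z0'"
      by (rule state_eq_trans[OF state_eq_sym[OF z(3)[OF order_refl]] state_eq_trans[OF init z0(2)]])
    fix t :: real assume t: "0 \<le> t"
    show "y t \<in> dpde_states a b B" "z' t \<in> H_states a b" "has_frechet_derivative (H_states_nrm a b) y (z' t) t"
      by (rule z(2)[OF t], rule z'(1)[OF t], rule deriv[OF t])
    show "state_eq a b (z' t) (delay_rhs a b A Ad \<tau> (y t))"
      by (rule state_eq_trans[OF z'(3)[OF t] delay_rhs_cong[OF z(3)[OF t]]])
  qed
qed

theorem corollary10:
  fixes a b \<tau> :: real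
    and A Ad :: "real \<Rightarrow> real^(3 \<times> 'n::finite)^'n"
    and B :: "real^(4 \<times> 'n)^(2 \<times> 'n)"
  assumes "a < b" and "\<tau> > 0"
    and "A \<in> Linf {a..b}" and "Ad \<in> Linf {a..b}"
    and "invertible (B ** H_mat a b)"
  shows "(\<forall>w0 w. w0 \<in> L2_states a b \<longrightarrow> (\<forall>t\<ge>0. w t \<in> L2_states a b) \<longrightarrow>
            (pie_solution a b (T_op a b B) (A_op a b A Ad B \<tau>) w0 w \<longleftrightarrow>
             dpde_solution a b A Ad B \<tau> (T_op a b B w0) (\<lambda>t. T_op a b B (w t))))
       \<and> (\<forall>z0 z. z0 \<in> dpde_states a b B \<longrightarrow> (\<forall>t\<ge>0. z t \<in> dpde_states a b B) \<longrightarrow>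
            (dpde_solution a b A Ad B \<tau> z0 z \<longleftrightarrow>
             pie_solution a b (T_op a b B) (A_op a b A Ad B \<tau>) (D_op a b z0) (\<lambda>t. D_op a b (z t))))"
proof (intro conjI allI impI)
  note ab = assms(1) and inv = assms(5)
  show "pie_solution a b (T_op a b B) (A_op a b A Ad B \<tau>) w0 w \<longleftrightarrow>
      dpde_solution a b A Ad B \<tau> (T_op a b B w0) (\<lambda>t. T_op a b B (w t))"
    if "w0 \<in> L2_states a b" "\<forall>t\<ge>0. w t \<in> L2_states a b" for w0 w
    by (rule pie_iff_dpde[OF ab inv]) (use that in auto)
  fix z0 :: "'n state" and z :: "real \<Rightarrow> 'n state" assume z0: "z0 \<in> dpde_states a b B" and "\<forall>t\<ge>0. z t \<in> dpde_states a b B"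
  then have z: "\<And>t. 0 \<le> t \<Longrightarrow> z t \<in> dpde_states a b B" by blast
  note d0 = T_op_D_op[OF ab inv z0] and d = T_op_D_op[OF ab inv z]
  have "dpde_solution a b A Ad B \<tau> z0 z \<longleftrightarrow>
      dpde_solution a b A Ad B \<tau> (T_op a b B (D_op a b z0)) (\<lambda>t. T_op a b B (D_op a b (z t)))"
    (is "?L \<longleftrightarrow> ?R")
  proof
    show ?R if ?L
      by (rule dpde_solution_cong[OF _ _ _ _ _ that])
         (auto intro: T_op_dpde_states(1)[OF ab inv] d0 d z state_eq_sym)
    show ?L if ?R
      by (rule dpde_solution_cong[OF z0 d0(2) _ z d(2) that]) (auto intro: T_op_dpde_states(1)[OF ab inv] d)
  qed
  also have "\<dots> \<longleftrightarrow> pie_solution a b (T_op a b B) (A_op a b A Ad B \<tau>) (D_op a b z0) (\<lambda>t. D_op a b (z t))"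
    by (rule pie_iff_dpde[OF ab inv d0(1) d(1), symmetric])
  finally show "dpde_solution a b A Ad B \<tau> z0 z \<longleftrightarrow>
      pie_solution a b (T_op a b B) (A_op a b A Ad B \<tau>) (D_op a b z0) (\<lambda>t. D_op a b (z t))" .
qed

end
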